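(* Let $\beta\ge0$ and $0<\epsilon<\frac12$. There is a constant $C=C(\beta,\epsilon,D)<\infty$ such that the following holds. For every bounded measurable function $f:D\times D\to\mathbb R$ which is symmetric, $f(x,y)=f(y,x)$, and has null diagonal average, $\int_Df(x,x)\,dx=0$ (with $x\mapsto f(x,x)$ measurable), for every even $N\ge2$ with $\beta<2\pi N$, and for all $\xi_1,\dots,\xi_N\in\{\pm1\}$ with $\sum_{i=1}^N\xi_i=0$, $$\int_{D^N}\Big(\frac1N\sum_{i,j=1}^N\xi_i\xi_jf(x_i,x_j)\Big)^2d\nu^N_\beta(x_1,\dots,x_N)\le C\Big(\|f\|_{L^{2/\epsilon}}^2+\frac1N\sup_{x\in D}|f(x,x)|^2+\frac1{N^{1-\epsilon}}\sup_{x\in D}|f(x,x)|\,\|f\|_{L^{1/\epsilon}}\Big),$$ where the $L^q$ norms are those of $L^q(D\times D)$.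
   Context: $D\subset\mathbb R^2$ is a bounded convex domain with smooth boundary and Lebesgue measure $1$. $G$ is the Green function of $-\Delta$ on $D$ with Dirichlet boundary conditions, $G(x,y)=-\frac1{2\pi}\log|x-y|+g(x,y)$, where for each $y\in D$ the function $g(\cdot,y)$ is harmonic in $D$ with $g(x,y)=\frac1{2\pi}\log|x-y|$ for $x\in\partial D$. The Hamiltonian is $H(x_1,\dots,x_N)=\sum_{1\le i<j\le N}\xi_i\xi_jG(x_i,x_j)+\frac12\sum_{i=1}^N\xi_i^2g(x_i,x_i)$, and the canonical Gibbs measure is the probability measure on $D^N$ $$d\nu_\beta^N=\frac1{Z_\beta^N}\exp\Big(-\frac\beta NH(x_1,\dots,x_N)\Big)dx_1\cdots dx_N,$$ with $Z_\beta^N$ the normalizing constant, which is finite for $0\le\beta<2\pi N$. *)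

theory Defs
  imports "HOL-Analysis.Analysis"
begin

section \<open>Smooth domains and harmonic functions\<close>

definition partial_deriv :: "'n::finite \<Rightarrow> (real^'n \<Rightarrow> real) \<Rightarrow> real^'n \<Rightarrow> real" where
  "partial_deriv i f x = frechet_derivative f (at x) (axis i 1)"

text \<open>\<open>C_k_on k U f\<close>: the function \<open>f\<close> is of class \<open>C^k\<close> on the set \<open>U\<close>, which is
  intended to be open. The value of \<open>partial_deriv\<close> is only meaningful at points of
  differentiability, which is why differentiability is required at each stage.\<close>

primrec C_k_on :: "nat \<Rightarrow> (real^'n::finite) set \<Rightarrow> (real^'n \<Rightarrow> real) \<Rightarrow> bool" where
  "C_k_on 0 U f \<longleftrightarrow> continuous_on U f"
| "C_k_on (Suc k) U f \<longleftrightarrow>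
     (\<forall>x\<in>U. f differentiable (at x)) \<and> (\<forall>i. C_k_on k U (partial_deriv i f))"

definition smooth_on :: "(real^'n::finite) set \<Rightarrow> (real^'n \<Rightarrow> real) \<Rightarrow> bool" where
  "smooth_on U f \<longleftrightarrow> (\<forall>k. C_k_on k U f)"

definition laplacian :: "(real^'n::finite \<Rightarrow> real) \<Rightarrow> real^'n \<Rightarrow> real" where
  "laplacian f x = (\<Sum>i\<in>UNIV. partial_deriv i (partial_deriv i f) x)"

definition harmonic_on :: "(real^'n::finite) set \<Rightarrow> (real^'n \<Rightarrow> real) \<Rightarrow> bool" where
  "harmonic_on U f \<longleftrightarrow> C_k_on 2 U f \<and> (\<forall>x\<in>U. laplacian f x = 0)"

text \<open>Smoothness of the boundary, expressed by local defining functions: near each boundary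
  point, \<open>D\<close> is a strict sublevel set of a smooth function without critical points.\<close>

definition smooth_boundary :: "(real^'n::finite) set \<Rightarrow> bool" where
  "smooth_boundary D \<longleftrightarrow>
     (\<forall>p\<in>frontier D. \<exists>U r. open U \<and> p \<in> U \<and> smooth_on U r \<and>
        (\<forall>x\<in>U. \<exists>i. partial_deriv i r x \<noteq> 0) \<and> D \<inter> U = {x\<in>U. r x < 0})"

section \<open>The Green function\<close>

text \<open>The regular part \<open>g\<close> of the Dirichlet Green function of minus the Laplacian on \<open>D\<close>. The
  boundary values are attained continuously; thus, by the maximum principle, \<open>g x y\<close> is uniquely
  determined for \<open>x\<close> in the closure of \<open>D\<close> and \<open>y\<close> in \<open>D\<close>.\<close>

definition green_regular_part :: "(real^2) set \<Rightarrow> (real^2 \<Rightarrow> real^2 \<Rightarrow> real) \<Rightarrow> bool" where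
  "green_regular_part D g \<longleftrightarrow>
     (\<forall>y\<in>D. harmonic_on D (\<lambda>x. g x y) \<and> continuous_on (closure D) (\<lambda>x. g x y) \<and>
        (\<forall>x\<in>frontier D. g x y = 1 / (2 * pi) * ln (norm (x - y))))"

text \<open>On the diagonal, where the Green function is infinite, the value below is a convention
  (\<open>ln 0 = 0\<close>); configurations with coinciding points form a null set.\<close>

definition green :: "(real^2 \<Rightarrow> real^2 \<Rightarrow> real) \<Rightarrow> real^2 \<Rightarrow> real^2 \<Rightarrow> real" where
  "green g x y = - 1 / (2 * pi) * ln (norm (x - y)) + g x y"

section \<open>The Gibbs measure\<close>

text \<open>The points and intensities are indexed by \<open>{..<N}\<close>.\<close>

definition hamiltonian ::
  "(real^2 \<Rightarrow> real^2 \<Rightarrow> real) \<Rightarrow> nat \<Rightarrow> (nat \<Rightarrow> real) \<Rightarrow> (nat \<Rightarrow> real^2) \<Rightarrow> real" where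
  "hamiltonian g N \<xi> x =
     (\<Sum>j<N. \<Sum>i<j. \<xi> i * \<xi> j * green g (x i) (x j))
     + 1 / 2 * (\<Sum>i<N. (\<xi> i)\<^sup>2 * g (x i) (x i))"

text \<open>Lebesgue measure on \<open>D^N\<close>. The completion makes Lebesgue measurable functions of the
  coordinates measurable, not only Borel ones.\<close>

definition config_lebesgue :: "(real^2) set \<Rightarrow> nat \<Rightarrow> (nat \<Rightarrow> real^2) measure" where
  "config_lebesgue D N = completion (\<Pi>\<^sub>M i\<in>{..<N}. restrict_space lborel D)"

definition partition_function ::
  "(real^2) set \<Rightarrow> (real^2 \<Rightarrow> real^2 \<Rightarrow> real) \<Rightarrow> real \<Rightarrow> nat \<Rightarrow> (nat \<Rightarrow> real) \<Rightarrow> real" where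
  "partition_function D g \<beta> N \<xi> =
     (\<integral>x. exp (- (\<beta> / real N) * hamiltonian g N \<xi> x) \<partial>config_lebesgue D N)"

definition gibbs_measure ::
  "(real^2) set \<Rightarrow> (real^2 \<Rightarrow> real^2 \<Rightarrow> real) \<Rightarrow> real \<Rightarrow> nat \<Rightarrow> (nat \<Rightarrow> real)
     \<Rightarrow> (nat \<Rightarrow> real^2) measure" where
  "gibbs_measure D g \<beta> N \<xi> =
     density (config_lebesgue D N)
       (\<lambda>x. ennreal (exp (- (\<beta> / real N) * hamiltonian g N \<xi> x) / partition_function D g \<beta> N \<xi>))"

section \<open>Norms\<close>

definition Lq_norm :: "real \<Rightarrow> 'a measure \<Rightarrow> ('a \<Rightarrow> real) \<Rightarrow> real" where
  "Lq_norm q M f = (\<integral>x. \<bar>f x\<bar> powr q \<partial>M) powr (1 / q)"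

end

theory Submission
  imports Defs "HOL-Probability.Probability" "HOL-Real_Asymp.Real_Asymp"
    "HOL-Complex_Analysis.Complex_Analysis"
begin

text \<open>By the Cauchy--Schwarz inequality, the integral is bounded by the product of two factors:
  the square root of the fourth moment, under Lebesgue measure, of the quadratic form in \<open>f\<close>, and the
  square root of the integral of the squared Gibbs weight, divided by the partition function.
  In the fourth moment neutrality removes the linear terms of the Hoeffding decomposition, and
  symmetrization reduces the degenerate remainder to the fourth moment of a Rademacher chaos. The
  partition function is bounded below by \<open>exp u \<ge> 1 + u\<close> and neutrality.

  For the weight, a Riemann map turns \<open>1 - exp (- 4 \<pi> G)\<close> into the positive semidefinite kernel
  \<open>(1 - |z|\<^sup>2) (1 - |w|\<^sup>2) / |1 - z cnj w|\<^sup>2\<close>;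
  hence \<open>4 \<pi> G = - ln (1 - T) = (\<Sum>n\<ge>1. T ^ n / n)\<close> and all its truncations
  are positive semidefinite. Replacing the interaction by a cutoff at a scale depending on the closest
  pair gives integrability for each \<open>N\<close> with \<open>\<beta> < 2 \<pi> N\<close> and polynomial growth in \<open>N\<close>. For large
  \<open>N\<close> a fixed cutoff part is bounded pointwise; the remaining kernel is small in \<open>L\<^sup>p\<close> and is
  handled by moments of the chaos up to order \<open>ln N\<close>, off the event, of small probability, that some
  pair is too close.\<close>

section \<open>Positive semidefinite kernels\<close>

text \<open>Squaring the weight doubles \<open>\<beta>\<close>: with
  \<open>k = \<beta> / (2 * pi * N)\<close>, the squared weight is singular like the distance of two
  opposite charges to the power \<open>- 2 * k\<close>, and like the distance to the boundary to the
  power \<open>- k\<close>. In the plane both powers are integrable for \<open>k < 1\<close>, that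
  is for \<open>\<beta> < 2 * pi * N\<close>, so the hypothesis pays exactly for the loss in
  Cauchy--Schwarz. The obstacle is uniformity in \<open>N\<close>. There are about
  \<open>N ^ 2 / 2\<close> pairs, and Onsager's inequality alone loses a power of \<open>N\<close>,
  which is harmless only on an event of comparably small probability. Elsewhere the exponent is a
  degenerate pair sum divided by \<open>N\<close>; its exponential moments stay bounded if the
  kernel is small enough. It can be made small, because the part of the interaction that is split
  off is a bounded positive semidefinite kernel and costs only its diagonal. The form
  \<open>- ln (1 - T)\<close> is what permits such cutoffs: the coefficients of its expansion in
  powers of \<open>T\<close> may be lowered, even by factors depending on the particles, without
  losing positivity.\<close>

definition psd :: "nat \<Rightarrow> (nat \<Rightarrow> nat \<Rightarrow> real) \<Rightarrow> bool" where
  "psd N A \<longleftrightarrow> (\<forall>v :: nat \<Rightarrow> real. 0 \<le> (\<Sum>i<N. \<Sum>j<N. v i * v j * A i j))"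

text \<open>Stability under entrywise products passes to all powers of \<open>T\<close> at once;
  positivity of \<open>T\<close> itself is the case of the all-ones matrix \<open>A\<close>.\<close>

definition schur_mult :: "nat \<Rightarrow> (nat \<Rightarrow> nat \<Rightarrow> real) \<Rightarrow> bool" where
  "schur_mult N T \<longleftrightarrow> (\<forall>A. psd N A \<longrightarrow> psd N (\<lambda>i j. T i j * A i j))"

lemma psd_cong: "(\<And>i j. i < N \<Longrightarrow> j < N \<Longrightarrow> A i j = B i j) \<Longrightarrow> psd N A = psd N B"
  unfolding psd_def by simp

lemma psd_rank_one: "psd N A \<Longrightarrow> psd N (\<lambda>i j. u i * u j * A i j)"
  unfolding psd_def
proof
  fix v assume *: "\<forall>v. 0 \<le> (\<Sum>i<N. \<Sum>j<N. v i * v j * A i j)"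
  from *[rule_format, of "\<lambda>i. v i * u i"]
  show "0 \<le> (\<Sum>i<N. \<Sum>j<N. v i * v j * (u i * u j * A i j))"
    by (simp add: mult_ac)
qed

lemma psd_sum: "(\<And>k. k \<in> K \<Longrightarrow> psd N (A k)) \<Longrightarrow> psd N (\<lambda>i j. \<Sum>k\<in>K. A k i j)"
  unfolding psd_def
proof
  fix v assume *: "\<And>k. k \<in> K \<Longrightarrow> \<forall>v. 0 \<le> (\<Sum>i<N. \<Sum>j<N. v i * v j * A k i j)"
  have "(\<Sum>i<N. \<Sum>j<N. v i * v j * (\<Sum>k\<in>K. A k i j)) = (\<Sum>i<N. \<Sum>j<N. \<Sum>k\<in>K. v i * v j * A k i j)"
    by (simp add: sum_distrib_left)
  also have "\<dots> = (\<Sum>i<N. \<Sum>k\<in>K. \<Sum>j<N. v i * v j * A k i j)"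
    by (intro sum.cong refl sum.swap)
  also have "\<dots> = (\<Sum>k\<in>K. \<Sum>i<N. \<Sum>j<N. v i * v j * A k i j)"
    by (rule sum.swap)
  finally show "0 \<le> (\<Sum>i<N. \<Sum>j<N. v i * v j * (\<Sum>k\<in>K. A k i j))"
    using * by (simp add: sum_nonneg)
qed

lemma psd_add: "psd N A \<Longrightarrow> psd N B \<Longrightarrow> psd N (\<lambda>i j. A i j + B i j)"
  unfolding psd_def by (simp add: distrib_left sum.distrib)

lemma psd_scale: "psd N A \<Longrightarrow> 0 \<le> c \<Longrightarrow> psd N (\<lambda>i j. c * A i j)"
  unfolding psd_def by (simp add: mult.left_commute[of _ c] flip: sum_distrib_left)

lemma psd_LIMSEQ:
  assumes "\<And>i j. i < N \<Longrightarrow> j < N \<Longrightarrow> (\<lambda>m. A m i j) \<longlonglongrightarrow> B i j" and "\<And>m. psd N (A m)"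
  shows "psd N B"
  unfolding psd_def
proof
  fix v
  have "(\<lambda>m. \<Sum>i<N. \<Sum>j<N. v i * v j * A m i j) \<longlonglongrightarrow> (\<Sum>i<N. \<Sum>j<N. v i * v j * B i j)"
    by (intro tendsto_intros assms) auto
  then show "0 \<le> (\<Sum>i<N. \<Sum>j<N. v i * v j * B i j)"
    by (rule LIMSEQ_le_const) (use assms(2) in \<open>auto simp: psd_def\<close>)
qed

text \<open>A Gram matrix: \<open>min (b i) (b j)\<close> is the inner product in \<open>L2\<close>
  of the indicators of \<open>{0..<b i}\<close> and \<open>{0..<b j}\<close>.\<close>

lemma psd_min:
  assumes "\<And>i. i < N \<Longrightarrow> 0 \<le> b i"
  shows "psd N (\<lambda>i j. min (b i) (b j))"
  unfolding psd_def
proof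
  fix v
  have *: "integrable lborel (\<lambda>x. indicator {0..<min (b i) (b j)} x * c)" if "i < N" "j < N" for i j and c :: real
    using that assms by (auto simp: min_def)
  have "(\<Sum>i<N. \<Sum>j<N. v i * v j * min (b i) (b j)) =
      (\<Sum>i<N. \<Sum>j<N. (\<integral>x. indicator {0..<min (b i) (b j)} x * (v i * v j) \<partial>lborel))"
    by (intro sum.cong refl) (use assms in \<open>auto simp: min_def\<close>)
  also have "\<dots> = (\<integral>x. (\<Sum>i<N. \<Sum>j<N. indicator {0..<min (b i) (b j)} x * (v i * v j)) \<partial>lborel)"
    by (subst Bochner_Integration.integral_sum, intro Bochner_Integration.integrable_sum *, simp, simp,
        intro sum.cong refl Bochner_Integration.integral_sum[symmetric] *) auto
  also have "\<dots> = (\<integral>x. (\<Sum>i<N. indicator {0..<b i} x * v i)\<^sup>2 \<partial>lborel)"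
    unfolding power2_eq_square sum_product
    by (intro Bochner_Integration.integral_cong refl sum.cong) (auto simp: indicator_def)
  also have "0 \<le> \<dots>" by simp
  finally show "0 \<le> (\<Sum>i<N. \<Sum>j<N. v i * v j * min (b i) (b j))" .
qed

text \<open>The squared modulus of the Szego kernel \<open>1 / (1 - z * cnj w)\<close> of the unit
  disc, normalized to be \<open>1\<close> on the diagonal. Its complement to \<open>1\<close> is the
  squared pseudo-hyperbolic distance, which is how the Green function enters.\<close>

definition szego :: "complex \<Rightarrow> complex \<Rightarrow> real" where
  "szego z w = (1 - (cmod z)\<^sup>2) * (1 - (cmod w)\<^sup>2) / (cmod (1 - z * cnj w))\<^sup>2"

text \<open>The squared modulus of the truncated geometric series is a double sum of hermitian rank
  one kernels. It is real, so real parts may be taken, and each real part splits into two real rank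
  one kernels.\<close>

lemma schur_mult_hermitian_square:
  assumes "psd N A"
  shows "psd N (\<lambda>i j. (cmod (\<Sum>k<m. (z i * cnj (z j)) ^ k))\<^sup>2 * A i j)"
proof -
  define u where "u k l i = z i ^ k * cnj (z i) ^ l" for k l :: nat and i
  have *: "complex_of_real ((cmod (\<Sum>k<m. (z i * cnj (z j)) ^ k))\<^sup>2) = (\<Sum>k<m. \<Sum>l<m. u k l i * cnj (u k l j))" for i j
    unfolding complex_norm_square by (simp add: sum_product power_mult_distrib u_def mult_ac)
  have "(cmod (\<Sum>k<m. (z i * cnj (z j)) ^ k))\<^sup>2 = (\<Sum>k<m. \<Sum>l<m. Re (u k l i * cnj (u k l j)))" for i j
    using arg_cong[OF *[of i j], of Re] by simp
  then have "(cmod (\<Sum>k<m. (z i * cnj (z j)) ^ k))\<^sup>2 * A i j =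
     (\<Sum>k<m. \<Sum>l<m. Re (u k l i) * Re (u k l j) * A i j + Im (u k l i) * Im (u k l j) * A i j)" for i j
    by (simp add: sum_distrib_right distrib_right)
  then show ?thesis
    by (simp only:) (intro psd_sum psd_add psd_rank_one assms)
qed

lemma schur_mult_szego:
  assumes z: "\<And>i. i < N \<Longrightarrow> cmod (z i) < 1"
  shows "schur_mult N (\<lambda>i j. szego (z i) (z j))"
  unfolding schur_mult_def
proof safe
  fix A assume A: "psd N A"
  have "psd N (\<lambda>i j. (cmod (1 / (1 - z i * cnj (z j))))\<^sup>2 * A i j)"
  proof (rule psd_LIMSEQ)
    show "psd N (\<lambda>i j. (cmod (\<Sum>k<m. (z i * cnj (z j)) ^ k))\<^sup>2 * A i j)" for m
      by (rule schur_mult_hermitian_square[OF A])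
    fix i j assume "i < N" "j < N"
    then have "cmod (z i * cnj (z j)) < 1"
      using z[of i] z[of j] by (metis mult_strict_mono' mult_1_left norm_mult complex_mod_cnj norm_ge_zero)
    then have "(\<lambda>m. \<Sum>k<m. (z i * cnj (z j)) ^ k) \<longlonglongrightarrow> 1 / (1 - z i * cnj (z j))"
      using geometric_sums sums_def by blast
    then show "(\<lambda>m. (cmod (\<Sum>k<m. (z i * cnj (z j)) ^ k))\<^sup>2 * A i j)
       \<longlonglongrightarrow> (cmod (1 / (1 - z i * cnj (z j))))\<^sup>2 * A i j"
      by (intro tendsto_intros)
  qed
  from psd_rank_one[OF this, of "\<lambda>i. 1 - (cmod (z i))\<^sup>2"]
  show "psd N (\<lambda>i j. szego (z i) (z j) * A i j)"
    by (simp add: szego_def norm_divide power_divide)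
qed

lemma ln_one_minus_sums:
  fixes x :: real
  assumes "0 \<le> x" "x < 1"
  shows "(\<lambda>n. x ^ Suc n / real (Suc n)) sums (- ln (1 - x))"
proof -
  have a: "summable (\<lambda>n. x ^ Suc n / real (Suc n))"
  proof (rule summable_comparison_test')
    show "summable (\<lambda>n. x ^ n)" using assms by simp
    show "norm (x ^ Suc n / real (Suc n)) \<le> x ^ n" if "n \<ge> 0" for n
    proof -
      have "x ^ Suc n / real (Suc n) \<le> x ^ Suc n / 1" using assms by (intro divide_left_mono) auto
      also have "\<dots> \<le> x ^ n" using assms by (simp add: mult_left_le_one_le)
      finally show ?thesis using assms by simp
    qed
  qed
  have "ln (1 - x) = (\<Sum>n. (- 1) ^ n * (1 / real (n + 1)) * (1 - x - 1) ^ Suc n)"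
    by (rule ln_series) (use assms in auto)
  also have "(\<lambda>n. (- 1) ^ n * (1 / real (n + 1)) * (1 - x - 1) ^ Suc n) = (\<lambda>n. - (x ^ Suc n / real (Suc n)))"
  proof
    fix n
    have "(- 1) ^ n * (1 / real (n + 1)) * (1 - x - 1) ^ Suc n = (- 1) ^ n * (- 1) ^ Suc n * (x ^ Suc n / real (Suc n))"
      by (simp add: power_minus[of x])
    also have "(- 1 :: real) ^ n * (- 1) ^ Suc n = - 1" by (simp flip: power_mult_distrib)
    finally show "(- 1) ^ n * (1 / real (n + 1)) * (1 - x - 1) ^ Suc n = - (x ^ Suc n / real (Suc n))" by simp
  qed
  finally show ?thesis using a by (simp add: suminf_minus summable_sums)
qed

text \<open>The coefficient of \<open>T i j ^ n\<close> in the series is \<open>1 / n\<close> times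
  \<open>min (l i ^ n) (l j ^ n) - b ^ n\<close>, since powers commute with \<open>min\<close> on
  nonnegative numbers. This is the \<open>min\<close> of the nonnegative quantities
  \<open>l i ^ n - b ^ n\<close>, a Gram matrix. Hence the cutoff \<open>l i\<close> may differ from
  particle to particle.\<close>

lemma psd_log:
  assumes T: "schur_mult N T" "\<And>i j. i < N \<Longrightarrow> j < N \<Longrightarrow> 0 \<le> T i j \<and> T i j \<le> 1"
    and l: "0 \<le> b" "\<And>i. i < N \<Longrightarrow> b \<le> l i \<and> l i < 1"
  shows "psd N (\<lambda>i j. ln ((1 - b * T i j) / (1 - min (l i) (l j) * T i j)))"
proof (rule psd_LIMSEQ)
  define B where "B n i j = T i j ^ n * (min (l i ^ n) (l j ^ n) - b ^ n)" for n i j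
  have pw: "psd N (\<lambda>i j. T i j ^ n * A i j)" if "psd N A" for n A
    using T(1) that by (induction n) (auto simp: schur_mult_def mult.assoc)
  have "psd N (\<lambda>i j. min (l i ^ n - b ^ n) (l j ^ n - b ^ n))" for n
    by (rule psd_min) (use l in \<open>auto intro: power_mono\<close>)
  then have "psd N (\<lambda>i j. min (l i ^ n) (l j ^ n) - b ^ n)" for n
    by (rule psd_cong[THEN iffD1, rotated]) (auto simp: min_def)
  then have B: "psd N (B n)" for n unfolding B_def by (rule pw)
  show "psd N (\<lambda>i j. \<Sum>n<m. 1 / real (Suc n) * B (Suc n) i j)" for m
    by (intro psd_sum psd_scale B) auto
  fix i j assume ij: "i < N" "j < N"
  define t where "t = min (l i) (l j)"
  have t: "b \<le> t" "t < 1" using l(2)[OF ij(1)] l(2)[OF ij(2)] by (auto simp: t_def)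
  have TT: "0 \<le> T i j" "T i j \<le> 1" using T(2) ij by auto
  have tp: "min (l i ^ n) (l j ^ n) = t ^ n" for n
  proof -
    have "0 \<le> l i" "0 \<le> l j" using l ij by (meson order_trans)+
    then show ?thesis unfolding t_def min_def
      by (auto intro: power_mono antisym) (metis linorder_le_cases power_mono order_antisym)
  qed
  have b1: "b * T i j < 1" using t TT l(1) by (metis le_less_trans mult_left_le)
  have t1: "t * T i j < 1" using t TT l(1) by (metis le_less_trans mult_left_le order_trans)
  have "(\<lambda>n. (t * T i j) ^ Suc n / real (Suc n) - (b * T i j) ^ Suc n / real (Suc n)) sums
     (- ln (1 - t * T i j) - - ln (1 - b * T i j))"
    by (intro sums_diff ln_one_minus_sums t1 b1) (use t TT l in auto)
  also have "- ln (1 - t * T i j) - - ln (1 - b * T i j) = ln ((1 - b * T i j) / (1 - t * T i j))"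
    using b1 t1 by (simp add: ln_div)
  also have "(\<lambda>n. (t * T i j) ^ Suc n / real (Suc n) - (b * T i j) ^ Suc n / real (Suc n)) =
     (\<lambda>n. 1 / real (Suc n) * B (Suc n) i j)"
    by (rule ext) (simp add: B_def tp power_mult_distrib diff_divide_distrib right_diff_distrib mult_ac del: power_Suc)
  finally show "(\<lambda>m. \<Sum>n<m. 1 / real (Suc n) * B (Suc n) i j) \<longlonglongrightarrow>
      ln ((1 - b * T i j) / (1 - min (l i) (l j) * T i j))"
    by (simp add: sums_def t_def)
qed

section \<open>Pair sums with neutral charges, and Onsager's inequality\<close>

lemma sum_sym_split:
  fixes h :: "nat \<Rightarrow> nat \<Rightarrow> real"
  assumes "\<And>i j. i < N \<Longrightarrow> j < N \<Longrightarrow> h i j = h j i"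
  shows "(\<Sum>i<N. \<Sum>j<N. h i j) = 2 * (\<Sum>j<N. \<Sum>i<j. h i j) + (\<Sum>i<N. h i i)"
  using assms
proof (induction N)
  case (Suc N)
  have "(\<Sum>i<N. h i N) = (\<Sum>i<N. h N i)" using Suc.prems by (intro sum.cong) auto
  then show ?case using Suc by (simp add: sum.distrib)
qed simp

lemma psd_pair_sum_ge:
  assumes "psd N Q" "\<And>i j. i < N \<Longrightarrow> j < N \<Longrightarrow> Q i j = Q j i" "\<And>i. i < N \<Longrightarrow> \<xi> i \<in> {1, -1::real}"
  shows "(\<Sum>j<N. \<Sum>i<j. \<xi> i * \<xi> j * Q i j) \<ge> - (1 / 2) * (\<Sum>i<N. Q i i)"
proof -
  have "0 \<le> (\<Sum>i<N. \<Sum>j<N. \<xi> i * \<xi> j * Q i j)" using assms(1) by (simp add: psd_def)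
  also have "\<dots> = 2 * (\<Sum>j<N. \<Sum>i<j. \<xi> i * \<xi> j * Q i j) + (\<Sum>i<N. \<xi> i * \<xi> i * Q i i)"
    by (rule sum_sym_split) (use assms(2) in simp)
  also have "(\<Sum>i<N. \<xi> i * \<xi> i * Q i i) = (\<Sum>i<N. Q i i)"
    by (intro sum.cong refl) (use assms(3) in force)
  finally show ?thesis by simp
qed

lemma neutral_pair_sum:
  fixes \<xi> :: "nat \<Rightarrow> real"
  assumes "\<And>i. i < N \<Longrightarrow> \<xi> i \<in> {1, -1}" "(\<Sum>i<N. \<xi> i) = 0"
  shows "(\<Sum>j<N. \<Sum>i<j. \<xi> i * \<xi> j) = - (real N / 2)"
proof -
  have "0 = (\<Sum>i<N. \<Sum>j<N. \<xi> i * \<xi> j)" using assms(2) by (simp flip: sum_distrib_left)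
  also have "\<dots> = 2 * (\<Sum>j<N. \<Sum>i<j. \<xi> i * \<xi> j) + (\<Sum>i<N. \<xi> i * \<xi> i)"
    by (rule sum_sym_split) simp
  also have "(\<Sum>i<N. \<xi> i * \<xi> i) = (\<Sum>i<N. 1)"
    by (intro sum.cong refl) (use assms(1) in force)
  finally show ?thesis by simp
qed

text \<open>By neutrality the full double sum vanishes, so the sum over pairs is minus half of its
  diagonal: terms depending on a single particle drop from order \<open>N ^ 2\<close> to order
  \<open>N\<close>.\<close>

lemma linear_pair_sum:
  fixes b :: "nat \<Rightarrow> real"
  assumes "\<And>i. i < N \<Longrightarrow> \<xi> i \<in> {1, -1}" "(\<Sum>i<N. \<xi> i) = 0"
  shows "(\<Sum>j<N. \<Sum>i<j. \<xi> i * \<xi> j * (b i + b j)) = - (\<Sum>i<N. b i)"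
proof -
  have "(\<Sum>i<N. \<Sum>j<N. \<xi> i * \<xi> j * (b i + b j)) =
      (\<Sum>i<N. \<xi> i * b i) * (\<Sum>j<N. \<xi> j) + (\<Sum>i<N. \<xi> i) * (\<Sum>j<N. \<xi> j * b j)"
    unfolding sum_product sum.distrib[symmetric] by (intro sum.cong refl) (simp add: algebra_simps)
  then have "0 = (\<Sum>i<N. \<Sum>j<N. \<xi> i * \<xi> j * (b i + b j))" using assms(2) by simp
  also have "\<dots> = 2 * (\<Sum>j<N. \<Sum>i<j. \<xi> i * \<xi> j * (b i + b j)) + (\<Sum>i<N. \<xi> i * \<xi> i * (b i + b i))"
    by (rule sum_sym_split) (simp add: algebra_simps)
  also have "(\<Sum>i<N. \<xi> i * \<xi> i * (b i + b i)) = (\<Sum>i<N. 2 * b i)"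
    by (intro sum.cong refl) (use assms(1) in force)
  finally show ?thesis by (simp flip: sum_distrib_left)
qed

text \<open>The electrostatic inequality of Onsager: the interaction is replaced by one cut off at a scale
  \<open>m i\<close> depending on the particle, which remains positive semidefinite.\<close>

lemma onsager:
  assumes T: "schur_mult N T" "\<And>i. i < N \<Longrightarrow> T i i = 1" "\<And>i j. i < N \<Longrightarrow> j < N \<Longrightarrow> T i j = T j i"
      "\<And>i j. i < N \<Longrightarrow> j < N \<Longrightarrow> i \<noteq> j \<Longrightarrow> 0 \<le> T i j \<and> T i j < 1"
    and xi: "\<And>i. i < N \<Longrightarrow> \<xi> i \<in> {1, -1::real}"
    and b: "0 \<le> b" and m: "\<And>i. i < N \<Longrightarrow> 0 < m i \<and> m i \<le> 1 - b"
    and mT: "\<And>i j. i < N \<Longrightarrow> j < N \<Longrightarrow> i \<noteq> j \<Longrightarrow> real N * m i \<le> 1 - T i j"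
  shows "(\<Sum>j<N. \<Sum>i<j. \<xi> i * \<xi> j * ln ((1 - b * T i j) / (1 - T i j)))
     \<ge> - (1 / 2) * (\<Sum>i<N. ln ((1 - b) / m i)) - real N / 2"
proof -
  define Q where "Q i j = ln ((1 - b * T i j) / (1 - min (1 - m i) (1 - m j) * T i j))" for i j
  have T01: "0 \<le> T i j \<and> T i j \<le> 1" if "i < N" "j < N" for i j
    using T(2)[of i] T(4)[of i j] that by (cases "i = j") auto
  have "psd N Q" unfolding Q_def
    by (rule psd_log[OF T(1) T01 b]) (use m in \<open>auto simp: algebra_simps\<close>)
  then have 1: "(\<Sum>j<N. \<Sum>i<j. \<xi> i * \<xi> j * Q i j) \<ge> - (1 / 2) * (\<Sum>i<N. Q i i)"
    by (rule psd_pair_sum_ge) (use T(3) xi in \<open>auto simp: Q_def min.commute\<close>)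
  have 2: "(\<Sum>i<N. Q i i) = (\<Sum>i<N. ln ((1 - b) / m i))"
    unfolding Q_def by (intro sum.cong refl) (use T(2) in simp)
  \<comment> \<open>Passing from the true interaction to \<open>Q\<close> changes each pair by an
    amount between \<open>0\<close> and \<open>1 / N\<close>, because \<open>N * M\<close> is at
    most \<open>1 - T i j\<close>. This is harmless for either sign of the charges, and at most
    \<open>N ^ 2 / 2\<close> pairs cost at most \<open>N / 2\<close>.\<close>
  have "(\<Sum>j<N. \<Sum>i<j. \<xi> i * \<xi> j * ln ((1 - b * T i j) / (1 - T i j)) - \<xi> i * \<xi> j * Q i j)
      \<ge> (\<Sum>j<N. \<Sum>i<j. - (1 / real N))"
  proof (intro sum_mono)
    fix i j assume "j \<in> {..<N}" "i \<in> {..<j}"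
    then have ij: "i < N" "j < N" "i \<noteq> j" by auto
    define M where "M = max (m i) (m j)"
    define t where "t = T i j"
    have t: "0 \<le> t" "t < 1" using T(4) ij by (auto simp: t_def)
    have M: "0 < M" "M \<le> 1 - b" "real N * M \<le> 1 - t"
      using m ij mT[of i j] mT[of j i] T(3)[of i j] by (auto simp: M_def max_def t_def)
    have mM: "min (1 - m i) (1 - m j) = 1 - M" by (auto simp: M_def)
    have p1: "0 < 1 - (1 - M) * t"
    proof -
      have "(1 - M) * t \<le> 1 * t" using M t by (intro mult_right_mono) auto
      then show ?thesis using t by linarith
    qed
    have p2: "0 < 1 - b * t"
    proof -
      have "b * t \<le> 1 * t" using M t by (intro mult_right_mono) auto
      then show ?thesis using t by linarith
    qed
    have eq: "ln ((1 - b * t) / (1 - t)) - ln ((1 - b * t) / (1 - (1 - M) * t)) = ln ((1 - (1 - M) * t) / (1 - t))"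
      using p1 p2 t by (simp add: ln_div)
    have r: "(1 - (1 - M) * t) / (1 - t) = 1 + M * t / (1 - t)" using t by (simp add: field_simps)
    have Mt: "0 \<le> M * t / (1 - t)" using M t by simp
    have "ln (1 + M * t / (1 - t)) \<le> M * t / (1 - t)" by (rule ln_add_one_self_le_self[OF Mt])
    also have "\<dots> \<le> M / (1 - t)" using M t by (intro divide_right_mono) (auto simp: mult_left_le)
    also have "\<dots> \<le> 1 / real N" using M(3) t ij by (simp add: field_simps)
    finally have up: "ln ((1 - (1 - M) * t) / (1 - t)) \<le> 1 / real N" using r by simp
    have lo: "0 \<le> ln ((1 - (1 - M) * t) / (1 - t))" unfolding r using Mt by simp
    have "\<xi> i * \<xi> j \<in> {1, -1}" using xi[OF ij(1)] xi[OF ij(2)] by auto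
    then have "\<xi> i * \<xi> j * (ln ((1 - b * t) / (1 - t)) - ln ((1 - b * t) / (1 - (1 - M) * t))) \<ge> - (1 / real N)"
      unfolding eq using up lo by auto
    then show "- (1 / real N) \<le> \<xi> i * \<xi> j * ln ((1 - b * T i j) / (1 - T i j)) - \<xi> i * \<xi> j * Q i j"
      unfolding Q_def mM by (simp add: t_def right_diff_distrib)
  qed
  also have "(\<Sum>j<N. \<Sum>i<j. - (1 / real N)) \<ge> (\<Sum>j<N. - 1 / 2) - 0"
  proof -
    have "(\<Sum>j<N. real j) = (real N * real N - real N) / 2"
      by (induction N) (auto simp: field_simps)
    then have "(\<Sum>j<N. real j) \<le> real N * real N / 2" by simp
    then have "(\<Sum>j<N. real j) / real N \<le> real N / 2" by (cases "N = 0") (auto simp: field_simps)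
    then show ?thesis by (simp add: sum_negf flip: sum_divide_distrib)
  qed
  finally have 3: "(\<Sum>j<N. \<Sum>i<j. \<xi> i * \<xi> j * ln ((1 - b * T i j) / (1 - T i j)) - \<xi> i * \<xi> j * Q i j) \<ge> - real N / 2"
    by (simp add: sum_negf)
  show ?thesis using 1 2 3 by (simp add: sum_subtractf)
qed

section \<open>Rademacher chaos\<close>

text \<open>Expectation over independent uniform signs at the indices below \<open>n\<close>, the
  remaining entries being \<open>0\<close>. The recursion splits off the last sign, which matches
  the induction on matrices below.\<close>

primrec radavg :: "nat \<Rightarrow> ((nat \<Rightarrow> real) \<Rightarrow> real) \<Rightarrow> real" where
  "radavg 0 F = F (\<lambda>_. 0)"
| "radavg (Suc n) F = (radavg n (\<lambda>e. F (e(n := 1))) + radavg n (\<lambda>e. F (e(n := -1)))) / 2"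

lemma radavg_mono:
  "(\<And>e. (\<And>i. i < n \<Longrightarrow> e i \<in> {1, -1}) \<Longrightarrow> F e \<le> G e) \<Longrightarrow> radavg n F \<le> radavg n G"
proof (induction n arbitrary: F G)
  case (Suc n)
  have "radavg n (\<lambda>e. F (e(n := s))) \<le> radavg n (\<lambda>e. G (e(n := s)))" if "s \<in> {1, -1}" for s
    by (intro Suc.IH Suc.prems) (use that in \<open>auto simp: less_Suc_eq\<close>)
  from this[of 1] this[of "-1"] show ?case by simp
qed simp

lemma radavg_add: "radavg n (\<lambda>e. F e + G e) = radavg n F + radavg n G"
  by (induction n arbitrary: F G) (auto simp: add_divide_distrib)

lemma radavg_mult: "radavg n (\<lambda>e. c * F e) = c * radavg n F"
  by (induction n arbitrary: F) (auto simp: field_simps)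

lemma radavg_const: "radavg n (\<lambda>e. c) = c"
  by (induction n) auto

lemma cosh_even_sums: "(\<lambda>n. (x::real) ^ (2 * n) / fact (2 * n)) sums cosh x"
proof -
  have s1: "(\<lambda>n. if even n then x ^ n /\<^sub>R fact n else 0) sums cosh x" by (rule cosh_converges)
  have "(\<lambda>n. (if even (2 * n) then x ^ (2 * n) /\<^sub>R fact (2 * n) else 0)) sums cosh x"
    by (subst sums_mono_reindex[of "\<lambda>n. 2 * n" "\<lambda>n. if even n then x ^ n /\<^sub>R fact n else 0" "cosh x"])
       (use s1 in \<open>auto simp: strict_mono_def elim!: evenE\<close>)
  then show ?thesis by (simp add: field_simps)
qed

text \<open>Termwise comparison of the Taylor series through
  \<open>2 ^ n * fact n \<le> fact (2 * n)\<close>; this is the subgaussian bound for a single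
  sign.\<close>

lemma cosh_le_exp_square: "cosh (x::real) \<le> exp (x\<^sup>2 / 2)"
proof -
  have s3: "(\<lambda>n. (x\<^sup>2 / 2) ^ n /\<^sub>R fact n) sums exp (x\<^sup>2 / 2)" by (rule exp_converges)
  show ?thesis
  proof (rule sums_le[OF _ cosh_even_sums s3])
    fix n
    have "2 ^ n * fact n \<le> (fact (2 * n) :: real)"
    proof (induction n)
      case (Suc n)
      have "2 ^ Suc n * fact (Suc n) = (2 * real n + 2) * (2 ^ n * fact n)" by (simp add: algebra_simps)
      also have "\<dots> \<le> (2 * real n + 2) * fact (2 * n)" using Suc by (intro mult_left_mono) auto
      also have "\<dots> \<le> (2 * real n + 2) * ((2 * real n + 1) * fact (2 * n))"
        by (intro mult_left_mono) (simp_all add: distrib_right)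
      also have "\<dots> = fact (2 * Suc n)" by (simp add: algebra_simps)
      finally show ?case .
    qed simp
    then have "x ^ (2 * n) / fact (2 * n) \<le> x ^ (2 * n) / (2 ^ n * fact n)"
      by (intro divide_left_mono) auto
    also have "\<dots> = (x\<^sup>2 / 2) ^ n /\<^sub>R fact n"
      by (simp only: power_divide power_mult[symmetric]) (simp add: field_simps)
    finally show "x ^ (2 * n) / fact (2 * n) \<le> (x\<^sup>2 / 2) ^ n /\<^sub>R fact n" .
  qed
qed

definition quadform :: "nat \<Rightarrow> (nat \<Rightarrow> nat \<Rightarrow> real) \<Rightarrow> (nat \<Rightarrow> real) \<Rightarrow> real" where
  "quadform n A e = (\<Sum>j<n. \<Sum>i<j. A i j * e i * e j)"

definition hs_norm :: "nat \<Rightarrow> (nat \<Rightarrow> nat \<Rightarrow> real) \<Rightarrow> real" where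
  "hs_norm n A = L2_set (\<lambda>(i, j). A i j) ({..<n} \<times> {..<n})"

lemma hs_norm_square: "(hs_norm n A)\<^sup>2 = (\<Sum>i<n. \<Sum>j<n. (A i j)\<^sup>2)"
  unfolding hs_norm_def L2_set_def by (simp add: sum_nonneg sum.cartesian_product split_def)

lemma hs_norm_nonneg: "0 \<le> hs_norm n A"
  by (simp add: hs_norm_def L2_set_nonneg)

text \<open>Averaging over the last sign \<open>e n\<close> adds the rank one matrix \<open>r i * r j\<close> to the remaining
  matrix, whose Hilbert--Schmidt norm however does not increase as long as it is at most \<open>1/2\<close>.\<close>

lemma radavg_exp_quadform:
  assumes "hs_norm n A \<le> 1 / 2" "\<And>i j. A i j = A j i" "\<And>i. A i i = 0"
  shows "radavg n (\<lambda>e. exp (quadform n A e)) \<le> exp (hs_norm n A / 2)"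
  using assms
proof (induction n arbitrary: A)
  case 0
  then show ?case by (simp add: quadform_def hs_norm_def)
next
  case (Suc n)
  define r where "r i = A i n" for i
  define R where "R = (\<Sum>i<n. (r i)\<^sup>2)"
  \<comment> \<open>Averaging over the last sign gives \<open>cosh S\<close> with \<open>S\<close>
    linear in the other signs, bounded by the exponential of half of \<open>S\<^sup>2\<close>. The
    diagonal of that square is the constant \<open>R\<close>, so \<open>A'\<close> receives only its
    off-diagonal part.\<close>
  define A' where "A' i j = (if i = j then 0 else A i j + r i * r j)" for i j
  define q where "q = hs_norm (Suc n) A"
  define q0 where "q0 = hs_norm n A"
  define q1 where "q1 = hs_norm n A'"
  have R0: "0 \<le> R" by (simp add: R_def sum_nonneg)
  have q: "0 \<le> q" "q \<le> 1 / 2" "0 \<le> q0" "0 \<le> q1" using Suc.prems by (auto simp: q_def q0_def q1_def hs_norm_nonneg)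
  have qsq: "q\<^sup>2 = q0\<^sup>2 + 2 * R"
  proof -
    have "(\<Sum>j<n. (A n j)\<^sup>2) = R" unfolding R_def r_def using Suc.prems(2) by metis
    then show ?thesis unfolding q_def q0_def hs_norm_square
      by (simp add: sum.distrib R_def r_def Suc.prems(3))
  qed
  have "q1 \<le> L2_set (\<lambda>(i, j). A i j + r i * r j) ({..<n} \<times> {..<n})"
    unfolding q1_def hs_norm_def L2_set_def
    by (intro real_sqrt_le_mono sum_mono) (auto simp: A'_def)
  also have "\<dots> = L2_set (\<lambda>p. (case p of (i, j) \<Rightarrow> A i j) + (case p of (i, j) \<Rightarrow> r i * r j)) ({..<n} \<times> {..<n})"
    by (simp add: split_def)
  also have "\<dots> \<le> q0 + L2_set (\<lambda>(i, j). r i * r j) ({..<n} \<times> {..<n})"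
    unfolding q0_def hs_norm_def by (rule L2_set_triangle_ineq)
  also have "L2_set (\<lambda>(i, j). r i * r j) ({..<n} \<times> {..<n}) = R"
  proof -
    have "(\<Sum>p\<in>{..<n} \<times> {..<n}. (case p of (i, j) \<Rightarrow> r i * r j)\<^sup>2) = R * R"
      by (simp add: R_def sum_product sum.cartesian_product split_def power_mult_distrib)
    then show ?thesis using R0 by (simp add: L2_set_def)
  qed
  finally have q1: "q1 \<le> q0 + R" .
  \<comment> \<open>This closes the induction: the factor \<open>exp (R / 2)\<close> is paid for by
    the decrease of the norm. Given \<open>q\<^sup>2 = q0\<^sup>2 + 2 * R\<close>, the stronger
    \<open>q0 \<le> q - 2 * R\<close> follows from \<open>4 * R * q \<le> 2 * R\<close>, which is
    where the bound \<open>1 / 2\<close> on \<open>q\<close> enters.\<close>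
  have q0R: "q0 + R \<le> q - R"
  proof -
    have "q0 \<le> q - 2 * R"
    proof (rule power2_le_imp_le)
      have "2 * R \<le> q\<^sup>2" using qsq by simp
      also have "\<dots> \<le> q * 1" unfolding power2_eq_square using q by (intro mult_left_mono) auto
      finally show "0 \<le> q - 2 * R" by simp
      have "4 * R * q \<le> 2 * R" using R0 q mult_left_mono[of q "1/2" "4 * R"] by simp
      moreover have "(q - 2 * R)\<^sup>2 = q\<^sup>2 - 4 * R * q + 4 * R\<^sup>2" by (simp add: power2_eq_square algebra_simps)
      ultimately show "q0\<^sup>2 \<le> (q - 2 * R)\<^sup>2" using qsq by (smt (verit) zero_le_power2)
    qed
    then show ?thesis by simp
  qed
  have q1': "q1 \<le> q - R" using q1 q0R by simp
  have pt: "(exp (quadform (Suc n) A (e(n := 1))) + exp (quadform (Suc n) A (e(n := -1)))) / 2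
      \<le> exp (R / 2) * exp (quadform n A' e)"
    if e: "\<And>i. i < n \<Longrightarrow> e i \<in> {1, -1}" for e :: "nat \<Rightarrow> real"
  proof -
    define S where "S = (\<Sum>i<n. r i * e i)"
    have qs: "quadform (Suc n) A (e(n := s)) = quadform n A e + s * S" for s
    proof -
      have "(\<Sum>j<n. \<Sum>i<j. A i j * (e(n := s)) i * (e(n := s)) j) = (\<Sum>j<n. \<Sum>i<j. A i j * e i * e j)"
        by (intro sum.cong refl) auto
      then show ?thesis unfolding quadform_def S_def r_def
        by (simp add: sum_distrib_left mult_ac)
    qed
    have "(exp (quadform (Suc n) A (e(n := 1))) + exp (quadform (Suc n) A (e(n := -1)))) / 2
       = exp (quadform n A e) * cosh S"
      unfolding qs cosh_field_def by (simp add: exp_add exp_diff exp_minus field_simps)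
    also have "\<dots> \<le> exp (quadform n A e) * exp (S\<^sup>2 / 2)"
      by (intro mult_left_mono cosh_le_exp_square) auto
    also have "\<dots> = exp (R / 2) * exp (quadform n A' e)"
    proof -
      have "S\<^sup>2 = (\<Sum>i<n. \<Sum>j<n. (r i * e i) * (r j * e j))" by (simp add: S_def power2_eq_square sum_product)
      also have "\<dots> = 2 * (\<Sum>j<n. \<Sum>i<j. (r i * e i) * (r j * e j)) + (\<Sum>i<n. (r i * e i) * (r i * e i))"
        by (rule sum_sym_split) simp
      also have "(\<Sum>i<n. (r i * e i) * (r i * e i)) = R"
        unfolding R_def by (intro sum.cong refl) (use e in \<open>force simp: power2_eq_square\<close>)
      finally have "S\<^sup>2 / 2 = (\<Sum>j<n. \<Sum>i<j. (r i * e i) * (r j * e j)) + R / 2" by simp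
      moreover have "quadform n A' e = quadform n A e + (\<Sum>j<n. \<Sum>i<j. (r i * e i) * (r j * e j))"
        unfolding quadform_def A'_def sum.distrib[symmetric]
        by (intro sum.cong refl) (auto simp: algebra_simps)
      ultimately have "quadform n A e + S\<^sup>2 / 2 = R / 2 + quadform n A' e" by simp
      then show ?thesis by (simp flip: exp_add)
    qed
    finally show ?thesis .
  qed
  have "radavg (Suc n) (\<lambda>e. exp (quadform (Suc n) A e)) =
     radavg n (\<lambda>e. 1/2 * exp (quadform (Suc n) A (e(n := 1))) + 1/2 * exp (quadform (Suc n) A (e(n := -1))))"
    unfolding radavg_add radavg_mult by simp
  also have "\<dots> \<le> radavg n (\<lambda>e. exp (R / 2) * exp (quadform n A' e))"
    by (rule radavg_mono) (use pt in \<open>auto simp: add_divide_distrib\<close>)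
  also have "\<dots> \<le> exp (R / 2) * exp (q1 / 2)"
  proof -
    have "A' i j = A' j i" "A' i i = 0" for i j using Suc.prems(2) by (auto simp: A'_def)
    moreover have "hs_norm n A' \<le> 1 / 2" using q1' q R0 by (simp add: q1_def)
    ultimately show ?thesis unfolding radavg_mult q1_def by (intro mult_left_mono Suc.IH) auto
  qed
  also have "\<dots> \<le> exp (q / 2)" using q1' by (simp flip: exp_add)
  finally show ?case by (simp add: q_def)
qed

lemma power_over_fact_le_cosh: "(x::real) ^ (2 * k) / fact (2 * k) \<le> cosh x"
proof -
  have "sum (\<lambda>n. x ^ (2 * n) / fact (2 * n)) {k} \<le> cosh x"
    unfolding sums_unique[OF cosh_even_sums]
    by (rule sum_le_suminf) (use cosh_even_sums[of x] in \<open>auto simp: sums_iff zero_le_even_power\<close>)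
  then show ?thesis by simp
qed

lemma quadform_scale: "quadform n (\<lambda>i j. c * A i j) e = c * quadform n A e"
  by (simp add: quadform_def sum_distrib_left mult_ac)

lemma hs_norm_scale: "hs_norm n (\<lambda>i j. c * A i j) = \<bar>c\<bar> * hs_norm n A"
proof (rule power2_eq_imp_eq)
  show "(hs_norm n (\<lambda>i j. c * A i j))\<^sup>2 = (\<bar>c\<bar> * hs_norm n A)\<^sup>2"
    by (simp add: hs_norm_square power_mult_distrib sum_distrib_left)
qed (auto simp: hs_norm_nonneg)

text \<open>Rescaling the matrix to norm \<open>1 / 2\<close> makes the exponential moments bounded,
  and a Taylor term of \<open>cosh\<close> is at most \<open>cosh\<close>. The factorial later
  cancels against the Taylor coefficients of the exponential.\<close>

lemma radavg_quadform_moment: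
  assumes sym: "\<And>i j. A i j = A j i" and dg: "\<And>i. A i i = 0"
  shows "radavg n (\<lambda>e. quadform n A e ^ (2 * k)) \<le> 2 * fact (2 * k) * (4 * (hs_norm n A)\<^sup>2) ^ k"
proof (cases "hs_norm n A = 0")
  case True
  have "(\<Sum>i<n. \<Sum>j<n. (A i j)\<^sup>2) = 0" using True hs_norm_square[of n A] by simp
  then have "A i j = 0" if "i < n" "j < n" for i j
    using that by (simp add: sum_nonneg_eq_0_iff sum_nonneg)
  then have "quadform n A e = 0" for e by (simp add: quadform_def)
  then have "radavg n (\<lambda>e. quadform n A e ^ (2 * k)) = 0 ^ (2 * k)" by (simp add: radavg_const)
  also have "\<dots> \<le> 2 * fact (2 * k) * (4 * (hs_norm n A)\<^sup>2) ^ k" using True by (cases k) auto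
  finally show ?thesis .
next
  case False
  define q where "q = hs_norm n A"
  have q: "0 < q" using False hs_norm_nonneg[of n A] by (simp add: q_def)
  define c where "c = 1 / (2 * q)"
  have c: "0 < c" "c * q = 1 / 2" using q by (auto simp: c_def)
  have ex: "radavg n (\<lambda>e. exp (quadform n (\<lambda>i j. t * A i j) e)) \<le> 2" if "\<bar>t\<bar> = c" for t
  proof -
    have "hs_norm n (\<lambda>i j. t * A i j) = 1 / 2" using c that by (simp add: hs_norm_scale q_def)
    then have "radavg n (\<lambda>e. exp (quadform n (\<lambda>i j. t * A i j) e)) \<le> exp ((1 / 2) / 2)"
      using radavg_exp_quadform[of n "\<lambda>i j. t * A i j"] sym dg by (metis mult_zero_right order_refl)
    also have "\<dots> \<le> 2"
    proof -
      have "exp (1 / 4 :: real) \<le> 1 + 1 / 4 + (1 / 4)\<^sup>2" by (rule exp_bound) auto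
      then show ?thesis by (simp add: power2_eq_square)
    qed
    finally show ?thesis .
  qed
  have "radavg n (\<lambda>e. quadform n A e ^ (2 * k)) =
      radavg n (\<lambda>e. (fact (2 * k) / c ^ (2 * k)) * ((c * quadform n A e) ^ (2 * k) / fact (2 * k)))"
    using c by (simp add: power_mult_distrib)
  also have "\<dots> = (fact (2 * k) / c ^ (2 * k)) * radavg n (\<lambda>e. (c * quadform n A e) ^ (2 * k) / fact (2 * k))"
    by (rule radavg_mult)
  also have "\<dots> \<le> (fact (2 * k) / c ^ (2 * k)) * radavg n (\<lambda>e. 1/2 * exp (quadform n (\<lambda>i j. c * A i j) e) + 1/2 * exp (quadform n (\<lambda>i j. - c * A i j) e))"
    unfolding quadform_scale
    by (intro mult_left_mono radavg_mono order_trans[OF power_over_fact_le_cosh])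
       (use c in \<open>auto simp: cosh_field_def add_divide_distrib\<close>)
  also have "\<dots> \<le> (fact (2 * k) / c ^ (2 * k)) * 2"
    unfolding radavg_add radavg_mult using ex[of c] ex[of "-c"] c
    by (intro mult_left_mono) auto
  also have "\<dots> = 2 * fact (2 * k) * (4 * q\<^sup>2) ^ k"
    by (simp add: c_def power_mult power_divide power_mult_distrib)
  finally show ?thesis by (simp add: q_def)
qed

section \<open>Symmetrization\<close>

definition pairsum :: "nat \<Rightarrow> (nat \<Rightarrow> real) \<Rightarrow> ('a \<Rightarrow> 'a \<Rightarrow> real) \<Rightarrow> (nat \<Rightarrow> 'a) \<Rightarrow> real" where
  "pairsum N s w x = (\<Sum>j<N. \<Sum>i<j. s i * s j * w (x i) (x j))"

lemma pairsum_Suc: "pairsum (Suc N) s w x = pairsum N s w x + (\<Sum>a<N. s a * s N * w (x a) (x N))"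
  by (simp add: pairsum_def)

text \<open>Hoeffding decomposition, an identity for any \<open>b\<close> and \<open>m\<close>. With
  \<open>b\<close> the partial mean of \<open>w\<close> and \<open>m\<close> its mean, the first
  term is degenerate; neutrality reduces the other two to order \<open>N\<close>.\<close>

lemma canonical_split:
  fixes b :: "'a \<Rightarrow> real"
  assumes "\<And>i. i < N \<Longrightarrow> \<xi> i \<in> {1, -1}" "(\<Sum>i<N. \<xi> i) = 0"
  shows "pairsum N \<xi> w x = pairsum N \<xi> (\<lambda>x y. w x y - b x - b y + m) x - (\<Sum>i<N. b (x i)) + m * real N / 2"
proof -
  have "pairsum N \<xi> w x = pairsum N \<xi> (\<lambda>x y. w x y - b x - b y + m) x
     + (\<Sum>j<N. \<Sum>i<j. \<xi> i * \<xi> j * (b (x i) + b (x j))) - m * (\<Sum>j<N. \<Sum>i<j. \<xi> i * \<xi> j)"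
    unfolding pairsum_def sum_distrib_left sum.distrib[symmetric] sum_subtractf[symmetric]
    by (intro sum.cong refl) (simp add: algebra_simps)
  then show ?thesis using linear_pair_sum[OF assms, of "\<lambda>i. b (x i)"] neutral_pair_sum[OF assms] by simp
qed

lemma pairsum_fresh: "N \<le> i \<Longrightarrow> pairsum N (s(i := r)) w (x(i := y)) = pairsum N s w x"
  unfolding pairsum_def by (intro sum.cong refl) auto

lemma pairsum_fresh'': "N \<le> i \<Longrightarrow> pairsum N s w (x(i := y)) = pairsum N s w x"
  unfolding pairsum_def by (intro sum.cong refl) auto

lemma pairsum_fresh': "N \<le> i \<Longrightarrow> pairsum N (s(i := r)) w x = pairsum N s w x"
  unfolding pairsum_def by (intro sum.cong refl) auto

text \<open>Freezing all particles but one leaves a constant plus \<open>r\<close> times a function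
  of \<open>y\<close>, the form needed for symmetrizing one coordinate at a time.\<close>

lemma pairsum_update:
  assumes sym: "\<And>a b. w a b = w b a" and "i < N"
  shows "pairsum N (s(i := r)) w (x(i := y)) =
     pairsum N (s(i := 0)) w x + r * (\<Sum>j\<in>{..<N} - {i}. s j * w (x j) y)"
  using \<open>i < N\<close>
proof (induction N)
  case (Suc N)
  show ?case
  proof (cases "i = N")
    case True
    have *: "{..<Suc N} - {N} = {..<N}" by auto
    show ?thesis
      unfolding pairsum_Suc True * by (simp add: pairsum_fresh pairsum_fresh' pairsum_fresh'' sum_distrib_left mult_ac)
  next
    case False
    then have i: "i < N" using Suc.prems by simp
    have *: "{..<Suc N} - {i} = insert N ({..<N} - {i})" using i by auto
    have R: "(\<Sum>a<N. (s(i := r)) a * (s(i := r)) N * w ((x(i := y)) a) ((x(i := y)) N)) =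
       r * s N * w y (x N) + (\<Sum>a\<in>{..<N} - {i}. s a * s N * w (x a) (x N))"
      using i by (subst sum.remove[of _ i]) (auto intro!: sum.cong)
    have Z: "(\<Sum>a<N. (s(i := 0)) a * (s(i := 0)) N * w (x a) (x N)) =
       (\<Sum>a\<in>{..<N} - {i}. s a * s N * w (x a) (x N))"
      using i by (subst sum.remove[of _ i]) (auto intro!: sum.cong)
    show ?thesis unfolding pairsum_Suc Suc.IH[OF i] R Z * using sym[of y "x N"]
      by (simp add: algebra_simps)
  qed
qed simp

lemma pairsum_bound:
  assumes "\<And>i. i < N \<Longrightarrow> \<bar>s i\<bar> \<le> S" "\<And>i j. i < N \<Longrightarrow> j < N \<Longrightarrow> \<bar>w (x i) (x j)\<bar> \<le> B" "0 \<le> B"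
  shows "\<bar>pairsum N s w x\<bar> \<le> real N * real N * (S * S * B)"
proof -
  have SB: "\<bar>s i * s j * w (x i) (x j)\<bar> \<le> S * S * B" if "i < N" "j < N" for i j
    unfolding abs_mult using that assms(1)[of i] by (intro mult_mono assms) auto
  have "\<bar>pairsum N s w x\<bar> \<le> (\<Sum>j<N. \<Sum>i<j. S * S * B)"
    unfolding pairsum_def
    by (intro order_trans[OF sum_abs] sum_mono) (use SB in auto)
  also have "\<dots> \<le> (\<Sum>j<N. real N * (S * S * B))"
    using assms(3) mult_right_mono[of _ "real N" "S * S * B"] by (intro sum_mono) (simp add: zero_le_mult_iff)
  finally show ?thesis by (simp add: mult_ac)
qed

context prob_space
begin

text \<open>Fubini in one coordinate without changing the index set: the coordinate \<open>i\<close>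
  of the outer variable is overwritten and integrates to \<open>1\<close>.\<close>

lemma nn_integral_resample:
  assumes I: "finite I" "i \<in> I" and F[measurable]: "F \<in> borel_measurable (PiM I (\<lambda>_. M))"
  shows "(\<integral>\<^sup>+x. F x \<partial>PiM I (\<lambda>_. M)) = (\<integral>\<^sup>+x. (\<integral>\<^sup>+y. F (x(i := y)) \<partial>M) \<partial>PiM I (\<lambda>_. M))"
proof -
  interpret P: product_sigma_finite "\<lambda>_. M" by standard
  define J where "J = I - {i}"
  have J: "I = insert i J" "finite J" "i \<notin> J" using I by (auto simp: J_def)
  have upd: "(\<lambda>(x, y). x(i := y)) \<in> PiM I (\<lambda>_. M) \<Otimes>\<^sub>M M \<rightarrow>\<^sub>M PiM I (\<lambda>_. M)"
    using measurable_fun_upd[of I I i fst "PiM I (\<lambda>_. M) \<Otimes>\<^sub>M M" "\<lambda>_. M" snd] I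
    by (simp add: split_def insert_absorb)
  have "(\<lambda>p. F (case p of (x, y) \<Rightarrow> x(i := y))) \<in> borel_measurable (PiM I (\<lambda>_. M) \<Otimes>\<^sub>M M)"
    by (rule measurable_compose[OF upd F])
  then have G: "(\<lambda>x. \<integral>\<^sup>+y. F (x(i := y)) \<partial>M) \<in> borel_measurable (PiM I (\<lambda>_. M))"
    by (intro borel_measurable_nn_integral) (simp add: split_def)
  have "(\<integral>\<^sup>+x. (\<integral>\<^sup>+y. F (x(i := y)) \<partial>M) \<partial>PiM I (\<lambda>_. M)) = (\<integral>\<^sup>+x. (\<integral>\<^sup>+y'. (\<integral>\<^sup>+y. F (x(i := y)) \<partial>M) \<partial>M) \<partial>PiM J (\<lambda>_. M))"
    using G unfolding J(1) by (subst P.product_nn_integral_insert[OF J(2,3)]) auto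
  also have "\<dots> = (\<integral>\<^sup>+x. F x \<partial>PiM I (\<lambda>_. M))"
    using F unfolding J(1) by (subst P.product_nn_integral_insert[OF J(2,3)]) (auto simp: emeasure_space_1)
  finally show ?thesis by simp
qed

lemma measurable_resample:
  "i \<in> I \<Longrightarrow> (\<lambda>p. (fst p)(i := snd p)) \<in> PiM I (\<lambda>_. M) \<Otimes>\<^sub>M M \<rightarrow>\<^sub>M PiM I (\<lambda>_. M)"
  by (rule measurable_fun_upd[of I I i]) auto

lemma distr_resample:
  assumes I: "finite I" "i \<in> I"
  shows "distr (PiM I (\<lambda>_. M) \<Otimes>\<^sub>M M) (PiM I (\<lambda>_. M)) (\<lambda>p. (fst p)(i := snd p)) = PiM I (\<lambda>_. M)"
proof (rule measure_eqI)
  fix A assume "A \<in> sets (distr (PiM I (\<lambda>_. M) \<Otimes>\<^sub>M M) (PiM I (\<lambda>_. M)) (\<lambda>p. (fst p)(i := snd p)))"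
  then have A[measurable]: "A \<in> sets (PiM I (\<lambda>_. M))" by simp
  note measurable_resample[OF I(2), measurable]
  have "emeasure (distr (PiM I (\<lambda>_. M) \<Otimes>\<^sub>M M) (PiM I (\<lambda>_. M)) (\<lambda>p. (fst p)(i := snd p))) A
     = (\<integral>\<^sup>+p. indicator A ((fst p)(i := snd p)) \<partial>(PiM I (\<lambda>_. M) \<Otimes>\<^sub>M M))"
    by (subst nn_integral_indicator[symmetric], simp, subst nn_integral_distr) auto
  also have "\<dots> = (\<integral>\<^sup>+x. (\<integral>\<^sup>+y. indicator A (x(i := y)) \<partial>M) \<partial>PiM I (\<lambda>_. M))"
    by (subst nn_integral_fst[symmetric]) auto
  also have "\<dots> = (\<integral>\<^sup>+x. indicator A x \<partial>PiM I (\<lambda>_. M))"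
    by (rule nn_integral_resample[OF I, symmetric]) auto
  finally show "emeasure (distr (PiM I (\<lambda>_. M) \<Otimes>\<^sub>M M) (PiM I (\<lambda>_. M)) (\<lambda>p. (fst p)(i := snd p))) A
     = emeasure (PiM I (\<lambda>_. M)) A" by simp
qed simp

lemma integral_resample:
  fixes F :: "_ \<Rightarrow> real"
  assumes I: "finite I" "i \<in> I" and F: "integrable (PiM I (\<lambda>_. M)) F"
  shows "(\<integral>x. F x \<partial>PiM I (\<lambda>_. M)) = (\<integral>x. (\<integral>y. F (x(i := y)) \<partial>M) \<partial>PiM I (\<lambda>_. M))"
    and "integrable (PiM I (\<lambda>_. M)) (\<lambda>x. \<integral>y. F (x(i := y)) \<partial>M)"
proof -
  interpret PP: prob_space "PiM I (\<lambda>_. M)" by (intro prob_space_PiM prob_space_axioms)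
  interpret pair_sigma_finite "PiM I (\<lambda>_. M)" M by standard
  note Fm[measurable] = borel_measurable_integrable[OF F]
  note measurable_resample[OF I(2), measurable]
  have int: "integrable (PiM I (\<lambda>_. M) \<Otimes>\<^sub>M M) (\<lambda>p. F ((fst p)(i := snd p)))"
  proof (subst integrable_distr_eq[symmetric, of "\<lambda>p. (fst p)(i := snd p)" _ "PiM I (\<lambda>_. M)"])
    show "integrable (distr (PiM I (\<lambda>_. M) \<Otimes>\<^sub>M M) (PiM I (\<lambda>_. M)) (\<lambda>p. (fst p)(i := snd p))) F"
      using F by (simp only: distr_resample[OF I])
  qed auto
  have "(\<integral>x. F x \<partial>PiM I (\<lambda>_. M)) = (\<integral>p. F ((fst p)(i := snd p)) \<partial>(PiM I (\<lambda>_. M) \<Otimes>\<^sub>M M))"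
    by (subst distr_resample[OF I, symmetric], subst integral_distr) auto
  also have "\<dots> = (\<integral>x. (\<integral>y. F (x(i := y)) \<partial>M) \<partial>PiM I (\<lambda>_. M))"
    using integral_fst'[OF int] by simp
  finally show "(\<integral>x. F x \<partial>PiM I (\<lambda>_. M)) = (\<integral>x. (\<integral>y. F (x(i := y)) \<partial>M) \<partial>PiM I (\<lambda>_. M))" .
  show "integrable (PiM I (\<lambda>_. M)) (\<lambda>x. \<integral>y. F (x(i := y)) \<partial>M)"
    using integrable_fst'[OF int] by simp
qed

lemma integrable_bounded:
  fixes f :: "_ \<Rightarrow> real"
  assumes "f \<in> borel_measurable M" "\<And>x. x \<in> space M \<Longrightarrow> \<bar>f x\<bar> \<le> B"
  shows "integrable M f"
  by (rule integrable_const_bound[of f B]) (use assms in auto)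

text \<open>Symmetrization without an independent copy: \<open>a + s * b y\<close> is the midpoint
  of \<open>a + 2 * s * b y\<close> and \<open>a\<close>, and since \<open>b\<close> has mean zero,
  Jensen's inequality bounds \<open>a ^ (2 * k)\<close> by the mean of
  \<open>(a - 2 * s * b y) ^ (2 * k)\<close>.\<close>

lemma even_moment_symmetrize_step:
  fixes b :: "_ \<Rightarrow> real"
  assumes b: "b \<in> borel_measurable M" "\<And>y. y \<in> space M \<Longrightarrow> \<bar>b y\<bar> \<le> B" and b0: "(\<integral>y. b y \<partial>M) = 0"
  shows "(\<integral>y. (a + s * b y) ^ (2 * k) \<partial>M) \<le>
    ((\<integral>y. (a + 2 * s * b y) ^ (2 * k) \<partial>M) + (\<integral>y. (a + - 2 * s * b y) ^ (2 * k) \<partial>M)) / 2"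
proof -
  note b(1)[measurable]
  have cx: "convex_on UNIV (\<lambda>x::real. x ^ (2 * k))" by (rule convex_power_even) simp
  have int: "integrable M (\<lambda>y. (a + r * b y) ^ (2 * k))" for r
  proof (rule integrable_bounded)
    fix y assume y: "y \<in> space M"
    have "\<bar>a + r * b y\<bar> \<le> \<bar>a\<bar> + \<bar>r\<bar> * B"
      using b(2)[OF y] by (intro order_trans[OF abs_triangle_ineq] add_mono) (auto simp: abs_mult mult_left_mono)
    then show "\<bar>(a + r * b y) ^ (2 * k)\<bar> \<le> (\<bar>a\<bar> + \<bar>r\<bar> * B) ^ (2 * k)"
      unfolding power_abs by (rule power_mono) simp
  qed simp
  have intb: "integrable M b" by (rule integrable_bounded[OF b])
  have E: "(\<integral>y. a + - 2 * s * b y \<partial>M) = a" using intb b0 by (simp add: prob_space)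
  have "a ^ (2 * k) \<le> (\<integral>y. (a + - 2 * s * b y) ^ (2 * k) \<partial>M)"
    using jensens_inequality[of "\<lambda>y. a + - 2 * s * b y" UNIV _ _ "\<lambda>x. x ^ (2 * k)", OF _ _ _ int cx] intb E by simp
  moreover have "(\<integral>y. (a + s * b y) ^ (2 * k) \<partial>M) \<le> (\<integral>y. 1/2 * (a + 2 * s * b y) ^ (2 * k) + 1/2 * a ^ (2 * k) \<partial>M)"
  proof (rule integral_mono)
    fix y
    show "(a + s * b y) ^ (2 * k) \<le> 1/2 * (a + 2 * s * b y) ^ (2 * k) + 1/2 * a ^ (2 * k)"
    proof -
      have "(1 - 1/2) *\<^sub>R (a + 2 * s * b y) + (1/2) *\<^sub>R a = a + s * b y" by (simp add: algebra_simps)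
      then show ?thesis using convex_onD[OF cx, of "1/2" "a + 2 * s * b y" a] by simp
    qed
  qed (use int in auto)
  moreover have "(\<integral>y. 1/2 * (a + 2 * s * b y) ^ (2 * k) + 1/2 * a ^ (2 * k) \<partial>M)
      = 1/2 * (\<integral>y. (a + 2 * s * b y) ^ (2 * k) \<partial>M) + 1/2 * a ^ (2 * k)"
    using int[of "2 * s"] by (simp add: prob_space)
  ultimately show ?thesis by simp
qed

context
  fixes w :: "'a \<Rightarrow> 'a \<Rightarrow> real" and B :: real
  assumes wm: "(\<lambda>p. w (fst p) (snd p)) \<in> borel_measurable (M \<Otimes>\<^sub>M M)"
    and wB: "\<And>x y. x \<in> space M \<Longrightarrow> y \<in> space M \<Longrightarrow> \<bar>w x y\<bar> \<le> B"
    and wsym: "\<And>x y. w x y = w y x"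
begin

lemma measurable_kernel_component:
  assumes "i \<in> I" "j \<in> I"
  shows "(\<lambda>x. w (x i) (x j)) \<in> borel_measurable (PiM I (\<lambda>_. M))"
proof -
  have "(\<lambda>x. (x i, x j)) \<in> PiM I (\<lambda>_. M) \<rightarrow>\<^sub>M M \<Otimes>\<^sub>M M" using assms by measurable
  from measurable_compose[OF this wm] show ?thesis by simp
qed

lemma measurable_pairsum[measurable]: "pairsum N s w \<in> borel_measurable (PiM {..<N} (\<lambda>_. M))"
  unfolding pairsum_def
  by (intro borel_measurable_sum borel_measurable_times borel_measurable_const measurable_kernel_component) auto

lemma integrable_pairsum_power: "integrable (PiM {..<N} (\<lambda>_. M)) (\<lambda>x. pairsum N s w x ^ k)"
proof -
  interpret PP: prob_space "PiM {..<N} (\<lambda>_. M)" by (intro prob_space_PiM prob_space_axioms)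
  obtain z where z: "z \<in> space M" using not_empty by auto
  have B: "0 \<le> B" using wB[OF z z] by simp
  define S where "S = (\<Sum>i<N. \<bar>s i\<bar>)"
  have S: "\<bar>s i\<bar> \<le> S" if "i < N" for i unfolding S_def by (rule member_le_sum) (use that in auto)
  show ?thesis
  proof (rule PP.integrable_bounded)
    fix x assume x: "x \<in> space (PiM {..<N} (\<lambda>_. M))"
    have "\<bar>pairsum N s w x\<bar> \<le> real N * real N * (S * S * B)"
      by (rule pairsum_bound) (use S B x wB in \<open>auto simp: space_PiM PiE_iff\<close>)
    then show "\<bar>pairsum N s w x ^ k\<bar> \<le> (real N * real N * (S * S * B)) ^ k"
      unfolding power_abs by (rule power_mono) simp
  qed measurable
qed

lemma pairsum_symmetrize_step:
  assumes w0: "\<And>x. x \<in> space M \<Longrightarrow> (\<integral>y. w x y \<partial>M) = 0" and i: "i < N"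
  shows "(\<integral>x. pairsum N s w x ^ (2 * k) \<partial>PiM {..<N} (\<lambda>_. M)) \<le>
     ((\<integral>x. pairsum N (s(i := 2 * s i)) w x ^ (2 * k) \<partial>PiM {..<N} (\<lambda>_. M)) +
      (\<integral>x. pairsum N (s(i := - 2 * s i)) w x ^ (2 * k) \<partial>PiM {..<N} (\<lambda>_. M))) / 2"
proof -
  have ii: "finite {..<N}" "i \<in> {..<N}" using i by auto
  note R = integral_resample[OF ii integrable_pairsum_power]
  define F where "F r x = (\<integral>y. pairsum N (s(i := r)) w (x(i := y)) ^ (2 * k) \<partial>M)" for r x
  have Fi: "integrable (PiM {..<N} (\<lambda>_. M)) (F r)" for r
    unfolding F_def by (rule R(2))
  have "(\<integral>x. F (s i) x \<partial>PiM {..<N} (\<lambda>_. M)) \<le> (\<integral>x. (F (2 * s i) x + F (- 2 * s i) x) / 2 \<partial>PiM {..<N} (\<lambda>_. M))"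
  proof (rule integral_mono)
    fix x assume "x \<in> space (PiM {..<N} (\<lambda>_. M))"
    then have x: "x j \<in> space M" if "j < N" for j using that by (auto simp: space_PiM PiE_iff)
    define b where "b y = (\<Sum>j\<in>{..<N} - {i}. s j * w (x j) y)" for y
    have wj: "w (x j) \<in> borel_measurable M" if "j < N" for j
      using measurable_compose[OF measurable_Pair1'[OF x[OF that]] wm] by simp
    have wi: "integrable M (w (x j))" if "j < N" for j
      by (rule integrable_bounded[OF wj[OF that] wB]) (use x that in auto)
    have "F r x = (\<integral>y. (pairsum N (s(i := 0)) w x + r * b y) ^ (2 * k) \<partial>M)" for r
      unfolding F_def b_def pairsum_update[OF wsym i] ..
    moreover have "\<bar>b y\<bar> \<le> (\<Sum>j\<in>{..<N} - {i}. \<bar>s j\<bar> * B)" if "y \<in> space M" for y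
      unfolding b_def by (intro order_trans[OF sum_abs] sum_mono)
        (use that x wB in \<open>auto simp: abs_mult intro!: mult_left_mono\<close>)
    moreover have "b \<in> borel_measurable M"
      unfolding b_def using wj by (intro borel_measurable_sum borel_measurable_times) auto
    moreover have "(\<integral>y. b y \<partial>M) = 0"
      unfolding b_def using wi by (subst Bochner_Integration.integral_sum) (auto simp: w0 x)
    ultimately show "F (s i) x \<le> (F (2 * s i) x + F (- 2 * s i) x) / 2"
      by (simp only: mult.assoc[symmetric]) (rule even_moment_symmetrize_step)
  qed (use Fi in auto)
  also have "\<dots> = ((\<integral>x. F (2 * s i) x \<partial>PiM {..<N} (\<lambda>_. M)) + (\<integral>x. F (- 2 * s i) x \<partial>PiM {..<N} (\<lambda>_. M))) / 2"
    using Fi by simp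
  finally show ?thesis
    unfolding F_def by (simp only: R(1)[symmetric] fun_upd_triv)
qed

lemma integrable_radavg:
  "(\<And>e. integrable L (F e)) \<Longrightarrow> integrable L (\<lambda>x. radavg n (\<lambda>e. F e x))"
  by (induction n arbitrary: F) auto

lemma integral_radavg:
  fixes F :: "(nat \<Rightarrow> real) \<Rightarrow> _ \<Rightarrow> real"
  shows "(\<And>e. integrable L (F e)) \<Longrightarrow> (\<integral>x. radavg n (\<lambda>e. F e x) \<partial>L) = radavg n (\<lambda>e. \<integral>x. F e x \<partial>L)"
  by (induction n arbitrary: F) (auto simp: integrable_radavg)

text \<open>After all coordinates are symmetrized the charges are \<open>2 * e i\<close> with random
  signs \<open>e\<close>, which multiplies the kernel by \<open>4\<close> and its squared norm by
  \<open>16\<close>; the moment of the chaos contributes another factor \<open>4\<close>, whence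
  \<open>64\<close>.\<close>

lemma pairsum_moment:
  assumes w0: "\<And>x. x \<in> space M \<Longrightarrow> (\<integral>y. w x y \<partial>M) = 0"
    and xi: "\<And>i. i < N \<Longrightarrow> \<xi> i \<in> {1, -1}"
  shows "(\<integral>x. pairsum N \<xi> w x ^ (2 * k) \<partial>PiM {..<N} (\<lambda>_. M)) \<le>
     2 * fact (2 * k) * (\<integral>x. (64 * (\<Sum>i<N. \<Sum>j\<in>{..<N} - {i}. (w (x i) (x j))\<^sup>2)) ^ k \<partial>PiM {..<N} (\<lambda>_. M))"
proof -
  \<comment> \<open>Charges whose first \<open>n\<close> entries have been randomized. The original
    sign \<open>\<xi> i\<close> of a randomized entry disappears, because both signs are
    averaged.\<close>
  define S where "S n e i = (if i < n then 2 * e i else \<xi> i)" for n and e :: "nat \<Rightarrow> real" and i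
  define E where "E s = (\<integral>x. pairsum N s w x ^ (2 * k) \<partial>PiM {..<N} (\<lambda>_. M))" for s
  interpret PP: prob_space "PiM {..<N} (\<lambda>_. M)" by (intro prob_space_PiM prob_space_axioms)
  have "E \<xi> \<le> radavg n (\<lambda>e. E (S n e))" if "n \<le> N" for n
    using that
  proof (induction n)
    case 0
    then show ?case by (simp add: S_def)
  next
    case (Suc n)
    have step: "E (S n e) \<le> (E (S (Suc n) (e(n := 1))) + E (S (Suc n) (e(n := -1)))) / 2" for e
    proof -
      have *: "S (Suc n) (e(n := r)) = (S n e)(n := 2 * r)" for r by (auto simp: S_def fun_eq_iff)
      have "S n e n = \<xi> n" by (simp add: S_def)
      then show ?thesis unfolding * using pairsum_symmetrize_step[OF w0, of n N "S n e" k] Suc.prems xi[of n]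
        by (auto simp: E_def)
    qed
    have "E \<xi> \<le> radavg n (\<lambda>e. E (S n e))" using Suc by simp
    also have "\<dots> \<le> radavg n (\<lambda>e. 1/2 * E (S (Suc n) (e(n := 1))) + 1/2 * E (S (Suc n) (e(n := -1))))"
      by (rule radavg_mono) (use step in \<open>simp add: add_divide_distrib\<close>)
    also have "\<dots> = radavg (Suc n) (\<lambda>e. E (S (Suc n) e))"
      unfolding radavg_add radavg_mult by simp
    finally show ?case .
  qed
  from this[of N] have "E \<xi> \<le> radavg N (\<lambda>e. E (S N e))" by simp
  also have "\<dots> = (\<integral>x. radavg N (\<lambda>e. pairsum N (S N e) w x ^ (2 * k)) \<partial>PiM {..<N} (\<lambda>_. M))"
    unfolding E_def by (rule integral_radavg[symmetric, OF integrable_pairsum_power])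
  also have "\<dots> \<le> (\<integral>x. 2 * fact (2 * k) * (64 * (\<Sum>i<N. \<Sum>j\<in>{..<N} - {i}. (w (x i) (x j))\<^sup>2)) ^ k \<partial>PiM {..<N} (\<lambda>_. M))"
  proof (rule integral_mono)
    show "integrable (PiM {..<N} (\<lambda>_. M)) (\<lambda>x. radavg N (\<lambda>e. pairsum N (S N e) w x ^ (2 * k)))"
      by (rule integrable_radavg[OF integrable_pairsum_power])
    show "integrable (PiM {..<N} (\<lambda>_. M)) (\<lambda>x. 2 * fact (2 * k) * (64 * (\<Sum>i<N. \<Sum>j\<in>{..<N} - {i}. (w (x i) (x j))\<^sup>2)) ^ k)"
    proof (rule PP.integrable_bounded)
      show "(\<lambda>x. 2 * fact (2 * k) * (64 * (\<Sum>i<N. \<Sum>j\<in>{..<N} - {i}. (w (x i) (x j))\<^sup>2)) ^ k) \<in> borel_measurable (PiM {..<N} (\<lambda>_. M))"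
        by (intro borel_measurable_times borel_measurable_const borel_measurable_power borel_measurable_sum
            measurable_kernel_component) auto
      fix x assume x: "x \<in> space (PiM {..<N} (\<lambda>_. M))"
      have "(\<Sum>i<N. \<Sum>j\<in>{..<N} - {i}. (w (x i) (x j))\<^sup>2) \<le> (\<Sum>i<N. \<Sum>j\<in>{..<N} - {i}. B\<^sup>2)"
        using x wB by (intro sum_mono) (auto simp: space_PiM PiE_iff power2_le_iff_abs_le intro!: abs_le_square_iff[THEN iffD1] order_trans[OF wB])
      then show "\<bar>2 * fact (2 * k) * (64 * (\<Sum>i<N. \<Sum>j\<in>{..<N} - {i}. (w (x i) (x j))\<^sup>2)) ^ k\<bar>
         \<le> 2 * fact (2 * k) * (64 * (\<Sum>i<N. \<Sum>j\<in>{..<N} - {i}. B\<^sup>2)) ^ k"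
        unfolding abs_mult by (intro mult_mono) (auto simp: power_abs sum_nonneg intro!: power_mono)
    qed
    fix x :: "nat \<Rightarrow> 'a"
    define A where "A i j = (if i = j then 0 else 4 * w (x i) (x j))" for i j
    have "pairsum N (S N e) w x = quadform N A e" for e
      unfolding pairsum_def quadform_def by (intro sum.cong refl) (auto simp: S_def A_def)
    moreover have "(hs_norm N A)\<^sup>2 = 16 * (\<Sum>i<N. \<Sum>j\<in>{..<N} - {i}. (w (x i) (x j))\<^sup>2)"
      unfolding hs_norm_square sum_distrib_left
    proof (rule sum.cong[OF refl])
      fix i assume i: "i \<in> {..<N}"
      have "(\<Sum>j<N. (A i j)\<^sup>2) = (\<Sum>j\<in>{..<N} - {i}. (A i j)\<^sup>2)"
        by (rule sum.mono_neutral_right) (auto simp: A_def)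
      also have "\<dots> = (\<Sum>j\<in>{..<N} - {i}. 16 * (w (x i) (x j))\<^sup>2)"
        by (rule sum.cong) (auto simp: A_def power_mult_distrib)
      finally show "(\<Sum>j<N. (A i j)\<^sup>2) = (\<Sum>j\<in>{..<N} - {i}. 16 * (w (x i) (x j))\<^sup>2)" .
    qed
    ultimately show "radavg N (\<lambda>e. pairsum N (S N e) w x ^ (2 * k))
        \<le> 2 * fact (2 * k) * (64 * (\<Sum>i<N. \<Sum>j\<in>{..<N} - {i}. (w (x i) (x j))\<^sup>2)) ^ k"
      using radavg_quadform_moment[of A N k] wsym by (simp add: A_def mult.assoc)
  qed
  finally show ?thesis by (simp add: E_def)
qed

end

end

section \<open>Harmonic functions\<close>

definition zc :: "real^2 \<Rightarrow> complex" where "zc x = Complex (x $ 1) (x $ 2)"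
definition rc :: "complex \<Rightarrow> real^2" where "rc z = vector [Re z, Im z]"

lemma rc_zc [simp]: "rc (zc x) = x"
  by (simp add: rc_def zc_def vec_eq_iff forall_2)

lemma zc_rc [simp]: "zc (rc z) = z"
  by (simp add: rc_def zc_def)

lemma linear_zc: "linear zc"
  by (rule linearI) (simp_all add: zc_def complex_eq_iff)

lemma linear_rc: "linear rc"
  by (rule linearI) (simp_all add: rc_def vec_eq_iff forall_2)

lemma zc_diff: "zc x - zc y = zc (x - y)"
  by (simp add: linear_diff[OF linear_zc])

lemma norm_zc [simp]: "cmod (zc x) = norm x"
  by (simp add: zc_def cmod_def norm_vec_def L2_set_def sum_2)

lemma continuous_on_zc: "continuous_on S zc"
  by (intro linear_continuous_on linear_conv_bounded_linear[THEN iffD1] linear_zc)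

lemma continuous_on_rc: "continuous_on S rc"
  by (intro linear_continuous_on linear_conv_bounded_linear[THEN iffD1] linear_rc)

lemma zc_image: "zc ` D = rc -` D"
  by (auto simp: image_iff intro!: bexI[of _ "rc _"])

lemma open_zc_image: "open D \<Longrightarrow> open (zc ` D)"
  unfolding zc_image by (rule open_vimage) (auto intro: continuous_on_rc)

lemma partial_deriv_eqI: "(f has_derivative f') (at x) \<Longrightarrow> partial_deriv i f x = f' (axis i 1)"
  unfolding partial_deriv_def by (simp flip: frechet_derivative_at)

text \<open>A partial derivative of the real part of \<open>F\<close> is again the real part of a
  holomorphic function, namely of \<open>deriv F\<close> times the constant
  \<open>zc (axis i 1)\<close>; this closes the induction on \<open>k\<close>.\<close>

lemma C_k_on_Re_holomorphic:
  assumes "open D" "F holomorphic_on zc ` D" "\<And>x. x \<in> D \<Longrightarrow> f x = Re (F (zc x))"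
  shows "C_k_on k D f"
    and "x \<in> D \<Longrightarrow> (f has_derivative (\<lambda>v. Re (deriv F (zc x) * zc v))) (at x)"
proof -
  have der: "(f has_derivative (\<lambda>v. Re (deriv F (zc x) * zc v))) (at x)"
    if "x \<in> D" "F holomorphic_on zc ` D" "\<And>x. x \<in> D \<Longrightarrow> f x = Re (F (zc x))" for x F and f :: "real^2 \<Rightarrow> real"
  proof -
    have "(F has_field_derivative deriv F (zc x)) (at (zc x))"
      using that assms(1) open_zc_image by (intro holomorphic_derivI) auto
    then have "(F has_derivative (\<lambda>h. deriv F (zc x) * h)) (at (zc x))"
      by (simp add: has_field_derivative_def)
    moreover have "(zc has_derivative zc) (at x)"
      by (intro bounded_linear_imp_has_derivative linear_conv_bounded_linear[THEN iffD1] linear_zc)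
    ultimately have "(F \<circ> zc has_derivative (\<lambda>h. deriv F (zc x) * h) \<circ> zc) (at x)"
      by (rule diff_chain_at[rotated])
    then have "((\<lambda>x. Re (F (zc x))) has_derivative (\<lambda>v. Re (deriv F (zc x) * zc v))) (at x)"
      by (auto dest!: bounded_linear.has_derivative[OF bounded_linear_Re] simp: o_def)
    then show ?thesis
      by (rule has_derivative_transform_within_open[OF _ assms(1) that(1)]) (use that in auto)
  qed
  show "x \<in> D \<Longrightarrow> (f has_derivative (\<lambda>v. Re (deriv F (zc x) * zc v))) (at x)"
    using der assms by blast
  show "C_k_on k D f"
    using assms(2,3)
  proof (induction k arbitrary: F f)
    case 0
    have "continuous_on D (\<lambda>x. Re (F (zc x)))"
      using continuous_on_compose2[OF holomorphic_on_imp_continuous_on[OF 0(1)] continuous_on_zc]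
      by (intro continuous_intros) auto
    then show ?case by (simp add: 0(2))
  next
    case (Suc k)
    have "C_k_on k D (partial_deriv i f)" for i
    proof (rule Suc.IH)
      show "(\<lambda>z. deriv F z * zc (axis i 1)) holomorphic_on zc ` D"
        using Suc.prems(1) assms(1) by (intro holomorphic_intros open_zc_image) auto
      show "partial_deriv i f x = Re (deriv F (zc x) * zc (axis i 1))" if "x \<in> D" for x
        by (rule partial_deriv_eqI[OF der[OF that Suc.prems]])
    qed
    then show ?case using der[OF _ Suc.prems] by (auto simp: differentiable_def)
  qed
qed

text \<open>The Laplacian is the real part of the second derivative of \<open>F\<close> times
  \<open>1\<^sup>2 + \<i>\<^sup>2 = 0\<close>.\<close>

lemma harmonic_on_Re:
  assumes "open D" "F holomorphic_on zc ` D" "\<And>x. x \<in> D \<Longrightarrow> f x = Re (F (zc x))"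
  shows "harmonic_on D f"
  unfolding harmonic_on_def
proof safe
  show "C_k_on 2 D f" by (rule C_k_on_Re_holomorphic[OF assms])
  fix x assume x: "x \<in> D"
  have "partial_deriv i (partial_deriv i f) x = Re (deriv (deriv F) (zc x) * zc (axis i 1) * zc (axis i 1))" for i
  proof -
    have hol: "(\<lambda>z. deriv F z * zc (axis i 1)) holomorphic_on zc ` D"
      using assms by (intro holomorphic_intros open_zc_image) auto
    have eq: "partial_deriv i f x = Re (deriv F (zc x) * zc (axis i 1))" if "x \<in> D" for x
      by (rule partial_deriv_eqI[OF C_k_on_Re_holomorphic(2)[OF assms that]])
    have "deriv (\<lambda>z. deriv F z * zc (axis i 1)) (zc x) = deriv (deriv F) (zc x) * zc (axis i 1)"
      using holomorphic_deriv[OF assms(2) open_zc_image[OF assms(1)]] x open_zc_image[OF assms(1)]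
      by (intro deriv_cmult_right holomorphic_on_imp_differentiable_at) auto
    then show ?thesis
      using partial_deriv_eqI[OF C_k_on_Re_holomorphic(2)[OF assms(1) hol eq x]] by simp
  qed
  moreover have "zc (axis 1 1) = 1" "zc (axis 2 1) = \<i>"
    by (auto simp: zc_def axis_def complex_eq_iff)
  ultimately show "laplacian f x = 0" by (simp add: laplacian_def sum_2)
qed

section \<open>Maximum principle\<close>

lemma second_derivative_test:
  fixes f :: "real \<Rightarrow> real"
  assumes f: "\<And>s. \<bar>s\<bar> < r \<Longrightarrow> (f has_real_derivative f' s) (at s)" and f': "(f' has_real_derivative c) (at 0)"
    and r: "0 < r" and max: "\<And>s. \<bar>s\<bar> < r \<Longrightarrow> f s \<le> f 0"
  shows "c \<le> 0"
proof (rule ccontr)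
  assume "\<not> c \<le> 0"
  then obtain d where d: "0 < d" "\<And>h. 0 < h \<Longrightarrow> h < d \<Longrightarrow> f' 0 < f' h"
    using DERIV_pos_inc_right[OF f'] by auto
  have "f' 0 = 0" by (rule DERIV_local_max[OF f[of 0] r]) (use r max in auto)
  define h where "h = min d r / 2"
  have h: "0 < h" "h < d" "h < r" using d r by (auto simp: h_def)
  obtain z where z: "0 < z" "z < h" "f h - f 0 = (h - 0) * f' z"
    using MVT2[OF h(1), of f f'] f h by auto
  then have "0 < f h - f 0" using d(2)[of z] \<open>f' 0 = 0\<close> h by simp
  then show False using max[of h] h by simp
qed

lemma has_derivative_along_axis:
  fixes f :: "real^2 \<Rightarrow> real"
  assumes "f differentiable (at (x + s *\<^sub>R axis i 1))"
  shows "((\<lambda>s. f (x + s *\<^sub>R axis i 1)) has_real_derivative partial_deriv i f (x + s *\<^sub>R axis i 1)) (at s)"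
proof -
  let ?y = "x + s *\<^sub>R axis i 1"
  have 1: "(f has_derivative frechet_derivative f (at ?y)) (at ?y)"
    using assms by (simp add: frechet_derivative_works)
  have 2: "((\<lambda>s. x + s *\<^sub>R axis i 1) has_derivative (\<lambda>t. t *\<^sub>R axis i 1)) (at s)"
    by (auto intro!: derivative_eq_intros)
  have "((\<lambda>s. f (x + s *\<^sub>R axis i 1)) has_derivative (\<lambda>t. frechet_derivative f (at ?y) (t *\<^sub>R axis i 1))) (at s)"
    using diff_chain_at[OF 2 1] by (simp add: o_def)
  moreover have "frechet_derivative f (at ?y) (t *\<^sub>R axis i 1) = partial_deriv i f ?y * t" for t
    using linear_scale[OF has_derivative_linear[OF 1]] by (simp add: partial_deriv_def)
  ultimately show ?thesis by (simp add: has_field_derivative_def)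
qed

text \<open>Weak maximum principle for \<open>f - h\<close>. The boundary condition is phrased
  through compact exhaustion because one of the functions will come from a Riemann map, for which no
  extension to the closure is assumed.\<close>

lemma harmonic_compare:
  fixes f h :: "real^2 \<Rightarrow> real"
  assumes D: "open D" "bounded D" and f: "harmonic_on D f" and h: "harmonic_on D h"
    and bd: "\<And>e. 0 < e \<Longrightarrow> \<exists>K. compact K \<and> K \<subseteq> D \<and> (\<forall>x\<in>D - K. f x - h x \<le> e)"
    and x: "x \<in> D"
  shows "f x \<le> h x"
proof (rule ccontr)
  assume neg: "\<not> f x \<le> h x"
  define \<delta> where "\<delta> = f x - h x"
  have \<delta>: "0 < \<delta>" using neg by (simp add: \<delta>_def)
  obtain R where R: "0 < R" "\<And>y. y \<in> D \<Longrightarrow> norm y \<le> R" using D(2) bounded_pos by metis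
  \<comment> \<open>Adding \<open>\<eta>\<close> times the squared norm gives \<open>u\<close> the
    positive Laplacian \<open>4 * \<eta>\<close>, and
    \<open>\<eta> * R\<^sup>2 = \<delta> / 4\<close> is small enough for the maximum over
    \<open>D\<close> to be attained on \<open>insert x K\<close>.\<close>
  define \<eta> where "\<eta> = \<delta> / (4 * R\<^sup>2)"
  have \<eta>: "0 < \<eta>" "\<eta> * R\<^sup>2 = \<delta> / 4" using \<delta> R by (auto simp: \<eta>_def field_simps)
  define u where "u y = f y - h y + \<eta> * (norm y)\<^sup>2" for y
  obtain K where K: "compact K" "K \<subseteq> D" "\<And>y. y \<in> D - K \<Longrightarrow> f y - h y \<le> \<delta> / 4"
    using bd[of "\<delta> / 4"] \<delta> by auto
  have dif: "f differentiable (at y)" "h differentiable (at y)"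
     "partial_deriv i f differentiable (at y)" "partial_deriv i h differentiable (at y)" if "y \<in> D" for y i
    using f h that by (auto simp: harmonic_on_def numeral_2_eq_2)
  have cont: "continuous_on D f" "continuous_on D h"
    using dif by (meson differentiable_imp_continuous_within continuous_at_imp_continuous_on)+
  have "continuous_on (insert x K) u"
    unfolding u_def using K x by (intro continuous_intros) (auto intro: continuous_on_subset[OF cont(1)] continuous_on_subset[OF cont(2)])
  then obtain p where p: "p \<in> insert x K" "\<And>y. y \<in> insert x K \<Longrightarrow> u y \<le> u p"
    using continuous_attains_sup[of "insert x K" u] K(1) by auto
  have pD: "p \<in> D" using p K x by auto
  have max: "u y \<le> u p" if "y \<in> D" for y
  proof (cases "y \<in> K")
    case False
    have "u y \<le> \<delta> / 4 + \<eta> * R\<^sup>2" unfolding u_def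
      using K(3)[of y] False that R \<eta> by (intro add_mono mult_left_mono power_mono) auto
    also have "\<dots> \<le> \<delta>" using \<eta> \<delta> by simp
    also have "\<dots> \<le> u x" unfolding u_def \<delta>_def using \<eta> by simp
    finally show ?thesis using p(2)[of x] by simp
  qed (use p in auto)
  obtain r where r: "0 < r" "ball p r \<subseteq> D" using D(1) pD open_contains_ball by blast
  have in_D: "p + s *\<^sub>R axis i 1 \<in> D" if "\<bar>s\<bar> < r" for s i
    using r that by (auto simp: dist_norm subset_iff)
  have le: "partial_deriv i (partial_deriv i f) p - partial_deriv i (partial_deriv i h) p + 2 * \<eta> \<le> 0" for i
  proof (rule second_derivative_test[OF _ _ r(1)])
    let ?x = "\<lambda>s. p + s *\<^sub>R axis i 1"
    have n: "(norm (?x s))\<^sup>2 = (norm p)\<^sup>2 + 2 * s * (p $ i) + s\<^sup>2" for s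
      unfolding power2_norm_eq_inner
      by (simp add: inner_add_left inner_add_right inner_axis inner_commute[of "axis i 1"] power2_eq_square distrib_left)
    show "((\<lambda>s. u (?x s)) has_real_derivative
        partial_deriv i f (?x s) - partial_deriv i h (?x s) + \<eta> * (2 * (p $ i) + 2 * s)) (at s)"
      if "\<bar>s\<bar> < r" for s
      unfolding u_def n using has_derivative_along_axis[of f p s i] has_derivative_along_axis[of h p s i] dif in_D[OF that]
      by (auto intro!: derivative_eq_intros)
    show "((\<lambda>s. partial_deriv i f (?x s) - partial_deriv i h (?x s) + \<eta> * (2 * (p $ i) + 2 * s)) has_real_derivative
        partial_deriv i (partial_deriv i f) p - partial_deriv i (partial_deriv i h) p + 2 * \<eta>) (at 0)"
      using has_derivative_along_axis[of "partial_deriv i f" p 0 i] has_derivative_along_axis[of "partial_deriv i h" p 0 i] dif pD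
      by (auto intro!: derivative_eq_intros)
    show "u (?x s) \<le> u (?x 0)" if "\<bar>s\<bar> < r" for s
      using max[OF in_D[OF that]] by simp
  qed
  have "laplacian f p - laplacian h p + 4 * \<eta> \<le> 0"
    using le[of 1] le[of 2] by (simp add: laplacian_def sum_2)
  then show False using f h pD \<eta> by (simp add: harmonic_on_def)
qed

lemma harmonic_compare_closure:
  fixes f h :: "real^2 \<Rightarrow> real"
  assumes D: "open D" "bounded D" and f: "harmonic_on D f" and h: "harmonic_on D h"
    and c: "continuous_on (closure D) f" "continuous_on (closure D) h"
    and bd: "\<And>x. x \<in> frontier D \<Longrightarrow> f x \<le> h x"
    and x: "x \<in> D"
  shows "f x \<le> h x"
proof (rule harmonic_compare[OF D f h _ x])
  fix e :: real assume e: "0 < e"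
  define K where "K = {y \<in> closure D. f y - h y \<in> {e..}}"
  have "closed K" unfolding K_def
    by (rule continuous_closed_preimage[of "closure D" "\<lambda>y. f y - h y" "{e..}", unfolded vimage_def Int_def mem_Collect_eq])
       (auto intro!: continuous_intros c)
  moreover have "bounded K" unfolding K_def using D(2) by (auto intro: bounded_subset[OF bounded_closure])
  ultimately have "compact K" by (simp add: compact_eq_bounded_closed)
  moreover have "K \<subseteq> D"
    using bd e D(1) by (force simp: K_def frontier_def interior_open)
  moreover have "\<forall>y\<in>D - K. f y - h y \<le> e"
    using closure_subset[of D] by (auto simp: K_def)
  ultimately show "\<exists>K. compact K \<and> K \<subseteq> D \<and> (\<forall>x\<in>D - K. f x - h x \<le> e)" by blast
qed

lemma harmonic_on_const: "open D \<Longrightarrow> harmonic_on D (\<lambda>_ :: real^2. c)"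
  by (rule harmonic_on_Re[of D "\<lambda>_. of_real c"]) auto

section \<open>Bounds for the regular part\<close>

context
  fixes D :: "(real^2) set" and g :: "real^2 \<Rightarrow> real^2 \<Rightarrow> real"
  assumes D: "open D" "convex D" "bounded D" and g: "green_regular_part D g"
begin

lemma green_regular_props:
  assumes "y \<in> D"
  shows "harmonic_on D (\<lambda>x. g x y)" "continuous_on (closure D) (\<lambda>x. g x y)"
    "\<And>x. x \<in> frontier D \<Longrightarrow> g x y = 1 / (2 * pi) * ln (norm (x - y))"
  using g assms by (auto simp: green_regular_part_def)

lemma frontier_neq: "y \<in> D \<Longrightarrow> x \<in> frontier D \<Longrightarrow> x \<noteq> y"
  using D(1) by (auto simp: frontier_def interior_open)

text \<open>On the boundary the logarithm is at most \<open>ln \<Delta>\<close>, and constants are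
  harmonic. On the diagonal this bounds the self-energy; off the diagonal it bounds
  \<open>1 - T\<close> from below.\<close>

lemma green_regular_le:
  assumes "x \<in> D" "y \<in> D" and \<Delta>: "\<And>x y. x \<in> closure D \<Longrightarrow> y \<in> closure D \<Longrightarrow> norm (x - y) \<le> \<Delta>"
  shows "g x y \<le> 1 / (2 * pi) * ln \<Delta>"
proof (rule harmonic_compare_closure[OF D(1,3), of "\<lambda>x. g x y" "\<lambda>_. 1 / (2 * pi) * ln \<Delta>"])
  fix x assume x: "x \<in> frontier D"
  have "0 < norm (x - y)" using frontier_neq[OF assms(2) x] by simp
  moreover have "norm (x - y) \<le> \<Delta>"
    by (rule \<Delta>) (use x assms closure_subset[of D] in \<open>auto simp: frontier_def\<close>)
  ultimately have "ln (norm (x - y)) \<le> ln \<Delta>" by (intro ln_mono) auto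
  then show "g x y \<le> 1 / (2 * pi) * ln \<Delta>"
    using x assms by (simp add: green_regular_props(3) divide_right_mono)
qed (use assms D green_regular_props harmonic_on_const in auto)

text \<open>The comparison runs in the first argument with the pole at \<open>x\<close>, and is then
  evaluated at the pole itself. It makes the self-energy factor of the Gibbs weight at most a
  negative power of the distance to the boundary.\<close>

lemma green_regular_ge:
  assumes "x \<in> D"
  shows "1 / (2 * pi) * ln (infdist x (frontier D)) \<le> g x x"
proof (rule harmonic_compare_closure[OF D(1,3), of "\<lambda>_. 1 / (2 * pi) * ln (infdist x (frontier D))" "\<lambda>y. g y x"])
  fix y assume y: "y \<in> frontier D"
  have "infdist x (frontier D) \<le> norm (y - x)"
    using infdist_le[OF y, of x] by (simp add: dist_norm norm_minus_commute)
  moreover have "infdist x (frontier D) \<noteq> 0"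
    using in_closed_iff_infdist_zero[of "frontier D" x] y frontier_neq[OF assms] by auto
  ultimately have "ln (infdist x (frontier D)) \<le> ln (norm (y - x))"
    using infdist_nonneg[of x "frontier D"] by (intro ln_mono) auto
  then show "1 / (2 * pi) * ln (infdist x (frontier D)) \<le> g y x"
    using y assms
    by (simp add: green_regular_props(3) divide_right_mono)
qed (use assms D green_regular_props harmonic_on_const in auto)

text \<open>Comparison with the Green function of a half-plane containing \<open>D\<close>, whose boundary touches
  \<open>D\<close> at a point nearest to \<open>x\<close>.\<close>

lemma green_regular_le_halfplane:
  assumes x: "x \<in> D" and y: "y \<in> D"
  shows "g x y \<le> 1 / (2 * pi) * ln (norm (x - y) + 2 * infdist x (frontier D))"
proof -
  have "frontier D \<noteq> {}"
    using D(3) x frontier_eq_empty[of D] not_bounded_UNIV by auto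
  then obtain p where p: "p \<in> frontier D" "infdist x (frontier D) = dist x p"
    using infdist_attains_inf[of "frontier D" x] by auto
  define d where "d = infdist x (frontier D)"
  have pD: "p \<notin> D" using p D(1) by (auto simp: frontier_def interior_open)
  obtain a b where ab: "a \<noteq> 0" "\<And>z. z \<in> D \<Longrightarrow> a \<bullet> z \<le> b" "b \<le> a \<bullet> p"
    using separating_hyperplane_sets[of D "{p}"] D(2) x pD by auto
  define n where "n = a /\<^sub>R norm a"
  have n1: "n \<bullet> n = 1" using ab(1) by (simp add: n_def dot_square_norm power2_eq_square)
  have cl: "n \<bullet> z \<le> n \<bullet> p" if "z \<in> closure D" for z
  proof -
    have "closure D \<subseteq> {z. n \<bullet> z \<le> n \<bullet> p}"
    proof (rule closure_minimal[OF _ closed_halfspace_le], safe)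
      fix z assume "z \<in> D"
      then have "a \<bullet> z \<le> a \<bullet> p" using ab(2)[of z] ab(3) by linarith
      then show "n \<bullet> z \<le> n \<bullet> p" unfolding n_def inner_scaleR_left by (rule mult_left_mono) simp
    qed
    then show ?thesis using that by auto
  qed
  have strict: "n \<bullet> z < n \<bullet> p" if "z \<in> D" for z
  proof -
    obtain r where r: "0 < r" "ball z r \<subseteq> D" using D(1) \<open>z \<in> D\<close> open_contains_ball by blast
    have "norm n = 1" using n1 by (simp add: norm_eq_1)
    then have "z + (r / 2) *\<^sub>R n \<in> D" using r by (auto simp: dist_norm subset_iff)
    then have "n \<bullet> (z + (r / 2) *\<^sub>R n) \<le> n \<bullet> p" using cl closure_subset by blast
    then show ?thesis using r n1 by (simp add: inner_add_right)
  qed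
  \<comment> \<open>The mirror image of \<open>y\<close> in the supporting line through
    \<open>p\<close> with normal \<open>n\<close>. Points of the closure are no farther from
    \<open>y\<close> than from \<open>q\<close>, so \<open>ln (norm (z - q))\<close> dominates
    \<open>ln (norm (z - y))\<close> on the boundary; it is harmonic on \<open>D\<close> as
    \<open>q\<close> lies outside the closure.\<close>
  define q where "q = y + (2 * (n \<bullet> p - n \<bullet> y)) *\<^sub>R n"
  have dq: "(norm (z - q))\<^sup>2 = (norm (z - y))\<^sup>2 + 4 * (n \<bullet> p - n \<bullet> y) * (n \<bullet> p - n \<bullet> z)" for z
  proof -
    define c where "c = 2 * (n \<bullet> p - n \<bullet> y)"
    have zq: "z - q = (z - y) - c *\<^sub>R n" by (simp add: q_def c_def)
    have "(norm (z - q))\<^sup>2 = (norm (z - y))\<^sup>2 - 2 * c * (n \<bullet> (z - y)) + c * c * (n \<bullet> n)"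
      unfolding power2_norm_eq_inner zq by (simp add: inner_diff_left inner_diff_right inner_commute algebra_simps)
    then show ?thesis using n1 by (simp add: c_def inner_diff_right algebra_simps)
  qed
  have nq: "n \<bullet> p < n \<bullet> q" using strict[OF y] n1 by (simp add: q_def inner_add_right)
  have qcl: "z \<noteq> q" if "z \<in> closure D" for z using cl[OF that] nq by auto
  have "simply_connected (zc ` D)"
    by (intro convex_imp_simply_connected convex_linear_image linear_zc D)
  moreover have "(\<lambda>z. z - zc q) holomorphic_on zc ` D" by (intro holomorphic_intros)
  moreover have "\<forall>z\<in>zc ` D. z - zc q \<noteq> 0"
    using qcl closure_subset[of D] rc_zc by (metis (no_types) eq_iff_diff_eq_0 imageE subsetD)
  ultimately obtain L where L: "L holomorphic_on zc ` D" "\<And>z. z \<in> zc ` D \<Longrightarrow> z - zc q = exp (L z)"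
    using simply_connected_eq_holomorphic_log[OF open_zc_image[OF D(1)]] by metis
  have harm: "harmonic_on D (\<lambda>x. 1 / (2 * pi) * ln (norm (x - q)))"
  proof (rule harmonic_on_Re[OF D(1), of "\<lambda>z. of_real (1 / (2 * pi)) * L z"])
    show "(\<lambda>z. of_real (1 / (2 * pi)) * L z) holomorphic_on zc ` D" by (intro holomorphic_intros L)
    fix x assume "x \<in> D"
    then have "norm (x - q) = exp (Re (L (zc x)))"
      using L(2)[of "zc x"] by (metis imageI norm_exp_eq_Re norm_zc zc_diff)
    then show "1 / (2 * pi) * ln (norm (x - q)) = Re (of_real (1 / (2 * pi)) * L (zc x))" by simp
  qed
  have "g x y \<le> 1 / (2 * pi) * ln (norm (x - q))"
  proof (rule harmonic_compare_closure[OF D(1,3) _ harm _ _ _ x])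
    show "harmonic_on D (\<lambda>x. g x y)" "continuous_on (closure D) (\<lambda>x. g x y)"
      by (rule green_regular_props[OF y])+
    show "continuous_on (closure D) (\<lambda>x. 1 / (2 * pi) * ln (norm (x - q)))"
      using qcl by (intro continuous_intros) auto
    fix z assume z: "z \<in> frontier D"
    have "norm (z - y) \<le> norm (z - q)"
    proof (rule power2_le_imp_le)
      show "(norm (z - y))\<^sup>2 \<le> (norm (z - q))\<^sup>2"
        unfolding dq using strict[OF y] cl[of z] z by (simp add: frontier_def)
    qed simp
    then have "ln (norm (z - y)) \<le> ln (norm (z - q))" using frontier_neq[OF y z] by (intro ln_mono) auto
    then show "g z y \<le> 1 / (2 * pi) * ln (norm (z - q))"
      using green_regular_props(3)[OF y z] by (simp add: divide_right_mono)
  qed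
  also have "\<dots> \<le> 1 / (2 * pi) * ln (norm (x - y) + 2 * d)"
  proof -
    have "n \<bullet> (p - x) \<le> norm n * norm (p - x)" by (rule norm_cauchy_schwarz)
    then have 1: "n \<bullet> p - n \<bullet> x \<le> d"
      using n1 p by (simp add: inner_diff_right d_def dist_norm norm_minus_commute norm_eq_1[symmetric])
    have "n \<bullet> (x - y) \<le> norm n * norm (x - y)" by (rule norm_cauchy_schwarz)
    then have 2: "n \<bullet> p - n \<bullet> y \<le> d + norm (x - y)"
      using n1 1 by (simp add: inner_diff_right norm_eq_1[symmetric])
    have d0: "0 \<le> d" by (simp add: d_def infdist_nonneg)
    \<comment> \<open>With \<open>r = norm (x - y)\<close>, the distances of \<open>x\<close> and
      \<open>y\<close> to the line are at most \<open>d\<close> and \<open>d + r\<close>, and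
      \<open>r\<^sup>2 + 4 * (d + r) * d = (r + 2 * d)\<^sup>2\<close>.\<close>
    have "norm (x - q) \<le> norm (x - y) + 2 * d"
    proof (rule power2_le_imp_le)
      have "(n \<bullet> p - n \<bullet> y) * (n \<bullet> p - n \<bullet> x) \<le> (d + norm (x - y)) * d"
        using 1 2 strict[OF x] d0 by (intro mult_mono) auto
      then show "(norm (x - q))\<^sup>2 \<le> (norm (x - y) + 2 * d)\<^sup>2"
        unfolding dq by (simp add: power2_eq_square algebra_simps)
    qed (use d0 in auto)
    moreover have "0 < norm (x - q)" using qcl[of x] x closure_subset[of D] by auto
    ultimately have "ln (norm (x - q)) \<le> ln (norm (x - y) + 2 * d)" by (intro ln_mono) auto
    then show ?thesis by (simp add: divide_right_mono)
  qed
  finally show ?thesis by (simp add: d_def)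
qed

end

section \<open>The Green function in conformal coordinates\<close>

lemma szego_sym: "szego z w = szego w z"
proof -
  have "cmod (1 - z * cnj w) = cmod (cnj (1 - z * cnj w))" by (rule complex_mod_cnj[symmetric])
  then show ?thesis by (simp add: szego_def mult_ac)
qed

lemma szego_self: "cmod z < 1 \<Longrightarrow> szego z z = 1"
proof -
  assume z: "cmod z < 1"
  have "1 - z * cnj z = of_real (1 - (cmod z)\<^sup>2)" by (simp only: complex_norm_square of_real_diff of_real_1)
  then have "cmod (1 - z * cnj z) = \<bar>1 - (cmod z)\<^sup>2\<bar>" by (simp only: norm_of_real)
  moreover have "(cmod z)\<^sup>2 < 1" using z by (simp add: abs_square_less_1)
  ultimately show ?thesis by (simp add: szego_def power2_eq_square)
qed

lemma szego_denominator: "cmod z < 1 \<Longrightarrow> cmod w < 1 \<Longrightarrow> 1 - z * cnj w \<noteq> 0"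
proof
  assume "cmod z < 1" "cmod w < 1" "1 - z * cnj w = 0"
  then have "cmod z * cmod w = 1" by (metis complex_mod_cnj eq_iff_diff_eq_0 norm_mult norm_one)
  moreover have "cmod z * cmod w < 1 * 1" using \<open>cmod z < 1\<close> \<open>cmod w < 1\<close> by (intro mult_strict_mono') auto
  ultimately show False by simp
qed

lemma szego_nonneg: "cmod z < 1 \<Longrightarrow> cmod w < 1 \<Longrightarrow> 0 \<le> szego z w"
  unfolding szego_def by (intro divide_nonneg_nonneg mult_nonneg_nonneg) (auto simp: abs_square_le_1)

lemma one_minus_szego:
  assumes "cmod z < 1" "cmod w < 1"
  shows "1 - szego z w = (cmod ((z - w) / (1 - z * cnj w)))\<^sup>2"
proof -
  have nz: "cmod (1 - z * cnj w) \<noteq> 0" using szego_denominator[OF assms] by simp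
  have "complex_of_real ((cmod (1 - z * cnj w))\<^sup>2 - (1 - (cmod z)\<^sup>2) * (1 - (cmod w)\<^sup>2)) = complex_of_real ((cmod (z - w))\<^sup>2)"
    by (simp only: of_real_diff of_real_mult of_real_1 complex_norm_square complex_cnj_diff complex_cnj_mult complex_cnj_one complex_cnj_cnj)
      (simp add: algebra_simps)
  then have "(cmod (1 - z * cnj w))\<^sup>2 - (1 - (cmod z)\<^sup>2) * (1 - (cmod w)\<^sup>2) = (cmod (z - w))\<^sup>2"
    by (simp only: of_real_eq_iff)
  then show ?thesis using nz by (simp add: szego_def norm_divide power_divide field_simps)
qed

lemma szego_boundary_bound:
  assumes "cmod w < 1" "cmod z < 1"
  shows "szego z w \<le> (1 - (cmod z)\<^sup>2) * (2 / (1 - cmod w))"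
proof -
  have "cmod (z * cnj w) \<le> cmod w" using assms by (simp add: norm_mult mult_left_le_one_le)
  then have 1: "1 - cmod w \<le> cmod (1 - z * cnj w)"
    using norm_triangle_ineq2[of 1 "z * cnj w"] by simp
  have "(1 - (cmod w)\<^sup>2) / (cmod (1 - z * cnj w))\<^sup>2 \<le> (1 - (cmod w)\<^sup>2) / (1 - cmod w)\<^sup>2"
    using 1 assms by (intro divide_left_mono power_mono mult_pos_pos zero_less_power)
      (auto simp: abs_square_le_1)
  also have "\<dots> = (1 + cmod w) / (1 - cmod w)"
    using assms by (simp add: power2_eq_square divide_simps) (simp add: algebra_simps)
  also have "\<dots> \<le> 2 / (1 - cmod w)" using assms by (intro divide_right_mono) auto
  finally have "(1 - (cmod z)\<^sup>2) * ((1 - (cmod w)\<^sup>2) / (cmod (1 - z * cnj w))\<^sup>2) \<le> (1 - (cmod z)\<^sup>2) * (2 / (1 - cmod w))"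
    using assms by (intro mult_left_mono) (auto simp: abs_square_le_1)
  then show ?thesis by (simp add: szego_def)
qed

text \<open>For a conformal map \<open>f\<close> onto the disc,
  \<open>(f z - f b) / (1 - f z * cnj (f b))\<close> has a simple zero at \<open>b\<close> and no
  other. Dividing by \<open>z - b\<close> leaves a zero-free function, and the real part of its
  holomorphic logarithm is, up to a factor, the regular part. The map \<open>\<phi>\<close> is
  obtained before \<open>g\<close>, so that one kernel serves every \<open>g\<close>.\<close>

lemma green_conformal:
  assumes D: "open D" "convex D" "bounded D" "D \<noteq> {}"
  obtains \<phi> where "continuous_on D \<phi>" "\<And>x. x \<in> D \<Longrightarrow> cmod (\<phi> x) < 1"
    "\<And>x y. x \<in> D \<Longrightarrow> y \<in> D \<Longrightarrow> x \<noteq> y \<Longrightarrow> szego (\<phi> x) (\<phi> y) < 1"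
    "\<And>g x y. green_regular_part D g \<Longrightarrow> x \<in> D \<Longrightarrow> y \<in> D \<Longrightarrow> x \<noteq> y \<Longrightarrow>
       green g x y = - 1 / (4 * pi) * ln (1 - szego (\<phi> x) (\<phi> y))"
proof -
  define S where "S = zc ` D"
  have S: "open S" unfolding S_def by (rule open_zc_image[OF D(1)])
  have sc: "simply_connected S"
    unfolding S_def by (intro convex_imp_simply_connected convex_linear_image linear_zc D)
  have bS: "bounded S" unfolding S_def using D(3) linear_zc by (simp add: bounded_linear_image linear_conv_bounded_linear)
  then have "S \<noteq> UNIV" using not_bounded_UNIV by auto
  then have "\<exists>f h. f holomorphic_on S \<and> h holomorphic_on ball 0 1 \<and>
      (\<forall>z \<in> S. f z \<in> ball 0 1 \<and> h (f z) = z) \<and> (\<forall>z \<in> ball 0 1. h z \<in> S \<and> f (h z) = z)"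
    using iffD1[OF Riemann_mapping_theorem[of S]] S sc D(4) unfolding S_def by blast
  then obtain f h where fh: "f holomorphic_on S" "h holomorphic_on ball 0 1"
     "\<And>z. z \<in> S \<Longrightarrow> f z \<in> ball 0 1 \<and> h (f z) = z" "\<And>z. z \<in> ball 0 1 \<Longrightarrow> h z \<in> S \<and> f (h z) = z"
    by blast
  define \<phi> where "\<phi> x = f (zc x)" for x
  have f1: "cmod (f z) < 1" if "z \<in> S" for z using fh(3)[OF that] by simp
  have inj: "inj_on f S" using fh(3) by (metis inj_onI)
  have \<phi>1: "cmod (\<phi> x) < 1" if "x \<in> D" for x using f1 that by (simp add: \<phi>_def S_def)
  have cont: "continuous_on D \<phi>" unfolding \<phi>_def
    using continuous_on_compose2[OF holomorphic_on_imp_continuous_on[OF fh(1)] continuous_on_zc] by (auto simp: S_def)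
  have zinj: "zc x = zc y \<longleftrightarrow> x = y" for x y by (metis rc_zc)
  have s1: "szego (\<phi> x) (\<phi> y) < 1" if "x \<in> D" "y \<in> D" "x \<noteq> y" for x y
  proof -
    have "\<phi> x \<noteq> \<phi> y" using that inj by (auto simp: \<phi>_def S_def inj_on_def zinj)
    then have "0 < 1 - szego (\<phi> x) (\<phi> y)"
      using that \<phi>1 szego_denominator[of "\<phi> x" "\<phi> y"] by (simp add: one_minus_szego norm_divide)
    then show ?thesis by simp
  qed
  have key: "green g x y = - 1 / (4 * pi) * ln (1 - szego (\<phi> x) (\<phi> y))"
    if g: "green_regular_part D g" and x: "x \<in> D" and y: "y \<in> D" and xy: "x \<noteq> y" for g x y
  proof -
    define b where "b = zc y"
    have b: "b \<in> S" using y by (simp add: b_def S_def)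
    define q where "q z = (if z = b then deriv f b else (f z - f b) / (z - b))" for z
    have hq: "q holomorphic_on S"
    proof (rule pole_theorem_open_0[of "\<lambda>z. f z - f b" S b])
      show "(\<lambda>z. f z - f b) holomorphic_on S" by (intro holomorphic_intros fh(1))
      have "deriv (\<lambda>z. f z - f b) b = deriv f b"
        using fh(1) S b by (subst deriv_diff) (auto intro: holomorphic_on_imp_differentiable_at)
      then show "q b = deriv (\<lambda>z. f z - f b) b" by (simp add: q_def)
    qed (auto simp: q_def S)
    have q0: "q z \<noteq> 0" if "z \<in> S" for z
      using that holomorphic_injective_imp_regular[OF fh(1) S inj b] inj b by (auto simp: q_def inj_on_def)
    define k where "k z = q z / (1 - f z * cnj (f b))" for z
    have den: "1 - f z * cnj (f b) \<noteq> 0" if "z \<in> S" for z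
      by (rule szego_denominator) (use that b f1 in auto)
    have hk: "k holomorphic_on S" unfolding k_def by (intro holomorphic_intros hq fh(1) den)
    have k0: "\<forall>z\<in>S. k z \<noteq> 0" using q0 den by (simp add: k_def)
    obtain L where L: "L holomorphic_on S" "\<And>z. z \<in> S \<Longrightarrow> k z = exp (L z)"
      using simply_connected_eq_holomorphic_log[OF S] sc hk k0 by metis
    define u where "u x = - 1 / (2 * pi) * Re (L (zc x))" for x
    have hu: "harmonic_on D u"
    proof (rule harmonic_on_Re[OF D(1), of "\<lambda>z. of_real (- 1 / (2 * pi)) * L z"])
      show "(\<lambda>z. of_real (- 1 / (2 * pi)) * L z) holomorphic_on zc ` D"
        by (intro holomorphic_intros L(1)[unfolded S_def])
    qed (simp add: u_def)
    have usz: "u x - 1 / (2 * pi) * ln (norm (x - y)) = - 1 / (4 * pi) * ln (1 - szego (\<phi> x) (\<phi> y))"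
      if "x \<in> D" "x \<noteq> y" for x
    proof -
      have xS: "zc x \<in> S" "zc x \<noteq> b" using that by (auto simp: S_def b_def zinj)
      have "k (zc x) * (zc x - b) = (\<phi> x - \<phi> y) / (1 - \<phi> x * cnj (\<phi> y))"
        using xS by (simp add: k_def q_def \<phi>_def b_def)
      then have "cmod (k (zc x)) * norm (x - y) = cmod ((\<phi> x - \<phi> y) / (1 - \<phi> x * cnj (\<phi> y)))"
        by (metis b_def norm_mult norm_zc zc_diff)
      then have "1 - szego (\<phi> x) (\<phi> y) = (exp (Re (L (zc x))) * norm (x - y))\<^sup>2"
        using L(2)[OF xS(1)] one_minus_szego[OF \<phi>1[OF that(1)] \<phi>1[OF y]] by simp
      then have "ln (1 - szego (\<phi> x) (\<phi> y)) = 2 * (Re (L (zc x)) + ln (norm (x - y)))"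
        using that by (simp add: ln_realpow ln_mult)
      then show ?thesis by (simp add: u_def field_simps)
    qed
    \<comment> \<open>Both \<open>g\<close> and \<open>u\<close> differ from
      \<open>1 / (2 * pi) * ln (norm (x - y))\<close> by a quantity tending to \<open>0\<close> at
      the boundary: \<open>g\<close> by its boundary values, \<open>u\<close> because
      \<open>\<phi>\<close> leaves every smaller disc. Away from the pole, \<open>K1\<close> and
      \<open>K2\<close> collect the points where one of the differences may exceed
      \<open>e / 2\<close>.\<close>
    have close: "\<exists>K. compact K \<and> K \<subseteq> D \<and> (\<forall>x\<in>D - K. \<bar>g x y - u x\<bar> \<le> e)" if e: "0 < e" for e
    proof -
      obtain r where r: "0 < r" "cball y r \<subseteq> D" using D(1) y open_contains_cball by blast
      define v where "v x = g x y - 1 / (2 * pi) * ln (norm (x - y))" for x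
      define C where "C = closure D - ball y r"
      have cC: "compact C" unfolding C_def using D(3) by (intro compact_diff) auto
      have yC: "y \<notin> C" using r by (simp add: C_def)
      define K1 where "K1 = {x \<in> C. \<bar>v x\<bar> \<in> {e / 2..}}"
      have cv: "continuous_on C (\<lambda>x. \<bar>v x\<bar>)"
        unfolding v_def
        by (intro continuous_intros continuous_on_subset[OF green_regular_props(2)[OF D(1-3) g y]])
           (use yC in \<open>auto simp: C_def\<close>)
      have cK1: "compact K1" unfolding K1_def
        using continuous_closed_preimage[OF cv compact_imp_closed[OF cC], of "{e / 2..}"] cC
        by (metis (no_types) closed_real_atLeast compact_Int_closed Collect_conj_eq Collect_mem_eq inf.left_idem vimage_def)
      have K1D: "K1 \<subseteq> D"
      proof
        fix x assume x: "x \<in> K1"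
        show "x \<in> D"
        proof (rule ccontr)
          assume "x \<notin> D"
          then have "x \<in> frontier D" using x D(1) by (auto simp: K1_def C_def frontier_def interior_open)
          then have "v x = 0" using green_regular_props(3)[OF D(1-3) g y] by (simp add: v_def)
          then show False using x e by (simp add: K1_def)
        qed
      qed
      \<comment> \<open>Chosen backwards: \<open>szego \<le> s\<close> bounds
        \<open>- ln (1 - szego) / (4 * pi)\<close> by \<open>e / 2\<close>, and by
        \<open>szego_boundary_bound\<close> this holds once
        \<open>1 - (cmod (\<phi> x))\<^sup>2 \<le> t\<close>.\<close>
      define s where "s = 1 - exp (- (2 * pi * e))"
      have s: "0 < s" "s < 1" using e by (auto simp: s_def)
      define t where "t = s * (1 - cmod (f b)) / 2"
      have fb: "cmod (f b) < 1" by (rule f1[OF b])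
      have t: "0 < t" "t < 1"
      proof -
        show "0 < t" using s fb by (simp add: t_def)
        have "s * (1 - cmod (f b)) \<le> 1 * 1" using s fb by (intro mult_mono) auto
        then show "t < 1" by (simp add: t_def)
      qed
      define R where "R = sqrt (1 - t)"
      have R: "0 \<le> R" "R < 1" "R\<^sup>2 = 1 - t" using t by (auto simp: R_def real_less_lsqrt)
      define K2 where "K2 = rc ` h ` cball 0 R"
      have cb: "cball 0 R \<subseteq> ball (0 :: complex) 1" using R by auto
      have cK2: "compact K2" unfolding K2_def
        by (intro compact_continuous_image continuous_on_rc compact_cball)
          (use holomorphic_on_imp_continuous_on[OF fh(2)] cb continuous_on_subset in blast)
      have K2D: "K2 \<subseteq> D" using fh(4) cb by (fastforce simp: K2_def S_def)
      have est: "\<bar>g x y - u x\<bar> \<le> e" if x: "x \<in> D" "x \<notin> K1" "x \<notin> K2" "x \<notin> cball y r" for x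
      proof -
        have xy: "x \<noteq> y" using x(4) r by auto
        have "x \<in> C" using x closure_subset[of D] by (auto simp: C_def)
        then have v: "\<bar>v x\<bar> \<le> e / 2" using x(2) by (auto simp: K1_def)
        have xS: "zc x \<in> S" using x by (simp add: S_def)
        have "R < cmod (\<phi> x)"
        proof (rule ccontr)
          assume "\<not> R < cmod (\<phi> x)"
          then have "\<phi> x \<in> cball 0 R" by simp
          then have "rc (h (\<phi> x)) \<in> K2" by (auto simp: K2_def)
          then show False using x(3) fh(3)[OF xS] by (simp add: \<phi>_def)
        qed
        then have "R\<^sup>2 \<le> (cmod (\<phi> x))\<^sup>2" using R by (intro power_mono) auto
        then have "1 - (cmod (\<phi> x))\<^sup>2 \<le> t" using R by simp
        then have "szego (\<phi> x) (\<phi> y) \<le> t * (2 / (1 - cmod (\<phi> y)))"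
          using \<phi>1[OF y] by (intro order_trans[OF szego_boundary_bound[OF \<phi>1[OF y] \<phi>1[OF x(1)]]] mult_right_mono) auto
        also have "\<dots> = s" using fb by (simp add: t_def \<phi>_def b_def)
        finally have 1: "exp (- (2 * pi * e)) \<le> 1 - szego (\<phi> x) (\<phi> y)" by (simp add: s_def)
        have "0 \<le> szego (\<phi> x) (\<phi> y)" using szego_nonneg \<phi>1 x y by simp
        then have 2: "ln (1 - szego (\<phi> x) (\<phi> y)) \<le> 0" using s1[OF x(1) y xy] by simp
        have 3: "- (2 * pi * e) \<le> ln (1 - szego (\<phi> x) (\<phi> y))" using 1 s1[OF x(1) y xy] by (simp add: ln_ge_iff)
        have "g x y - u x = v x - (u x - 1 / (2 * pi) * ln (norm (x - y)))" by (simp add: v_def)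
        also have "\<dots> = v x + 1 / (4 * pi) * ln (1 - szego (\<phi> x) (\<phi> y))" unfolding usz[OF x(1) xy] by simp
        finally have "\<bar>g x y - u x\<bar> \<le> \<bar>v x\<bar> + \<bar>1 / (4 * pi) * ln (1 - szego (\<phi> x) (\<phi> y))\<bar>" by linarith
        also have "\<bar>1 / (4 * pi) * ln (1 - szego (\<phi> x) (\<phi> y))\<bar> \<le> e / 2"
          using 2 3 by (simp add: abs_mult field_simps)
        finally show ?thesis using v by simp
      qed
      have "compact (K1 \<union> K2 \<union> cball y r)" using cK1 cK2 by (intro compact_Un compact_cball)
      moreover have "K1 \<union> K2 \<union> cball y r \<subseteq> D" using K1D K2D r by blast
      ultimately show ?thesis using est by blast
    qed
    have c: "\<exists>K. compact K \<and> K \<subseteq> D \<and> (\<forall>x\<in>D - K. g x y - u x \<le> e)"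
      "\<exists>K. compact K \<and> K \<subseteq> D \<and> (\<forall>x\<in>D - K. u x - g x y \<le> e)" if "0 < e" for e
    proof -
      obtain K where K: "compact K" "K \<subseteq> D" "\<And>x. x \<in> D - K \<Longrightarrow> \<bar>g x y - u x\<bar> \<le> e"
        using close[OF \<open>0 < e\<close>] by blast
      have "g x y - u x \<le> e \<and> u x - g x y \<le> e" if "x \<in> D - K" for x
        using K(3)[OF that] by linarith
      then show "\<exists>K. compact K \<and> K \<subseteq> D \<and> (\<forall>x\<in>D - K. g x y - u x \<le> e)"
        "\<exists>K. compact K \<and> K \<subseteq> D \<and> (\<forall>x\<in>D - K. u x - g x y \<le> e)" using K(1,2) by blast+
    qed
    have "g x y \<le> u x"
      by (rule harmonic_compare[OF D(1,3) green_regular_props(1)[OF D(1-3) g y] hu c(1) x])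
    moreover have "u x \<le> g x y"
      by (rule harmonic_compare[OF D(1,3) hu green_regular_props(1)[OF D(1-3) g y] c(2) x])
    ultimately have "g x y = u x" by simp
    then show ?thesis unfolding usz[OF x xy, symmetric] by (simp add: green_def)
  qed
  show thesis by (rule that[OF cont \<phi>1 s1 key])
qed

section \<open>Integrability of negative powers\<close>

text \<open>Dyadic decomposition: where \<open>v x\<close> lies between
  \<open>2 powr (- n - 1)\<close> and \<open>2 powr (- n)\<close>, the integrand is at most
  \<open>c n\<close>, and the resulting series is geometric with ratio
  \<open>2 powr (q - k) < 1\<close>. Points with \<open>v x = 0\<close> contribute nothing, as
  \<open>0 powr (- q) = 0\<close>.\<close>

lemma (in prob_space) nn_integral_neg_powr:
  assumes [measurable]: "v \<in> borel_measurable M"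
    and small: "\<And>\<tau>. 0 < \<tau> \<Longrightarrow> \<tau> \<le> 1 \<Longrightarrow> emeasure M {x \<in> space M. v x < \<tau>} \<le> ennreal (C * \<tau> powr k)"
    and q: "0 \<le> q" "q < k" and C: "0 \<le> C" and v: "\<And>x. x \<in> space M \<Longrightarrow> 0 \<le> v x"
  shows "(\<integral>\<^sup>+x. ennreal (v x powr (- q)) \<partial>M) \<le> ennreal (1 + C * (2 powr q / (1 - 2 powr (q - k))))"
proof -
  define c where "c n = 2 powr (real (Suc n) * q)" for n
  define \<tau> where "\<tau> n = (2::real) powr (- real n)" for n
  define A where "A n = {x \<in> space M. v x < \<tau> n}" for n
  have [measurable]: "A n \<in> sets M" for n unfolding A_def by measurable
  have pt: "ennreal (v x powr (- q)) \<le> 1 + (\<Sum>n. ennreal (c n) * indicator (A n) x)" if x: "x \<in> space M" for x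
  proof (cases "1 \<le> v x \<or> v x = 0")
    case True
    then have "v x powr (- q) \<le> 1" using q by (auto simp: powr_minus powr_le1 inverse_le_1_iff ge_one_powr_ge_zero)
    then have "ennreal (v x powr (- q)) \<le> 1 + 0" using ennreal_leI by fastforce
    also have "\<dots> \<le> 1 + (\<Sum>n. ennreal (c n) * indicator (A n) x)" by (intro add_mono) auto
    finally show ?thesis .
  next
    case False
    then have vx: "0 < v x" "v x < 1" using v[OF x] by auto
    define n where "n = nat (\<lceil>- log 2 (v x)\<rceil> - 1)"
    have l: "0 < - log 2 (v x)" using vx by simp
    then have "1 \<le> \<lceil>- log 2 (v x)\<rceil>" by (simp add: le_ceiling_iff)
    then have n1: "real n = real_of_int \<lceil>- log 2 (v x)\<rceil> - 1" by (simp add: n_def)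
    have n: "real n < - log 2 (v x)" "- log 2 (v x) \<le> real (Suc n)" unfolding of_nat_Suc n1 by linarith+
    have vlog: "v x = 2 powr (log 2 (v x))" using vx by simp
    have "v x < \<tau> n" unfolding \<tau>_def by (subst vlog, rule powr_less_mono) (use n in auto)
    then have "x \<in> A n" using x by (simp add: A_def)
    have "v x powr (- q) = 2 powr (- log 2 (v x) * q)" by (subst vlog, subst powr_powr) simp
    also have "\<dots> \<le> c n" unfolding c_def using n q by (intro powr_mono mult_right_mono) auto
    finally have "ennreal (v x powr (- q)) \<le> ennreal (c n) * indicator (A n) x"
      using \<open>x \<in> A n\<close> by (simp add: ennreal_leI)
    also have "\<dots> \<le> (\<Sum>n. ennreal (c n) * indicator (A n) x)"
    proof -
      have "f n \<le> suminf f" for f :: "nat \<Rightarrow> ennreal" using sum_le_suminf[of f "{n}"] by auto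
      then show ?thesis .
    qed
    also have "\<dots> \<le> 1 + \<dots>" by simp
    finally show ?thesis .
  qed
  define \<rho> where "\<rho> = (2::real) powr (q - k)"
  have \<rho>: "0 < \<rho>" "\<rho> < 1" unfolding \<rho>_def using q by (auto simp: powr_less_one)
  have term_le: "ennreal (c n) * emeasure M (A n) \<le> ennreal (C * 2 powr q * \<rho> ^ n)" for n
  proof -
    have "emeasure M (A n) \<le> ennreal (C * \<tau> n powr k)"
      unfolding A_def by (rule small) (auto simp: \<tau>_def powr_minus inverse_le_1_iff ge_one_powr_ge_zero)
    then have "ennreal (c n) * emeasure M (A n) \<le> ennreal (c n) * ennreal (C * \<tau> n powr k)" by (rule mult_left_mono) simp
    also have "\<dots> = ennreal (c n * (C * \<tau> n powr k))" by (rule ennreal_mult[symmetric]) (use C in \<open>auto simp: c_def\<close>)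
    also have "c n * (C * \<tau> n powr k) = C * 2 powr q * \<rho> ^ n"
    proof -
      have "c n * \<tau> n powr k = 2 powr q * 2 powr (real n * (q - k))"
        unfolding c_def \<tau>_def by (simp add: powr_powr flip: powr_add) (simp add: algebra_simps)
      also have "2 powr (real n * (q - k)) = \<rho> ^ n"
        unfolding \<rho>_def by (simp add: powr_powr powr_realpow[symmetric] mult.commute)
      finally show ?thesis by simp
    qed
    finally show ?thesis .
  qed
  have "(\<integral>\<^sup>+x. ennreal (v x powr (- q)) \<partial>M) \<le> (\<integral>\<^sup>+x. 1 + (\<Sum>n. ennreal (c n) * indicator (A n) x) \<partial>M)"
    by (rule nn_integral_mono) (rule pt)
  also have "\<dots> = 1 + (\<Sum>n. ennreal (c n) * emeasure M (A n))"
    by (subst nn_integral_add) (auto simp: emeasure_space_1 nn_integral_suminf nn_integral_cmult)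
  also have "\<dots> \<le> 1 + (\<Sum>n. ennreal (C * 2 powr q * \<rho> ^ n))"
    by (intro add_left_mono suminf_le term_le) auto
  also have "(\<Sum>n. ennreal (C * 2 powr q * \<rho> ^ n)) = ennreal (C * 2 powr q * (1 / (1 - \<rho>)))"
  proof (rule suminf_ennreal_eq)
    show "(\<lambda>n. C * 2 powr q * \<rho> ^ n) sums (C * 2 powr q * (1 / (1 - \<rho>)))"
      using \<rho> by (intro sums_mult geometric_sums) auto
  qed (use C \<rho> in auto)
  also have "1 + ennreal (C * 2 powr q * (1 / (1 - \<rho>))) = ennreal (1 + C * (2 powr q / (1 - \<rho>)))"
    using C \<rho> by (subst ennreal_plus) auto
  finally show ?thesis by (simp add: \<rho>_def)
qed

section \<open>Measure of small discs and of layers along the boundary\<close>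

context
  fixes D :: "(real^2) set"
  assumes D: "open D" "convex D" "bounded D" "measure lebesgue D = 1"
begin

abbreviation "\<mu> \<equiv> restrict_space lborel D"

lemma D_borel [measurable]: "D \<in> sets borel"
  using D(1) by auto

lemma space_\<mu> [simp]: "space \<mu> = D"
  by (simp add: space_restrict_space)

lemma emeasure_D: "emeasure lborel D = 1"
proof -
  have "emeasure lborel D < \<infinity>" by (rule emeasure_bounded_finite[OF D(3)])
  then have "emeasure lborel D = ennreal (measure lborel D)" by (intro emeasure_eq_ennreal_measure) auto
  then show ?thesis using D(4) by (simp add: measure_completion)
qed

lemma prob_space_\<mu>: "prob_space \<mu>"
  by (rule prob_spaceI) (simp add: emeasure_restrict_space emeasure_D)

lemma emeasure_near_point:
  assumes "0 < \<tau>"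
  shows "emeasure \<mu> {x \<in> space \<mu>. norm (x - y) < \<tau>} \<le> ennreal (4 * \<tau> powr 2)"
proof -
  have "emeasure \<mu> {x \<in> space \<mu>. norm (x - y) < \<tau>} = emeasure lborel {x \<in> D. norm (x - y) < \<tau>}"
    by (subst emeasure_restrict_space) auto
  also have "\<dots> \<le> emeasure lborel (ball y \<tau>)"
    by (rule emeasure_mono) (auto simp: dist_norm norm_minus_commute)
  also have "\<dots> = ennreal (pi * \<tau> ^ 2)"
    using assms by (simp add: emeasure_ball unit_ball_vol_2)
  also have "\<dots> \<le> ennreal (4 * \<tau> powr 2)"
    using assms pi_less_4 by (intro ennreal_leI) (simp add: mult_right_mono)
  finally show ?thesis .
qed

text \<open>Shrinking \<open>D\<close> by the factor \<open>1 - s\<close> towards an interior point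
  \<open>c\<close> yields a set \<open>E\<close> of measure \<open>(1 - s)\<^sup>2\<close>. By
  convexity the ball of radius \<open>s * r = \<tau>\<close> around each point of \<open>E\<close>
  lies in \<open>D\<close>, so the layer misses \<open>E\<close> and has measure at most
  \<open>1 - (1 - s)\<^sup>2 \<le> 2 * \<tau> / r\<close>.\<close>

lemma emeasure_near_boundary:
  obtains C where "0 < C" "\<And>\<tau>. 0 < \<tau> \<Longrightarrow>
    emeasure \<mu> {x \<in> space \<mu>. infdist x (frontier D) < \<tau>} \<le> ennreal (C * \<tau> powr 1)"
proof -
  interpret prob_space \<mu> by (rule prob_space_\<mu>)
  obtain c where c: "c \<in> D" using not_empty by auto
  obtain r where r: "0 < r" "ball c r \<subseteq> D" using D(1) c open_contains_ball by blast
  have fr: "frontier D \<noteq> {}" using D(3) c frontier_eq_empty[of D] not_bounded_UNIV by auto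
  have "emeasure \<mu> {x \<in> space \<mu>. infdist x (frontier D) < \<tau>} \<le> ennreal (2 / r * \<tau> powr 1)" if \<tau>: "0 < \<tau>" for \<tau>
  proof (cases "\<tau> < r")
    case False
    have "emeasure \<mu> {x \<in> space \<mu>. infdist x (frontier D) < \<tau>} \<le> 1" by (rule emeasure_le_1)
    also have "1 \<le> ennreal (2 / r * \<tau> powr 1)" using False r \<tau> by (simp add: field_simps)
    finally show ?thesis .
  next
    case True
    define s where "s = \<tau> / r"
    have s: "0 < s" "s < 1" using True \<tau> r by (auto simp: s_def)
    define E where "E = (\<lambda>x. (1 - s) *\<^sub>R x + s *\<^sub>R c) ` D"
    have E_D: "E \<subseteq> D" unfolding E_def using D(2) c s by (auto intro!: convexD)
    have oE: "open E"
    proof -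
      have "E = (\<lambda>x. s *\<^sub>R c + x) ` (\<lambda>x. (1 - s) *\<^sub>R x) ` D" by (auto simp: E_def image_image add.commute)
      then show ?thesis using D(1) s by (simp add: open_translation open_scaling)
    qed
    have E_far: "\<tau> \<le> infdist x (frontier D)" if x: "x \<in> E" for x
    proof -
      obtain z where z: "z \<in> D" "x = (1 - s) *\<^sub>R z + s *\<^sub>R c" using x by (auto simp: E_def)
      have "ball x \<tau> \<subseteq> D"
      proof
        fix y assume y: "y \<in> ball x \<tau>"
        define b where "b = c + (1 / s) *\<^sub>R (y - x)"
        have "norm (y - x) < s * r" using y r by (simp add: s_def dist_norm norm_minus_commute)
        then have "norm (y - x) / s < r" using s by (simp add: field_simps)
        then have "norm ((1 / s) *\<^sub>R (y - x)) < r" unfolding norm_scaleR using s by simp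
        then have "b \<in> ball c r" by (simp add: b_def dist_norm)
        then have "b \<in> D" using r by auto
        moreover have "y = (1 - s) *\<^sub>R z + s *\<^sub>R b" using s by (simp add: b_def z(2) scaleR_add_right)
        ultimately show "y \<in> D" using D(2) z(1) s by (auto intro!: convexD)
      qed
      then have "\<tau> \<le> dist x p" if "p \<in> frontier D" for p
        using that D(1) by (force simp: frontier_def interior_open)
      then show ?thesis unfolding infdist_notempty[OF fr] using fr by (intro cINF_greatest) auto
    qed
    have eE: "emeasure lborel E = ennreal ((1 - s)\<^sup>2)"
    proof -
      have "emeasure lebesgue E = ennreal (\<bar>1 - s\<bar> ^ DIM(real^2)) * emeasure lebesgue D"
        unfolding E_def by (rule emeasure_lebesgue_affine)
      then show ?thesis using s emeasure_D oE by simp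
    qed
    have "emeasure \<mu> {x \<in> space \<mu>. infdist x (frontier D) < \<tau>} = emeasure lborel {x \<in> D. infdist x (frontier D) < \<tau>}"
      by (subst emeasure_restrict_space) auto
    also have "\<dots> \<le> emeasure lborel (D - E)"
      using E_far oE by (intro emeasure_mono) force+
    also have "\<dots> = 1 - ennreal ((1 - s)\<^sup>2)"
      using E_D oE by (subst emeasure_Diff) (auto simp: eE emeasure_D)
    also have "\<dots> = ennreal (1 - (1 - s)\<^sup>2)" by (simp add: ennreal_minus flip: ennreal_1)
    also have "\<dots> \<le> ennreal (2 / r * \<tau> powr 1)"
      using \<tau> r by (intro ennreal_leI) (simp add: s_def power2_eq_square algebra_simps)
    finally show ?thesis .
  qed
  then show thesis using r by (intro that[of "2 / r"]) auto
qed

end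

section \<open>Products over pairs of particles\<close>

lemma nn_Cauchy_Schwarz_le:
  assumes "f \<in> borel_measurable M" "g \<in> borel_measurable M"
    and "(\<integral>\<^sup>+x. f x ^ 2 \<partial>M) \<le> ennreal (A\<^sup>2)" "(\<integral>\<^sup>+x. g x ^ 2 \<partial>M) \<le> ennreal (B\<^sup>2)" "0 \<le> A" "0 \<le> B"
  shows "(\<integral>\<^sup>+x. f x * g x \<partial>M) \<le> ennreal (A * B)"
proof -
  define X where "X = (\<integral>\<^sup>+x. f x * g x \<partial>M)"
  have "X ^ 2 \<le> (\<integral>\<^sup>+x. f x ^ 2 \<partial>M) * (\<integral>\<^sup>+x. g x ^ 2 \<partial>M)"
    unfolding X_def by (rule Cauchy_Schwarz_nn_integral[OF assms(1,2)])
  also have "\<dots> \<le> ennreal (A\<^sup>2) * ennreal (B\<^sup>2)" by (intro mult_mono assms) auto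
  also have "\<dots> = ennreal ((A * B)\<^sup>2)" by (simp add: power_mult_distrib ennreal_mult)
  finally have *: "X ^ 2 \<le> ennreal ((A * B)\<^sup>2)" .
  show ?thesis
  proof (cases X)
    case (real r)
    then have "ennreal (r\<^sup>2) \<le> ennreal ((A * B)\<^sup>2)" using * by (simp add: ennreal_power)
    then have "r\<^sup>2 \<le> (A * B)\<^sup>2" by (simp add: ennreal_le_iff)
    then have "r \<le> A * B" by (rule power2_le_imp_le) (use assms in auto)
    then show ?thesis using real by (simp add: X_def ennreal_leI)
  next
    case top
    then have "X ^ 2 = top" by (simp add: power2_eq_square ennreal_top_mult)
    then show ?thesis using * by (simp add: top_unique)
  qed
qed

text \<open>Cauchy--Schwarz and Young with a free weight \<open>\<eta>\<close>. The prefactor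
  \<open>1 + N * \<eta>\<close> will be raised to the power \<open>N\<close>, so estimates uniform
  in \<open>N\<close> need it to be \<open>1 + O(1 / N)\<close>.\<close>

lemma square_sum_le:
  fixes p :: real
  assumes "finite J" "0 < \<eta>" "card J \<le> N"
  shows "(p + (\<Sum>j\<in>J. v j))\<^sup>2 \<le> (1 + real N * \<eta>) * (p\<^sup>2 + (\<Sum>j\<in>J. (v j)\<^sup>2) / \<eta>)"
proof (cases "J = {}")
  case True
  have "1 * p\<^sup>2 \<le> (1 + real N * \<eta>) * p\<^sup>2" using assms by (intro mult_right_mono) auto
  then show ?thesis using True by simp
next
  case False
  define m where "m = real (card J)"
  define s where "s = (\<Sum>j\<in>J. v j)"
  define S where "S = (\<Sum>j\<in>J. (v j)\<^sup>2)"
  define t where "t = m * \<eta>"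
  have m: "0 < m" "m \<le> real N" using False assms by (auto simp: m_def card_gt_0_iff)
  have t: "0 < t" using m assms by (simp add: t_def)
  have S0: "0 \<le> S" by (simp add: S_def sum_nonneg)
  have "s\<^sup>2 \<le> m * S"
    using Cauchy_Schwarz_ineq_sum[of "\<lambda>_. 1" v J] by (simp add: s_def S_def m_def)
  then have "s\<^sup>2 / t \<le> S / \<eta>" using m assms by (simp add: t_def field_simps)
  moreover have "0 \<le> (t * p - s)\<^sup>2 / t" using t by simp
  then have "2 * p * s \<le> t * p\<^sup>2 + s\<^sup>2 / t" using t by (simp add: power2_eq_square field_simps)
  then have "(p + s)\<^sup>2 \<le> (1 + t) * (p\<^sup>2 + s\<^sup>2 / t)"
    using t by (simp add: power2_eq_square field_simps)
  ultimately have "(p + s)\<^sup>2 \<le> (1 + t) * (p\<^sup>2 + S / \<eta>)"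
    using t by (meson add_left_mono mult_left_mono order_trans less_imp_le add_nonneg_nonneg zero_le_one)
  also have "\<dots> \<le> (1 + real N * \<eta>) * (p\<^sup>2 + S / \<eta>)"
    using m assms S0 by (intro mult_right_mono) (auto simp: t_def mult_right_mono)
  finally show ?thesis by (simp add: s_def S_def)
qed

context prob_space
begin

context
  fixes p :: "'a \<Rightarrow> real" and v :: "'a \<Rightarrow> 'a \<Rightarrow> real" and P V \<eta> :: real
  assumes pm[measurable]: "p \<in> borel_measurable M"
    and vm[measurable]: "(\<lambda>z. v (fst z) (snd z)) \<in> borel_measurable (M \<Otimes>\<^sub>M M)"
    and p0: "\<And>x. 0 \<le> p x" and v0: "\<And>x y. 0 \<le> v x y"
    and P: "(\<integral>\<^sup>+x. ennreal ((p x)\<^sup>2) \<partial>M) \<le> ennreal P"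
    and V: "\<And>y. y \<in> space M \<Longrightarrow> (\<integral>\<^sup>+x. ennreal ((v x y)\<^sup>2) \<partial>M) \<le> ennreal V"
    and PV: "0 \<le> P" "0 \<le> V" "0 < \<eta>"
begin

lemma measurable_v_component:
  assumes "i \<in> I" "j \<in> I"
  shows "(\<lambda>x. v (x i) (x j)) \<in> borel_measurable (PiM I (\<lambda>_. M))"
proof -
  have "(\<lambda>x. (x i, x j)) \<in> PiM I (\<lambda>_. M) \<rightarrow>\<^sub>M M \<Otimes>\<^sub>M M" using assms by measurable
  from measurable_compose[OF this vm] show ?thesis by simp
qed

lemma measurable_p_component: "i \<in> I \<Longrightarrow> (\<lambda>x. p (x i)) \<in> borel_measurable (PiM I (\<lambda>_. M))"
  by measurable

lemma measurable_v_fst: "y \<in> space M \<Longrightarrow> (\<lambda>x. v x y) \<in> borel_measurable M"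
  using measurable_compose[OF measurable_Pair2' vm] by simp

lemma nn_integral_one_particle:
  assumes "finite J" "card J \<le> N" "\<And>j. j \<in> J \<Longrightarrow> x j \<in> space M"
  shows "(\<integral>\<^sup>+y. ennreal ((p y + (\<Sum>j\<in>J. v y (x j)))\<^sup>2) \<partial>M) \<le> ennreal ((1 + real N * \<eta>) * (P + real N * V / \<eta>))"
proof -
  note measurable_v_fst[OF assms(3), measurable]
  define e where "e = 1 / \<eta>"
  have e: "0 \<le> e" using PV by (simp add: e_def)
  have "(\<integral>\<^sup>+y. ennreal ((p y + (\<Sum>j\<in>J. v y (x j)))\<^sup>2) \<partial>M)
    \<le> (\<integral>\<^sup>+y. ennreal (1 + real N * \<eta>) * (ennreal ((p y)\<^sup>2) + (\<Sum>j\<in>J. ennreal ((v y (x j))\<^sup>2)) * ennreal e) \<partial>M)"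
  proof (rule nn_integral_mono)
    fix y
    have "ennreal ((p y + (\<Sum>j\<in>J. v y (x j)))\<^sup>2) \<le> ennreal ((1 + real N * \<eta>) * ((p y)\<^sup>2 + (\<Sum>j\<in>J. (v y (x j))\<^sup>2) * e))"
      using square_sum_le[OF assms(1) PV(3) assms(2), of "p y" "\<lambda>j. v y (x j)"] by (intro ennreal_leI) (simp add: e_def)
    also have "\<dots> = ennreal (1 + real N * \<eta>) * (ennreal ((p y)\<^sup>2) + (\<Sum>j\<in>J. ennreal ((v y (x j))\<^sup>2)) * ennreal e)"
      using PV e by (simp only: sum_ennreal ennreal_mult ennreal_plus sum_nonneg zero_le_power2 add_nonneg_nonneg
          mult_nonneg_nonneg zero_le_one of_nat_0_le_iff less_imp_le)
    finally show "ennreal ((p y + (\<Sum>j\<in>J. v y (x j)))\<^sup>2) \<le> ennreal (1 + real N * \<eta>) * (ennreal ((p y)\<^sup>2) + (\<Sum>j\<in>J. ennreal ((v y (x j))\<^sup>2)) * ennreal e)" .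
  qed
  also have "\<dots> = ennreal (1 + real N * \<eta>) * ((\<integral>\<^sup>+y. ennreal ((p y)\<^sup>2) \<partial>M) + (\<Sum>j\<in>J. \<integral>\<^sup>+y. ennreal ((v y (x j))\<^sup>2) \<partial>M) * ennreal e)"
    by (subst nn_integral_cmult, measurable, subst nn_integral_add, measurable,
        subst nn_integral_multc, measurable, subst nn_integral_sum) auto
  also have "\<dots> \<le> ennreal (1 + real N * \<eta>) * (ennreal P + (\<Sum>j\<in>J. ennreal V) * ennreal e)"
    using V assms(3) by (intro mult_left_mono add_mono P mult_right_mono sum_mono) auto
  also have "\<dots> = ennreal ((1 + real N * \<eta>) * (P + (\<Sum>j\<in>J. V) * e))"
    using PV e by (simp only: sum_ennreal ennreal_mult ennreal_plus sum_nonneg zero_le_power2 add_nonneg_nonneg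
          mult_nonneg_nonneg zero_le_one of_nat_0_le_iff less_imp_le)
  also have "\<dots> \<le> ennreal ((1 + real N * \<eta>) * (P + real N * V / \<eta>))"
    using PV assms(2) by (intro ennreal_leI mult_left_mono add_left_mono) (auto simp: e_def divide_right_mono mult_right_mono)
  finally show ?thesis .
qed

text \<open>The factor of particle \<open>i\<close> involves only particles with a smaller key, so
  the particle with the largest key occurs in its own factor alone and can be integrated out,
  uniformly in the others. The key is integer valued so that both the order of the indices and its
  reverse are instances.\<close>

lemma nn_integral_ordered_product:
  fixes key :: "nat \<Rightarrow> int"
  assumes "finite I" "inj_on key I" "card I \<le> N"
  shows "(\<integral>\<^sup>+x. (\<Prod>i\<in>I. ennreal ((p (x i) + (\<Sum>j\<in>{j\<in>I. key j < key i}. v (x i) (x j)))\<^sup>2)) \<partial>PiM I (\<lambda>_. M))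
     \<le> ennreal ((1 + real N * \<eta>) * (P + real N * V / \<eta>)) ^ card I"
  using assms
proof (induction I rule: finite_ranking_induct[where f = key])
  case empty
  interpret product_prob_space "\<lambda>_. M" "{}" by standard
  show ?case by (simp add: space_PiM PiM_empty)
next
  case (insert a S)
  show ?case
  proof (cases "a \<in> S")
    case True
    then show ?thesis using insert by (simp add: insert_absorb)
  next
    case False
    interpret product_sigma_finite "\<lambda>_. M" by standard
    have less: "key j < key a" if "j \<in> S" for j
      using insert.hyps(2)[OF that] insert.prems(1) False that by (metis inj_on_def insertI1 insertI2 order_less_le)
    define F where "F x = (\<Prod>i\<in>S. ennreal ((p (x i) + (\<Sum>j\<in>{j\<in>S. key j < key i}. v (x i) (x j)))\<^sup>2))" for x
    have Fm: "F \<in> borel_measurable (PiM S (\<lambda>_. M))"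
      unfolding F_def using pm
      by (intro borel_measurable_prod_ennreal measurable_compose[OF _ measurable_ennreal] borel_measurable_power
          borel_measurable_add borel_measurable_sum measurable_v_component measurable_p_component) auto
    have meas: "(\<lambda>x. \<Prod>i\<in>insert a S. ennreal ((p (x i) + (\<Sum>j\<in>{j\<in>insert a S. key j < key i}. v (x i) (x j)))\<^sup>2))
      \<in> borel_measurable (PiM (insert a S) (\<lambda>_. M))"
      by (intro borel_measurable_prod_ennreal measurable_compose[OF _ measurable_ennreal] borel_measurable_power
          borel_measurable_add borel_measurable_sum measurable_v_component measurable_p_component) auto
    have split: "(\<Prod>i\<in>insert a S. ennreal ((p ((x(a := y)) i) + (\<Sum>j\<in>{j\<in>insert a S. key j < key i}. v ((x(a := y)) i) ((x(a := y)) j)))\<^sup>2))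
      = ennreal ((p y + (\<Sum>j\<in>S. v y (x j)))\<^sup>2) * F x" for x y
    proof -
      have s1: "{j\<in>insert a S. key j < key a} = S" using less by auto
      have s2: "{j\<in>insert a S. key j < key i} = {j\<in>S. key j < key i}" if "i \<in> S" for i using less[OF that] by auto
      have a: "(p ((x(a := y)) a) + (\<Sum>j\<in>{j\<in>insert a S. key j < key a}. v ((x(a := y)) a) ((x(a := y)) j))) =
         p y + (\<Sum>j\<in>S. v y (x j))"
        unfolding s1 using False by (auto intro!: sum.cong)
      have b: "(p ((x(a := y)) i) + (\<Sum>j\<in>{j\<in>insert a S. key j < key i}. v ((x(a := y)) i) ((x(a := y)) j))) =
         p (x i) + (\<Sum>j\<in>{j\<in>S. key j < key i}. v (x i) (x j))" if "i \<in> S" for i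
        unfolding s2[OF that] using False that by (auto intro!: sum.cong)
      show ?thesis unfolding F_def prod.insert[OF insert.hyps(1) False] a
        by (intro arg_cong2[of _ _ _ _ times] prod.cong refl) (simp only: b)
    qed
    define B where "B = ennreal ((1 + real N * \<eta>) * (P + real N * V / \<eta>))"
    have "(\<integral>\<^sup>+x. (\<Prod>i\<in>insert a S. ennreal ((p (x i) + (\<Sum>j\<in>{j\<in>insert a S. key j < key i}. v (x i) (x j)))\<^sup>2)) \<partial>PiM (insert a S) (\<lambda>_. M))
       = (\<integral>\<^sup>+x. (\<integral>\<^sup>+y. ennreal ((p y + (\<Sum>j\<in>S. v y (x j)))\<^sup>2) * F x \<partial>M) \<partial>PiM S (\<lambda>_. M))"
      by (subst product_nn_integral_insert[OF insert.hyps(1) False meas]) (simp only: split)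
    also have "\<dots> \<le> (\<integral>\<^sup>+x. B * F x \<partial>PiM S (\<lambda>_. M))"
    proof (rule nn_integral_mono)
      fix x assume "x \<in> space (PiM S (\<lambda>_. M))"
      then have x: "x j \<in> space M" if "j \<in> S" for j using that by (auto simp: space_PiM PiE_iff)
      note measurable_v_fst[OF x, measurable]
      have "(\<integral>\<^sup>+y. ennreal ((p y + (\<Sum>j\<in>S. v y (x j)))\<^sup>2) * F x \<partial>M) = (\<integral>\<^sup>+y. ennreal ((p y + (\<Sum>j\<in>S. v y (x j)))\<^sup>2) \<partial>M) * F x"
        by (rule nn_integral_multc) measurable
      also have "\<dots> \<le> B * F x"
        unfolding B_def using insert.hyps insert.prems False
        by (intro mult_right_mono nn_integral_one_particle x) auto
      finally show "(\<integral>\<^sup>+y. ennreal ((p y + (\<Sum>j\<in>S. v y (x j)))\<^sup>2) * F x \<partial>M) \<le> B * F x" .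
    qed
    also have "\<dots> = B * (\<integral>\<^sup>+x. F x \<partial>PiM S (\<lambda>_. M))" by (rule nn_integral_cmult[OF Fm])
    also have "\<dots> \<le> B * B ^ card S"
      unfolding F_def B_def using insert False by (intro mult_left_mono insert.IH) auto
    finally show ?thesis using False insert.hyps by (simp add: B_def)
  qed
qed

text \<open>The dependence on all neighbours is not triangular. Splitting them into earlier and
  later ones gives two triangular products, separated by Cauchy--Schwarz; this is why the squares of
  \<open>p\<close> and \<open>v\<close> have to be integrable.\<close>

lemma nn_integral_neighbour_product:
  "(\<integral>\<^sup>+x. (\<Prod>i<N. ennreal ((p (x i) + (\<Sum>j<i. v (x i) (x j))) * (p (x i) + (\<Sum>j\<in>{i<..<N}. v (x i) (x j))))) \<partial>PiM {..<N} (\<lambda>_. M))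
     \<le> ennreal (((1 + real N * \<eta>) * (P + real N * V / \<eta>)) ^ N)"
proof -
  define B where "B = (1 + real N * \<eta>) * (P + real N * V / \<eta>)"
  have B: "0 \<le> B" using PV by (simp add: B_def)
  define F where "F x = (\<Prod>i<N. ennreal (p (x i) + (\<Sum>j<i. v (x i) (x j))))" for x
  define G where "G x = (\<Prod>i<N. ennreal (p (x i) + (\<Sum>j\<in>{i<..<N}. v (x i) (x j))))" for x
  have s: "{j\<in>{..<N}. int j < int i} = {..<i}" "{j\<in>{..<N}. - int j < - int i} = {i<..<N}" if "i < N" for i
    using that by auto
  have F2: "(\<integral>\<^sup>+x. F x ^ 2 \<partial>PiM {..<N} (\<lambda>_. M)) \<le> ennreal (B ^ N)"
  proof -
    have "F x ^ 2 = (\<Prod>i<N. ennreal ((p (x i) + (\<Sum>j\<in>{j\<in>{..<N}. int j < int i}. v (x i) (x j)))\<^sup>2))" for x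
      unfolding F_def prod_power_distrib
      by (intro prod.cong refl, subst s, simp, rule ennreal_power) (auto simp: p0 v0 sum_nonneg)
    then show ?thesis
      using nn_integral_ordered_product[of "{..<N}" int N] B by (simp add: ennreal_power B_def)
  qed
  have G2: "(\<integral>\<^sup>+x. G x ^ 2 \<partial>PiM {..<N} (\<lambda>_. M)) \<le> ennreal (B ^ N)"
  proof -
    have "G x ^ 2 = (\<Prod>i<N. ennreal ((p (x i) + (\<Sum>j\<in>{j\<in>{..<N}. - int j < - int i}. v (x i) (x j)))\<^sup>2))" for x
      unfolding G_def prod_power_distrib
      by (intro prod.cong refl, subst s, simp, rule ennreal_power) (auto simp: p0 v0 sum_nonneg)
    then show ?thesis
      using nn_integral_ordered_product[of "{..<N}" "\<lambda>i. - int i" N] B by (simp add: ennreal_power B_def inj_on_def)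
  qed
  have m: "F \<in> borel_measurable (PiM {..<N} (\<lambda>_. M))" "G \<in> borel_measurable (PiM {..<N} (\<lambda>_. M))"
    unfolding F_def G_def
    by (intro borel_measurable_prod_ennreal measurable_compose[OF _ measurable_ennreal]
          borel_measurable_add borel_measurable_sum measurable_v_component measurable_p_component; force)+
  have "(\<integral>\<^sup>+x. F x * G x \<partial>PiM {..<N} (\<lambda>_. M)) \<le> ennreal (sqrt (B ^ N) * sqrt (B ^ N))"
    by (rule nn_Cauchy_Schwarz_le[OF m]) (use F2 G2 B in auto)
  moreover have "F x * G x = (\<Prod>i<N. ennreal ((p (x i) + (\<Sum>j<i. v (x i) (x j))) * (p (x i) + (\<Sum>j\<in>{i<..<N}. v (x i) (x j)))))" for x
    unfolding F_def G_def prod.distrib[symmetric]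
    by (intro prod.cong refl ennreal_mult[symmetric]) (auto simp: p0 v0 sum_nonneg)
  ultimately show ?thesis using B by (simp add: B_def)
qed

end

lemma nn_integral_component:
  assumes "finite I" "i \<in> I" and [measurable]: "h \<in> borel_measurable M"
  shows "(\<integral>\<^sup>+x. h (x i) \<partial>PiM I (\<lambda>_. M)) = (\<integral>\<^sup>+u. h u \<partial>M)"
proof -
  interpret PP: prob_space "PiM I (\<lambda>_. M)" by (intro prob_space_PiM prob_space_axioms)
  have [measurable]: "(\<lambda>x. h (x i)) \<in> borel_measurable (PiM I (\<lambda>_. M))" using assms(2) by measurable
  show ?thesis using assms by (subst nn_integral_resample[of I i]) (auto simp: PP.emeasure_space_1)
qed

lemma nn_integral_pair_component:
  assumes I: "finite I" "i \<in> I" "j \<in> I" "i \<noteq> j"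
    and f: "(\<lambda>z. f (fst z) (snd z)) \<in> borel_measurable (M \<Otimes>\<^sub>M M)"
  shows "(\<integral>\<^sup>+x. f (x i) (x j) \<partial>PiM I (\<lambda>_. M)) = (\<integral>\<^sup>+u. (\<integral>\<^sup>+y. f y u \<partial>M) \<partial>M)"
proof -
  have "(\<lambda>x. (x i, x j)) \<in> PiM I (\<lambda>_. M) \<rightarrow>\<^sub>M M \<Otimes>\<^sub>M M" using I by measurable
  from measurable_compose[OF this f] have m: "(\<lambda>x. f (x i) (x j)) \<in> borel_measurable (PiM I (\<lambda>_. M))" by simp
  have "(\<lambda>z. (snd z, fst z)) \<in> M \<Otimes>\<^sub>M M \<rightarrow>\<^sub>M M \<Otimes>\<^sub>M M" by measurable
  from measurable_compose[OF this f] have "(\<lambda>u. \<integral>\<^sup>+y. f y u \<partial>M) \<in> borel_measurable M"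
    by (intro borel_measurable_nn_integral) (simp add: split_def)
  from nn_integral_component[OF I(1,3) this] show ?thesis
    using I by (subst nn_integral_resample[OF I(1,2) m]) simp
qed

end

text \<open>The exponent is chosen so that the square of the logarithm is at most
  \<open>16 * sqrt u\<close>, which for \<open>u\<close> of order
  \<open>norm (x - y) powr (- 2)\<close> is integrable in the plane.\<close>

lemma ln_one_plus_le_root: "0 \<le> (u::real) \<Longrightarrow> ln (1 + u) \<le> 4 * u powr (1 / 4)"
proof -
  assume u: "0 \<le> u"
  define t where "t = u powr (1 / 4)"
  have t: "0 \<le> t" by (simp add: t_def)
  have u4: "u = t ^ 4" using u by (cases "u = 0") (auto simp: t_def powr_power)
  have "1 + u \<le> (1 + t) ^ 4" unfolding u4 using t by (simp add: power4_eq_xxxx algebra_simps)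
  then have "ln (1 + u) \<le> ln ((1 + t) ^ 4)" using u t by (intro ln_mono) auto
  also have "\<dots> = 4 * ln (1 + t)" using t by (simp add: ln_realpow)
  also have "\<dots> \<le> 4 * t" using ln_add_one_self_le_self[OF t] by simp
  finally show ?thesis by (simp add: t_def)
qed

lemma powr_le_Bernoulli: "0 \<le> u \<Longrightarrow> 0 \<le> s \<Longrightarrow> s \<le> 1 \<Longrightarrow> u powr s \<le> 1 + s * (u::real)"
proof (cases "u = 0")
  case False
  assume a: "0 \<le> u" "0 \<le> s" "s \<le> 1"
  have "exp ((1 - s) *\<^sub>R 0 + s *\<^sub>R ln u) \<le> (1 - s) * exp 0 + s * exp (ln u)"
    by (rule convex_onD[OF exp_convex]) (use a in auto)
  then show ?thesis using False a by (simp add: powr_def mult.commute)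
qed auto

lemma add_powr_le: "0 \<le> a \<Longrightarrow> 0 \<le> b \<Longrightarrow> 0 \<le> k \<Longrightarrow> k \<le> 1 \<Longrightarrow> (a + b) powr k \<le> 2 * (a powr k + (b::real) powr k)"
proof -
  assume a: "0 \<le> a" "0 \<le> b" "0 \<le> k" "k \<le> 1"
  have "(a + b) powr k \<le> (2 * max a b) powr k" using a by (intro powr_mono2) auto
  also have "\<dots> = 2 powr k * (max a b) powr k" using a by (simp add: powr_mult)
  also have "\<dots> \<le> 2 powr 1 * (a powr k + b powr k)"
    using a by (intro mult_mono powr_mono) (auto simp: max_def)
  finally show ?thesis by simp
qed

section \<open>Estimates for the Gibbs weight\<close>

text \<open>The kernel \<open>T\<close> stands for \<open>1 - exp (- 4 pi G)\<close>, where \<open>G\<close> is the Green function.\<close>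

locale vortex_domain =
  fixes D :: "(real^2) set" and T :: "real^2 \<Rightarrow> real^2 \<Rightarrow> real" and \<Delta> :: real
  assumes D: "open D" "convex D" "bounded D" "measure lebesgue D = 1"
    and T_meas: "(\<lambda>z. T (fst z) (snd z)) \<in> borel_measurable (restrict_space lborel D \<Otimes>\<^sub>M restrict_space lborel D)"
    and T_sym: "T x y = T y x"
    and T_diag: "x \<in> D \<Longrightarrow> T x x = 1"
    and T_range: "x \<in> D \<Longrightarrow> y \<in> D \<Longrightarrow> x \<noteq> y \<Longrightarrow> 0 \<le> T x y \<and> T x y < 1"
    and T_mult: "(\<And>i. i < N \<Longrightarrow> X i \<in> D) \<Longrightarrow> schur_mult N (\<lambda>i j. T (X i) (X j))"
    and \<Delta>: "1 \<le> \<Delta>"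
    and T_lower: "x \<in> D \<Longrightarrow> y \<in> D \<Longrightarrow> (norm (x - y))\<^sup>2 \<le> \<Delta>\<^sup>2 * (1 - T x y)"
    and T_lower_boundary: "x \<in> D \<Longrightarrow> y \<in> D \<Longrightarrow> x \<noteq> y \<Longrightarrow>
       (norm (x - y))\<^sup>2 \<le> (norm (x - y) + 2 * infdist x (frontier D))\<^sup>2 * (1 - T x y)"
begin

abbreviation "M \<equiv> restrict_space lborel D"
abbreviation "P N \<equiv> PiM {..<N::nat} (\<lambda>_. M)"

sublocale prob_space M by (rule prob_space_\<mu>[OF D])

lemma space_M: "space M = D" by (rule space_\<mu>[OF D])

lemma prob_space_P: "prob_space (P N)"
  by (intro prob_space_PiM prob_space_axioms)

text \<open>Off the diagonal this is \<open>4 * pi\<close> times the Green function; on the diagonal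
  of \<open>D\<close>, \<open>T\<close> is \<open>1\<close> and \<open>ln 0 = 0\<close> makes it
  \<open>0\<close>.\<close>

definition L :: "real^2 \<Rightarrow> real^2 \<Rightarrow> real" where "L x y = - ln (1 - T x y)"
definition dist_bd :: "real^2 \<Rightarrow> real" where "dist_bd x = infdist x (frontier D)"

lemma dist_bd_pos: "x \<in> D \<Longrightarrow> 0 < dist_bd x"
proof -
  assume x: "x \<in> D"
  have "frontier D \<noteq> {}" using D(3) x frontier_eq_empty[of D] not_bounded_UNIV by auto
  moreover have "x \<notin> frontier D" using x D(1) by (auto simp: frontier_def interior_open)
  ultimately have "infdist x (frontier D) \<noteq> 0"
    using in_closed_iff_infdist_zero[of "frontier D" x] by auto
  then show ?thesis using infdist_nonneg[of x "frontier D"] by (simp add: dist_bd_def less_le)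
qed

lemma id_meas [measurable]: "(\<lambda>x. x) \<in> borel_measurable M"
  by (rule measurable_restrict_space1) auto

lemma norm_meas [measurable]: "(\<lambda>z. norm (fst z - snd z)) \<in> borel_measurable (M \<Otimes>\<^sub>M M)"
  using measurable_compose[OF measurable_fst id_meas] measurable_compose[OF measurable_snd id_meas] by measurable

lemma dist_bd_meas [measurable]: "dist_bd \<in> borel_measurable M"
proof -
  have "(\<lambda>x. infdist x (frontier D)) \<in> borel_measurable borel"
    by (intro borel_measurable_continuous_onI continuous_intros)
  then show ?thesis unfolding dist_bd_def[abs_def] by (intro measurable_restrict_space1) auto
qed

lemma L_meas: "(\<lambda>z. L (fst z) (snd z)) \<in> borel_measurable (M \<Otimes>\<^sub>M M)"
  unfolding L_def using T_meas by measurable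

lemma T_le1: "x \<in> D \<Longrightarrow> y \<in> D \<Longrightarrow> 0 \<le> T x y \<and> T x y \<le> 1"
  using T_range[of x y] T_diag[of x] by (cases "x = y") auto

lemma measurable_pair_P:
  assumes "(\<lambda>z. f (fst z) (snd z)) \<in> borel_measurable (M \<Otimes>\<^sub>M M)" "i < N" "j < N"
  shows "(\<lambda>x. f (x i) (x j)) \<in> borel_measurable (P N)"
proof -
  have "(\<lambda>x. (x i, x j)) \<in> P N \<rightarrow>\<^sub>M M \<Otimes>\<^sub>M M"
    using assms by (intro measurable_Pair measurable_component_singleton) auto
  from measurable_compose[OF this assms(1)] show ?thesis by simp
qed

lemma measurable_pairsum_L [measurable]: "pairsum N \<xi> L \<in> borel_measurable (P N)"
  unfolding pairsum_def
  by (intro borel_measurable_sum borel_measurable_times borel_measurable_const measurable_pair_P[OF L_meas]) auto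

text \<open>With \<open>k = \<beta> / (2 * pi * N)\<close> this dominates the square of the
  unnormalized Gibbs weight: the pair interaction is kept, and the self-energies are estimated by
  the distance to the boundary.\<close>

abbreviation "majorant N k \<xi> x \<equiv> exp (- k * pairsum N \<xi> L x) * (\<Prod>i<N. dist_bd (x i) powr (- k))"

lemma space_P_D: "x \<in> space (P N) \<Longrightarrow> i < N \<Longrightarrow> x i \<in> D"
  by (auto simp: space_PiM PiE_iff space_M)

lemma emeasure_close_pair:
  assumes "i < N" "j < N" "i \<noteq> j" "0 < \<tau>"
  shows "emeasure (P N) {x \<in> space (P N). norm (x i - x j) < \<tau>} \<le> ennreal (4 * \<tau>\<^sup>2)"
proof -
  have [measurable]: "{x \<in> space (P N). norm (x i - x j) < \<tau>} \<in> sets (P N)"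
    using measurable_pair_P[OF norm_meas, of i N j] assms by measurable
  have m: "(\<lambda>z. indicator {..<\<tau>} (norm (fst z - snd z)) :: ennreal) \<in> borel_measurable (M \<Otimes>\<^sub>M M)"
    by measurable
  have "emeasure (P N) {x \<in> space (P N). norm (x i - x j) < \<tau>} =
     (\<integral>\<^sup>+x. indicator {..<\<tau>} (norm (x i - x j)) \<partial>P N)"
    by (subst nn_integral_indicator[symmetric], measurable, rule nn_integral_cong) (auto simp: indicator_def)
  also have "\<dots> = (\<integral>\<^sup>+u. (\<integral>\<^sup>+y. indicator {..<\<tau>} (norm (y - u)) \<partial>M) \<partial>M)"
    by (rule nn_integral_pair_component[OF _ _ _ _ m]) (use assms in auto)
  also have "\<dots> \<le> (\<integral>\<^sup>+u. ennreal (4 * \<tau>\<^sup>2) \<partial>M)"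
  proof (rule nn_integral_mono)
    fix u
    have [measurable]: "{y \<in> space M. norm (y - u) < \<tau>} \<in> sets M" by measurable
    have "(\<integral>\<^sup>+y. indicator {..<\<tau>} (norm (y - u)) \<partial>M) = emeasure M {y \<in> space M. norm (y - u) < \<tau>}"
      by (subst nn_integral_indicator[symmetric], measurable, rule nn_integral_cong) (auto simp: indicator_def)
    also have "\<dots> \<le> ennreal (4 * \<tau>\<^sup>2)" using emeasure_near_point[OF D assms(4)] assms(4) by simp
    finally show "(\<integral>\<^sup>+y. indicator {..<\<tau>} (norm (y - u)) \<partial>M) \<le> ennreal (4 * \<tau>\<^sup>2)" .
  qed
  finally show ?thesis by (simp add: emeasure_space_1)
qed

lemma AE_distinct: "AE x in P N. \<forall>i<N. \<forall>j<N. i \<noteq> j \<longrightarrow> x i \<noteq> x j"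
proof -
  have "AE x in P N. x i \<noteq> x j" if ij: "i < N" "j < N" "i \<noteq> j" for i j
  proof (rule AE_I)
    show "{x \<in> space (P N). \<not> x i \<noteq> x j} \<subseteq> {x \<in> space (P N). norm (x i - x j) \<le> 0}" by auto
    show S: "{x \<in> space (P N). norm (x i - x j) \<le> 0} \<in> sets (P N)"
      using measurable_pair_P[OF norm_meas, of i N j] ij by measurable
    show "emeasure (P N) {x \<in> space (P N). norm (x i - x j) \<le> 0} = 0"
    proof (rule ccontr)
      assume n: "emeasure (P N) {x \<in> space (P N). norm (x i - x j) \<le> 0} \<noteq> 0"
      interpret PP: prob_space "P N" by (rule prob_space_P)
      \<comment> \<open>If coincidence had probability \<open>e > 0\<close>, the close-pair estimate
        at the scale \<open>sqrt e / 4\<close> would give \<open>e \<le> e / 4\<close>.\<close>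
      define e where "e = PP.prob {x \<in> space (P N). norm (x i - x j) \<le> 0}"
      have e: "0 < e" using n by (simp add: e_def PP.emeasure_eq_measure measure_nonneg less_le)
      have "ennreal e \<le> ennreal (4 * (sqrt e / 4)\<^sup>2)"
      proof -
        have "ennreal e \<le> emeasure (P N) {x \<in> space (P N). norm (x i - x j) < sqrt e / 4}"
          unfolding e_def PP.emeasure_eq_measure[symmetric]
          using measurable_pair_P[OF norm_meas, of i N j] ij e unfolding e_def[symmetric]
          by (intro emeasure_mono) auto
        also have "\<dots> \<le> ennreal (4 * (sqrt e / 4)\<^sup>2)" by (rule emeasure_close_pair) (use ij e in auto)
        finally show ?thesis .
      qed
      then have "e \<le> e / 4" using e by (simp add: power_divide)
      then show False using e by simp
    qed
  qed
  then show ?thesis by (simp add: AE_all_countable)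
qed

lemma nn_integral_norm_powr:
  assumes "0 \<le> q" "q < 2"
  obtains C where "0 \<le> C" "\<And>y. (\<integral>\<^sup>+x. ennreal (norm (x - y) powr (- q)) \<partial>M) \<le> ennreal C"
proof (rule that)
  show "(\<integral>\<^sup>+x. ennreal (norm (x - y) powr (- q)) \<partial>M) \<le> ennreal (1 + 4 * (2 powr q / (1 - 2 powr (q - 2))))" for y
    by (rule nn_integral_neg_powr) (use assms emeasure_near_point[OF D] in auto)
  have "2 powr (q - 2) \<le> 2 powr (0::real)" using assms by (intro powr_mono) auto
  then show "0 \<le> 1 + 4 * (2 powr q / (1 - 2 powr (q - 2)))" by simp
qed

lemma nn_integral_dist_bd_powr:
  assumes "0 \<le> q" "q < 1"
  obtains C where "0 \<le> C" "(\<integral>\<^sup>+x. ennreal (dist_bd x powr (- q)) \<partial>M) \<le> ennreal C"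
proof -
  obtain C where C: "0 < C" "\<And>\<tau>. 0 < \<tau> \<Longrightarrow>
    emeasure M {x \<in> space M. infdist x (frontier D) < \<tau>} \<le> ennreal (C * \<tau> powr 1)"
    by (rule emeasure_near_boundary[OF D]) blast
  have "emeasure M {x \<in> space M. dist_bd x < \<tau>} \<le> ennreal (C * \<tau> powr 1)" if "0 < \<tau>" for \<tau>
    using C(2)[OF that] by (simp add: dist_bd_def)
  moreover have "0 \<le> dist_bd x" for x by (simp add: dist_bd_def infdist_nonneg)
  ultimately have "(\<integral>\<^sup>+x. ennreal (dist_bd x powr (- q)) \<partial>M) \<le> ennreal (1 + C * (2 powr q / (1 - 2 powr (q - 1))))"
    by (intro nn_integral_neg_powr) (use assms C(1) in auto)
  moreover have "0 \<le> 1 + C * (2 powr q / (1 - 2 powr (q - 1)))"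
  proof -
    have "2 powr (q - 1) \<le> 2 powr (0::real)" using assms by (intro powr_mono) auto
    then show ?thesis using C by simp
  qed
  ultimately show thesis by (rule that[rotated])
qed

text \<open>Onsager's inequality with the cutoff \<open>Min (insert \<theta> {1 - T (x i) (x j) | j}) / N\<close>.\<close>

definition nnsq :: "nat \<Rightarrow> real \<Rightarrow> (nat \<Rightarrow> real^2) \<Rightarrow> nat \<Rightarrow> real" where
  "nnsq N \<theta> x i = Min (insert \<theta> ((\<lambda>j. 1 - T (x i) (x j)) ` ({..<N} - {i})))"

lemma pairsum_L_ge:
  assumes x: "\<And>i. i < N \<Longrightarrow> x i \<in> D" and dis: "\<And>i j. i < N \<Longrightarrow> j < N \<Longrightarrow> i \<noteq> j \<Longrightarrow> x i \<noteq> x j"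
    and xi: "\<And>i. i < N \<Longrightarrow> \<xi> i \<in> {1, -1}" and \<theta>: "0 < \<theta>" "\<theta> \<le> 1" and N: "1 \<le> N"
  shows "- pairsum N \<xi> L x \<le> (1 / 2) * (\<Sum>i<N. ln (real N / nnsq N \<theta> x i)) + real N / 2"
    and "\<And>i. i < N \<Longrightarrow> 0 < nnsq N \<theta> x i"
proof -
  have T: "0 \<le> T (x i) (x j) \<and> T (x i) (x j) < 1" if "i < N" "j < N" "i \<noteq> j" for i j
    by (rule T_range) (use that x dis in auto)
  show pos: "0 < nnsq N \<theta> x i" if "i < N" for i
    unfolding nnsq_def using \<theta> T that by (subst Min_gr_iff) auto
  have le: "nnsq N \<theta> x i \<le> \<theta>" for i unfolding nnsq_def by (rule Min_le) auto
  have leT: "nnsq N \<theta> x i \<le> 1 - T (x i) (x j)" if "j < N" "i \<noteq> j" for i j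
    unfolding nnsq_def by (rule Min_le) (use that in auto)
  have "(\<Sum>j<N. \<Sum>i<j. \<xi> i * \<xi> j * ln ((1 - 0 * T (x i) (x j)) / (1 - T (x i) (x j))))
     \<ge> - (1 / 2) * (\<Sum>i<N. ln ((1 - 0) / (nnsq N \<theta> x i / real N))) - real N / 2"
  proof (rule onsager[OF T_mult])
    fix i assume i: "i < N"
    have "nnsq N \<theta> x i / real N \<le> nnsq N \<theta> x i / 1" using pos[OF i] N by (intro divide_left_mono) auto
    then show "0 < nnsq N \<theta> x i / real N \<and> nnsq N \<theta> x i / real N \<le> 1 - 0"
      using pos[OF i] N le[of i] \<theta> by simp
  next
    fix i j assume "i < N" "j < N" "i \<noteq> j"
    then show "real N * (nnsq N \<theta> x i / real N) \<le> 1 - T (x i) (x j)" using leT N by simp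
  qed (use T_diag x T_sym T xi in auto)
  moreover have "(\<Sum>j<N. \<Sum>i<j. \<xi> i * \<xi> j * ln ((1 - 0 * T (x i) (x j)) / (1 - T (x i) (x j)))) = pairsum N \<xi> L x"
    unfolding pairsum_def L_def by (intro sum.cong refl arg_cong2[of _ _ _ _ times]) (use T in \<open>auto simp: ln_div\<close>)
  ultimately show "- pairsum N \<xi> L x \<le> (1 / 2) * (\<Sum>i<N. ln (real N / nnsq N \<theta> x i)) + real N / 2" by simp
qed

lemma exp_pairsum_L_le:
  assumes x: "\<And>i. i < N \<Longrightarrow> x i \<in> D" and dis: "\<And>i j. i < N \<Longrightarrow> j < N \<Longrightarrow> i \<noteq> j \<Longrightarrow> x i \<noteq> x j"
    and xi: "\<And>i. i < N \<Longrightarrow> \<xi> i \<in> {1, -1}" and \<theta>: "0 < \<theta>" "\<theta> \<le> 1" and N: "1 \<le> N" and k: "0 \<le> k"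
  shows "exp (- k * pairsum N \<xi> L x) \<le> exp (k * real N / 2) * (\<Prod>i<N. (real N / nnsq N \<theta> x i) powr (k / 2))"
proof -
  have "- k * pairsum N \<xi> L x \<le> k * ((1 / 2) * (\<Sum>i<N. ln (real N / nnsq N \<theta> x i)) + real N / 2)"
    using mult_left_mono[OF pairsum_L_ge(1)[OF x dis xi \<theta> N] k] by simp
  also have "\<dots> = k * real N / 2 + (\<Sum>i<N. k / 2 * ln (real N / nnsq N \<theta> x i))"
    by (simp add: distrib_left sum_distrib_left)
  finally have "exp (- k * pairsum N \<xi> L x) \<le> exp (k * real N / 2) * (\<Prod>i<N. exp (k / 2 * ln (real N / nnsq N \<theta> x i)))"
    by (simp add: exp_add exp_sum flip: exp_add exp_sum)
  also have "(\<Prod>i<N. exp (k / 2 * ln (real N / nnsq N \<theta> x i))) = (\<Prod>i<N. (real N / nnsq N \<theta> x i) powr (k / 2))"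
    using pairsum_L_ge(2)[OF x dis xi \<theta> N] N by (intro prod.cong refl) (force simp: powr_def)
  finally show ?thesis .
qed

lemma nnsq_cases: "nnsq N \<theta> x i = \<theta> \<or> (\<exists>j<N. j \<noteq> i \<and> nnsq N \<theta> x i = 1 - T (x i) (x j))"
proof -
  have "nnsq N \<theta> x i \<in> insert \<theta> ((\<lambda>j. 1 - T (x i) (x j)) ` ({..<N} - {i}))"
    unfolding nnsq_def by (rule Min_in) auto
  then show ?thesis by auto
qed

text \<open>Since \<open>q \<ge> 1\<close>, expanding the product leaves both one-sided sums with
  coefficient at least one. A nearest neighbour, on whichever side it is, can thus be absorbed on
  top of \<open>q * q\<close>.\<close>

lemma neighbour_product_ge:
  fixes v :: "real^2 \<Rightarrow> real^2 \<Rightarrow> real" and i j N :: nat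
  assumes "1 \<le> q" "\<And>y z. 0 \<le> v y z" "j < N" "j \<noteq> i"
  shows "q * q \<le> (q + (\<Sum>j<i. v (x i) (x j))) * (q + (\<Sum>j\<in>{i<..<N}. v (x i) (x j)))"
    and "v (x i) (x j) + q * q \<le> (q + (\<Sum>j<i. v (x i) (x j))) * (q + (\<Sum>j\<in>{i<..<N}. v (x i) (x j)))"
proof -
  define A where "A = (\<Sum>j<i. v (x i) (x j))"
  define B where "B = (\<Sum>j\<in>{i<..<N}. v (x i) (x j))"
  have A: "0 \<le> A" "0 \<le> B" by (auto simp: A_def B_def assms(2) sum_nonneg)
  have e: "(q + A) * (q + B) = q * q + A * q + q * B + A * B" by (simp add: algebra_simps)
  have 1: "A \<le> A * q" "B \<le> q * B" using A assms(1) mult_left_mono[of 1 q A] mult_right_mono[of 1 q B] by auto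
  have 2: "0 \<le> A * B" using A by simp
  have "v (x i) (x j) \<le> A + B"
  proof (cases "j < i")
    case True
    then have "v (x i) (x j) \<le> A" unfolding A_def by (intro member_le_sum) (auto simp: assms)
    then show ?thesis using A by simp
  next
    case False
    then have "v (x i) (x j) \<le> B" unfolding B_def using assms by (intro member_le_sum) auto
    then show ?thesis using A by simp
  qed
  then show "q * q \<le> (q + A) * (q + B)" "v (x i) (x j) + q * q \<le> (q + A) * (q + B)"
    unfolding e using 1 2 A by linarith+
qed

text \<open>Only sums of singularities are affordable in this scheme:
  \<open>dist_bd x powr (- k)\<close> and \<open>norm (x - y) powr (- 2 * k)\<close> are separately
  integrable for \<open>k < 1\<close>, but a product of the boundary factor with the neighbour
  factor would be squared, and \<open>dist_bd x powr (- 2 * k)\<close> is out of reach for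
  \<open>k \<ge> 1 / 2\<close>. The bound \<open>T_lower_boundary\<close> turns the product into a
  sum.\<close>

lemma fixed_N_bound:
  assumes k: "0 \<le> k" "k < 1" and N: "1 \<le> N"
  obtains C where "0 \<le> C" "\<And>\<xi>. (\<And>i. i < N \<Longrightarrow> \<xi> i \<in> {1, -1}) \<Longrightarrow>
    (\<integral>\<^sup>+x. ennreal (majorant N k \<xi> x) \<partial>P N) \<le> ennreal C"
proof -
  define p where "p x = 1 + dist_bd x powr (- k / 2)" for x
  define v where "v x y = 2 * norm (x - y) powr (- k)" for x y :: "real^2"
  obtain C1 where C1: "0 \<le> C1" "(\<integral>\<^sup>+x. ennreal (dist_bd x powr (- k)) \<partial>M) \<le> ennreal C1"
    by (rule nn_integral_dist_bd_powr[of k]) (use k in auto)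
  obtain C2 where C2: "0 \<le> C2" "\<And>y. (\<integral>\<^sup>+x. ennreal (norm (x - y) powr (- (2 * k))) \<partial>M) \<le> ennreal C2"
    by (rule nn_integral_norm_powr[of "2 * k"]) (use k in auto)
  have vm: "(\<lambda>z. v (fst z) (snd z)) \<in> borel_measurable (M \<Otimes>\<^sub>M M)" unfolding v_def by measurable
  have pm: "p \<in> borel_measurable M" unfolding p_def by measurable
  have pI: "(\<integral>\<^sup>+x. ennreal ((p x)\<^sup>2) \<partial>M) \<le> ennreal (2 + 2 * C1)"
  proof -
    have "(\<integral>\<^sup>+x. ennreal ((p x)\<^sup>2) \<partial>M) \<le> (\<integral>\<^sup>+x. 2 + 2 * ennreal (dist_bd x powr (- k)) \<partial>M)"
    proof (rule nn_integral_mono)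
      fix x
      have "(p x)\<^sup>2 \<le> 2 + 2 * (dist_bd x powr (- k / 2))\<^sup>2"
        using sum_squares_bound[of 1 "dist_bd x powr (- k / 2)"] by (simp add: p_def power2_eq_square algebra_simps)
      also have "(dist_bd x powr (- k / 2))\<^sup>2 = dist_bd x powr (- k)"
        by (simp add: power2_eq_square flip: powr_add)
      finally have "ennreal ((p x)\<^sup>2) \<le> ennreal (2 + 2 * dist_bd x powr (- k))" by (rule ennreal_leI)
      also have "\<dots> = 2 + 2 * ennreal (dist_bd x powr (- k))" by (simp add: ennreal_plus ennreal_mult)
      finally show "ennreal ((p x)\<^sup>2) \<le> 2 + 2 * ennreal (dist_bd x powr (- k))" .
    qed
    also have "\<dots> = 2 + 2 * (\<integral>\<^sup>+x. ennreal (dist_bd x powr (- k)) \<partial>M)"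
      by (subst nn_integral_add) (auto simp: emeasure_space_1 nn_integral_cmult)
    also have "\<dots> \<le> 2 + 2 * ennreal C1" by (intro add_left_mono mult_left_mono C1) auto
    also have "\<dots> = ennreal (2 + 2 * C1)" using C1 by (simp add: ennreal_plus ennreal_mult)
    finally show ?thesis .
  qed
  have vI: "(\<integral>\<^sup>+x. ennreal ((v x y)\<^sup>2) \<partial>M) \<le> ennreal (4 * C2)" if "y \<in> space M" for y
  proof -
    have "(\<integral>\<^sup>+x. ennreal ((v x y)\<^sup>2) \<partial>M) = (\<integral>\<^sup>+x. 4 * ennreal (norm (x - y) powr (- (2 * k))) \<partial>M)"
    proof (rule nn_integral_cong)
      fix x
      have "(v x y)\<^sup>2 = 4 * (norm (x - y) powr (- k))\<^sup>2" by (simp add: v_def power2_eq_square)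
      also have "(norm (x - y) powr (- k))\<^sup>2 = norm (x - y) powr (- (2 * k))"
        by (simp add: power2_eq_square flip: powr_add)
      finally show "ennreal ((v x y)\<^sup>2) = 4 * ennreal (norm (x - y) powr (- (2 * k)))" by (simp add: ennreal_mult)
    qed
    also have "\<dots> = 4 * (\<integral>\<^sup>+x. ennreal (norm (x - y) powr (- (2 * k))) \<partial>M)" by (rule nn_integral_cmult) measurable
    also have "\<dots> \<le> 4 * ennreal C2" by (intro mult_left_mono C2) auto
    finally show ?thesis using C2 by (simp add: ennreal_mult)
  qed
  define B where "B = (1 + real N * 1) * ((2 + 2 * C1) + real N * (4 * C2) / 1)"
  let ?nbr = "\<lambda>x i. (p (x i) + (\<Sum>j<i. v (x i) (x j))) * (p (x i) + (\<Sum>j\<in>{i<..<N}. v (x i) (x j)))"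
  have prod: "(\<integral>\<^sup>+x. (\<Prod>i<N. ennreal (?nbr x i)) \<partial>P N)
     \<le> ennreal (B ^ N)"
    unfolding B_def
    by (rule nn_integral_neighbour_product[OF pm vm _ _ pI vI]) (use C1 C2 in \<open>auto simp: p_def v_def add_nonneg_nonneg\<close>)
  define c where "c = exp (k * real N / 2) * (2 * real N powr (k / 2)) ^ N"
  have c: "0 \<le> c" by (simp add: c_def)
  have bound: "(\<integral>\<^sup>+x. ennreal (majorant N k \<xi> x) \<partial>P N) \<le> ennreal (c * B ^ N)"
    if xi: "\<And>i. i < N \<Longrightarrow> \<xi> i \<in> {1, -1}" for \<xi>
  proof -
    have "(\<integral>\<^sup>+x. ennreal (majorant N k \<xi> x) \<partial>P N)
      \<le> (\<integral>\<^sup>+x. ennreal c * (\<Prod>i<N. ennreal (?nbr x i)) \<partial>P N)"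
    proof (rule nn_integral_mono_AE)
      show "AE x in P N. ennreal (majorant N k \<xi> x)
        \<le> ennreal c * (\<Prod>i<N. ennreal (?nbr x i))"
        using AE_distinct[of N] AE_space
      proof eventually_elim
        case (elim x)
        then have x: "\<And>i. i < N \<Longrightarrow> x i \<in> D" and dis: "\<And>i j. i < N \<Longrightarrow> j < N \<Longrightarrow> i \<noteq> j \<Longrightarrow> x i \<noteq> x j"
          using space_P_D by auto
        define G where "G i = (p (x i) + (\<Sum>j<i. v (x i) (x j))) * (p (x i) + (\<Sum>j\<in>{i<..<N}. v (x i) (x j)))" for i
        have G0: "0 \<le> G i" for i unfolding G_def by (intro mult_nonneg_nonneg add_nonneg_nonneg sum_nonneg) (auto simp: p_def v_def)
        have each: "(real N / nnsq N 1 x i) powr (k / 2) * dist_bd (x i) powr (- k) \<le> (2 * real N powr (k / 2)) * G i"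
          if i: "i < N" for i
        proof -
          have pos: "0 < nnsq N 1 x i" by (rule pairsum_L_ge(2)[OF x dis xi _ _ N i]) auto
          define d where "d = dist_bd (x i)"
          have d: "0 < d" using dist_bd_pos x i by (simp add: d_def)
          have p1: "1 \<le> p (x i)" by (simp add: p_def)
          have pp: "d powr (- k) \<le> p (x i) * p (x i)"
          proof -
            have "d powr (- k) = d powr (- k / 2) * d powr (- k / 2)" by (simp flip: powr_add)
            also have "\<dots> \<le> p (x i) * p (x i)" by (intro mult_mono) (auto simp: p_def d_def)
            finally show ?thesis .
          qed
          have "(1 / nnsq N 1 x i) powr (k / 2) * d powr (- k) \<le> 2 * G i"
            using nnsq_cases[of N 1 x i]
          proof (elim disjE exE conjE)
            assume "nnsq N 1 x i = 1"
            then have "(1 / nnsq N 1 x i) powr (k / 2) * d powr (- k) = d powr (- k)" by simp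
            also have "\<dots> \<le> p (x i) * p (x i)" by (rule pp)
            also have "\<dots> \<le> G i" unfolding G_def
              by (intro mult_mono) (auto simp: p_def v_def sum_nonneg add_nonneg_nonneg)
            finally show ?thesis using G0[of i] by simp
          next
            fix j assume j: "j < N" "j \<noteq> i" "nnsq N 1 x i = 1 - T (x i) (x j)"
            define r where "r = norm (x i - x j)"
            have r: "0 < r" using dis[OF i j(1)] j by (simp add: r_def)
            have tb: "r\<^sup>2 \<le> (r + 2 * d)\<^sup>2 * nnsq N 1 x i"
              unfolding j(3) r_def d_def dist_bd_def by (rule T_lower_boundary) (use x i j dis[OF i j(1)] in auto)
            have "1 / nnsq N 1 x i \<le> ((r + 2 * d) / r)\<^sup>2"
              using tb pos r by (simp add: field_simps power_divide)
            then have "(1 / nnsq N 1 x i) powr (k / 2) \<le> (((r + 2 * d) / r)\<^sup>2) powr (k / 2)"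
              using pos k by (intro powr_mono2) auto
            also have "\<dots> = ((r + 2 * d) / r) powr k"
              using r d powr_powr[of "(r + 2 * d) / r" 2 "k / 2"] by (simp add: powr_numeral)
            finally have "(1 / nnsq N 1 x i) powr (k / 2) * d powr (- k) \<le> ((r + 2 * d) / r) powr k * (1 / d) powr k"
            proof -
              assume *: "(1 / nnsq N 1 x i) powr (k / 2) \<le> ((r + 2 * d) / r) powr k"
              have "d powr (- k) = (1 / d) powr k" using d by (simp add: powr_minus_divide powr_divide)
              then show ?thesis using * by (simp only:) (rule mult_right_mono, auto)
            qed
            \<comment> \<open>The gain from the half-plane comparison:
              \<open>(r + 2 * d) / r * (1 / d) = 1 / d + 2 / r\<close>, so the boundary and the pair
              singularity are added instead of multiplied.\<close>
            also have "\<dots> = (1 / d + 2 / r) powr k"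
              using r d by (subst powr_mult[symmetric]) (auto simp: field_simps)
            also have "\<dots> \<le> 2 * ((1 / d) powr k + (2 / r) powr k)" by (rule add_powr_le) (use r d k in auto)
            also have "(1 / d) powr k = d powr (- k)" using d by (simp add: powr_minus_divide powr_divide)
            also have "(2 / r) powr k \<le> 2 * r powr (- k)"
            proof -
              have "(2 / r) powr k = 2 powr k * r powr (- k)" using r by (simp add: powr_minus_divide powr_divide)
              also have "\<dots> \<le> 2 powr 1 * r powr (- k)" using k by (intro mult_right_mono powr_mono) auto
              finally show ?thesis by simp
            qed
            also have "2 * r powr (- k) = v (x i) (x j)" by (simp add: v_def r_def)
            finally have "(1 / nnsq N 1 x i) powr (k / 2) * d powr (- k) \<le> 2 * (d powr (- k) + v (x i) (x j))" by simp
            also have "\<dots> \<le> 2 * (v (x i) (x j) + p (x i) * p (x i))" using pp by simp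
            also have "\<dots> \<le> 2 * G i" unfolding G_def
              by (intro mult_left_mono neighbour_product_ge(2)[OF p1 _ j(1,2)]) (auto simp: v_def)
            finally show ?thesis .
          qed
          then have "real N powr (k / 2) * ((1 / nnsq N 1 x i) powr (k / 2) * d powr (- k)) \<le> real N powr (k / 2) * (2 * G i)"
            by (rule mult_left_mono) simp
          moreover have "(real N / nnsq N 1 x i) powr (k / 2) = real N powr (k / 2) * (1 / nnsq N 1 x i) powr (k / 2)"
            using pos by (simp add: powr_divide)
          ultimately show ?thesis by (simp add: d_def mult_ac)
        qed
        have "exp (- k * pairsum N \<xi> L x) * (\<Prod>i<N. dist_bd (x i) powr (- k))
          \<le> (exp (k * real N / 2) * (\<Prod>i<N. (real N / nnsq N 1 x i) powr (k / 2))) * (\<Prod>i<N. dist_bd (x i) powr (- k))"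
          by (intro mult_right_mono exp_pairsum_L_le[OF x dis xi _ _ N k(1)] prod_nonneg) auto
        also have "\<dots> = exp (k * real N / 2) * (\<Prod>i<N. (real N / nnsq N 1 x i) powr (k / 2) * dist_bd (x i) powr (- k))"
          by (simp add: prod.distrib)
        also have "\<dots> \<le> exp (k * real N / 2) * (\<Prod>i<N. (2 * real N powr (k / 2)) * G i)"
          by (intro mult_left_mono prod_mono) (use each in auto)
        also have "\<dots> = c * (\<Prod>i<N. G i)" by (simp add: c_def prod.distrib)
        finally have "ennreal (majorant N k \<xi> x) \<le> ennreal (c * (\<Prod>i<N. G i))"
          by (rule ennreal_leI)
        also have "\<dots> = ennreal c * (\<Prod>i<N. ennreal (G i))"
          using c G0 by (simp add: ennreal_mult prod_nonneg prod_ennreal)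
        finally show ?case unfolding G_def .
      qed
    qed
    also have "\<dots> = ennreal c * (\<integral>\<^sup>+x. (\<Prod>i<N. ennreal (?nbr x i)) \<partial>P N)"
    proof (rule nn_integral_cmult)
      show "(\<lambda>x. \<Prod>i<N. ennreal (?nbr x i)) \<in> borel_measurable (P N)"
        using pm by (intro borel_measurable_prod_ennreal measurable_compose[OF _ measurable_ennreal] borel_measurable_times
            borel_measurable_add borel_measurable_sum measurable_pair_P[OF vm]) auto
    qed
    also have "\<dots> \<le> ennreal c * ennreal (B ^ N)" by (intro mult_left_mono prod) auto
    also have "\<dots> = ennreal (c * B ^ N)" using c C1 C2 by (intro ennreal_mult[symmetric]) (auto simp: B_def)
    finally show ?thesis .
  qed
  show thesis by (rule that[OF _ bound]) (use c C1 C2 in \<open>auto simp: B_def\<close>)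
qed

end

text \<open>From the index \<open>K\<close> on, the even Taylor terms decrease at least by the
  factor \<open>1 / 4\<close>, so the partial sum contains at least half of \<open>cosh u\<close>;
  for \<open>u \<le> 0\<close> the constant term suffices. The truncation is needed because only
  finitely many moments will be under control.\<close>

lemma exp_le_cosh_partial_sum:
  assumes "u \<le> real K"
  shows "exp u \<le> 4 * (\<Sum>n\<le>K. u ^ (2 * n) / fact (2 * n))"
proof (cases "u \<le> 0")
  case True
  have "exp u \<le> 1" using True by simp
  also have "1 \<le> (\<Sum>n\<in>{0}. u ^ (2 * n) / fact (2 * n))" by simp
  also have "\<dots> \<le> (\<Sum>n\<le>K. u ^ (2 * n) / fact (2 * n))" by (rule sum_mono2) (auto simp: zero_le_even_power)
  also have "\<dots> \<le> 4 * (\<Sum>n\<le>K. u ^ (2 * n) / fact (2 * n))" using calculation exp_gt_zero[of u] by linarith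
  finally show ?thesis .
next
  case False
  define a where "a n = u ^ (2 * n) / fact (2 * n)" for n
  have a0: "0 \<le> a n" for n by (simp add: a_def zero_le_even_power)
  have step: "a (Suc n) \<le> a n * (1 / 4)" if "K \<le> n" for n
  proof -
    have un: "u * u \<le> real n * real n" using False assms that by (intro mult_mono) auto
    have "a (Suc n) = a n * (u * u / ((2 * real n + 1) * (2 * real n + 2)))"
      by (simp add: a_def field_simps)
    also have "\<dots> \<le> a n * (1 / 4)"
    proof (rule mult_left_mono[OF _ a0])
      have "4 * (u * u) \<le> (2 * real n + 1) * (2 * real n + 2)"
        using un by (simp add: algebra_simps)
      then show "u * u / ((2 * real n + 1) * (2 * real n + 2)) \<le> 1 / 4"
        by (subst pos_divide_le_eq) (auto intro!: mult_pos_pos add_nonneg_pos)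
    qed
    finally show ?thesis .
  qed
  have tail: "a (m + Suc K) \<le> a K * (1 / 4) ^ Suc m" for m
  proof (induction m)
    case (Suc m)
    have "a (Suc m + Suc K) \<le> a (m + Suc K) * (1 / 4)" using step[of "m + Suc K"] by simp
    also have "\<dots> \<le> a K * (1 / 4) ^ Suc m * (1 / 4)" using Suc by simp
    finally show ?case by simp
  qed (use step[of K] in simp)
  have sa: "a sums cosh u" unfolding a_def by (rule cosh_even_sums)
  have t1: "(\<lambda>m. a (m + Suc K)) sums (cosh u - (\<Sum>n<Suc K. a n))" using sa sums_split_initial_segment by blast
  have t2: "(\<lambda>m. a K * ((1 / 4) ^ m * (1 / 4))) sums (a K * (1 / (1 - 1 / 4) * (1 / 4)))"
    by (intro sums_mult sums_mult2 geometric_sums) auto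
  have "cosh u - (\<Sum>n<Suc K. a n) \<le> a K * (1 / (1 - 1 / 4) * (1 / 4))"
    by (rule sums_le[OF _ t1 t2]) (use tail in \<open>simp add: mult.commute\<close>)
  also have "\<dots> \<le> a K" using a0[of K] by simp
  also have "a K \<le> (\<Sum>n<Suc K. a n)" using a0 by (intro member_le_sum) auto
  finally have "cosh u \<le> 2 * (\<Sum>n\<le>K. a n)" by (simp add: lessThan_Suc_atMost)
  moreover have "exp u \<le> 2 * cosh u" by (simp add: cosh_field_def)
  ultimately show ?thesis by (simp add: a_def)
qed

lemma log_cube_small: "(\<lambda>N. (ln (real N) + 1) ^ 3 / real N) \<longlonglongrightarrow> 0"
  by real_asymp

lemma convex_on_power: "convex_on {0::real..} (\<lambda>x. x ^ k)"
  by (cases "even k") (auto intro: convex_on_subset[OF convex_power_even] convex_power_odd)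

lemma power_average_le:
  assumes "\<And>i. i < N \<Longrightarrow> 0 \<le> z i" "1 \<le> N"
  shows "((1 / real N) * (\<Sum>i<N. z i)) ^ k \<le> (1 / real N) * (\<Sum>i<N. z i ^ k)"
proof -
  have "(\<Sum>i<N. (1 / real N) *\<^sub>R z i) ^ k \<le> (\<Sum>i<N. (1 / real N) * z i ^ k)"
    by (rule convex_on_sum[OF _ _ convex_on_power]) (use assms in \<open>auto simp: lessThan_empty_iff\<close>)
  then show ?thesis by (simp add: sum_distrib_left)
qed

lemma exp_le_one_plus_double: "0 \<le> s \<Longrightarrow> s \<le> 1 \<Longrightarrow> exp s \<le> 1 + 2 * (s::real)"
  using exp_bound[of s] mult_left_mono[of s 1 s] by (simp add: power2_eq_square)

context prob_space
begin

text \<open>Convexity reduces the double average to a row \<open>z i\<close>, for which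
  \<open>(z i / \<eta>) ^ k \<le> exp (k * z i / \<eta>)\<close>. Given \<open>x i\<close>, the
  terms of a row are independent, and the assumption on \<open>k\<close> keeps each exponent at most
  \<open>1\<close>, so each factor has mean at most \<open>1 + 2 * k / N\<close>; together they give
  \<open>exp (2 * k)\<close>.\<close>

lemma average_moment:
  fixes Y :: "'a \<Rightarrow> 'a \<Rightarrow> real"
  assumes Ym: "(\<lambda>z. Y (fst z) (snd z)) \<in> borel_measurable (M \<Otimes>\<^sub>M M)"
    and Y: "\<And>x y. x \<in> space M \<Longrightarrow> y \<in> space M \<Longrightarrow> 0 \<le> Y x y \<and> Y x y \<le> Ymax"
    and Yint: "\<And>x. x \<in> space M \<Longrightarrow> (\<integral>\<^sup>+y. ennreal (Y x y) \<partial>M) \<le> ennreal \<eta>"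
    and \<eta>: "0 < \<eta>" and N: "1 \<le> N" and k: "real k * Ymax \<le> \<eta> * real N"
  shows "(\<integral>\<^sup>+x. ennreal (((1 / (real N)\<^sup>2) * (\<Sum>i<N. \<Sum>j\<in>{..<N} - {i}. Y (x i) (x j))) ^ k) \<partial>PiM {..<N} (\<lambda>_. M))
     \<le> ennreal ((exp 2 * \<eta>) ^ k)"
proof -
  interpret P: product_sigma_finite "\<lambda>_. M" by standard
  define c where "c = real k / (real N * \<eta>)"
  have c: "0 \<le> c" using \<eta> by (simp add: c_def)
  have xD: "x i \<in> space M" if "x \<in> space (PiM {..<N} (\<lambda>_. M))" "i < N" for x i
    using that by (auto simp: space_PiM PiE_iff)
  have comp: "(\<lambda>x. Y (x i) (x j)) \<in> borel_measurable (PiM I (\<lambda>_. M))" if "i \<in> I" "j \<in> I" for i j I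
  proof -
    have "(\<lambda>x. (x i, x j)) \<in> PiM I (\<lambda>_. M) \<rightarrow>\<^sub>M M \<Otimes>\<^sub>M M"
      using that by (intro measurable_Pair measurable_component_singleton) auto
    from measurable_compose[OF this Ym] show ?thesis by simp
  qed
  define E where "E i x = (\<Prod>j\<in>{..<N} - {i}. ennreal (exp (c * Y (x i) (x j))))" for i x
  have Em: "E i \<in> borel_measurable (PiM {..<N} (\<lambda>_. M))" if "i < N" for i
    unfolding E_def using that
    by (intro borel_measurable_prod_ennreal measurable_compose[OF _ measurable_ennreal]
        measurable_compose[OF _ borel_measurable_exp] borel_measurable_times borel_measurable_const comp) auto
  have EI: "(\<integral>\<^sup>+x. E i x \<partial>PiM {..<N} (\<lambda>_. M)) \<le> ennreal (exp (2 * real k))" if i: "i < N" for i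
  proof -
    define J where "J = {..<N} - {i}"
    have J: "{..<N} = insert i J" "finite J" "i \<notin> J" using i by (auto simp: J_def)
    have one: "(\<integral>\<^sup>+u. ennreal (exp (c * Y y u)) \<partial>M) \<le> ennreal (1 + 2 * real k / real N)" if y: "y \<in> space M" for y
    proof -
      have ym: "(\<lambda>u. Y y u) \<in> borel_measurable M" using measurable_compose[OF measurable_Pair1'[OF y] Ym] by simp
      have "(\<integral>\<^sup>+u. ennreal (exp (c * Y y u)) \<partial>M) \<le> (\<integral>\<^sup>+u. 1 + ennreal (2 * c) * ennreal (Y y u) \<partial>M)"
      proof (rule nn_integral_mono)
        fix u assume u: "u \<in> space M"
        have "c * Y y u \<le> c * Ymax" using Y[OF y u] c by (intro mult_left_mono) auto
        also have "\<dots> \<le> 1" using k N \<eta> by (simp add: c_def divide_le_eq mult.commute)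
        finally have "exp (c * Y y u) \<le> 1 + 2 * (c * Y y u)"
          using Y[OF y u] c by (intro exp_le_one_plus_double) auto
        then have "ennreal (exp (c * Y y u)) \<le> ennreal (1 + (2 * c) * Y y u)" by (intro ennreal_leI) (simp add: mult.assoc)
        also have "\<dots> = 1 + ennreal (2 * c) * ennreal (Y y u)"
          using Y[OF y u] c by (simp add: ennreal_plus ennreal_mult)
        finally show "ennreal (exp (c * Y y u)) \<le> 1 + ennreal (2 * c) * ennreal (Y y u)" .
      qed
      also have "\<dots> = 1 + ennreal (2 * c) * (\<integral>\<^sup>+u. ennreal (Y y u) \<partial>M)"
        using ym by (subst nn_integral_add) (auto simp: emeasure_space_1 nn_integral_cmult)
      also have "\<dots> \<le> 1 + ennreal (2 * c) * ennreal \<eta>" by (intro add_left_mono mult_left_mono Yint y) auto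
      also have "\<dots> = ennreal (1 + 2 * c * \<eta>)" using c \<eta> by (simp add: ennreal_plus ennreal_mult)
      also have "2 * c * \<eta> = 2 * real k / real N" using \<eta> by (simp add: c_def)
      finally show ?thesis .
    qed
    have upd: "E i (x(i := y)) = (\<Prod>j\<in>J. ennreal (exp (c * Y y (x j))))" for x y
      unfolding E_def J_def[symmetric] using J(3) by (intro prod.cong refl) auto
    have "(\<integral>\<^sup>+x. E i x \<partial>PiM {..<N} (\<lambda>_. M)) = (\<integral>\<^sup>+y. (\<integral>\<^sup>+x. E i (x(i := y)) \<partial>PiM J (\<lambda>_. M)) \<partial>M)"
      using Em[OF i] unfolding J(1) by (rule P.product_nn_integral_insert_rev[OF J(2,3)])
    also have "\<dots> \<le> (\<integral>\<^sup>+y. ennreal (exp (2 * real k)) \<partial>M)"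
    proof (rule nn_integral_mono)
      fix y assume y: "y \<in> space M"
      have ym: "(\<lambda>u. Y y u) \<in> borel_measurable M" using measurable_compose[OF measurable_Pair1'[OF y] Ym] by simp
      have "(\<integral>\<^sup>+x. E i (x(i := y)) \<partial>PiM J (\<lambda>_. M)) = (\<Prod>j\<in>J. \<integral>\<^sup>+u. ennreal (exp (c * Y y u)) \<partial>M)"
        unfolding upd using ym by (intro P.product_nn_integral_prod J(2)) auto
      also have "\<dots> \<le> (\<Prod>j\<in>J. ennreal (1 + 2 * real k / real N))" by (intro prod_mono_ennreal one y)
      also have "\<dots> = ennreal ((1 + 2 * real k / real N) ^ card J)"
        by (simp only: prod_constant) (rule ennreal_power, simp)
      also have "\<dots> \<le> ennreal (exp (2 * real k))"
      proof (rule ennreal_leI)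
        have "(1 + 2 * real k / real N) ^ card J \<le> (1 + 2 * real k / real N) ^ N"
          by (rule power_increasing) (auto simp: J_def card_Diff_subset i)
        also have "\<dots> \<le> exp (2 * real k / real N) ^ N" by (intro power_mono exp_ge_add_one_self) auto
        also have "\<dots> = exp (2 * real k)" using N by (simp flip: exp_of_nat_mult)
        finally show "(1 + 2 * real k / real N) ^ card J \<le> exp (2 * real k)" .
      qed
      finally show "(\<integral>\<^sup>+x. E i (x(i := y)) \<partial>PiM J (\<lambda>_. M)) \<le> ennreal (exp (2 * real k))" .
    qed
    finally show ?thesis by (simp add: emeasure_space_1)
  qed
  have "(\<integral>\<^sup>+x. ennreal (((1 / (real N)\<^sup>2) * (\<Sum>i<N. \<Sum>j\<in>{..<N} - {i}. Y (x i) (x j))) ^ k) \<partial>PiM {..<N} (\<lambda>_. M))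
     \<le> (\<integral>\<^sup>+x. ennreal (\<eta> ^ k / real N) * (\<Sum>i<N. E i x) \<partial>PiM {..<N} (\<lambda>_. M))"
  proof (rule nn_integral_mono)
    fix x assume x: "x \<in> space (PiM {..<N} (\<lambda>_. M))"
    define z where "z i = (1 / real N) * (\<Sum>j\<in>{..<N} - {i}. Y (x i) (x j))" for i
    have z0: "0 \<le> z i" if "i < N" for i
      unfolding z_def using Y xD[OF x] that by (intro mult_nonneg_nonneg sum_nonneg) auto
    have zk: "z i ^ k \<le> \<eta> ^ k * (\<Prod>j\<in>{..<N} - {i}. exp (c * Y (x i) (x j)))" if i: "i < N" for i
    proof -
      have "z i / \<eta> \<le> exp (z i / \<eta>)" using exp_ge_add_one_self[of "z i / \<eta>"] by linarith
      then have "(z i / \<eta>) ^ k \<le> exp (z i / \<eta>) ^ k" using z0[OF i] \<eta> by (intro power_mono) auto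
      also have "\<dots> = exp (real k * (z i / \<eta>))" by (simp flip: exp_of_nat_mult)
      also have "real k * (z i / \<eta>) = (\<Sum>j\<in>{..<N} - {i}. c * Y (x i) (x j))"
        by (simp add: z_def c_def sum_distrib_left sum_divide_distrib mult_ac)
      also have "exp \<dots> = (\<Prod>j\<in>{..<N} - {i}. exp (c * Y (x i) (x j)))" by (simp add: exp_sum)
      finally show ?thesis using \<eta> by (simp add: power_divide divide_le_eq mult.commute)
    qed
    have "(1 / (real N)\<^sup>2) * (\<Sum>i<N. \<Sum>j\<in>{..<N} - {i}. Y (x i) (x j)) = (1 / real N) * (\<Sum>i<N. z i)"
      by (simp add: z_def power2_eq_square flip: sum_divide_distrib)
    then have "((1 / (real N)\<^sup>2) * (\<Sum>i<N. \<Sum>j\<in>{..<N} - {i}. Y (x i) (x j))) ^ k \<le> (1 / real N) * (\<Sum>i<N. z i ^ k)"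
      using power_average_le[of N z k] z0 N by simp
    also have "\<dots> \<le> (1 / real N) * (\<Sum>i<N. \<eta> ^ k * (\<Prod>j\<in>{..<N} - {i}. exp (c * Y (x i) (x j))))"
      using zk by (intro mult_left_mono sum_mono) auto
    also have "\<dots> = \<eta> ^ k / real N * (\<Sum>i<N. \<Prod>j\<in>{..<N} - {i}. exp (c * Y (x i) (x j)))"
      by (simp flip: sum_distrib_left)
    finally have "ennreal (((1 / (real N)\<^sup>2) * (\<Sum>i<N. \<Sum>j\<in>{..<N} - {i}. Y (x i) (x j))) ^ k)
       \<le> ennreal (\<eta> ^ k / real N * (\<Sum>i<N. \<Prod>j\<in>{..<N} - {i}. exp (c * Y (x i) (x j))))" by (rule ennreal_leI)
    also have "\<dots> = ennreal (\<eta> ^ k / real N) * (\<Sum>i<N. E i x)"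
    proof -
      have "(\<Sum>i<N. E i x) = ennreal (\<Sum>i<N. \<Prod>j\<in>{..<N} - {i}. exp (c * Y (x i) (x j)))"
        unfolding E_def by (simp add: prod_ennreal sum_ennreal prod_nonneg)
      then show ?thesis using \<eta> by (simp only:) (rule ennreal_mult, auto intro!: sum_nonneg prod_nonneg)
    qed
    finally show "ennreal (((1 / (real N)\<^sup>2) * (\<Sum>i<N. \<Sum>j\<in>{..<N} - {i}. Y (x i) (x j))) ^ k)
       \<le> ennreal (\<eta> ^ k / real N) * (\<Sum>i<N. E i x)" .
  qed
  also have "\<dots> = ennreal (\<eta> ^ k / real N) * (\<Sum>i<N. \<integral>\<^sup>+x. E i x \<partial>PiM {..<N} (\<lambda>_. M))"
    using Em by (subst nn_integral_cmult, intro borel_measurable_sum, simp, subst nn_integral_sum) auto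
  also have "\<dots> \<le> ennreal (\<eta> ^ k / real N) * (\<Sum>i<N. ennreal (exp (2 * real k)))"
    using EI by (intro mult_left_mono sum_mono) auto
  also have "\<dots> = ennreal (\<eta> ^ k / real N * (real N * exp (2 * real k)))"
    using \<eta> by (subst sum_ennreal, simp, subst ennreal_mult[symmetric]) auto
  also have "\<eta> ^ k / real N * (real N * exp (2 * real k)) = (exp 2 * \<eta>) ^ k"
    using N by (simp add: power_mult_distrib flip: exp_of_nat_mult)
  finally show ?thesis .
qed

text \<open>The factorial of the chaos moment and the powers of \<open>N\<close> cancel, so the
  bound is geometric in \<open>k\<close>: for small \<open>\<eta>\<close> the even part of the
  exponential series is summable, up to the order permitted by
  \<open>k * B\<^sup>2 \<le> \<eta> * N\<close>.\<close>

lemma canonical_pairsum_moment: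
  fixes w :: "'a \<Rightarrow> 'a \<Rightarrow> real"
  assumes wm: "(\<lambda>p. w (fst p) (snd p)) \<in> borel_measurable (M \<Otimes>\<^sub>M M)"
    and wB: "\<And>x y. x \<in> space M \<Longrightarrow> y \<in> space M \<Longrightarrow> \<bar>w x y\<bar> \<le> B"
    and wsym: "\<And>x y. w x y = w y x"
    and w0: "\<And>x. x \<in> space M \<Longrightarrow> (\<integral>y. w x y \<partial>M) = 0"
    and xi: "\<And>i. i < N \<Longrightarrow> \<xi> i \<in> {1, -1}"
    and wint: "\<And>x. x \<in> space M \<Longrightarrow> (\<integral>\<^sup>+y. ennreal ((w x y)\<^sup>2) \<partial>M) \<le> ennreal \<eta>"
    and \<eta>: "0 < \<eta>" and N: "1 \<le> N" and k: "real k * B\<^sup>2 \<le> \<eta> * real N"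
  shows "(\<integral>x. (c / real N * pairsum N \<xi> w x) ^ (2 * k) / fact (2 * k) \<partial>PiM {..<N} (\<lambda>_. M))
     \<le> 2 * (64 * c\<^sup>2 * (exp 2 * \<eta>)) ^ k"
proof -
  define S where "S x = (\<Sum>i<N. \<Sum>j\<in>{..<N} - {i}. (w (x i) (x j))\<^sup>2)" for x
  have Sm[measurable]: "S \<in> borel_measurable (PiM {..<N} (\<lambda>_. M))"
    unfolding S_def
    by (intro borel_measurable_sum borel_measurable_power measurable_kernel_component[OF wm wB wsym]) auto
  have S0: "0 \<le> S x" for x by (simp add: S_def sum_nonneg)
  have w2: "0 \<le> (w x y)\<^sup>2 \<and> (w x y)\<^sup>2 \<le> B\<^sup>2" if "x \<in> space M" "y \<in> space M" for x y
    using wB[OF that] by (simp add: abs_le_square_iff[symmetric])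
  have avg: "(\<integral>\<^sup>+x. ennreal (((1 / (real N)\<^sup>2) * S x) ^ k) \<partial>PiM {..<N} (\<lambda>_. M)) \<le> ennreal ((exp 2 * \<eta>) ^ k)"
    unfolding S_def
    by (rule average_moment[OF _ w2 wint \<eta> N k]) (use wm in auto)
  have "(\<integral>x. ((1 / (real N)\<^sup>2) * S x) ^ k \<partial>PiM {..<N} (\<lambda>_. M)) \<le> (exp 2 * \<eta>) ^ k"
    using avg \<eta> S0 by (subst integral_eq_nn_integral) (auto intro!: enn2real_leI)
  then have avg': "(\<integral>x. (64 * S x) ^ k \<partial>PiM {..<N} (\<lambda>_. M)) \<le> (64 * (real N)\<^sup>2) ^ k * (exp 2 * \<eta>) ^ k"
  proof -
    have "(64 * S x) ^ k = (64 * (real N)\<^sup>2) ^ k * ((1 / (real N)\<^sup>2) * S x) ^ k" for x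
      using N by (subst power_mult_distrib[symmetric]) simp
    then have "(\<integral>x. (64 * S x) ^ k \<partial>PiM {..<N} (\<lambda>_. M)) = (64 * (real N)\<^sup>2) ^ k * (\<integral>x. ((1 / (real N)\<^sup>2) * S x) ^ k \<partial>PiM {..<N} (\<lambda>_. M))"
      by simp
    then show ?thesis using \<open>_ \<le> (exp 2 * \<eta>) ^ k\<close> by (simp add: mult_left_mono)
  qed
  have "(\<integral>x. (c / real N * pairsum N \<xi> w x) ^ (2 * k) / fact (2 * k) \<partial>PiM {..<N} (\<lambda>_. M))
     = (c / real N) ^ (2 * k) / fact (2 * k) * (\<integral>x. pairsum N \<xi> w x ^ (2 * k) \<partial>PiM {..<N} (\<lambda>_. M))"
  proof -
    have "(c / real N * pairsum N \<xi> w x) ^ (2 * k) / fact (2 * k) =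
        (c / real N) ^ (2 * k) / fact (2 * k) * pairsum N \<xi> w x ^ (2 * k)" for x
      unfolding power_mult_distrib by simp
    then show ?thesis by (simp only: integral_mult_right_zero)
  qed
  also have "\<dots> \<le> (c / real N) ^ (2 * k) / fact (2 * k) * (2 * fact (2 * k) * (\<integral>x. (64 * S x) ^ k \<partial>PiM {..<N} (\<lambda>_. M)))"
    using pairsum_moment[OF wm wB wsym w0 xi, where k = k] unfolding S_def
    by (intro mult_left_mono) (auto simp: zero_le_even_power)
  also have "\<dots> \<le> (c / real N) ^ (2 * k) / fact (2 * k) * (2 * fact (2 * k) * ((64 * (real N)\<^sup>2) ^ k * (exp 2 * \<eta>) ^ k))"
    using avg' by (intro mult_left_mono) (auto simp: zero_le_even_power)
  also have "\<dots> = 2 * (64 * c\<^sup>2 * (exp 2 * \<eta>)) ^ k"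
    using N by (simp add: power_mult power_divide power_mult_distrib)
  finally show ?thesis .
qed

end

section \<open>Bounds uniform in the number of particles\<close>

context vortex_domain
begin

text \<open>The cutoff \<open>\<theta> = 1 / N ^ 8\<close> is so short that near neighbours are
  rare: \<open>v\<close> carries a factor \<open>1 / N\<^sup>2\<close>, and with
  \<open>\<eta> = 1 / N\<^sup>2\<close> the constant per particle is \<open>1 + O(1 / N)\<close>.
  The price is \<open>(N / \<theta>) powr (k / 2) = N powr (9 * k / 2)\<close> per particle, where
  \<open>k * N = c\<close>.\<close>

lemma polynomial_bound:
  assumes c: "0 \<le> c"
  obtains C where "0 \<le> C" "\<And>N \<xi>. 1 \<le> N \<Longrightarrow> 2 * c \<le> real N \<Longrightarrow> (\<And>i. i < N \<Longrightarrow> \<xi> i \<in> {1, -1}) \<Longrightarrow>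
    (\<integral>\<^sup>+x. ennreal (exp (- (c / real N) * pairsum N \<xi> L x)) \<partial>P N) \<le> ennreal (C * real N powr (9 * c / 2))"
proof -
  obtain C2 where C2: "0 \<le> C2" "\<And>y. (\<integral>\<^sup>+x. ennreal (norm (x - y) powr (- 1)) \<partial>M) \<le> ennreal C2"
    by (rule nn_integral_norm_powr[of 1]) auto
  define C where "C = exp (c / 2) * (exp 1 * exp (\<Delta> * C2))"
  have bound: "(\<integral>\<^sup>+x. ennreal (exp (- (c / real N) * pairsum N \<xi> L x)) \<partial>P N) \<le> ennreal (C * real N powr (9 * c / 2))"
    if N: "1 \<le> N" "2 * c \<le> real N" and xi: "\<And>i. i < N \<Longrightarrow> \<xi> i \<in> {1, -1}" for N \<xi>
  proof -
    define k where "k = c / real N"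
    have k: "0 \<le> k" "k / 2 \<le> 1 / 4" using c N by (auto simp: k_def field_simps)
    define \<theta> where "\<theta> = 1 / real N ^ 8"
    have \<theta>: "0 < \<theta>" "\<theta> \<le> 1" using N by (auto simp: \<theta>_def)
    define v where "v x y = sqrt \<Delta> / (real N)\<^sup>2 * norm (x - y) powr (- (1 / 2))" for x y :: "real^2"
    have vm: "(\<lambda>z. v (fst z) (snd z)) \<in> borel_measurable (M \<Otimes>\<^sub>M M)" unfolding v_def by measurable
    have v0: "0 \<le> v x y" for x y using \<Delta> by (simp add: v_def)
    have vI: "(\<integral>\<^sup>+x. ennreal ((v x y)\<^sup>2) \<partial>M) \<le> ennreal (\<Delta> * C2 / real N ^ 4)" for y
    proof -
      have "(\<integral>\<^sup>+x. ennreal ((v x y)\<^sup>2) \<partial>M) = (\<integral>\<^sup>+x. ennreal (\<Delta> / real N ^ 4) * ennreal (norm (x - y) powr (- 1)) \<partial>M)"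
      proof (rule nn_integral_cong)
        fix x
        have "(norm (x - y) powr (- (1 / 2)))\<^sup>2 = norm (x - y) powr (- 1)"
          unfolding power2_eq_square by (subst powr_add[symmetric]) simp
        then have "(v x y)\<^sup>2 = \<Delta> / real N ^ 4 * norm (x - y) powr (- 1)"
          using \<Delta> by (simp add: v_def power_mult_distrib power_divide)
        then show "ennreal ((v x y)\<^sup>2) = ennreal (\<Delta> / real N ^ 4) * ennreal (norm (x - y) powr (- 1))"
          using \<Delta> by (simp only:) (rule ennreal_mult, auto)
      qed
      also have "\<dots> = ennreal (\<Delta> / real N ^ 4) * (\<integral>\<^sup>+x. ennreal (norm (x - y) powr (- 1)) \<partial>M)"
        by (rule nn_integral_cmult) measurable
      also have "\<dots> \<le> ennreal (\<Delta> / real N ^ 4) * ennreal C2" by (intro mult_left_mono C2) auto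
      also have "\<dots> = ennreal (\<Delta> * C2 / real N ^ 4)" using \<Delta> C2 by (subst ennreal_mult[symmetric]) auto
      finally show ?thesis .
    qed
    define B where "B = (1 + real N * (1 / (real N)\<^sup>2)) * (1 + real N * (\<Delta> * C2 / real N ^ 4) / (1 / (real N)\<^sup>2))"
    let ?nbr = "\<lambda>x i. (1 + (\<Sum>j<i. v (x i) (x j))) * (1 + (\<Sum>j\<in>{i<..<N}. v (x i) (x j)))"
    have prod: "(\<integral>\<^sup>+x. (\<Prod>i<N. ennreal (?nbr x i)) \<partial>P N)
       \<le> ennreal (B ^ N)"
      unfolding B_def
      by (rule nn_integral_neighbour_product[OF borel_measurable_const vm _ v0 _ vI])
         (use C2 \<Delta> N in \<open>auto simp: emeasure_space_1\<close>)
    have Be: "B = (1 + 1 / real N) * (1 + \<Delta> * C2 / real N)"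
      using N by (simp add: B_def power2_eq_square power4_eq_xxxx)
    have BN: "B ^ N \<le> exp 1 * exp (\<Delta> * C2)"
    proof -
      have "(1 + 1 / real N) ^ N \<le> exp (1 / real N) ^ N" by (intro power_mono exp_ge_add_one_self) auto
      moreover have "exp (1 / real N) ^ N = exp 1" using N by (simp flip: exp_of_nat_mult)
      moreover have "(1 + \<Delta> * C2 / real N) ^ N \<le> exp (\<Delta> * C2 / real N) ^ N"
        using \<Delta> C2 by (intro power_mono exp_ge_add_one_self) auto
      moreover have "exp (\<Delta> * C2 / real N) ^ N = exp (\<Delta> * C2)" using N by (simp flip: exp_of_nat_mult)
      ultimately show ?thesis unfolding Be power_mult_distrib using \<Delta> C2 by (intro mult_mono) auto
    qed
    define c' where "c' = exp (c / 2) * real N powr (9 * c / 2)"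
    have "(\<integral>\<^sup>+x. ennreal (exp (- k * pairsum N \<xi> L x)) \<partial>P N)
      \<le> (\<integral>\<^sup>+x. ennreal c' * (\<Prod>i<N. ennreal (?nbr x i)) \<partial>P N)"
    proof (rule nn_integral_mono_AE)
      show "AE x in P N. ennreal (exp (- k * pairsum N \<xi> L x))
        \<le> ennreal c' * (\<Prod>i<N. ennreal (?nbr x i))"
        using AE_distinct[of N] AE_space
      proof eventually_elim
        case (elim x)
        then have x: "\<And>i. i < N \<Longrightarrow> x i \<in> D" and dis: "\<And>i j. i < N \<Longrightarrow> j < N \<Longrightarrow> i \<noteq> j \<Longrightarrow> x i \<noteq> x j"
          using space_P_D by auto
        define G where "G i = (1 + (\<Sum>j<i. v (x i) (x j))) * (1 + (\<Sum>j\<in>{i<..<N}. v (x i) (x j)))" for i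
        have s0: "0 \<le> (\<Sum>j<i. v (x i) (x j))" "0 \<le> (\<Sum>j\<in>{i<..<N}. v (x i) (x j))" for i
          by (auto intro: sum_nonneg v0)
        have G0: "0 \<le> G i" for i unfolding G_def using s0[of i] by (intro mult_nonneg_nonneg) auto
        have G1: "1 \<le> G i" for i unfolding G_def using s0[of i] by (intro mult_ge1_I) auto
        have each: "(real N / nnsq N \<theta> x i) powr (k / 2) \<le> real N powr (9 * k / 2) * G i" if i: "i < N" for i
        proof -
          have pos: "0 < nnsq N \<theta> x i" by (rule pairsum_L_ge(2)[OF x dis xi \<theta> N(1) i])
          have le: "nnsq N \<theta> x i \<le> \<theta>" unfolding nnsq_def by (rule Min_le) auto
          have "(\<theta> / nnsq N \<theta> x i) powr (k / 2) \<le> G i"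
            using nnsq_cases[of N \<theta> x i]
          proof (elim disjE exE conjE)
            assume "nnsq N \<theta> x i = \<theta>"
            then show ?thesis using \<theta> G1[of i] by simp
          next
            fix j assume j: "j < N" "j \<noteq> i" "nnsq N \<theta> x i = 1 - T (x i) (x j)"
            define r where "r = norm (x i - x j)"
            have r: "0 < r" using dis[OF i j(1)] j by (simp add: r_def)
            have tb: "r\<^sup>2 \<le> \<Delta>\<^sup>2 * nnsq N \<theta> x i"
              unfolding j(3) r_def by (rule T_lower) (use x i j in auto)
            have "1 \<le> \<theta> / nnsq N \<theta> x i" using le pos by simp
            \<comment> \<open>The base is at least \<open>1\<close>, and
              \<open>2 * c \<le> N\<close> gives \<open>k / 2 \<le> 1 / 4\<close>, so the exponent
              may be raised to one not depending on \<open>N\<close>; \<open>1 / 4\<close> leaves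
              the distance to the power \<open>- 1 / 2\<close>, whose square is integrable.\<close>
            then have "(\<theta> / nnsq N \<theta> x i) powr (k / 2) \<le> (\<theta> / nnsq N \<theta> x i) powr (1 / 4)"
              using k by (intro powr_mono) auto
            also have "\<dots> \<le> (\<theta> * (\<Delta>\<^sup>2 / r\<^sup>2)) powr (1 / 4)"
              using tb pos r \<theta> by (intro powr_mono2) (auto simp: field_simps)
            also have "\<dots> = v (x i) (x j)"
            proof -
              define y where "y = 1 / (real N)\<^sup>2 * \<Delta> powr (1 / 2) * r powr (- (1 / 2))"
              have "(\<Delta> powr (1 / 2)) ^ 4 = \<Delta>\<^sup>2" using \<Delta> by (simp add: powr_power)
              moreover have "(r powr (- (1 / 2))) ^ 4 = 1 / r\<^sup>2" using r by (subst powr_power) (auto simp: powr_minus_divide)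
              moreover have "(1 / (real N)\<^sup>2) ^ 4 = \<theta>" by (simp add: \<theta>_def power_divide flip: power_mult)
              ultimately have "\<theta> * (\<Delta>\<^sup>2 / r\<^sup>2) = y ^ 4" unfolding y_def power_mult_distrib by simp
              moreover have "(y ^ 4) powr (1 / 4) = y"
              proof -
                have "0 < y" using r \<Delta> N by (simp add: y_def)
                then show ?thesis using powr_powr[of y 4 "1 / 4"] by simp
              qed
              ultimately have "(\<theta> * (\<Delta>\<^sup>2 / r\<^sup>2)) powr (1 / 4) = y" by simp
              then show ?thesis using \<Delta> by (simp add: v_def r_def y_def powr_half_sqrt)
            qed
            also have "\<dots> \<le> G i"
            proof -
              have "v (x i) (x j) + 1 * 1 \<le> G i"
                unfolding G_def by (rule neighbour_product_ge(2)[OF order_refl _ j(1,2)]) (rule v0)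
              then show ?thesis by simp
            qed
            finally show ?thesis .
          qed
          then have "(real N ^ 9) powr (k / 2) * (\<theta> / nnsq N \<theta> x i) powr (k / 2) \<le> (real N ^ 9) powr (k / 2) * G i"
            by (rule mult_left_mono) simp
          moreover have "(real N ^ 9) powr (k / 2) * (\<theta> / nnsq N \<theta> x i) powr (k / 2) = (real N / nnsq N \<theta> x i) powr (k / 2)"
            using pos \<theta> N by (subst powr_mult[symmetric]) (auto simp: \<theta>_def eval_nat_numeral)
          moreover have "(real N ^ 9) powr (k / 2) = real N powr (9 * k / 2)"
            using N by (simp add: powr_powr flip: powr_numeral)
          ultimately show ?thesis by simp
        qed
        have "exp (- k * pairsum N \<xi> L x) \<le> exp (k * real N / 2) * (\<Prod>i<N. (real N / nnsq N \<theta> x i) powr (k / 2))"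
          by (rule exp_pairsum_L_le[OF x dis xi \<theta> N(1) k(1)])
        also have "\<dots> \<le> exp (k * real N / 2) * (\<Prod>i<N. real N powr (9 * k / 2) * G i)"
          by (intro mult_left_mono prod_mono) (use each in auto)
        also have "\<dots> = c' * (\<Prod>i<N. G i)"
          using N by (simp add: c'_def prod.distrib k_def powr_power)
        finally have "ennreal (exp (- k * pairsum N \<xi> L x)) \<le> ennreal (c' * (\<Prod>i<N. G i))"
          by (rule ennreal_leI)
        also have "\<dots> = ennreal c' * (\<Prod>i<N. ennreal (G i))"
          using G0 by (simp add: ennreal_mult prod_nonneg prod_ennreal c'_def)
        finally show ?case unfolding G_def .
      qed
    qed
    also have "\<dots> = ennreal c' * (\<integral>\<^sup>+x. (\<Prod>i<N. ennreal (?nbr x i)) \<partial>P N)"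
    proof (rule nn_integral_cmult)
      show "(\<lambda>x. \<Prod>i<N. ennreal (?nbr x i)) \<in> borel_measurable (P N)"
        by (intro borel_measurable_prod_ennreal measurable_compose[OF _ measurable_ennreal] borel_measurable_times
            borel_measurable_add borel_measurable_sum borel_measurable_const measurable_pair_P[OF vm]) auto
    qed
    also have "\<dots> \<le> ennreal c' * ennreal (B ^ N)" by (intro mult_left_mono prod) auto
    also have "\<dots> \<le> ennreal c' * ennreal (exp 1 * exp (\<Delta> * C2))" by (intro mult_left_mono ennreal_leI BN) auto
    also have "\<dots> = ennreal (C * real N powr (9 * c / 2))"
      by (subst ennreal_mult[symmetric]) (auto simp: c'_def C_def mult_ac)
    finally show ?thesis by (simp add: k_def)
  qed
  show thesis by (rule that[OF _ bound]) (auto simp: C_def)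
qed

text \<open>The part of \<open>L\<close> that is lost when \<open>T\<close> is damped to
  \<open>l * T\<close>. It concentrates at short distances as \<open>l\<close> tends to
  \<open>1\<close>, and on \<open>D\<close> the case \<open>l = 0\<close> is \<open>L\<close>
  itself.\<close>

definition R :: "real \<Rightarrow> real^2 \<Rightarrow> real^2 \<Rightarrow> real" where
  "R l x y = ln ((1 - l * T x y) / (1 - T x y))"

lemma R_sym: "R l x y = R l y x" by (simp add: R_def T_sym)

lemma R_meas: "(\<lambda>z. R l (fst z) (snd z)) \<in> borel_measurable (M \<Otimes>\<^sub>M M)"
  unfolding R_def using T_meas by measurable

lemma R_diag: "x \<in> D \<Longrightarrow> R l x x = 0" by (simp add: R_def T_diag)

lemma R_bounds:
  assumes l: "0 \<le> l" "l < 1" and x: "x \<in> D" "y \<in> D"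
  shows "0 \<le> R l x y" "(R l x y)\<^sup>2 \<le> 16 * sqrt (1 - l) * \<Delta> * norm (x - y) powr (- 1)"
    and "x \<noteq> y \<Longrightarrow> R l x y \<le> - ln (1 - T x y)"
    and "x \<noteq> y \<Longrightarrow> L x y = - ln (1 - l * T x y) + R l x y"
proof -
  have lT: "0 < 1 - l * T x y"
    using T_le1[OF x] l mult_left_le[of "T x y" l] by (smt (verit))
  have *: "0 \<le> R l x y \<and> (R l x y)\<^sup>2 \<le> 16 * sqrt (1 - l) * \<Delta> * norm (x - y) powr (- 1) \<and> R l x y \<le> - ln (1 - T x y)
     \<and> L x y = - ln (1 - l * T x y) + R l x y"
    if xy: "x \<noteq> y"
  proof -
    have t: "0 \<le> T x y" "T x y < 1" using T_range[OF x xy] by auto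
    define r where "r = norm (x - y)"
    have r: "0 < r" using xy by (simp add: r_def)
    define u where "u = (1 - l) * T x y / (1 - T x y)"
    have u0: "0 \<le> u" using t l by (simp add: u_def)
    have R: "R l x y = ln (1 + u)" unfolding R_def u_def using t by (intro arg_cong[where f=ln]) (simp add: field_simps)
    have "u \<le> (1 - l) / (1 - T x y)" unfolding u_def using t l by (intro divide_right_mono) (auto simp: mult_left_le)
    also have "\<dots> \<le> (1 - l) * (\<Delta>\<^sup>2 / r\<^sup>2)"
      using T_lower[OF x] t l r by (simp add: r_def divide_simps mult_left_mono mult_ac)
    finally have u1: "u \<le> (1 - l) * (\<Delta>\<^sup>2 / r\<^sup>2)" .
    have "R l x y \<le> 4 * u powr (1 / 4)" unfolding R by (rule ln_one_plus_le_root[OF u0])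
    moreover have R0: "0 \<le> R l x y" unfolding R using u0 by simp
    ultimately have "(R l x y)\<^sup>2 \<le> (4 * u powr (1 / 4))\<^sup>2" by (intro power_mono)
    also have "\<dots> = 16 * sqrt u"
    proof -
      have "(u powr (1 / 4))\<^sup>2 = u powr (1 / 2)" by (simp add: power2_eq_square flip: powr_add)
      then show ?thesis using u0 by (simp add: power_mult_distrib powr_half_sqrt)
    qed
    also have "\<dots> \<le> 16 * sqrt ((1 - l) * (\<Delta>\<^sup>2 / r\<^sup>2))" using u1 by simp
    also have "\<dots> = 16 * sqrt (1 - l) * \<Delta> * r powr (- 1)"
      using r \<Delta> l by (simp add: real_sqrt_mult real_sqrt_divide powr_minus_divide)
    finally have A: "(R l x y)\<^sup>2 \<le> 16 * sqrt (1 - l) * \<Delta> * r powr (- 1)" .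
    have e: "R l x y = ln (1 - l * T x y) - ln (1 - T x y)"
      unfolding R_def using lT t by (simp add: ln_div)
    have "ln (1 - l * T x y) \<le> 0" using lT l t by simp
    then show ?thesis using A R0 e by (simp add: r_def L_def)
  qed
  show "0 \<le> R l x y" "(R l x y)\<^sup>2 \<le> 16 * sqrt (1 - l) * \<Delta> * norm (x - y) powr (- 1)"
    using * R_diag[OF x(1)] by (cases "x = y"; simp)+
  show "x \<noteq> y \<Longrightarrow> R l x y \<le> - ln (1 - T x y)" "x \<noteq> y \<Longrightarrow> L x y = - ln (1 - l * T x y) + R l x y" using * by auto
qed

text \<open>The smallness is uniform in \<open>x\<close> because the moment bound conditions on one
  particle. By \<open>R_bounds\<close> the integral is of order \<open>sqrt (1 - l)\<close>, so
  \<open>l = 1 - s\<^sup>2\<close> with \<open>s\<close> proportional to \<open>\<sigma>\<close> is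
  small enough.\<close>

lemma small_kernel:
  assumes "0 < \<sigma>" "\<sigma> \<le> 1"
  obtains l where "0 \<le> l" "l < 1" "\<And>x. x \<in> D \<Longrightarrow> (\<integral>\<^sup>+y. ennreal ((R l x y)\<^sup>2) \<partial>M) \<le> ennreal \<sigma>"
proof -
  obtain C2 where C2: "0 \<le> C2" "\<And>y. (\<integral>\<^sup>+x. ennreal (norm (x - y) powr (- 1)) \<partial>M) \<le> ennreal C2"
    by (rule nn_integral_norm_powr[of 1]) auto
  define s where "s = \<sigma> / (16 * \<Delta> * C2 + 1)"
  have p: "1 \<le> 16 * \<Delta> * C2 + 1" using \<Delta> C2 by simp
  have p0: "0 < 16 * \<Delta> * C2 + 1" using p by linarith
  have s: "0 < s" "s \<le> 1"
  proof -
    show "0 < s" unfolding s_def using assms p0 by (intro divide_pos_pos)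
    have "\<sigma> \<le> 16 * \<Delta> * C2 + 1" using p assms by linarith
    then show "s \<le> 1" unfolding s_def using p0 by (simp only: divide_le_eq_1_pos)
  qed
  define l where "l = 1 - s\<^sup>2"
  have l: "0 \<le> l" "l < 1" "sqrt (1 - l) = s" using s by (auto simp: l_def power_le_one)
  show thesis
  proof (rule that[OF l(1,2)])
    fix x assume x: "x \<in> D"
    have "(\<integral>\<^sup>+y. ennreal ((R l x y)\<^sup>2) \<partial>M) \<le> (\<integral>\<^sup>+y. ennreal (16 * s * \<Delta>) * ennreal (norm (y - x) powr (- 1)) \<partial>M)"
    proof (rule nn_integral_mono)
      fix y assume "y \<in> space M"
      then have y: "y \<in> D" by (simp add: space_M)
      have "(R l x y)\<^sup>2 \<le> 16 * s * \<Delta> * norm (y - x) powr (- 1)"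
        using R_bounds(2)[OF l(1,2) x y] l(3) by (simp add: norm_minus_commute)
      then show "ennreal ((R l x y)\<^sup>2) \<le> ennreal (16 * s * \<Delta>) * ennreal (norm (y - x) powr (- 1))"
        using s \<Delta> by (subst ennreal_mult[symmetric]) (auto intro: ennreal_leI)
    qed
    also have "\<dots> = ennreal (16 * s * \<Delta>) * (\<integral>\<^sup>+y. ennreal (norm (y - x) powr (- 1)) \<partial>M)"
      by (rule nn_integral_cmult) measurable
    also have "\<dots> \<le> ennreal (16 * s * \<Delta>) * ennreal C2" by (intro mult_left_mono C2) auto
    also have "\<dots> = ennreal (16 * s * \<Delta> * C2)" using s \<Delta> C2 by (subst ennreal_mult[symmetric]) auto
    also have "\<dots> \<le> ennreal \<sigma>"
    proof (rule ennreal_leI)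
      have "16 * s * \<Delta> * C2 = \<sigma> * ((16 * \<Delta> * C2) / (16 * \<Delta> * C2 + 1))" by (simp add: s_def)
      also have "\<dots> \<le> \<sigma> * 1"
        by (rule mult_left_mono, unfold divide_le_eq_1_pos[OF p0]) (use assms in auto)
      finally show "16 * s * \<Delta> * C2 \<le> \<sigma>" by simp
    qed
    finally show "(\<integral>\<^sup>+y. ennreal ((R l x y)\<^sup>2) \<partial>M) \<le> ennreal \<sigma>" .
  qed
qed

definition good :: "nat \<Rightarrow> nat \<Rightarrow> (nat \<Rightarrow> real^2) set" where
  "good kp N = {x \<in> space (P N). \<forall>i<N. \<forall>j<N. i \<noteq> j \<longrightarrow> 1 \<le> real N ^ kp * (1 - T (x i) (x j))}"

lemma good_sets [measurable]: "good kp N \<in> sets (P N)"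
proof -
  have [measurable]: "(\<lambda>x. if i < N \<and> j < N then T (x i) (x j) else 0) \<in> borel_measurable (P N)" for i j
    using measurable_pair_P[OF T_meas, of i N j] by (cases "i < N \<and> j < N") auto
  have "good kp N = {x \<in> space (P N). \<forall>i\<in>{..<N}. \<forall>j\<in>{..<N}. i \<noteq> j \<longrightarrow> 1 \<le> real N ^ kp * (1 - (if i < N \<and> j < N then T (x i) (x j) else 0))}"
    unfolding good_def by auto
  also have "\<dots> \<in> sets (P N)" by measurable
  finally show ?thesis .
qed

text \<open>Split \<open>L = - ln (1 - l * T) + R l\<close>. The first part is bounded below pointwise. On \<open>good kp N\<close> the
  kernel \<open>R l\<close> is at most \<open>kp * ln N\<close>, and Onsager's inequality bounds the exponent of its weight by some
  \<open>K = O(ln N)\<close>, so that the exponential may be replaced by the moments of order at most \<open>2 * K\<close>.\<close>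

lemma good_bound:
  assumes c: "0 \<le> c"
  obtains C N0 where "0 \<le> C" "\<And>N \<xi>. N0 \<le> N \<Longrightarrow> (\<And>i. i < N \<Longrightarrow> \<xi> i \<in> {1, -1}) \<Longrightarrow> (\<Sum>i<N. \<xi> i) = 0 \<Longrightarrow>
    (\<integral>\<^sup>+x. indicator (good kp N) x * ennreal (exp (- (c / real N) * pairsum N \<xi> L x)) \<partial>P N) \<le> ennreal C"
proof -
  \<comment> \<open>As \<open>2048 = 2 * 64 * 16\<close>, the base
    \<open>64 * c\<^sup>2 * (exp 2 * (16 * \<sigma>))\<close> of the moment bound is at most
    \<open>1 / 2\<close>; the factor \<open>16\<close> is the loss from making the kernel
    degenerate.\<close>
  define \<sigma> where "\<sigma> = 1 / (1 + 2048 * c\<^sup>2 * exp 2)"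
  have den: "1 \<le> 1 + 2048 * c\<^sup>2 * exp 2" by simp
  have dpos: "0 < 1 + 2048 * c\<^sup>2 * exp 2" using den by linarith
  have \<sigma>: "0 < \<sigma>" "\<sigma> \<le> 1"
    unfolding \<sigma>_def using dpos den by (simp only: zero_less_divide_1_iff, simp only: divide_le_eq_1_pos)
  have small: "64 * c\<^sup>2 * (exp 2 * (16 * \<sigma>)) \<le> 1 / 2"
  proof -
    define d where "d = 1 + 2048 * c\<^sup>2 * exp 2"
    have "\<sigma> * d = 1" "0 < d" using dpos by (simp_all only: \<sigma>_def d_def) (simp only: times_divide_eq_left mult_1_left divide_self_if, simp)
    then have "2 * (64 * c\<^sup>2 * (exp 2 * (16 * \<sigma>))) = 1 - \<sigma>" by (simp add: d_def algebra_simps)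
    then show ?thesis using \<sigma> by linarith
  qed
  obtain l where l: "0 \<le> l" "l < 1" and RI: "\<And>x. x \<in> D \<Longrightarrow> (\<integral>\<^sup>+y. ennreal ((R l x y)\<^sup>2) \<partial>M) \<le> ennreal \<sigma>"
    using small_kernel[OF \<sigma>] by blast
  \<comment> \<open>Collects the constants in
    \<open>K * (Mx + 2)\<^sup>2 \<le> a * (ln N + 1) ^ 3\<close>. Eventually the right side is below
    \<open>16 * \<sigma> * N\<close>, so that all moments up to order \<open>2 * K\<close> are
    admissible.\<close>
  define a where "a = (c * (real kp + 1) + 2 * c + 1) * (real kp + 2)\<^sup>2"
  have a: "0 \<le> a" using c by (simp add: a_def)
  have "eventually (\<lambda>N. (ln (real N) + 1) ^ 3 / real N < 16 * \<sigma> / (a + 1)) sequentially"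
    using order_tendstoD(2)[OF log_cube_small, of "16 * \<sigma> / (a + 1)"] \<sigma> a by simp
  then obtain N1 where N1: "\<And>N. N1 \<le> N \<Longrightarrow> (ln (real N) + 1) ^ 3 / real N < 16 * \<sigma> / (a + 1)"
    by (auto simp: eventually_sequentially)
  define C where "C = exp (c / 2 * (- ln (1 - l)) + c) * 16"
  have bound: "(\<integral>\<^sup>+x. indicator (good kp N) x * ennreal (exp (- (c / real N) * pairsum N \<xi> L x)) \<partial>P N) \<le> ennreal C"
    if N: "max N1 1 \<le> N" and xi: "\<And>i. i < N \<Longrightarrow> \<xi> i \<in> {1, -1}" and neu: "(\<Sum>i<N. \<xi> i) = 0" for N \<xi>
  proof -
    interpret PP: prob_space "P N" by (rule prob_space_P)
    have N1': "1 \<le> N" using N by simp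
    have ln0: "0 \<le> ln (real N)" using N1' by simp
    define Mx where "Mx = real kp * ln (real N)"
    have Mx: "0 \<le> Mx" using ln0 by (simp add: Mx_def)
    \<comment> \<open>On \<open>good kp N\<close> this equals \<open>R l\<close> at every pair of
      distinct particles. The truncation is needed since the moments are taken over all
      configurations and require a bounded kernel.\<close>
    define w where "w x y = min (R l x y) Mx" for x y
    have wD: "0 \<le> w x y" "w x y \<le> Mx" "w x y \<le> R l x y" if "x \<in> D" "y \<in> D" for x y
      using R_bounds(1)[OF l that] Mx by (auto simp: w_def)
    have wm: "(\<lambda>z. w (fst z) (snd z)) \<in> borel_measurable (M \<Otimes>\<^sub>M M)"
      unfolding w_def using R_meas by measurable
    have wx: "w x \<in> borel_measurable M" if "x \<in> D" for x
      using measurable_compose[OF measurable_Pair1' wm] that by (simp add: space_M)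
    have wint: "integrable M (w x)" if "x \<in> D" for x
      by (rule integrable_bounded[OF wx[OF that]]) (use wD that in \<open>auto simp: space_M\<close>)
    have w2int: "integrable M (\<lambda>y. (w x y)\<^sup>2)" if "x \<in> D" for x
      by (rule integrable_bounded[of _ "Mx\<^sup>2"])
        (use wx[OF that] wD that in \<open>auto simp: space_M intro!: power_mono\<close>)
    have w2nn: "(\<integral>\<^sup>+y. ennreal ((w x y)\<^sup>2) \<partial>M) \<le> ennreal \<sigma>" if "x \<in> D" for x
      by (rule order_trans[OF nn_integral_mono RI[OF that]])
        (use wD that in \<open>auto simp: space_M intro!: ennreal_leI power_mono\<close>)
    have w2I: "(\<integral>y. (w x y)\<^sup>2 \<partial>M) \<le> \<sigma>" if "x \<in> D" for x
      using w2nn[OF that] \<sigma> wx[OF that] by (subst integral_eq_nn_integral) (auto intro!: enn2real_leI)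
    define b where "b x = (\<integral>y. w x y \<partial>M)" for x
    have bm: "b \<in> borel_measurable M"
      unfolding b_def using wm by (intro borel_measurable_lebesgue_integral) (simp add: split_def)
    have b0: "0 \<le> b x" if "x \<in> D" for x
      unfolding b_def using wD that by (intro integral_nonneg_AE AE_I2) (auto simp: space_M)
    have b2: "(b x)\<^sup>2 \<le> \<sigma>" if x: "x \<in> D" for x
    proof -
      have "0 \<le> (\<integral>y. (w x y - b x)\<^sup>2 \<partial>M)" by simp
      also have "\<dots> = (\<integral>y. (w x y)\<^sup>2 - 2 * b x * w x y + (b x)\<^sup>2 \<partial>M)"
        by (intro Bochner_Integration.integral_cong refl) (simp add: power2_diff)
      also have "\<dots> = (\<integral>y. (w x y)\<^sup>2 \<partial>M) - 2 * b x * b x + (b x)\<^sup>2"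
        using wint[OF x] w2int[OF x] by (simp add: b_def prob_space)
      finally show ?thesis using w2I[OF x] by (simp add: power2_eq_square)
    qed
    have bs: "b x \<le> sqrt \<sigma>" if "x \<in> D" for x using b2[OF that] by (rule real_le_rsqrt)
    have s1: "sqrt \<sigma> \<le> 1" using \<sigma> by simp
    have bint: "integrable M b"
      by (rule integrable_bounded[OF bm, of "sqrt \<sigma>"]) (use b0 bs in \<open>auto simp: space_M\<close>)
    define m where "m = (\<integral>x. b x \<partial>M)"
    have m0: "0 \<le> m" unfolding m_def using b0 by (intro integral_nonneg_AE AE_I2) (auto simp: space_M)
    have ms: "m \<le> sqrt \<sigma>"
    proof -
      have "m \<le> (\<integral>x. sqrt \<sigma> \<partial>M)" unfolding m_def using bs by (intro integral_mono bint) (auto simp: space_M)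
      then show ?thesis by (simp add: prob_space)
    qed
    have m2: "m\<^sup>2 \<le> \<sigma>" using ms m0 \<sigma> power_mono[of m "sqrt \<sigma>" 2] by simp
    define w0 where "w0 x y = w x y - b x - b y + m" for x y
    have w0m: "(\<lambda>z. w0 (fst z) (snd z)) \<in> borel_measurable (M \<Otimes>\<^sub>M M)"
      unfolding w0_def using wm measurable_compose[OF measurable_fst bm] measurable_compose[OF measurable_snd bm] by measurable
    have w0B: "\<bar>w0 x y\<bar> \<le> Mx + 2" if "x \<in> D" "y \<in> D" for x y
      using wD[OF that] b0[OF that(1)] b0[OF that(2)] order_trans[OF bs[OF that(1)] s1]
        order_trans[OF bs[OF that(2)] s1] m0 order_trans[OF ms s1] by (auto simp: w0_def)
    have w0s: "w0 x y = w0 y x" for x y by (simp add: w0_def w_def R_sym)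
    have w00: "(\<integral>y. w0 x y \<partial>M) = 0" if "x \<in> D" for x
      unfolding w0_def using wint[OF that] bint by (simp add: prob_space b_def[symmetric] m_def[symmetric])
    have w0I: "(\<integral>\<^sup>+y. ennreal ((w0 x y)\<^sup>2) \<partial>M) \<le> ennreal (16 * \<sigma>)" if x: "x \<in> D" for x
    proof -
      have "(\<integral>\<^sup>+y. ennreal ((w0 x y)\<^sup>2) \<partial>M) \<le> (\<integral>\<^sup>+y. 4 * ennreal ((w x y)\<^sup>2) + ennreal (12 * \<sigma>) \<partial>M)"
      proof (rule nn_integral_mono)
        fix y assume "y \<in> space M"
        then have y: "y \<in> D" by (simp add: space_M)
        have "(p - q - r + s)\<^sup>2 \<le> 4 * (p\<^sup>2 + q\<^sup>2 + r\<^sup>2 + s\<^sup>2)" for p q r s :: real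
        proof -
          have "4 * (p\<^sup>2 + q\<^sup>2 + r\<^sup>2 + s\<^sup>2) - (p - q - r + s)\<^sup>2 =
            (p + q)\<^sup>2 + (p + r)\<^sup>2 + (p - s)\<^sup>2 + (q - r)\<^sup>2 + (q + s)\<^sup>2 + (r + s)\<^sup>2"
            by (simp add: power2_eq_square algebra_simps)
          then show ?thesis by (smt (verit) zero_le_power2)
        qed
        then have "(w0 x y)\<^sup>2 \<le> 4 * ((w x y)\<^sup>2 + (b x)\<^sup>2 + (b y)\<^sup>2 + m\<^sup>2)" unfolding w0_def .
        also have "\<dots> \<le> 4 * (w x y)\<^sup>2 + 12 * \<sigma>"
        proof -
          have "4 * (p + q + r + s) \<le> 4 * p + 12 * t" if "q \<le> t" "r \<le> t" "s \<le> t" for p q r s t :: real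
            using that by simp
          from this[OF b2[OF x] b2[OF y] m2] show ?thesis .
        qed
        finally have "(w0 x y)\<^sup>2 \<le> 4 * (w x y)\<^sup>2 + 12 * \<sigma>" .
        then have "ennreal ((w0 x y)\<^sup>2) \<le> ennreal (4 * (w x y)\<^sup>2 + 12 * \<sigma>)" by (rule ennreal_leI)
        also have "\<dots> = 4 * ennreal ((w x y)\<^sup>2) + ennreal (12 * \<sigma>)" using \<sigma> by (simp add: ennreal_plus ennreal_mult)
        finally show "ennreal ((w0 x y)\<^sup>2) \<le> 4 * ennreal ((w x y)\<^sup>2) + ennreal (12 * \<sigma>)" .
      qed
      also have "\<dots> = 4 * (\<integral>\<^sup>+y. ennreal ((w x y)\<^sup>2) \<partial>M) + ennreal (12 * \<sigma>)"
        using wx[OF x] by (subst nn_integral_add) (auto simp: nn_integral_cmult emeasure_space_1)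
      also have "\<dots> \<le> 4 * ennreal \<sigma> + ennreal (12 * \<sigma>)" by (intro add_right_mono mult_left_mono w2nn x) auto
      also have "\<dots> = ennreal (16 * \<sigma>)" using \<sigma> by (simp add: ennreal_mult[symmetric] ennreal_plus[symmetric] flip: ennreal_numeral)
      finally show ?thesis .
    qed
    \<comment> \<open>An integer above the bound of the exponent \<open>U\<close> on
      \<open>good kp N\<close>, hence of order \<open>ln N\<close>.\<close>
    define K where "K = nat \<lceil>c * (real kp + 1) * ln (real N) + 2 * c\<rceil>"
    have K: "c * (real kp + 1) * ln (real N) + 2 * c \<le> real K" "real K \<le> c * (real kp + 1) * ln (real N) + 2 * c + 1"
    proof -
      have "0 \<le> c * (real kp + 1) * ln (real N) + 2 * c" using c ln0 by simp
      then show "c * (real kp + 1) * ln (real N) + 2 * c \<le> real K" "real K \<le> c * (real kp + 1) * ln (real N) + 2 * c + 1"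
        unfolding K_def by linarith+
    qed
    have KB: "real k * (Mx + 2)\<^sup>2 \<le> 16 * \<sigma> * real N" if "k \<le> K" for k
    proof -
      define h where "h = ln (real N) + 1"
      have h: "1 \<le> h" using ln0 by (simp add: h_def)
      have "real K \<le> (c * (real kp + 1) + 2 * c + 1) * h"
      proof -
        have "2 * c + 1 \<le> (2 * c + 1) * h" using h c mult_left_mono[of 1 h "2 * c + 1"] by simp
        moreover have "c * (real kp + 1) * ln (real N) \<le> c * (real kp + 1) * h" using c by (intro mult_left_mono) (auto simp: h_def)
        ultimately show ?thesis using K(2) by (simp add: distrib_right)
      qed
      moreover have "Mx + 2 \<le> (real kp + 2) * h"
        using h mult_left_mono[of "ln (real N)" h "real kp"] by (simp add: Mx_def h_def distrib_right)
      then have "(Mx + 2)\<^sup>2 \<le> ((real kp + 2) * h)\<^sup>2" using Mx by (intro power_mono) auto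
      ultimately have "real K * (Mx + 2)\<^sup>2 \<le> ((c * (real kp + 1) + 2 * c + 1) * h) * ((real kp + 2) * h)\<^sup>2"
        using c h by (intro mult_mono) auto
      also have "\<dots> = a * h ^ 3" by (simp add: a_def power2_eq_square power3_eq_cube)
      also have "\<dots> \<le> (a + 1) * h ^ 3" using h by simp
      also have "\<dots> \<le> 16 * \<sigma> * real N"
      proof -
        have "h ^ 3 / real N < 16 * \<sigma> / (a + 1)" using N1[of N] N by (simp add: h_def)
        then show ?thesis using N1' a by (simp add: field_simps)
      qed
      finally have "real K * (Mx + 2)\<^sup>2 \<le> 16 * \<sigma> * real N" .
      moreover have "real k * (Mx + 2)\<^sup>2 \<le> real K * (Mx + 2)\<^sup>2" using that by (intro mult_right_mono) auto
      ultimately show ?thesis by simp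
    qed
    define U where "U x = - c / real N * pairsum N \<xi> w0 x" for x
    have U_int: "integrable (P N) (\<lambda>x. U x ^ (2 * k) / fact (2 * k))" for k
    proof -
      have "integrable (P N) (\<lambda>x. pairsum N \<xi> w0 x ^ (2 * k))"
        by (rule integrable_pairsum_power[OF w0m, of "Mx + 2"]) (use w0B w0s in \<open>auto simp: space_M\<close>)
      then show ?thesis unfolding U_def power_mult_distrib by simp
    qed
    have U_mom: "(\<integral>x. U x ^ (2 * k) / fact (2 * k) \<partial>P N) \<le> 2 * (1 / 2) ^ k" if "k \<le> K" for k
    proof -
      have "(\<integral>x. U x ^ (2 * k) / fact (2 * k) \<partial>P N) \<le> 2 * (64 * (- c)\<^sup>2 * (exp 2 * (16 * \<sigma>))) ^ k"
        unfolding U_def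
        by (rule canonical_pairsum_moment[OF w0m, of "Mx + 2"])
          (use w0B w0s w00 w0I xi \<sigma> N1' KB[OF that] in \<open>auto simp: space_M\<close>)
      also have "\<dots> \<le> 2 * (1 / 2) ^ k" using small by (intro mult_left_mono power_mono) (auto simp: \<sigma>_def)
      finally show ?thesis .
    qed
    define c0 where "c0 = exp (c / 2 * (- ln (1 - l)) + c)"
    have pt: "indicator (good kp N) x * ennreal (exp (- (c / real N) * pairsum N \<xi> L x))
       \<le> ennreal (c0 * (4 * (\<Sum>k\<le>K. U x ^ (2 * k) / fact (2 * k))))" for x
    proof (cases "x \<in> good kp N")
      case True
      then have xs: "x \<in> space (P N)" and gd: "\<And>i j. i < N \<Longrightarrow> j < N \<Longrightarrow> i \<noteq> j \<Longrightarrow> 1 \<le> real N ^ kp * (1 - T (x i) (x j))"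
        by (auto simp: good_def)
      have x: "\<And>i. i < N \<Longrightarrow> x i \<in> D" using space_P_D[OF xs] .
      have dis: "x i \<noteq> x j" if "i < N" "j < N" "i \<noteq> j" for i j
        using gd[OF that] T_diag[OF x[OF that(1)]] by auto
      have Tij: "0 \<le> T (x i) (x j) \<and> T (x i) (x j) < 1" if "i < N" "j < N" "i \<noteq> j" for i j
        by (rule T_range) (use that x dis in auto)
      \<comment> \<open>On the good event every pair satisfies
        \<open>1 - T (x i) (x j) \<ge> 1 / N ^ kp\<close>, so one cutoff serves all particles; the
        extra factor \<open>1 / N\<close> is the one required by \<open>onsager\<close>.\<close>
      define m0' where "m0' = (1 - l) / real N ^ (kp + 1)"
      have "(\<Sum>j<N. \<Sum>i<j. \<xi> i * \<xi> j * ln ((1 - l * T (x i) (x j)) / (1 - T (x i) (x j))))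
        \<ge> - (1 / 2) * (\<Sum>i<N. ln ((1 - l) / m0')) - real N / 2"
      proof (rule onsager[OF T_mult])
        fix i assume "i < N"
        have "1 \<le> real N ^ (kp + 1)" using N1' by (intro one_le_power) auto
        then show "0 < m0' \<and> m0' \<le> 1 - l" using l by (simp add: m0'_def divide_le_eq mult_left_mono[of 1 _ "1 - l", simplified])
      next
        fix i j assume ij: "i < N" "j < N" "i \<noteq> j"
        have "real N * m0' = (1 - l) / real N ^ kp" using N1' by (simp add: m0'_def)
        also have "\<dots> \<le> 1 / real N ^ kp" using l by (intro divide_right_mono) auto
        also have "\<dots> \<le> 1 - T (x i) (x j)" using gd[OF ij] N1' by (simp add: divide_le_eq mult.commute)
        finally show "real N * m0' \<le> 1 - T (x i) (x j)" .
      qed (use T_diag x T_sym Tij xi l in auto)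
      moreover have "(1 - l) / m0' = real N ^ (kp + 1)" using l by (simp add: m0'_def)
      moreover have "ln (real N ^ (kp + 1)) = (real kp + 1) * ln (real N)"
        using N1' by (subst ln_realpow) auto
      ultimately have psR: "pairsum N \<xi> (R l) x \<ge> - (1 / 2) * (real N * ((real kp + 1) * ln (real N))) - real N / 2"
        by (simp add: pairsum_def R_def)
      have "R l (x i) (x j) \<le> Mx" if ij: "i < N" "j < N" "i \<noteq> j" for i j
      proof -
        have "R l (x i) (x j) \<le> - ln (1 - T (x i) (x j))"
          by (rule R_bounds(3)[OF l]) (use x ij dis in auto)
        also have "\<dots> = ln (1 / (1 - T (x i) (x j)))" using Tij[OF ij] by (simp add: ln_div)
        also have "\<dots> \<le> ln (real N ^ kp)"
          using gd[OF ij] Tij[OF ij] by (intro ln_mono) (auto simp: divide_le_eq)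
        also have "\<dots> = Mx" using N1' by (simp add: Mx_def ln_realpow)
        finally show ?thesis .
      qed
      then have psw: "pairsum N \<xi> w x = pairsum N \<xi> (R l) x"
        unfolding pairsum_def w_def by (intro sum.cong refl arg_cong2[of _ _ _ _ times]) auto
      have split: "pairsum N \<xi> w x = pairsum N \<xi> w0 x - (\<Sum>i<N. b (x i)) + m * real N / 2"
        unfolding w0_def[abs_def] by (rule canonical_split[OF xi neu])
      have sb: "0 \<le> (\<Sum>i<N. b (x i))" "(\<Sum>i<N. b (x i)) \<le> real N"
      proof -
        show "0 \<le> (\<Sum>i<N. b (x i))" using b0 x by (intro sum_nonneg) auto
        have "(\<Sum>i<N. b (x i)) \<le> (\<Sum>i<N. 1)" using bs x s1 by (intro sum_mono) (meson lessThan_iff order_trans)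
        then show "(\<Sum>i<N. b (x i)) \<le> real N" by simp
      qed
      define cN where "cN = c / real N"
      have cN: "0 \<le> cN" "cN * real N = c" using c N1' by (auto simp: cN_def)
      have Uw: "U x = - cN * pairsum N \<xi> w x - cN * (\<Sum>i<N. b (x i)) + c * m / 2"
        unfolding U_def split using cN N1' by (simp add: cN_def algebra_simps)
      have UK: "U x \<le> real K"
      proof -
        have "- cN * pairsum N \<xi> w x \<le> cN * (1 / 2 * (real N * ((real kp + 1) * ln (real N))) + real N / 2)"
          using mult_left_mono[OF psR cN(1)] unfolding psw by (simp add: algebra_simps)
        also have "\<dots> = (cN * real N) * ((real kp + 1) * ln (real N) / 2 + 1 / 2)" by (simp add: algebra_simps)
        also have "\<dots> = c * (real kp + 1) * ln (real N) / 2 + c / 2" unfolding cN(2) by (simp add: algebra_simps)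
        finally have "- cN * pairsum N \<xi> w x \<le> c * (real kp + 1) * ln (real N) / 2 + c / 2" .
        moreover have "0 \<le> cN * (\<Sum>i<N. b (x i))" using cN sb by simp
        moreover have "c * m / 2 \<le> c / 2" using mult_left_mono[OF order_trans[OF ms s1] c] by simp
        moreover have "0 \<le> c * (real kp + 1) * ln (real N)" using c ln0 by simp
        ultimately show ?thesis using Uw K(1) c by linarith
      qed
      \<comment> \<open>The damped interaction is positive semidefinite with the finite diagonal
        \<open>- ln (1 - l)\<close>, so after multiplication by \<open>c / N\<close> it costs only a
        constant. The trivial \<open>min l l\<close> matches the shape of
        \<open>psd_log\<close>.\<close>
      have psP: "pairsum N \<xi> (\<lambda>x y. - ln (1 - l * T x y)) x \<ge> - (1 / 2) * (real N * (- ln (1 - l)))"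
      proof -
        define Q where "Q i j = ln ((1 - 0 * T (x i) (x j)) / (1 - min l l * T (x i) (x j)))" for i j
        have Qe: "Q i j = - ln (1 - l * T (x i) (x j))" if "i < N" "j < N" for i j
        proof -
          have "0 < 1 - l * T (x i) (x j)"
            using T_le1[of "x i" "x j"] x that l mult_left_le[of "T (x i) (x j)" l] by (smt (verit))
          then show ?thesis by (simp add: Q_def ln_div)
        qed
        have "psd N Q" unfolding Q_def
          by (rule psd_log[OF T_mult]) (use x T_le1 l in auto)
        from psd_pair_sum_ge[OF this _ xi]
        have "(\<Sum>j<N. \<Sum>i<j. \<xi> i * \<xi> j * Q i j) \<ge> - (1 / 2) * (\<Sum>i<N. Q i i)"
          by (simp add: Q_def T_sym)
        moreover have "(\<Sum>i<N. Q i i) = real N * (- ln (1 - l))"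
          using Qe T_diag x by simp
        moreover have "(\<Sum>j<N. \<Sum>i<j. \<xi> i * \<xi> j * Q i j) = pairsum N \<xi> (\<lambda>x y. - ln (1 - l * T x y)) x"
          unfolding pairsum_def by (intro sum.cong refl arg_cong2[of _ _ _ _ times]) (use Qe in auto)
        ultimately show ?thesis by simp
      qed
      have psL: "pairsum N \<xi> L x = pairsum N \<xi> (\<lambda>x y. - ln (1 - l * T x y)) x + pairsum N \<xi> w x"
        unfolding psw unfolding pairsum_def sum.distrib[symmetric]
      proof (intro sum.cong refl)
        fix i j assume "j \<in> {..<N}" "i \<in> {..<j}"
        then have "L (x i) (x j) = - ln (1 - l * T (x i) (x j)) + R l (x i) (x j)"
          by (intro R_bounds(4)[OF l] x dis) auto
        then show "\<xi> i * \<xi> j * L (x i) (x j) = \<xi> i * \<xi> j * - ln (1 - l * T (x i) (x j)) + \<xi> i * \<xi> j * R l (x i) (x j)"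
          by (simp only: distrib_left)
      qed
      have "- cN * pairsum N \<xi> L x \<le> (c / 2 * (- ln (1 - l)) + c) + U x"
      proof -
        have "- cN * pairsum N \<xi> (\<lambda>x y. - ln (1 - l * T x y)) x \<le> (cN * real N) / 2 * (- ln (1 - l))"
          using mult_left_mono[OF psP cN(1)] by (simp add: algebra_simps)
        then have 1: "- cN * pairsum N \<xi> (\<lambda>x y. - ln (1 - l * T x y)) x \<le> c / 2 * (- ln (1 - l))" unfolding cN(2) .
        have "cN * (\<Sum>i<N. b (x i)) \<le> cN * real N" using cN sb by (intro mult_left_mono) auto
        then have 2: "cN * (\<Sum>i<N. b (x i)) \<le> c" unfolding cN(2) .
        have 3: "0 \<le> c * m" using c m0 by simp
        show ?thesis unfolding psL distrib_left using 1 2 3 Uw by linarith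
      qed
      then have "exp (- cN * pairsum N \<xi> L x) \<le> c0 * exp (U x)" by (simp add: c0_def flip: exp_add)
      also have "\<dots> \<le> c0 * (4 * (\<Sum>k\<le>K. U x ^ (2 * k) / fact (2 * k)))"
        by (intro mult_left_mono exp_le_cosh_partial_sum UK) (simp add: c0_def)
      finally show ?thesis using True by (simp add: cN_def ennreal_leI)
    qed simp
    have "(\<integral>\<^sup>+x. indicator (good kp N) x * ennreal (exp (- (c / real N) * pairsum N \<xi> L x)) \<partial>P N)
      \<le> (\<integral>\<^sup>+x. ennreal (c0 * (4 * (\<Sum>k\<le>K. U x ^ (2 * k) / fact (2 * k)))) \<partial>P N)"
      by (rule nn_integral_mono) (rule pt)
    also have "\<dots> = ennreal (\<integral>x. c0 * (4 * (\<Sum>k\<le>K. U x ^ (2 * k) / fact (2 * k))) \<partial>P N)"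
      by (rule nn_integral_eq_integral)
        (use U_int in \<open>auto simp: c0_def zero_le_even_power intro!: sum_nonneg divide_nonneg_pos mult_nonneg_nonneg\<close>)
    also have "(\<integral>x. c0 * (4 * (\<Sum>k\<le>K. U x ^ (2 * k) / fact (2 * k))) \<partial>P N) = c0 * (4 * (\<Sum>k\<le>K. \<integral>x. U x ^ (2 * k) / fact (2 * k) \<partial>P N))"
      using U_int by simp
    also have "ennreal \<dots> \<le> ennreal (c0 * (4 * (\<Sum>k\<le>K. 2 * (1 / 2) ^ k)))"
      using U_mom by (intro ennreal_leI mult_left_mono sum_mono) (auto simp: c0_def)
    also have "\<dots> \<le> ennreal (c0 * (4 * 4))"
    proof (intro ennreal_leI mult_left_mono)
      have "(\<Sum>k\<le>K. (1 / 2 :: real) ^ k) \<le> (\<Sum>k. (1 / 2) ^ k)" by (rule sum_le_suminf) auto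
      also have "\<dots> = 2" using suminf_geometric[of "1 / 2 :: real"] by simp
      finally show "(\<Sum>k\<le>K. 2 * (1 / 2 :: real) ^ k) \<le> 4" by (simp flip: sum_distrib_left)
    qed (auto simp: c0_def)
    also have "c0 * (4 * 4) = C" by (simp add: C_def c0_def)
    finally show ?thesis .
  qed
  show thesis by (rule that[of C "max N1 1", OF _ bound]) (auto simp: C_def)
qed

text \<open>Off the good event the polynomial bound is used at \<open>2 * c\<close>, through
  Cauchy--Schwarz. A union bound over at most \<open>N\<^sup>2\<close> pairs, each at squared
  distance of order \<open>1 / N ^ kp\<close>, gives a probability of order \<open>1 / N ^ n\<close>
  with \<open>n = kp - 2\<close>; this beats the growth \<open>N powr (9 * c)\<close> because
  \<open>n \<ge> 9 * c\<close>.\<close>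

lemma mean_field_bound:
  assumes c: "0 \<le> c"
  obtains C N0 where "0 \<le> C" "\<And>N \<xi>. N0 \<le> N \<Longrightarrow> (\<And>i. i < N \<Longrightarrow> \<xi> i \<in> {1, -1}) \<Longrightarrow> (\<Sum>i<N. \<xi> i) = 0 \<Longrightarrow>
    (\<integral>\<^sup>+x. ennreal (exp (- (c / real N) * pairsum N \<xi> L x)) \<partial>P N) \<le> ennreal C"
proof -
  define n where "n = nat \<lceil>9 * c\<rceil>"
  have n: "9 * c \<le> real n" unfolding n_def by linarith
  define kp where "kp = n + 2"
  obtain C1 N1 where C1: "0 \<le> C1" and G: "\<And>N \<xi>. N1 \<le> N \<Longrightarrow> (\<And>i. i < N \<Longrightarrow> \<xi> i \<in> {1, -1}) \<Longrightarrow> (\<Sum>i<N. \<xi> i) = 0 \<Longrightarrow>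
    (\<integral>\<^sup>+x. indicator (good kp N) x * ennreal (exp (- (c / real N) * pairsum N \<xi> L x)) \<partial>P N) \<le> ennreal C1"
    using good_bound[OF c, of kp] by blast
  obtain C2 where C2: "0 \<le> C2" and Q: "\<And>N \<xi>. 1 \<le> N \<Longrightarrow> 2 * (2 * c) \<le> real N \<Longrightarrow> (\<And>i. i < N \<Longrightarrow> \<xi> i \<in> {1, -1}) \<Longrightarrow>
    (\<integral>\<^sup>+x. ennreal (exp (- (2 * c / real N) * pairsum N \<xi> L x)) \<partial>P N) \<le> ennreal (C2 * real N powr (9 * (2 * c) / 2))"
    using polynomial_bound[of "2 * c"] c by auto
  define N0 where "N0 = max N1 (max 1 (nat \<lceil>4 * c\<rceil>))"
  define C where "C = C1 + 2 * \<Delta> * sqrt C2"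
  have bound: "(\<integral>\<^sup>+x. ennreal (exp (- (c / real N) * pairsum N \<xi> L x)) \<partial>P N) \<le> ennreal C"
    if N: "N0 \<le> N" and xi: "\<And>i. i < N \<Longrightarrow> \<xi> i \<in> {1, -1}" and neu: "(\<Sum>i<N. \<xi> i) = 0" for N \<xi>
  proof -
    have N': "N1 \<le> N" "1 \<le> N" "nat \<lceil>4 * c\<rceil> \<le> N" using N by (auto simp: N0_def)
    have N4: "2 * (2 * c) \<le> real N" using N'(3) by linarith
    define W where "W x = ennreal (exp (- (c / real N) * pairsum N \<xi> L x))" for x
    have Wm: "W \<in> borel_measurable (P N)" unfolding W_def by measurable
    define bad where "bad = space (P N) - good kp N"
    have bad_m[measurable]: "bad \<in> sets (P N)" unfolding bad_def by measurable
    define \<tau> where "\<tau> = \<Delta> / sqrt (real N ^ kp)"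
    have \<tau>: "0 < \<tau>" "\<tau>\<^sup>2 = \<Delta>\<^sup>2 / real N ^ kp" using \<Delta> N'(2) by (auto simp: \<tau>_def power_divide)
    define A where "A i j = (if i \<noteq> j then {x \<in> space (P N). norm (x i - x j) < \<tau>} else {})" for i j
    have A_m: "A i j \<in> sets (P N)" if "i < N" "j < N" for i j
    proof -
      have "{x \<in> space (P N). norm (x i - x j) < \<tau>} \<in> sets (P N)"
        using measurable_pair_P[OF norm_meas that] by measurable
      then show ?thesis by (simp add: A_def)
    qed
    have sub: "bad \<subseteq> (\<Union>p\<in>{..<N} \<times> {..<N}. A (fst p) (snd p))"
    proof
      fix x assume x: "x \<in> bad"
      then have xs: "x \<in> space (P N)" by (simp add: bad_def)
      obtain i j where ij: "i < N" "j < N" "i \<noteq> j" "real N ^ kp * (1 - T (x i) (x j)) < 1"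
        using x by (auto simp: bad_def good_def not_le)
      have "(norm (x i - x j))\<^sup>2 \<le> \<Delta>\<^sup>2 * (1 - T (x i) (x j))"
        by (rule T_lower) (use space_P_D[OF xs] ij in auto)
      also have "\<dots> < \<Delta>\<^sup>2 * (1 / real N ^ kp)"
        using ij(4) \<Delta> N'(2) by (intro mult_strict_left_mono) (auto simp: field_simps)
      finally have "(norm (x i - x j))\<^sup>2 < \<tau>\<^sup>2" by (simp add: \<tau>(2))
      then have "norm (x i - x j) < \<tau>" using \<tau>(1) by (simp add: power_less_imp_less_base)
      then have "x \<in> A i j" using xs ij by (simp add: A_def)
      then show "x \<in> (\<Union>p\<in>{..<N} \<times> {..<N}. A (fst p) (snd p))" using ij by force
    qed
    have "emeasure (P N) bad \<le> emeasure (P N) (\<Union>p\<in>{..<N} \<times> {..<N}. A (fst p) (snd p))"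
      using A_m by (intro emeasure_mono sub sets.finite_UN) auto
    also have "\<dots> \<le> (\<Sum>p\<in>{..<N} \<times> {..<N}. emeasure (P N) (A (fst p) (snd p)))"
      using A_m by (intro emeasure_subadditive_finite) auto
    also have "\<dots> \<le> (\<Sum>p\<in>{..<N} \<times> {..<N}. ennreal (4 * \<tau>\<^sup>2))"
      using emeasure_close_pair \<tau>(1) by (intro sum_mono) (auto simp: A_def)
    also have "\<dots> = ennreal (real (N * N) * (4 * \<tau>\<^sup>2))"
      by (subst sum_ennreal) auto
    also have "real (N * N) * (4 * \<tau>\<^sup>2) = 4 * \<Delta>\<^sup>2 / real N ^ n"
      using N'(2) unfolding \<tau>(2) kp_def by (simp add: power_add power2_eq_square)
    finally have bad: "emeasure (P N) bad \<le> ennreal (4 * \<Delta>\<^sup>2 / real N ^ n)" .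
    define a1 where "a1 = sqrt (4 * \<Delta>\<^sup>2 / real N ^ n)"
    define a2 where "a2 = sqrt (C2 * real N powr (9 * c))"
    have a12: "0 \<le> a1" "0 \<le> a2" "a1\<^sup>2 = 4 * \<Delta>\<^sup>2 / real N ^ n" "a2\<^sup>2 = C2 * real N powr (9 * c)"
      using \<Delta> C2 by (auto simp: a1_def a2_def)
    have "(\<integral>\<^sup>+x. indicator bad x * W x \<partial>P N) \<le> ennreal (a1 * a2)"
    proof (rule nn_Cauchy_Schwarz_le[OF _ Wm _ _ a12(1,2)])
      have "(\<integral>\<^sup>+x. (indicator bad x)\<^sup>2 \<partial>P N) = (\<integral>\<^sup>+x. indicator bad x \<partial>P N)"
        by (intro nn_integral_cong) (auto simp: indicator_def)
      then show "(\<integral>\<^sup>+x. (indicator bad x)\<^sup>2 \<partial>P N) \<le> ennreal (a1\<^sup>2)"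
        using bad by (simp add: a12)
      have "(W x)\<^sup>2 = ennreal (exp (- (2 * c / real N) * pairsum N \<xi> L x))" for x
      proof -
        have "(exp (- (c / real N) * pairsum N \<xi> L x))\<^sup>2 = exp (- (2 * c / real N) * pairsum N \<xi> L x)"
          unfolding power2_eq_square exp_add[symmetric] by (simp add: algebra_simps)
        then show ?thesis by (simp add: W_def ennreal_power)
      qed
      then show "(\<integral>\<^sup>+x. (W x)\<^sup>2 \<partial>P N) \<le> ennreal (a2\<^sup>2)"
        using Q[OF N'(2) N4 xi] by (simp add: a12)
    qed measurable
    also have "a1 * a2 \<le> 2 * \<Delta> * sqrt C2"
    proof -
      have "real N powr (9 * c) \<le> real N powr real n" using n N'(2) by (intro powr_mono) auto
      then have "real N powr (9 * c) \<le> real N ^ n" using N'(2) by (simp add: powr_realpow)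
      then have "real N powr (9 * c) / real N ^ n \<le> 1" using N'(2) by simp
      then have "4 * \<Delta>\<^sup>2 * C2 * (real N powr (9 * c) / real N ^ n) \<le> 4 * \<Delta>\<^sup>2 * C2 * 1"
        using C2 by (intro mult_left_mono) auto
      then have "(a1 * a2)\<^sup>2 \<le> 4 * \<Delta>\<^sup>2 * C2"
        by (simp add: power_mult_distrib a12)
      also have "\<dots> = (2 * \<Delta> * sqrt C2)\<^sup>2" using C2 by (simp add: power_mult_distrib)
      finally show ?thesis by (rule power2_le_imp_le) (use \<Delta> C2 in auto)
    qed
    finally have badW: "(\<integral>\<^sup>+x. indicator bad x * W x \<partial>P N) \<le> ennreal (2 * \<Delta> * sqrt C2)"
      by (simp add: ennreal_leI)
    have "(\<integral>\<^sup>+x. W x \<partial>P N) = (\<integral>\<^sup>+x. indicator (good kp N) x * W x + indicator bad x * W x \<partial>P N)"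
      by (intro nn_integral_cong) (auto simp: bad_def indicator_def)
    also have "\<dots> = (\<integral>\<^sup>+x. indicator (good kp N) x * W x \<partial>P N) + (\<integral>\<^sup>+x. indicator bad x * W x \<partial>P N)"
      by (intro nn_integral_add borel_measurable_times_ennreal borel_measurable_indicator good_sets bad_m Wm)
    also have "\<dots> \<le> ennreal C1 + ennreal (2 * \<Delta> * sqrt C2)"
      using G[OF N'(1) xi neu] badW unfolding W_def by (intro add_mono) auto
    also have "\<dots> = ennreal C" using C1 C2 \<Delta> by (simp add: C_def ennreal_plus)
    finally show ?thesis by (simp add: W_def)
  qed
  show thesis by (rule that[OF _ bound]) (use C1 C2 \<Delta> in \<open>auto simp: C_def\<close>)
qed

text \<open>The boundary factors are separated by Cauchy--Schwarz. Their exponents are of order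
  \<open>1 / N\<close>, so by Bernoulli's inequality each squared factor has mean at most
  \<open>1 + O(1 / N)\<close>, and the product over the particles stays bounded.\<close>

lemma large_N_bound:
  assumes c: "0 \<le> c"
  obtains C N0 where "0 \<le> C" "\<And>N \<xi>. N0 \<le> N \<Longrightarrow> (\<And>i. i < N \<Longrightarrow> \<xi> i \<in> {1, -1}) \<Longrightarrow> (\<Sum>i<N. \<xi> i) = 0 \<Longrightarrow>
    (\<integral>\<^sup>+x. ennreal (majorant N (c / real N) \<xi> x) \<partial>P N) \<le> ennreal C"
proof -
  obtain C1 N1 where C1: "0 \<le> C1" and B: "\<And>N \<xi>. N1 \<le> N \<Longrightarrow> (\<And>i. i < N \<Longrightarrow> \<xi> i \<in> {1, -1}) \<Longrightarrow> (\<Sum>i<N. \<xi> i) = 0 \<Longrightarrow>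
    (\<integral>\<^sup>+x. ennreal (exp (- (2 * c / real N) * pairsum N \<xi> L x)) \<partial>P N) \<le> ennreal C1"
    using mean_field_bound[of "2 * c"] c by auto
  obtain A where A: "0 \<le> A" "(\<integral>\<^sup>+x. ennreal (dist_bd x powr (- (1 / 2))) \<partial>M) \<le> ennreal A"
    by (rule nn_integral_dist_bd_powr[of "1 / 2"]) auto
  define N0 where "N0 = max N1 (max 1 (nat \<lceil>4 * c\<rceil>))"
  define C where "C = sqrt C1 * sqrt (exp (4 * c * A))"
  have bound: "(\<integral>\<^sup>+x. ennreal (majorant N (c / real N) \<xi> x) \<partial>P N) \<le> ennreal C"
    if N: "N0 \<le> N" and xi: "\<And>i. i < N \<Longrightarrow> \<xi> i \<in> {1, -1}" and neu: "(\<Sum>i<N. \<xi> i) = 0" for N \<xi>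
  proof -
    interpret PS: product_sigma_finite "\<lambda>_. M" by standard
    have N': "N1 \<le> N" "1 \<le> N" "nat \<lceil>4 * c\<rceil> \<le> N" using N by (auto simp: N0_def)
    define s where "s = 4 * c / real N"
    have s: "0 \<le> s" "s \<le> 1" using N' c by (auto simp: s_def divide_le_eq)
    define f where "f x = ennreal (exp (- (c / real N) * pairsum N \<xi> L x))" for x
    define h where "h x = (\<Prod>i<N. ennreal (dist_bd (x i) powr (- (c / real N))))" for x
    have fm: "f \<in> borel_measurable (P N)" unfolding f_def by measurable
    have hm: "h \<in> borel_measurable (P N)" unfolding h_def
      by (intro borel_measurable_prod_ennreal) measurable
    have f2: "(\<integral>\<^sup>+x. (f x)\<^sup>2 \<partial>P N) \<le> ennreal ((sqrt C1)\<^sup>2)"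
    proof -
      have "(f x)\<^sup>2 = ennreal (exp (- (2 * c / real N) * pairsum N \<xi> L x))" for x
      proof -
        have "(exp (- (c / real N) * pairsum N \<xi> L x))\<^sup>2 = exp (- (2 * c / real N) * pairsum N \<xi> L x)"
          unfolding power2_eq_square exp_add[symmetric] by (simp add: algebra_simps)
        then show ?thesis by (simp add: f_def ennreal_power)
      qed
      then show ?thesis using B[OF N'(1) xi neu] C1 by simp
    qed
    have h2: "(\<integral>\<^sup>+x. (h x)\<^sup>2 \<partial>P N) \<le> ennreal ((sqrt (exp (4 * c * A)))\<^sup>2)"
    proof -
      have one: "(\<integral>\<^sup>+y. ennreal (dist_bd y powr (- (2 * c / real N))) \<partial>M) \<le> ennreal (1 + s * A)"
      proof -
        have "(\<integral>\<^sup>+y. ennreal (dist_bd y powr (- (2 * c / real N))) \<partial>M) \<le> (\<integral>\<^sup>+y. 1 + ennreal s * ennreal (dist_bd y powr (- (1 / 2))) \<partial>M)"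
        proof (rule nn_integral_mono)
          fix y
          have "dist_bd y powr (- (2 * c / real N)) = (dist_bd y powr (- (1 / 2))) powr s"
            by (simp add: powr_powr s_def)
          also have "\<dots> \<le> 1 + s * dist_bd y powr (- (1 / 2))" by (rule powr_le_Bernoulli[OF _ s]) simp
          finally have "ennreal (dist_bd y powr (- (2 * c / real N))) \<le> ennreal (1 + s * dist_bd y powr (- (1 / 2)))"
            by (rule ennreal_leI)
          also have "\<dots> = 1 + ennreal s * ennreal (dist_bd y powr (- (1 / 2)))"
            using s by (simp add: ennreal_plus ennreal_mult)
          finally show "ennreal (dist_bd y powr (- (2 * c / real N))) \<le> 1 + ennreal s * ennreal (dist_bd y powr (- (1 / 2)))" .
        qed
        also have "\<dots> = 1 + ennreal s * (\<integral>\<^sup>+y. ennreal (dist_bd y powr (- (1 / 2))) \<partial>M)"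
          by (subst nn_integral_add) (auto simp: emeasure_space_1 nn_integral_cmult)
        also have "\<dots> \<le> 1 + ennreal s * ennreal A" by (intro add_left_mono mult_left_mono A) auto
        also have "\<dots> = ennreal (1 + s * A)" using s A by (simp add: ennreal_plus ennreal_mult)
        finally show ?thesis .
      qed
      have "(h x)\<^sup>2 = (\<Prod>i<N. ennreal (dist_bd (x i) powr (- (2 * c / real N))))" for x
        unfolding h_def prod_power_distrib
      proof (intro prod.cong refl)
        fix i
        have "(dist_bd (x i) powr (- (c / real N)))\<^sup>2 = dist_bd (x i) powr (- (2 * c / real N))"
          unfolding power2_eq_square powr_add[symmetric] by simp
        then show "(ennreal (dist_bd (x i) powr (- (c / real N))))\<^sup>2 = ennreal (dist_bd (x i) powr (- (2 * c / real N)))"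
          by (simp add: ennreal_power)
      qed
      then have "(\<integral>\<^sup>+x. (h x)\<^sup>2 \<partial>P N) = (\<integral>\<^sup>+x. (\<Prod>i<N. ennreal (dist_bd (x i) powr (- (2 * c / real N)))) \<partial>P N)" by simp
      also have "\<dots> = (\<Prod>i<N. \<integral>\<^sup>+y. ennreal (dist_bd y powr (- (2 * c / real N))) \<partial>M)"
        by (rule PS.product_nn_integral_prod) auto
      also have "\<dots> \<le> (\<Prod>i<N. ennreal (1 + s * A))" by (intro prod_mono_ennreal one)
      also have "\<dots> = ennreal ((1 + s * A) ^ N)" using s A by (simp only: prod_constant card_lessThan) (rule ennreal_power, simp)
      also have "\<dots> \<le> ennreal (exp (4 * c * A))"
      proof (rule ennreal_leI)
        have "(1 + s * A) ^ N \<le> exp (s * A) ^ N" using s A by (intro power_mono exp_ge_add_one_self) auto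
        also have "\<dots> = exp (4 * c * A)" using N'(2) by (simp add: s_def flip: exp_of_nat_mult)
        finally show "(1 + s * A) ^ N \<le> exp (4 * c * A)" .
      qed
      finally show ?thesis by simp
    qed
    have "(\<integral>\<^sup>+x. f x * h x \<partial>P N) \<le> ennreal (sqrt C1 * sqrt (exp (4 * c * A)))"
      by (rule nn_Cauchy_Schwarz_le[OF fm hm f2 h2]) (use C1 in auto)
    moreover have "f x * h x = ennreal (majorant N (c / real N) \<xi> x)" for x
      by (simp add: f_def h_def prod_ennreal ennreal_mult prod_nonneg)
    ultimately show ?thesis by (simp add: C_def)
  qed
  show thesis by (rule that[OF _ bound]) (use C1 in \<open>auto simp: C_def\<close>)
qed

text \<open>The finitely many \<open>N\<close> below the threshold of the uniform bound are covered
  by constants of their own, which are summed; for them the condition on \<open>\<beta>\<close> says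
  that the exponent \<open>\<beta> / (2 * pi * N)\<close> is less than \<open>1\<close>.\<close>

lemma weight_bound:
  assumes \<beta>: "0 \<le> \<beta>"
  obtains C where "0 \<le> C" "\<And>N \<xi>. 1 \<le> N \<Longrightarrow> \<beta> < 2 * pi * real N \<Longrightarrow> (\<And>i. i < N \<Longrightarrow> \<xi> i \<in> {1, -1}) \<Longrightarrow> (\<Sum>i<N. \<xi> i) = 0 \<Longrightarrow>
    (\<integral>\<^sup>+x. ennreal (majorant N (\<beta> / (2 * pi) / real N) \<xi> x) \<partial>P N) \<le> ennreal C"
proof -
  define c where "c = \<beta> / (2 * pi)"
  have c: "0 \<le> c" using \<beta> by (simp add: c_def)
  obtain C1 N1 where C1: "0 \<le> C1" and B: "\<And>N \<xi>. N1 \<le> N \<Longrightarrow> (\<And>i. i < N \<Longrightarrow> \<xi> i \<in> {1, -1}) \<Longrightarrow> (\<Sum>i<N. \<xi> i) = 0 \<Longrightarrow>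
    (\<integral>\<^sup>+x. ennreal (majorant N (c / real N) \<xi> x) \<partial>P N) \<le> ennreal C1"
    using large_N_bound[OF c] by blast
  have "\<forall>N. \<exists>C. 0 \<le> C \<and> (1 \<le> N \<longrightarrow> c < real N \<longrightarrow> (\<forall>\<xi>. (\<forall>i<N. \<xi> i \<in> {1, -1}) \<longrightarrow>
    (\<integral>\<^sup>+x. ennreal (majorant N (c / real N) \<xi> x) \<partial>P N) \<le> ennreal C))"
  proof
    fix N
    show "\<exists>C. 0 \<le> C \<and> (1 \<le> N \<longrightarrow> c < real N \<longrightarrow> (\<forall>\<xi>. (\<forall>i<N. \<xi> i \<in> {1, -1}) \<longrightarrow>
      (\<integral>\<^sup>+x. ennreal (majorant N (c / real N) \<xi> x) \<partial>P N) \<le> ennreal C))"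
    proof (cases "1 \<le> N \<and> c < real N")
      case True
      obtain C where "0 \<le> C" "\<And>\<xi>. (\<And>i. i < N \<Longrightarrow> \<xi> i \<in> {1, -1}) \<Longrightarrow>
        (\<integral>\<^sup>+x. ennreal (majorant N (c / real N) \<xi> x) \<partial>P N) \<le> ennreal C"
        using fixed_N_bound[of "c / real N" N] True c by auto
      then show ?thesis by auto
    qed auto
  qed
  then obtain CN where CN: "\<And>N. 0 \<le> CN N" "\<And>N \<xi>. 1 \<le> N \<Longrightarrow> c < real N \<Longrightarrow> (\<And>i. i < N \<Longrightarrow> \<xi> i \<in> {1, -1}) \<Longrightarrow>
    (\<integral>\<^sup>+x. ennreal (majorant N (c / real N) \<xi> x) \<partial>P N) \<le> ennreal (CN N)"
    by (subst (asm) choice_iff) blast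
  define C where "C = C1 + (\<Sum>N<N1. CN N)"
  have "(\<integral>\<^sup>+x. ennreal (majorant N (c / real N) \<xi> x) \<partial>P N) \<le> ennreal C"
    if N: "1 \<le> N" "\<beta> < 2 * pi * real N" and xi: "\<And>i. i < N \<Longrightarrow> \<xi> i \<in> {1, -1}" and neu: "(\<Sum>i<N. \<xi> i) = 0" for N \<xi>
  proof (cases "N1 \<le> N")
    case True
    show ?thesis by (rule order_trans[OF B[OF True xi neu] ennreal_leI]) (auto simp: C_def intro!: sum_nonneg CN(1))
  next
    case False
    have "c < real N" using N by (simp add: c_def field_simps)
    moreover have "CN N \<le> C" unfolding C_def using False C1 CN(1)
      by (intro order_trans[OF member_le_sum[of N "{..<N1}" CN]]) auto
    ultimately show ?thesis by (intro order_trans[OF CN(2)[OF N(1) _ xi] ennreal_leI])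
  qed
  moreover have "0 \<le> C" unfolding C_def using C1 CN(1) by (intro add_nonneg_nonneg sum_nonneg) auto
  ultimately show thesis using that unfolding c_def by blast
qed

end

section \<open>The fourth moment\<close>

lemma power4_sum4_le: "(a - b + c + d) ^ 4 \<le> 64 * (a ^ 4 + b ^ 4 + c ^ 4 + (d::real) ^ 4)"
proof -
  have "(\<Sum>i<4::nat. (1/4) *\<^sub>R ([a, - b, c, d] ! i)) ^ 4 \<le> (\<Sum>i<4::nat. (1/4) * ([a, - b, c, d] ! i) ^ 4)"
    by (rule convex_on_sum[OF _ _ convex_power_even]) (auto simp: lessThan_empty_iff)
  then have "((a - b + c + d) / 4) ^ 4 \<le> (a ^ 4 + b ^ 4 + c ^ 4 + d ^ 4) / 4"
    by (simp add: eval_nat_numeral lessThan_Suc add_divide_distrib diff_divide_distrib algebra_simps)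
  then show ?thesis by (simp add: power_divide)
qed

context prob_space
begin

lemma expectation_power4_le:
  fixes f :: "'a \<Rightarrow> real"
  assumes "f \<in> borel_measurable M" "\<And>x. x \<in> space M \<Longrightarrow> \<bar>f x\<bar> \<le> B"
  shows "ennreal ((\<integral>x. f x \<partial>M) ^ 4) \<le> (\<integral>\<^sup>+x. ennreal (f x ^ 4) \<partial>M)"
proof -
  have i4: "integrable M (\<lambda>x. f x ^ 4)"
  proof (rule integrable_bounded[of _ "B ^ 4"])
    fix x assume "x \<in> space M"
    then have "\<bar>f x\<bar> ^ 4 \<le> B ^ 4" by (intro power_mono assms) auto
    then show "\<bar>f x ^ 4\<bar> \<le> B ^ 4" by (simp only: power_abs)
  qed (use assms(1) in measurable)
  have i1: "integrable M f" by (rule integrable_bounded[OF assms])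
  have "(\<integral>x. f x \<partial>M) ^ 4 \<le> (\<integral>x. f x ^ 4 \<partial>M)"
    by (rule jensens_inequality[where I = UNIV]) (use i1 i4 in \<open>auto intro: convex_power_even\<close>)
  then have "ennreal ((\<integral>x. f x \<partial>M) ^ 4) \<le> ennreal (\<integral>x. f x ^ 4 \<partial>M)" by (rule ennreal_leI)
  also have "\<dots> = (\<integral>\<^sup>+x. ennreal (f x ^ 4) \<partial>M)"
    by (rule nn_integral_eq_integral[symmetric, OF i4]) (simp add: zero_le_even_power)
  finally show ?thesis .
qed

text \<open>Hoeffding's lemma with \<open>t = 1 / (s * sqrt N)\<close> gives the factor
  \<open>exp (1 / (2 * N))\<close> per particle, hence bounded exponential moments for
  \<open>h\<close> and \<open>- h\<close>; the Taylor term of order four of \<open>cosh\<close> then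
  controls the fourth moment.\<close>

lemma fourth_moment_average:
  fixes h :: "'a \<Rightarrow> real"
  assumes h: "h \<in> borel_measurable M" "\<And>x. x \<in> space M \<Longrightarrow> \<bar>h x\<bar> \<le> s" and s: "0 \<le> s"
    and h0: "(\<integral>x. h x \<partial>M) = 0" and N: "1 \<le> N"
  shows "(\<integral>\<^sup>+x. ennreal ((1 / real N * (\<Sum>i<N. h (x i))) ^ 4) \<partial>PiM {..<N} (\<lambda>_. M)) \<le> ennreal (48 * s ^ 4 / (real N)\<^sup>2)"
proof (cases "s = 0")
  case True
  have "(\<integral>\<^sup>+x. ennreal ((1 / real N * (\<Sum>i<N. h (x i))) ^ 4) \<partial>PiM {..<N} (\<lambda>_. M)) = (\<integral>\<^sup>+x. 0 \<partial>PiM {..<N} (\<lambda>_. M))"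
    by (intro nn_integral_cong) (use h(2) True in \<open>auto simp: space_PiM PiE_iff\<close>)
  then show ?thesis by simp
next
  case False
  then have s: "0 < s" using s by simp
  interpret P: product_sigma_finite "\<lambda>_. M" by standard
  note h(1)[measurable]
  define t where "t = 1 / (s * sqrt (real N))"
  have t: "0 < t" using s N by (simp add: t_def)
  have t2: "t\<^sup>2 * (s - (- s))\<^sup>2 / 8 = 1 / (2 * real N)" using s N by (simp add: t_def power_divide power_mult_distrib field_simps power2_eq_square)
  have one: "(\<integral>\<^sup>+x. ennreal (exp (t * k x)) \<partial>M) \<le> ennreal (exp (1 / (2 * real N)))"
    if "k \<in> borel_measurable M" "\<And>x. x \<in> space M \<Longrightarrow> \<bar>k x\<bar> \<le> s" "(\<integral>x. k x \<partial>M) = 0" for k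
  proof -
    interpret interval_bounded_random_variable M k "- s" s
      by unfold_locales (use that in \<open>auto intro!: AE_I2 simp: abs_le_iff\<close>, force)
    from Hoeffdings_lemma_nn_integral_0[OF t that(3)] show ?thesis unfolding t2 .
  qed
  have prod: "(\<integral>\<^sup>+x. ennreal (exp (t * (\<Sum>i<N. k (x i)))) \<partial>PiM {..<N} (\<lambda>_. M)) \<le> 2"
    if k: "k \<in> borel_measurable M" "\<And>x. x \<in> space M \<Longrightarrow> \<bar>k x\<bar> \<le> s" "(\<integral>x. k x \<partial>M) = 0" for k
  proof -
    note k(1)[measurable]
    have "(\<integral>\<^sup>+x. ennreal (exp (t * (\<Sum>i<N. k (x i)))) \<partial>PiM {..<N} (\<lambda>_. M))
      = (\<integral>\<^sup>+x. (\<Prod>i<N. ennreal (exp (t * k (x i)))) \<partial>PiM {..<N} (\<lambda>_. M))"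
      by (simp add: prod_ennreal sum_distrib_left exp_sum)
    also have "\<dots> = (\<Prod>i<N. \<integral>\<^sup>+y. ennreal (exp (t * k y)) \<partial>M)" by (rule P.product_nn_integral_prod) auto
    also have "\<dots> \<le> (\<Prod>i<N. ennreal (exp (1 / (2 * real N))))" by (intro prod_mono_ennreal one k)
    also have "\<dots> = ennreal (exp (1 / (2 * real N)) ^ N)" by (simp only: prod_constant card_lessThan) (rule ennreal_power, simp)
    also have "exp (1 / (2 * real N)) ^ N = exp (1 / 2)" using N by (simp flip: exp_of_nat_mult)
    also have "ennreal (exp (1 / 2)) \<le> ennreal 2"
      using exp_bound[of "1 / 2 :: real"] by (intro ennreal_leI) (simp add: power2_eq_square)
    finally show ?thesis by simp
  qed
  define c where "c = 24 * s ^ 4 / (real N)\<^sup>2"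
  have c: "0 \<le> c" by (simp add: c_def)
  have pt: "ennreal ((1 / real N * (\<Sum>i<N. h (x i))) ^ 4) \<le>
     ennreal (c / 2) * (ennreal (exp (t * (\<Sum>i<N. h (x i)))) + ennreal (exp (t * (\<Sum>i<N. - h (x i)))))" for x
  proof -
    define S where "S = (\<Sum>i<N. h (x i))"
    have t4: "t ^ 4 = 1 / (s ^ 4 * (real N)\<^sup>2)"
    proof -
      have "sqrt (real N) ^ 4 = (real N)\<^sup>2" by (simp add: power4_eq_xxxx power2_eq_square)
      then show ?thesis by (simp add: t_def power_divide power_mult_distrib)
    qed
    have "(1 / real N * S) ^ 4 = c * ((t * S) ^ 4 / 24)"
    proof -
      have "(1 / real N * S) ^ 4 = S ^ 4 / ((real N)\<^sup>2)\<^sup>2" by (simp add: power_divide flip: power_mult)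
      also have "\<dots> = c * ((t * S) ^ 4 / 24)"
        unfolding power_mult_distrib[of t] t4 c_def using s N by (simp add: power2_eq_square)
      finally show ?thesis .
    qed
    also have "(t * S) ^ 4 / 24 \<le> cosh (t * S)" using power_over_fact_le_cosh[of "t * S" 2] by (simp add: eval_nat_numeral)
    then have "c * ((t * S) ^ 4 / 24) \<le> c * cosh (t * S)" by (intro mult_left_mono c)
    also have "\<dots> = c / 2 * (exp (t * S) + exp (t * (- S)))" by (simp add: cosh_field_def)
    finally have "ennreal ((1 / real N * S) ^ 4) \<le> ennreal (c / 2 * (exp (t * S) + exp (t * (- S))))" by (rule ennreal_leI)
    also have "\<dots> = ennreal (c / 2) * (ennreal (exp (t * S)) + ennreal (exp (t * (- S))))"
    proof -
      have e: "ennreal (exp (t * S)) + ennreal (exp (t * (- S))) = ennreal (exp (t * S) + exp (t * (- S)))"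
        by (rule ennreal_plus[symmetric]) auto
      show ?thesis unfolding e by (rule ennreal_mult) (use c in auto)
    qed
    finally show ?thesis by (simp add: S_def sum_negf)
  qed
  have "(\<integral>\<^sup>+x. ennreal ((1 / real N * (\<Sum>i<N. h (x i))) ^ 4) \<partial>PiM {..<N} (\<lambda>_. M))
    \<le> (\<integral>\<^sup>+x. ennreal (c / 2) * (ennreal (exp (t * (\<Sum>i<N. h (x i)))) + ennreal (exp (t * (\<Sum>i<N. - h (x i))))) \<partial>PiM {..<N} (\<lambda>_. M))"
    by (rule nn_integral_mono) (rule pt)
  also have "\<dots> = ennreal (c / 2) * ((\<integral>\<^sup>+x. ennreal (exp (t * (\<Sum>i<N. h (x i)))) \<partial>PiM {..<N} (\<lambda>_. M)) + (\<integral>\<^sup>+x. ennreal (exp (t * (\<Sum>i<N. - h (x i)))) \<partial>PiM {..<N} (\<lambda>_. M)))"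
    by (subst nn_integral_cmult, measurable, subst nn_integral_add) auto
  also have "\<dots> \<le> ennreal (c / 2) * (2 + 2)"
    using prod[OF h h0] prod[of "\<lambda>x. - h x"] h h0 by (intro mult_left_mono add_mono) auto
  also have "\<dots> = ennreal (c / 2 * 4)" using c by (subst ennreal_mult) auto
  finally show ?thesis by (simp add: c_def)
qed

end

context vortex_domain
begin

text \<open>The degenerate part of \<open>w\<close> is treated as a chaos with \<open>k = 2\<close>,
  and the means \<open>b\<close> and \<open>m\<close> by Jensen's inequality, so that only the
  integral of the fourth power of \<open>w\<close> enters. The function \<open>h\<close> stands for
  the diagonal of the double sum; having mean zero, it averages out at the rate of independent
  variables.\<close>

lemma fourth_moment_bound:
  fixes w :: "real^2 \<Rightarrow> real^2 \<Rightarrow> real" and h :: "real^2 \<Rightarrow> real"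
  assumes wm: "(\<lambda>z. w (fst z) (snd z)) \<in> borel_measurable (M \<Otimes>\<^sub>M M)"
    and wB: "\<And>x y. x \<in> D \<Longrightarrow> y \<in> D \<Longrightarrow> \<bar>w x y\<bar> \<le> B"
    and wsym: "\<And>x y. w x y = w y x"
    and h: "h \<in> borel_measurable M" "\<And>x. x \<in> D \<Longrightarrow> \<bar>h x\<bar> \<le> s" "0 \<le> s"
    and h0: "(\<integral>x. h x \<partial>M) = 0" and N: "1 \<le> N"
    and xi: "\<And>i. i < N \<Longrightarrow> \<xi> i \<in> {1, -1}" and neu: "(\<Sum>i<N. \<xi> i) = 0"
    and Q: "(\<integral>\<^sup>+x. (\<integral>\<^sup>+y. ennreal (w x y ^ 4) \<partial>M) \<partial>M) \<le> ennreal Q" "0 \<le> Q"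
  shows "(\<integral>\<^sup>+x. ennreal ((2 / real N * pairsum N \<xi> w x + 1 / real N * (\<Sum>i<N. h (x i))) ^ 4) \<partial>P N)
     \<le> ennreal (10 ^ 11 * (Q + s ^ 4 / (real N)\<^sup>2))"
proof -
  interpret PP: prob_space "P N" by (rule prob_space_P)
  have wx: "w x \<in> borel_measurable M" if "x \<in> D" for x
    using measurable_compose[OF measurable_Pair1' wm] that by (simp add: space_M)
  have wint: "integrable M (w x)" if "x \<in> D" for x
    by (rule integrable_bounded[OF wx[OF that]]) (use wB that in \<open>auto simp: space_M\<close>)
  define b where "b x = (\<integral>y. w x y \<partial>M)" for x
  have bm[measurable]: "b \<in> borel_measurable M"
    unfolding b_def using wm by (intro borel_measurable_lebesgue_integral) (simp add: split_def)
  have B: "\<bar>b x\<bar> \<le> B" if "x \<in> D" for x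
  proof -
    have "\<bar>b x\<bar> \<le> (\<integral>y. \<bar>w x y\<bar> \<partial>M)" unfolding b_def by (rule integral_abs_bound)
    also have "\<dots> \<le> (\<integral>y. B \<partial>M)" using wint[OF that] wB that by (intro integral_mono) (auto simp: space_M)
    finally show ?thesis by (simp add: prob_space)
  qed
  have bint: "integrable M b" by (rule integrable_bounded[OF bm]) (use B in \<open>auto simp: space_M\<close>)
  define m where "m = (\<integral>x. b x \<partial>M)"
  have b4: "ennreal (b x ^ 4) \<le> (\<integral>\<^sup>+y. ennreal (w x y ^ 4) \<partial>M)" if "x \<in> D" for x
    unfolding b_def by (rule expectation_power4_le[OF wx[OF that]]) (use wB that in \<open>auto simp: space_M\<close>)
  have b4I: "(\<integral>\<^sup>+x. ennreal (b x ^ 4) \<partial>M) \<le> ennreal Q"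
    by (rule order_trans[OF nn_integral_mono Q(1)]) (use b4 in \<open>auto simp: space_M\<close>)
  have "ennreal (m ^ 4) \<le> (\<integral>\<^sup>+x. ennreal (b x ^ 4) \<partial>M)"
    unfolding m_def by (rule expectation_power4_le[OF bm]) (use B in \<open>auto simp: space_M\<close>)
  then have "ennreal (m ^ 4) \<le> ennreal Q" using b4I by (rule order_trans)
  then have m4: "m ^ 4 \<le> Q" using Q(2) by (simp add: ennreal_le_iff)
  have mB: "\<bar>m\<bar> \<le> B"
  proof -
    have "\<bar>m\<bar> \<le> (\<integral>x. \<bar>b x\<bar> \<partial>M)" unfolding m_def by (rule integral_abs_bound)
    also have "\<dots> \<le> (\<integral>x. B \<partial>M)" using bint B by (intro integral_mono) (auto simp: space_M)
    finally show ?thesis by (simp add: prob_space)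
  qed
  define w0 where "w0 x y = w x y - b x - b y + m" for x y
  have w0m: "(\<lambda>z. w0 (fst z) (snd z)) \<in> borel_measurable (M \<Otimes>\<^sub>M M)"
    unfolding w0_def using wm measurable_compose[OF measurable_fst bm] measurable_compose[OF measurable_snd bm] by measurable
  have w0B: "\<bar>w0 x y\<bar> \<le> 4 * B" if "x \<in> D" "y \<in> D" for x y
    using wB[OF that] B[OF that(1)] B[OF that(2)] mB unfolding w0_def by linarith
  have w0s: "w0 x y = w0 y x" for x y by (simp add: w0_def wsym[of x y])
  have w00: "(\<integral>y. w0 x y \<partial>M) = 0" if "x \<in> D" for x
    unfolding w0_def using wint[OF that] bint by (simp add: prob_space b_def[symmetric] m_def[symmetric])
  have wm4: "(\<lambda>x. \<integral>\<^sup>+y. ennreal (w x y ^ 4) \<partial>M) \<in> borel_measurable M"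
    using wm by (intro borel_measurable_nn_integral) (simp add: split_def)
  have w04I: "(\<integral>\<^sup>+x. (\<integral>\<^sup>+y. ennreal (w0 x y ^ 4) \<partial>M) \<partial>M) \<le> ennreal (256 * Q)"
  proof -
    have "(\<integral>\<^sup>+x. (\<integral>\<^sup>+y. ennreal (w0 x y ^ 4) \<partial>M) \<partial>M)
      \<le> (\<integral>\<^sup>+x. ennreal 64 * ((\<integral>\<^sup>+y. ennreal (w x y ^ 4) \<partial>M) + ennreal (b x ^ 4) + (ennreal Q + ennreal Q)) \<partial>M)"
    proof (rule nn_integral_mono)
      fix x assume "x \<in> space M"
      then have x: "x \<in> D" by (simp add: space_M)
      note wx[OF x, measurable]
      have "(\<integral>\<^sup>+y. ennreal (w0 x y ^ 4) \<partial>M) \<le> (\<integral>\<^sup>+y. ennreal 64 * (ennreal (w x y ^ 4) + ennreal (b x ^ 4) + ennreal (b y ^ 4) + ennreal (m ^ 4)) \<partial>M)"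
      proof (rule nn_integral_mono)
        fix y
        have "w0 x y ^ 4 \<le> 64 * (w x y ^ 4 + b x ^ 4 + b y ^ 4 + m ^ 4)"
          using power4_sum4_le[of "w x y" "b x" "- b y" m] by (simp add: w0_def)
        then have "ennreal (w0 x y ^ 4) \<le> ennreal (64 * (w x y ^ 4 + b x ^ 4 + b y ^ 4 + m ^ 4))" by (rule ennreal_leI)
        also have "\<dots> = ennreal 64 * (ennreal (w x y ^ 4) + ennreal (b x ^ 4) + ennreal (b y ^ 4) + ennreal (m ^ 4))"
          by (subst ennreal_mult) (auto simp: zero_le_even_power ennreal_plus)
        finally show "ennreal (w0 x y ^ 4) \<le> ennreal 64 * (ennreal (w x y ^ 4) + ennreal (b x ^ 4) + ennreal (b y ^ 4) + ennreal (m ^ 4))" .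
      qed
      also have "\<dots> = ennreal 64 * ((\<integral>\<^sup>+y. ennreal (w x y ^ 4) \<partial>M) + ennreal (b x ^ 4) + (\<integral>\<^sup>+y. ennreal (b y ^ 4) \<partial>M) + ennreal (m ^ 4))"
        by (subst nn_integral_cmult, measurable) (simp add: nn_integral_add emeasure_space_1)
      also have "\<dots> \<le> ennreal 64 * ((\<integral>\<^sup>+y. ennreal (w x y ^ 4) \<partial>M) + ennreal (b x ^ 4) + ennreal Q + ennreal Q)"
        using b4I m4 by (intro mult_left_mono add_mono) (auto intro: ennreal_leI)
      finally show "(\<integral>\<^sup>+y. ennreal (w0 x y ^ 4) \<partial>M) \<le> ennreal 64 * ((\<integral>\<^sup>+y. ennreal (w x y ^ 4) \<partial>M) + ennreal (b x ^ 4) + (ennreal Q + ennreal Q))"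
        by (simp add: add.assoc)
    qed
    also have "\<dots> = ennreal 64 * ((\<integral>\<^sup>+x. (\<integral>\<^sup>+y. ennreal (w x y ^ 4) \<partial>M) \<partial>M) + (\<integral>\<^sup>+x. ennreal (b x ^ 4) \<partial>M) + (ennreal Q + ennreal Q))"
      using wm4 by (subst nn_integral_cmult, measurable) (simp add: nn_integral_add emeasure_space_1)
    also have "\<dots> \<le> ennreal 64 * (ennreal Q + ennreal Q + (ennreal Q + ennreal Q))"
      by (intro mult_left_mono add_mono Q(1) b4I) auto
    also have "\<dots> = ennreal (64 * (Q + Q + (Q + Q)))"
    proof -
      have "ennreal Q + ennreal Q + (ennreal Q + ennreal Q) = ennreal (Q + Q + (Q + Q))"
        using Q(2) by (simp only: ennreal_plus add_nonneg_nonneg)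
      then show ?thesis using Q(2) by (simp only:) (rule ennreal_mult[symmetric], auto)
    qed
    also have "64 * (Q + Q + (Q + Q)) = 256 * Q" by simp
    finally show ?thesis .
  qed
  have i4: "integrable (P N) (\<lambda>x. pairsum N \<xi> w0 x ^ 4)"
    by (rule integrable_pairsum_power[OF w0m, of "4 * B"]) (use w0B w0s in \<open>auto simp: space_M\<close>)
  define S where "S x = (\<Sum>i<N. \<Sum>j\<in>{..<N} - {i}. (w0 (x i) (x j))\<^sup>2)" for x
  have Sm: "S \<in> borel_measurable (P N)"
    unfolding S_def by (intro borel_measurable_sum borel_measurable_power measurable_pair_P[OF w0m]) auto
  have S0: "0 \<le> S x" for x by (simp add: S_def sum_nonneg)
  \<comment> \<open>Jensen's inequality twice, over the rows and within a row; setting the diagonal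
    of \<open>y\<close> to zero lets both averages run over all \<open>N\<close> indices.\<close>
  have avg: "(1 / (real N)\<^sup>2 * S x)\<^sup>2 \<le> 1 / (real N)\<^sup>2 * (\<Sum>i<N. \<Sum>j\<in>{..<N} - {i}. w0 (x i) (x j) ^ 4)" for x
  proof -
    define y where "y i j = (if i = j then 0 else (w0 (x i) (x j))\<^sup>2)" for i j
    have ys: "(\<Sum>j<N. y i j ^ n) = (\<Sum>j\<in>{..<N} - {i}. ((w0 (x i) (x j))\<^sup>2) ^ n)" if "i < N" "0 < n" for i n
    proof -
      have "(\<Sum>j<N. y i j ^ n) = (\<Sum>j\<in>{..<N} - {i}. y i j ^ n)"
        by (rule sum.mono_neutral_right) (use that in \<open>auto simp: y_def\<close>)
      also have "\<dots> = (\<Sum>j\<in>{..<N} - {i}. ((w0 (x i) (x j))\<^sup>2) ^ n)"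
        by (rule sum.cong) (auto simp: y_def)
      finally show ?thesis .
    qed
    have "1 / (real N)\<^sup>2 * S x = 1 / real N * (\<Sum>i<N. 1 / real N * (\<Sum>j<N. y i j))"
      using ys[of _ 1] by (simp add: S_def power2_eq_square flip: sum_divide_distrib)
    then have "(1 / (real N)\<^sup>2 * S x)\<^sup>2 \<le> 1 / real N * (\<Sum>i<N. (1 / real N * (\<Sum>j<N. y i j))\<^sup>2)"
      using power_average_le[of N "\<lambda>i. 1 / real N * (\<Sum>j<N. y i j)" 2] N by (simp add: y_def sum_nonneg)
    also have "\<dots> \<le> 1 / real N * (\<Sum>i<N. 1 / real N * (\<Sum>j<N. (y i j)\<^sup>2))"
      by (intro mult_left_mono sum_mono power_average_le N) (auto simp: y_def)
    also have "\<dots> = 1 / (real N)\<^sup>2 * (\<Sum>i<N. \<Sum>j\<in>{..<N} - {i}. ((w0 (x i) (x j))\<^sup>2)\<^sup>2)"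
      using ys[of _ 2] by (simp add: power2_eq_square flip: sum_divide_distrib)
    finally show ?thesis by (simp flip: power_mult)
  qed
  have pair4: "(\<integral>\<^sup>+x. ennreal (1 / (real N)\<^sup>2 * (\<Sum>i<N. \<Sum>j\<in>{..<N} - {i}. w0 (x i) (x j) ^ 4)) \<partial>P N) \<le> ennreal (256 * Q)"
  proof -
    have m4: "(\<lambda>z. ennreal (w0 (fst z) (snd z) ^ 4)) \<in> borel_measurable (M \<Otimes>\<^sub>M M)" using w0m by measurable
    have each: "(\<integral>\<^sup>+x. ennreal (w0 (x i) (x j) ^ 4) \<partial>P N) \<le> ennreal (256 * Q)" if "i < N" "j < N" "i \<noteq> j" for i j
    proof -
      have "(\<integral>\<^sup>+x. ennreal (w0 (x i) (x j) ^ 4) \<partial>P N) = (\<integral>\<^sup>+u. (\<integral>\<^sup>+y. ennreal (w0 y u ^ 4) \<partial>M) \<partial>M)"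
        by (rule nn_integral_pair_component[OF _ _ _ _ m4]) (use that in auto)
      also have "\<dots> = (\<integral>\<^sup>+u. (\<integral>\<^sup>+y. ennreal (w0 u y ^ 4) \<partial>M) \<partial>M)" by (subst w0s) simp
      finally show ?thesis using w04I by simp
    qed
    have "(\<integral>\<^sup>+x. ennreal (1 / (real N)\<^sup>2 * (\<Sum>i<N. \<Sum>j\<in>{..<N} - {i}. w0 (x i) (x j) ^ 4)) \<partial>P N)
      = (\<integral>\<^sup>+x. ennreal (1 / (real N)\<^sup>2) * (\<Sum>i<N. \<Sum>j\<in>{..<N} - {i}. ennreal (w0 (x i) (x j) ^ 4)) \<partial>P N)"
    proof (rule nn_integral_cong)
      fix x
      have "(\<Sum>i<N. \<Sum>j\<in>{..<N} - {i}. ennreal (w0 (x i) (x j) ^ 4)) = ennreal (\<Sum>i<N. \<Sum>j\<in>{..<N} - {i}. w0 (x i) (x j) ^ 4)"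
        by (simp add: sum_ennreal sum_nonneg zero_le_even_power)
      then show "ennreal (1 / (real N)\<^sup>2 * (\<Sum>i<N. \<Sum>j\<in>{..<N} - {i}. w0 (x i) (x j) ^ 4))
        = ennreal (1 / (real N)\<^sup>2) * (\<Sum>i<N. \<Sum>j\<in>{..<N} - {i}. ennreal (w0 (x i) (x j) ^ 4))"
        by (simp only:) (rule ennreal_mult, auto intro!: sum_nonneg simp: zero_le_even_power)
    qed
    also have "\<dots> = ennreal (1 / (real N)\<^sup>2) * (\<Sum>i<N. \<Sum>j\<in>{..<N} - {i}. \<integral>\<^sup>+x. ennreal (w0 (x i) (x j) ^ 4) \<partial>P N)"
    proof -
      have mm: "(\<lambda>x. ennreal (w0 (x i) (x j) ^ 4)) \<in> borel_measurable (P N)" if "i < N" "j < N" for i j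
        using measurable_pair_P[OF w0m that] by measurable
      have "(\<integral>\<^sup>+x. (\<Sum>i<N. \<Sum>j\<in>{..<N} - {i}. ennreal (w0 (x i) (x j) ^ 4)) \<partial>P N)
         = (\<Sum>i<N. \<integral>\<^sup>+x. (\<Sum>j\<in>{..<N} - {i}. ennreal (w0 (x i) (x j) ^ 4)) \<partial>P N)"
        by (rule nn_integral_sum, intro borel_measurable_sum mm) auto
      also have "\<dots> = (\<Sum>i<N. \<Sum>j\<in>{..<N} - {i}. \<integral>\<^sup>+x. ennreal (w0 (x i) (x j) ^ 4) \<partial>P N)"
        by (intro sum.cong refl nn_integral_sum mm) auto
      finally show ?thesis
        by (subst nn_integral_cmult, intro borel_measurable_sum mm) auto
    qed
    also have "\<dots> \<le> ennreal (1 / (real N)\<^sup>2) * (\<Sum>i<N. \<Sum>j\<in>{..<N} - {i}. ennreal (256 * Q))"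
      using each by (intro mult_left_mono sum_mono) auto
    also have "\<dots> \<le> ennreal (1 / (real N)\<^sup>2) * (\<Sum>i<N. \<Sum>j<N. ennreal (256 * Q))"
      by (intro mult_left_mono sum_mono sum_mono2) auto
    also have "\<dots> = ennreal (1 / (real N)\<^sup>2) * ennreal (\<Sum>i<N. \<Sum>j<N. 256 * Q)"
      using Q(2) by (subst sum_ennreal, simp, subst sum_ennreal) auto
    also have "\<dots> = ennreal (1 / (real N)\<^sup>2 * (\<Sum>i<N. \<Sum>j<N. 256 * Q))"
      using Q(2) by (intro ennreal_mult[symmetric]) auto
    also have "1 / (real N)\<^sup>2 * (\<Sum>i<N. \<Sum>j<N. 256 * Q) = 256 * Q" using N by (simp add: power2_eq_square)
    finally show ?thesis .
  qed
  \<comment> \<open>The constant is \<open>16 * 48 * 4096 * 256\<close>: the fourth power of the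
    prefactor \<open>2\<close>, the factor \<open>2 * fact 4\<close>, the square of
    \<open>64\<close>, and the loss from \<open>w\<close> to \<open>w0\<close>.\<close>
  have Apart: "(\<integral>\<^sup>+x. ennreal ((2 / real N * pairsum N \<xi> w0 x) ^ 4) \<partial>P N) \<le> ennreal (805306368 * Q)"
  proof -
    have Sbnd: "S x \<le> (\<Sum>i<N. \<Sum>j\<in>{..<N} - {i}. (4 * B)\<^sup>2)" if "x \<in> space (P N)" for x
      unfolding S_def
    proof (intro sum_mono)
      fix i j assume "i \<in> {..<N}" "j \<in> {..<N} - {i}"
      then have "\<bar>w0 (x i) (x j)\<bar> \<le> \<bar>4 * B\<bar>"
        using order_trans[OF w0B abs_ge_self] space_P_D[OF that] by auto
      then show "(w0 (x i) (x j))\<^sup>2 \<le> (4 * B)\<^sup>2" by (simp only: abs_le_square_iff)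
    qed
    have S2i: "integrable (P N) (\<lambda>x. (64 * S x)\<^sup>2)"
    proof (rule PP.integrable_bounded)
      fix x assume "x \<in> space (P N)"
      then have "64 * S x \<le> 64 * (\<Sum>i<N. \<Sum>j\<in>{..<N} - {i}. (4 * B)\<^sup>2)" by (intro mult_left_mono Sbnd) auto
      then have "(64 * S x)\<^sup>2 \<le> (64 * (\<Sum>i<N. \<Sum>j\<in>{..<N} - {i}. (4 * B)\<^sup>2))\<^sup>2"
        by (rule power_mono) (simp add: S0)
      then show "\<bar>(64 * S x)\<^sup>2\<bar> \<le> (64 * (\<Sum>i<N. \<Sum>j\<in>{..<N} - {i}. (4 * B)\<^sup>2))\<^sup>2" by (simp only: abs_power2)
    qed (use Sm in measurable)
    have "(\<integral>\<^sup>+x. ennreal ((64 * S x)\<^sup>2) \<partial>P N) \<le> (\<integral>\<^sup>+x. ennreal (4096 * real N ^ 4) * ennreal (1 / (real N)\<^sup>2 * (\<Sum>i<N. \<Sum>j\<in>{..<N} - {i}. w0 (x i) (x j) ^ 4)) \<partial>P N)"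
    proof (rule nn_integral_mono)
      fix x
      have "(64 * S x)\<^sup>2 = 4096 * real N ^ 4 * (1 / (real N)\<^sup>2 * S x)\<^sup>2"
        using N by (simp add: power_mult_distrib power_divide flip: power_mult)
      also have "\<dots> \<le> 4096 * real N ^ 4 * (1 / (real N)\<^sup>2 * (\<Sum>i<N. \<Sum>j\<in>{..<N} - {i}. w0 (x i) (x j) ^ 4))"
        by (intro mult_left_mono avg) auto
      finally show "ennreal ((64 * S x)\<^sup>2) \<le> ennreal (4096 * real N ^ 4) * ennreal (1 / (real N)\<^sup>2 * (\<Sum>i<N. \<Sum>j\<in>{..<N} - {i}. w0 (x i) (x j) ^ 4))"
        by (subst ennreal_mult[symmetric]) (auto intro!: ennreal_leI divide_nonneg_nonneg sum_nonneg simp: zero_le_even_power)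
    qed
    also have "\<dots> = ennreal (4096 * real N ^ 4) * (\<integral>\<^sup>+x. ennreal (1 / (real N)\<^sup>2 * (\<Sum>i<N. \<Sum>j\<in>{..<N} - {i}. w0 (x i) (x j) ^ 4)) \<partial>P N)"
      by (rule nn_integral_cmult)
        (intro measurable_compose[OF _ measurable_ennreal] borel_measurable_times borel_measurable_const borel_measurable_sum
          borel_measurable_power measurable_pair_P[OF w0m]; auto)
    also have "\<dots> \<le> ennreal (4096 * real N ^ 4) * ennreal (256 * Q)" by (intro mult_left_mono pair4) auto
    also have "\<dots> = ennreal (4096 * real N ^ 4 * (256 * Q))" using Q(2) by (intro ennreal_mult[symmetric]) auto
    finally have "ennreal (\<integral>x. (64 * S x)\<^sup>2 \<partial>P N) \<le> ennreal (4096 * real N ^ 4 * (256 * Q))"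
      using S2i by (subst nn_integral_eq_integral[symmetric]) auto
    then have SI: "(\<integral>x. (64 * S x)\<^sup>2 \<partial>P N) \<le> 4096 * real N ^ 4 * (256 * Q)" using Q(2) by (simp add: ennreal_le_iff)
    have "(\<integral>x. pairsum N \<xi> w0 x ^ (2 * 2) \<partial>P N) \<le> 2 * fact (2 * 2) * (\<integral>x. (64 * S x) ^ 2 \<partial>P N)"
      unfolding S_def
      by (rule pairsum_moment[OF w0m, of "4 * B"]) (use w0B w0s w00 xi in \<open>auto simp: space_M\<close>)
    moreover have "2 * fact (2 * 2) = (48 :: real)" by (simp add: fact_numeral)
    ultimately have pm: "(\<integral>x. pairsum N \<xi> w0 x ^ 4 \<partial>P N) \<le> 48 * (\<integral>x. (64 * S x) ^ 2 \<partial>P N)" by simp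
    have "(\<integral>x. pairsum N \<xi> w0 x ^ 4 \<partial>P N) \<le> 48 * (4096 * real N ^ 4 * (256 * Q))"
      by (rule order_trans[OF pm mult_left_mono[OF SI]]) simp
    then have "16 / real N ^ 4 * (\<integral>x. pairsum N \<xi> w0 x ^ 4 \<partial>P N) \<le> 16 / real N ^ 4 * (48 * (4096 * real N ^ 4 * (256 * Q)))"
      by (intro mult_left_mono) auto
    then have le: "16 / real N ^ 4 * (\<integral>x. pairsum N \<xi> w0 x ^ 4 \<partial>P N) \<le> 805306368 * Q" using N by simp
    have "(\<integral>\<^sup>+x. ennreal ((2 / real N * pairsum N \<xi> w0 x) ^ 4) \<partial>P N) = (\<integral>\<^sup>+x. ennreal (16 / real N ^ 4 * pairsum N \<xi> w0 x ^ 4) \<partial>P N)"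
      by (simp only: power_mult_distrib power_divide) simp
    also have "\<dots> = ennreal (\<integral>x. 16 / real N ^ 4 * pairsum N \<xi> w0 x ^ 4 \<partial>P N)"
      using i4 by (intro nn_integral_eq_integral) (auto simp: zero_le_even_power)
    also have "\<dots> \<le> ennreal (805306368 * Q)" using le by (intro ennreal_leI) simp
    finally show ?thesis .
  qed
  have Bpart: "(\<integral>\<^sup>+x. ennreal ((2 / real N * (\<Sum>i<N. b (x i))) ^ 4) \<partial>P N) \<le> ennreal (16 * Q)"
  proof -
    have "(\<integral>\<^sup>+x. ennreal ((2 / real N * (\<Sum>i<N. b (x i))) ^ 4) \<partial>P N) \<le> (\<integral>\<^sup>+x. ennreal (16 / real N) * (\<Sum>i<N. ennreal (b (x i) ^ 4)) \<partial>P N)"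
    proof (rule nn_integral_mono)
      fix x
      have "(\<Sum>i<N. (1 / real N) *\<^sub>R b (x i)) ^ 4 \<le> (\<Sum>i<N. (1 / real N) * b (x i) ^ 4)"
        by (rule convex_on_sum[OF _ _ convex_power_even]) (use N in \<open>auto simp: lessThan_empty_iff\<close>)
      then have "(1 / real N * (\<Sum>i<N. b (x i))) ^ 4 \<le> 1 / real N * (\<Sum>i<N. b (x i) ^ 4)" by (simp add: sum_distrib_left)
      then have "16 * (1 / real N * (\<Sum>i<N. b (x i))) ^ 4 \<le> 16 * (1 / real N * (\<Sum>i<N. b (x i) ^ 4))" by simp
      moreover have "(2 / real N * (\<Sum>i<N. b (x i))) ^ 4 = 16 * (1 / real N * (\<Sum>i<N. b (x i))) ^ 4"
        by (simp add: power_mult_distrib power_divide)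
      ultimately have "ennreal ((2 / real N * (\<Sum>i<N. b (x i))) ^ 4) \<le> ennreal (16 / real N * (\<Sum>i<N. b (x i) ^ 4))"
        by (intro ennreal_leI) simp
      also have "\<dots> = ennreal (16 / real N) * (\<Sum>i<N. ennreal (b (x i) ^ 4))"
        by (subst ennreal_mult) (auto intro!: sum_nonneg simp: zero_le_even_power sum_ennreal)
      finally show "ennreal ((2 / real N * (\<Sum>i<N. b (x i))) ^ 4) \<le> ennreal (16 / real N) * (\<Sum>i<N. ennreal (b (x i) ^ 4))" .
    qed
    also have "\<dots> = ennreal (16 / real N) * (\<Sum>i<N. \<integral>\<^sup>+x. ennreal (b (x i) ^ 4) \<partial>P N)"
      by (subst nn_integral_cmult, measurable, subst nn_integral_sum) auto
    also have "\<dots> \<le> ennreal (16 / real N) * (\<Sum>i<N. ennreal Q)"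
    proof (intro mult_left_mono sum_mono)
      fix i assume "i \<in> {..<N}"
      then show "(\<integral>\<^sup>+x. ennreal (b (x i) ^ 4) \<partial>P N) \<le> ennreal Q"
        using nn_integral_component[of "{..<N}" i "\<lambda>y. ennreal (b y ^ 4)"] b4I by simp
    qed auto
    also have "\<dots> = ennreal (16 / real N * (\<Sum>i<N. Q))"
      using Q(2) by (subst sum_ennreal, simp, intro ennreal_mult[symmetric]) auto
    also have "16 / real N * (\<Sum>i<N. Q) = 16 * Q" using N by simp
    finally show ?thesis .
  qed
  have Hpart: "(\<integral>\<^sup>+x. ennreal ((1 / real N * (\<Sum>i<N. h (x i))) ^ 4) \<partial>P N) \<le> ennreal (48 * s ^ 4 / (real N)\<^sup>2)"
    by (rule fourth_moment_average) (use h h0 N in \<open>auto simp: space_M\<close>)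
  have psm: "pairsum N \<xi> w0 \<in> borel_measurable (P N)"
    unfolding pairsum_def
    by (intro borel_measurable_sum borel_measurable_times borel_measurable_const measurable_pair_P[OF w0m]) auto
  note h(1)[measurable] psm[measurable]
  have "(\<integral>\<^sup>+x. ennreal ((2 / real N * pairsum N \<xi> w x + 1 / real N * (\<Sum>i<N. h (x i))) ^ 4) \<partial>P N)
    \<le> (\<integral>\<^sup>+x. ennreal 64 * (ennreal ((2 / real N * pairsum N \<xi> w0 x) ^ 4) + ennreal ((2 / real N * (\<Sum>i<N. b (x i))) ^ 4)
        + ennreal Q + ennreal ((1 / real N * (\<Sum>i<N. h (x i))) ^ 4)) \<partial>P N)"
  proof (rule nn_integral_mono)
    fix x
    have "pairsum N \<xi> w x = pairsum N \<xi> w0 x - (\<Sum>i<N. b (x i)) + m * real N / 2"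
      unfolding w0_def[abs_def] by (rule canonical_split[OF xi neu])
    then have "2 / real N * pairsum N \<xi> w x + 1 / real N * (\<Sum>i<N. h (x i)) =
      2 / real N * pairsum N \<xi> w0 x - 2 / real N * (\<Sum>i<N. b (x i)) + m + 1 / real N * (\<Sum>i<N. h (x i))"
      using N by (simp add: field_simps)
    then have "(2 / real N * pairsum N \<xi> w x + 1 / real N * (\<Sum>i<N. h (x i))) ^ 4 \<le>
      64 * ((2 / real N * pairsum N \<xi> w0 x) ^ 4 + (2 / real N * (\<Sum>i<N. b (x i))) ^ 4 + m ^ 4 + (1 / real N * (\<Sum>i<N. h (x i))) ^ 4)"
      by (simp only:) (rule power4_sum4_le)
    also have "\<dots> \<le> 64 * ((2 / real N * pairsum N \<xi> w0 x) ^ 4 + (2 / real N * (\<Sum>i<N. b (x i))) ^ 4 + Q + (1 / real N * (\<Sum>i<N. h (x i))) ^ 4)"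
      using m4 by (intro mult_left_mono add_mono) auto
    finally have "ennreal ((2 / real N * pairsum N \<xi> w x + 1 / real N * (\<Sum>i<N. h (x i))) ^ 4) \<le>
      ennreal (64 * ((2 / real N * pairsum N \<xi> w0 x) ^ 4 + (2 / real N * (\<Sum>i<N. b (x i))) ^ 4 + Q + (1 / real N * (\<Sum>i<N. h (x i))) ^ 4))"
      by (rule ennreal_leI)
    also have "\<dots> = ennreal 64 * (ennreal ((2 / real N * pairsum N \<xi> w0 x) ^ 4) + ennreal ((2 / real N * (\<Sum>i<N. b (x i))) ^ 4)
        + ennreal Q + ennreal ((1 / real N * (\<Sum>i<N. h (x i))) ^ 4))"
    proof -
      have "ennreal (64 * (p + q + Q + r)) = ennreal 64 * (ennreal p + ennreal q + ennreal Q + ennreal r)"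
        if "0 \<le> p" "0 \<le> q" "0 \<le> r" for p q r :: real
      proof -
        have e: "ennreal p + ennreal q + ennreal Q + ennreal r = ennreal (p + q + Q + r)"
          using that Q(2) by (simp only: ennreal_plus add_nonneg_nonneg)
        show ?thesis unfolding e by (rule ennreal_mult) (use that Q(2) in auto)
      qed
      then show ?thesis by (simp only: zero_le_even_power even_numeral)
    qed
    finally show "ennreal ((2 / real N * pairsum N \<xi> w x + 1 / real N * (\<Sum>i<N. h (x i))) ^ 4) \<le>
      ennreal 64 * (ennreal ((2 / real N * pairsum N \<xi> w0 x) ^ 4) + ennreal ((2 / real N * (\<Sum>i<N. b (x i))) ^ 4)
        + ennreal Q + ennreal ((1 / real N * (\<Sum>i<N. h (x i))) ^ 4))" .
  qed
  also have "\<dots> = ennreal 64 * ((\<integral>\<^sup>+x. ennreal ((2 / real N * pairsum N \<xi> w0 x) ^ 4) \<partial>P N) + (\<integral>\<^sup>+x. ennreal ((2 / real N * (\<Sum>i<N. b (x i))) ^ 4) \<partial>P N)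
        + ennreal Q + (\<integral>\<^sup>+x. ennreal ((1 / real N * (\<Sum>i<N. h (x i))) ^ 4) \<partial>P N))"
    by (subst nn_integral_cmult, measurable) (simp add: nn_integral_add PP.emeasure_space_1)
  also have "\<dots> \<le> ennreal 64 * (ennreal (805306368 * Q) + ennreal (16 * Q) + ennreal Q + ennreal (48 * s ^ 4 / (real N)\<^sup>2))"
    by (intro mult_left_mono add_mono Apart Bpart Hpart) auto
  also have "\<dots> = ennreal (64 * (805306368 * Q + 16 * Q + Q + 48 * s ^ 4 / (real N)\<^sup>2))"
  proof -
    have n: "0 \<le> 805306368 * Q" "0 \<le> 16 * Q" "0 \<le> 48 * s ^ 4 / (real N)\<^sup>2" using Q(2) h(3) by auto
    then have e: "ennreal (805306368 * Q) + ennreal (16 * Q) + ennreal Q + ennreal (48 * s ^ 4 / (real N)\<^sup>2) =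
      ennreal (805306368 * Q + 16 * Q + Q + 48 * s ^ 4 / (real N)\<^sup>2)"
      using Q(2) by (simp only: ennreal_plus add_nonneg_nonneg)
    show ?thesis unfolding e by (rule ennreal_mult[symmetric]) (use Q(2) n in auto)
  qed
  also have "\<dots> \<le> ennreal (10 ^ 11 * (Q + s ^ 4 / (real N)\<^sup>2))"
  proof (rule ennreal_leI)
    have "64 * (805306368 * Q + 16 * Q + Q + 48 * z) \<le> 10 ^ 11 * (Q + z)" if "0 \<le> z" for z
      using that Q(2) by simp
    from this[of "s ^ 4 / (real N)\<^sup>2"]
    show "64 * (805306368 * Q + 16 * Q + Q + 48 * s ^ 4 / (real N)\<^sup>2) \<le> 10 ^ 11 * (Q + s ^ 4 / (real N)\<^sup>2)"
      using h(3) by simp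
  qed
  finally show ?thesis .
qed

end

section \<open>The Gibbs measure\<close>

text \<open>\<open>T\<close> and \<open>\<Delta>\<close> are constructed from \<open>D\<close>
  alone, while \<open>g0\<close> supplies the lower bounds for \<open>1 - T\<close>. The remaining
  conclusions hold for every \<open>g\<close>, as the constant of the theorem must not depend on
  it.\<close>

lemma vortex_domain_of_green:
  assumes D: "open D" "convex D" "bounded D" "measure lebesgue D = 1"
    and g0: "green_regular_part D g0"
  obtains T \<Delta> where "vortex_domain D T \<Delta>"
    "\<And>g x y. green_regular_part D g \<Longrightarrow> x \<in> D \<Longrightarrow> y \<in> D \<Longrightarrow> x \<noteq> y \<Longrightarrow> green g x y = - 1 / (4 * pi) * ln (1 - T x y)"
    "\<And>g x. green_regular_part D g \<Longrightarrow> x \<in> D \<Longrightarrow> g x x \<le> 1 / (2 * pi) * ln \<Delta>"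
proof -
  have ne: "D \<noteq> {}" using D(4) by auto
  obtain \<phi> where \<phi>: "continuous_on D \<phi>" "\<And>x. x \<in> D \<Longrightarrow> cmod (\<phi> x) < 1"
    "\<And>x y. x \<in> D \<Longrightarrow> y \<in> D \<Longrightarrow> x \<noteq> y \<Longrightarrow> szego (\<phi> x) (\<phi> y) < 1"
    "\<And>g x y. green_regular_part D g \<Longrightarrow> x \<in> D \<Longrightarrow> y \<in> D \<Longrightarrow> x \<noteq> y \<Longrightarrow>
       green g x y = - 1 / (4 * pi) * ln (1 - szego (\<phi> x) (\<phi> y))"
    using green_conformal[OF D(1-3) ne] by blast
  define T where "T x y = szego (\<phi> x) (\<phi> y)" for x y
  define \<Delta> where "\<Delta> = max 1 (diameter (closure D))"
  have \<Delta>1: "1 \<le> \<Delta>" by (simp add: \<Delta>_def)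
  have \<Delta>: "norm (x - y) \<le> \<Delta>" if "x \<in> closure D" "y \<in> closure D" for x y
    using diameter_bounded_bound[OF bounded_closure[OF D(3)] that] by (simp add: \<Delta>_def dist_norm)
  \<comment> \<open>Through \<open>4 * pi * G = - ln (1 - T)\<close>, an upper bound by
    \<open>ln K\<close> for the regular part becomes a lower bound for \<open>1 - T\<close>. It is
    applied with \<open>K = \<Delta>\<close> and with the half-plane bound.\<close>
  have cmp: "(norm (x - y))\<^sup>2 \<le> K\<^sup>2 * (1 - T x y)"
    if x: "x \<in> D" "y \<in> D" "x \<noteq> y" and K: "0 < K" "g0 x y \<le> 1 / (2 * pi) * ln K" for x y K
  proof -
    have r: "0 < norm (x - y)" using x by simp
    have t: "0 < 1 - T x y" using \<phi>(3)[OF x] by (simp add: T_def)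
    have "- 1 / (4 * pi) * ln (1 - T x y) = - 1 / (2 * pi) * ln (norm (x - y)) + g0 x y"
      using \<phi>(4)[OF g0 x] by (simp add: T_def green_def)
    also have "\<dots> \<le> - 1 / (2 * pi) * ln (norm (x - y)) + 1 / (2 * pi) * ln K" using K by simp
    finally have "2 * ln (norm (x - y)) \<le> 2 * ln K + ln (1 - T x y)" by (simp add: field_simps)
    then have "ln ((norm (x - y))\<^sup>2) \<le> ln (K\<^sup>2 * (1 - T x y))"
      using r K t by (simp add: ln_mult ln_realpow)
    then show ?thesis using r K t by simp
  qed
  have vd: "vortex_domain D T \<Delta>"
  proof
    have "\<phi> \<in> borel_measurable (restrict_space borel D)" by (rule borel_measurable_continuous_on_restrict[OF \<phi>(1)])
    then have m: "\<phi> \<in> borel_measurable (restrict_space lborel D)"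
      by (simp add: measurable_cong_sets[OF sets_restrict_space_cong[OF sets_lborel] refl])
    show "(\<lambda>z. T (fst z) (snd z)) \<in> borel_measurable (restrict_space lborel D \<Otimes>\<^sub>M restrict_space lborel D)"
      unfolding T_def szego_def
      using borel_measurable_continuous_onI[of cnj, OF continuous_on_cnj[OF continuous_on_id]]
        measurable_compose[OF measurable_fst m] measurable_compose[OF measurable_snd m] by measurable
    show "T x y = T y x" for x y by (simp add: T_def szego_sym)
    show "T x x = 1" if "x \<in> D" for x using szego_self \<phi>(2)[OF that] by (simp add: T_def)
    show "0 \<le> T x y \<and> T x y < 1" if "x \<in> D" "y \<in> D" "x \<noteq> y" for x y
      using szego_nonneg[of "\<phi> x" "\<phi> y"] \<phi>(2,3) that by (simp add: T_def)
    show "schur_mult N (\<lambda>i j. T (X i) (X j))" if "\<And>i. i < N \<Longrightarrow> X i \<in> D" for N X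
      unfolding T_def using schur_mult_szego[of N "\<lambda>i. \<phi> (X i)"] \<phi>(2) that by blast
    show "(norm (x - y))\<^sup>2 \<le> \<Delta>\<^sup>2 * (1 - T x y)" if "x \<in> D" "y \<in> D" for x y
    proof (cases "x = y")
      case True
      then show ?thesis using szego_self \<phi>(2) that by (simp add: T_def)
    next
      case False
      show ?thesis
        by (rule cmp[OF that False]) (use \<Delta>1 green_regular_le[OF D(1-3) g0 that \<Delta>] in auto)
    qed
    show "(norm (x - y))\<^sup>2 \<le> (norm (x - y) + 2 * infdist x (frontier D))\<^sup>2 * (1 - T x y)"
      if "x \<in> D" "y \<in> D" "x \<noteq> y" for x y
      by (rule cmp[OF that]) (use that green_regular_le_halfplane[OF D(1-3) g0 that(1,2)] infdist_nonneg[of x "frontier D"] in \<open>auto intro: add_pos_nonneg\<close>)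
  qed (use D \<Delta>1 in auto)
  show thesis
    by (rule that[OF vd]) (use \<phi>(4) green_regular_le[OF D(1-3) _ _ _ \<Delta>] in \<open>auto simp: T_def\<close>)
qed

section \<open>Lower bound for the partition function, and replacement of \<open>f\<close> by Borel
  kernels\<close>

context vortex_domain
begin

lemma L_eq_R: "x \<in> D \<Longrightarrow> y \<in> D \<Longrightarrow> L x y = R 0 x y"
  using R_bounds(4)[of 0 x y] R_diag[of x 0] T_diag[of x] by (cases "x = y") (auto simp: L_def)

text \<open>Every pair of distinct particles has the same expectation \<open>r \<ge> 0\<close>, so
  by neutrality the expected pair sum is \<open>- (N / 2) * r\<close>. Finiteness of
  \<open>r\<close> comes from \<open>L \<le> 1 + L\<^sup>2\<close> and the bound on the square of
  \<open>R 0\<close>.\<close>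

lemma pairsum_L_integral:
  assumes xi: "\<And>i. i < N \<Longrightarrow> \<xi> i \<in> {1, -1}" and neu: "(\<Sum>i<N. \<xi> i) = 0"
  shows "integrable (P N) (pairsum N \<xi> L)" "(\<integral>x. pairsum N \<xi> L x \<partial>P N) \<le> 0"
proof -
  obtain C2 where C2: "0 \<le> C2" "\<And>y. (\<integral>\<^sup>+x. ennreal (norm (x - y) powr (- 1)) \<partial>M) \<le> ennreal C2"
    by (rule nn_integral_norm_powr[of 1]) auto
  define I where "I = (\<integral>\<^sup>+u. (\<integral>\<^sup>+y. ennreal (L y u) \<partial>M) \<partial>M)"
  have L0: "0 \<le> L x y" if "x \<in> D" "y \<in> D" for x y
    using R_bounds(1)[of 0 x y] that by (simp add: L_eq_R)
  have one: "(\<integral>\<^sup>+y. ennreal (L y u) \<partial>M) \<le> ennreal (1 + 16 * \<Delta> * C2)" if u: "u \<in> space M" for u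
  proof -
    have "(\<integral>\<^sup>+y. ennreal (L y u) \<partial>M) \<le> (\<integral>\<^sup>+y. 1 + ennreal (16 * \<Delta>) * ennreal (norm (y - u) powr (- 1)) \<partial>M)"
    proof (rule nn_integral_mono)
      fix y assume "y \<in> space M"
      then have D: "y \<in> D" "u \<in> D" using u by (auto simp: space_M)
      have "L y u \<le> 1 + (L y u)\<^sup>2"
        using zero_le_power2[of "L y u - 1 / 2"] by (simp add: power2_eq_square algebra_simps)
      also have "(L y u)\<^sup>2 \<le> 16 * \<Delta> * norm (y - u) powr (- 1)"
        using R_bounds(2)[of 0 y u] D by (simp add: L_eq_R)
      finally have "ennreal (L y u) \<le> ennreal (1 + 16 * \<Delta> * norm (y - u) powr (- 1))"
        by (intro ennreal_leI) simp
      also have "\<dots> = 1 + ennreal (16 * \<Delta>) * ennreal (norm (y - u) powr (- 1))"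
        using \<Delta> by (subst ennreal_plus) (auto simp: ennreal_mult[symmetric])
      finally show "ennreal (L y u) \<le> 1 + ennreal (16 * \<Delta>) * ennreal (norm (y - u) powr (- 1))" .
    qed
    also have "\<dots> = 1 + ennreal (16 * \<Delta>) * (\<integral>\<^sup>+y. ennreal (norm (y - u) powr (- 1)) \<partial>M)"
      by (subst nn_integral_add) (auto simp: nn_integral_cmult emeasure_space_1)
    also have "\<dots> \<le> 1 + ennreal (16 * \<Delta>) * ennreal C2" by (intro add_left_mono mult_left_mono C2) auto
    also have "\<dots> = ennreal (1 + 16 * \<Delta> * C2)" using \<Delta> C2 by (subst ennreal_plus) (auto simp: ennreal_mult[symmetric])
    finally show ?thesis .
  qed
  have "I \<le> (\<integral>\<^sup>+u. ennreal (1 + 16 * \<Delta> * C2) \<partial>M)" unfolding I_def by (rule nn_integral_mono) (rule one)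
  then have "I < \<infinity>" by (simp add: emeasure_space_1 le_less_trans)
  then obtain r where r: "0 \<le> r" "I = ennreal r" by (cases I) auto
  have pair: "integrable (P N) (\<lambda>x. L (x i) (x j))" "(\<integral>x. L (x i) (x j) \<partial>P N) = r" if ij: "i < N" "j < N" "i \<noteq> j" for i j
  proof -
    have m: "(\<lambda>z. ennreal (L (fst z) (snd z))) \<in> borel_measurable (M \<Otimes>\<^sub>M M)" using L_meas by measurable
    have e: "(\<integral>\<^sup>+x. ennreal (L (x i) (x j)) \<partial>P N) = ennreal r"
      unfolding r(2)[symmetric] I_def by (rule nn_integral_pair_component[OF _ _ _ _ m]) (use ij in auto)
    have mm: "(\<lambda>x. L (x i) (x j)) \<in> borel_measurable (P N)" by (rule measurable_pair_P[OF L_meas ij(1,2)])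
    have nn: "AE x in P N. 0 \<le> L (x i) (x j)"
      using space_P_D ij by (intro AE_I2 L0) auto
    show "integrable (P N) (\<lambda>x. L (x i) (x j))" by (rule integrableI_nn_integral_finite[OF mm nn e])
    show "(\<integral>x. L (x i) (x j) \<partial>P N) = r"
      using integral_eq_nn_integral[OF mm nn] e r by simp
  qed
  have int: "integrable (P N) (\<lambda>x. \<xi> i * \<xi> j * L (x i) (x j))" if "j < N" "i < j" for i j
    using pair(1)[of i j] that by simp
  show "integrable (P N) (pairsum N \<xi> L)"
    unfolding pairsum_def[abs_def] using int by (intro Bochner_Integration.integrable_sum) auto
  have "(\<integral>x. pairsum N \<xi> L x \<partial>P N) = (\<Sum>j<N. \<integral>x. (\<Sum>i<j. \<xi> i * \<xi> j * L (x i) (x j)) \<partial>P N)"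
    unfolding pairsum_def using int
    by (intro Bochner_Integration.integral_sum Bochner_Integration.integrable_sum) auto
  also have "\<dots> = (\<Sum>j<N. \<Sum>i<j. \<integral>x. \<xi> i * \<xi> j * L (x i) (x j) \<partial>P N)"
    using int by (intro sum.cong refl Bochner_Integration.integral_sum) auto
  also have "\<dots> = (\<Sum>j<N. \<Sum>i<j. \<xi> i * \<xi> j * r)"
    by (intro sum.cong refl) (use pair(2) in auto)
  also have "\<dots> = - (real N / 2) * r"
    using neutral_pair_sum[OF xi neu] by (simp flip: sum_distrib_right)
  also have "\<dots> \<le> 0" using r by simp
  finally show "(\<integral>x. pairsum N \<xi> L x \<partial>P N) \<le> 0" .
qed

text \<open>The mean of \<open>1 - k * pairsum N \<xi> L x\<close> is at least \<open>1\<close>. The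
  weight \<open>w\<close> is integrated over the completed measure, but its lower bound is asked
  only almost everywhere, which leaves out configurations with coinciding particles.\<close>

lemma exp_pairsum_integral_ge:
  assumes xi: "\<And>i. i < N \<Longrightarrow> \<xi> i \<in> {1, -1}" and neu: "(\<Sum>i<N. \<xi> i) = 0" and k: "0 \<le> k" and c: "0 \<le> c"
    and w: "integrable (completion (P N)) w" "AE x in P N. c * exp (- k * pairsum N \<xi> L x) \<le> w x"
  shows "c \<le> (\<integral>x. w x \<partial>completion (P N))"
proof -
  interpret PP: prob_space "P N" by (rule prob_space_P)
  note I = pairsum_L_integral[OF xi neu]
  have i1: "integrable (P N) (\<lambda>x. c * (1 - k * pairsum N \<xi> L x))"
    using I(1) by simp
  have "c \<le> c * (1 - k * (\<integral>x. pairsum N \<xi> L x \<partial>P N))"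
    using c k I(2) by (simp add: mult_left_mono mult_nonneg_nonpos algebra_simps)
  also have "\<dots> = (\<integral>x. c * (1 - k * pairsum N \<xi> L x) \<partial>P N)" using I(1) by (simp add: PP.prob_space)
  also have "\<dots> = (\<integral>x. c * (1 - k * pairsum N \<xi> L x) \<partial>completion (P N))"
    by (rule integral_completion[symmetric]) measurable
  also have "\<dots> \<le> (\<integral>x. w x \<partial>completion (P N))"
  proof (rule integral_mono_AE[OF _ w(1)])
    show "integrable (completion (P N)) (\<lambda>x. c * (1 - k * pairsum N \<xi> L x))"
      using i1 by (subst integrable_completion) measurable
    have "AE x in P N. c * (1 - k * pairsum N \<xi> L x) \<le> w x"
      using w(2)
    proof eventually_elim
      case (elim x)
      have "1 - k * pairsum N \<xi> L x \<le> exp (- k * pairsum N \<xi> L x)"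
        using exp_ge_add_one_self[of "- k * pairsum N \<xi> L x"] by simp
      then show ?case using elim c mult_left_mono by (metis order_trans)
    qed
    then show "AE x in completion (P N). c * (1 - k * pairsum N \<xi> L x) \<le> w x" by (simp add: AE_completion_iff)
  qed
  finally show ?thesis .
qed

text \<open>Two distinct coordinates are independent and each is distributed by Lebesgue measure on
  \<open>D\<close>, so a null set of pairs pulls back to a null set of configurations. This fails
  for \<open>i = j\<close>.\<close>

lemma AE_pair_transfer:
  assumes "AE z in lborel. Q (fst z) (snd (z :: (real^2) \<times> (real^2)))" and ij: "i < N" "j < N" "i \<noteq> j"
  shows "AE x in P N. Q (x i) (x j)"
proof -
  obtain A where A: "A \<in> null_sets lborel" "{z \<in> space lborel. \<not> Q (fst z) (snd z)} \<subseteq> A"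
    using assms(1) unfolding eventually_ae_filter by auto
  have Am[measurable]: "A \<in> sets (lborel \<Otimes>\<^sub>M lborel)"
  proof -
    have "sets (lborel \<Otimes>\<^sub>M lborel :: ((real^2) \<times> (real^2)) measure) = sets lborel" by (simp only: lborel_prod)
    then show ?thesis using A(1) by (simp only: null_sets_def mem_Collect_eq)
  qed
  have id2: "(\<lambda>z. (fst z, snd z)) \<in> M \<Otimes>\<^sub>M M \<rightarrow>\<^sub>M (lborel \<Otimes>\<^sub>M lborel)"
    using measurable_compose[OF measurable_fst id_meas] measurable_compose[OF measurable_snd id_meas]
    by (intro measurable_Pair) auto
  have m: "(\<lambda>z. indicator A (fst z, snd z) :: ennreal) \<in> borel_measurable (M \<Otimes>\<^sub>M M)"
    by (rule measurable_compose[OF id2]) measurable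
  have le: "(\<integral>\<^sup>+y. f y \<partial>M) \<le> (\<integral>\<^sup>+y. f y \<partial>lborel)" for f :: "real^2 \<Rightarrow> ennreal"
    by (subst nn_integral_restrict_space) (use D(1) in \<open>auto intro!: nn_integral_mono simp: indicator_def\<close>)
  have "(\<integral>\<^sup>+x. indicator A (x i, x j) \<partial>P N) = (\<integral>\<^sup>+u. (\<integral>\<^sup>+y. indicator A (y, u) \<partial>M) \<partial>M)"
    by (rule nn_integral_pair_component[OF _ _ _ _ m]) (use ij in auto)
  also have "\<dots> \<le> (\<integral>\<^sup>+u. (\<integral>\<^sup>+y. indicator A (y, u) \<partial>lborel) \<partial>lborel)"
    by (rule order_trans[OF nn_integral_mono[OF le] le])
  also have "\<dots> = (\<integral>\<^sup>+z. indicator A z \<partial>(lborel \<Otimes>\<^sub>M lborel))"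
    by (rule lborel_pair.nn_integral_snd) measurable
  also have "\<dots> = (\<integral>\<^sup>+z. indicator A z \<partial>lborel)" by (simp only: lborel_prod)
  also have "\<dots> = 0" using A(1) by (subst nn_integral_indicator) (auto simp: null_sets_def)
  finally have z: "(\<integral>\<^sup>+x. indicator A (x i, x j) \<partial>P N) = 0" by simp
  have "(\<lambda>x. (x i, x j)) \<in> P N \<rightarrow>\<^sub>M M \<Otimes>\<^sub>M M"
    using ij by (intro measurable_Pair measurable_component_singleton) auto
  from measurable_compose[OF this m] have "(\<lambda>x. indicator A (x i, x j) :: ennreal) \<in> borel_measurable (P N)" by simp
  from nn_integral_0_iff_AE[OF this] z have "AE x in P N. (indicator A (x i, x j) :: ennreal) = 0" by simp
  then show ?thesis
  proof eventually_elim
    case (elim x)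
    then have "(x i, x j) \<notin> A" by (auto simp: indicator_def split: if_splits)
    then show ?case using subsetD[OF A(2), of "(x i, x j)"] by auto
  qed
qed

lemma AE_component_transfer:
  assumes "AE z in lborel. Q (z :: real^2)" and i: "i < N"
  shows "AE x in P N. Q (x i)"
proof -
  have "AE z in M. Q z" using assms(1) D(1) by (subst AE_restrict_space_iff) auto
  then show ?thesis using AE_PiM_component[of "{..<N}" "\<lambda>_. M" i Q] prob_space_axioms i by auto
qed

text \<open>\<open>f\<close> is only Lebesgue measurable on \<open>D \<times> D\<close>, whereas the
  lemmas on product measures need joint Borel measurability. A Borel version, truncated to keep the
  pointwise bound, agrees with \<open>f\<close> off a null set; as the diagonal is a null set, it
  carries no information on \<open>f x x\<close>.\<close>

lemma Borel_kernel:
  fixes f :: "real^2 \<Rightarrow> real^2 \<Rightarrow> real"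
  assumes f: "(\<lambda>(x, y). f x y) \<in> borel_measurable (lebesgue_on (D \<times> D))"
    and B: "\<And>x y. x \<in> D \<Longrightarrow> y \<in> D \<Longrightarrow> \<bar>f x y\<bar> \<le> B" "0 \<le> B"
  obtains f' where "(\<lambda>z. f' (fst z) (snd z)) \<in> borel_measurable borel" "\<And>x y. \<bar>f' x y\<bar> \<le> B"
    "AE z in lborel. fst z \<in> D \<longrightarrow> snd z \<in> D \<longrightarrow> f (fst z) (snd z) = f' (fst z) (snd z)"
    "\<And>\<phi>. \<phi> \<in> borel_measurable borel \<Longrightarrow>
      (\<integral>\<^sup>+x. (\<integral>\<^sup>+y. ennreal (\<phi> (f' x y)) \<partial>M) \<partial>M) = (\<integral>\<^sup>+z. ennreal (\<phi> (f (fst z) (snd z))) \<partial>lebesgue_on (D \<times> D))"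
proof -
  define f0 where "f0 z = (if z \<in> D \<times> D then f (fst z) (snd z) else 0)" for z
  have DD: "open (D \<times> D)" using D(1) by (simp add: open_Times)
  have "f0 \<in> borel_measurable lebesgue"
    unfolding f0_def[abs_def] using f DD by (subst borel_measurable_if) (auto simp: split_def)
  then obtain f1 where f1: "f1 \<in> borel_measurable lborel" "AE z in lborel. f0 z = f1 z"
    using completion_ex_borel_measurable_real by metis
  define f' where "f' x y = max (- B) (min B (f1 (x, y)))" for x y
  have m: "(\<lambda>z. f' (fst z) (snd z)) \<in> borel_measurable borel" unfolding f'_def using f1(1) by simp
  have b: "\<bar>f' x y\<bar> \<le> B" for x y unfolding f'_def using B(2) by auto
  have ae: "AE z in lborel. fst z \<in> D \<longrightarrow> snd z \<in> D \<longrightarrow> f (fst z) (snd z) = f' (fst z) (snd z)"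
    using f1(2)
  proof eventually_elim
    case (elim z)
    show ?case
    proof (intro impI)
      assume z: "fst z \<in> D" "snd z \<in> D"
      then have "f1 z = f (fst z) (snd z)" using elim by (simp add: f0_def mem_Times_iff)
      then show "f (fst z) (snd z) = f' (fst z) (snd z)" using B(1)[OF z] by (auto simp: f'_def)
    qed
  qed
  have int: "(\<integral>\<^sup>+x. (\<integral>\<^sup>+y. ennreal (\<phi> (f' x y)) \<partial>M) \<partial>M) = (\<integral>\<^sup>+z. ennreal (\<phi> (f (fst z) (snd z))) \<partial>lebesgue_on (D \<times> D))"
    if \<phi>[measurable]: "\<phi> \<in> borel_measurable borel" for \<phi> :: "real \<Rightarrow> real"
  proof -
    define F where "F z = ennreal (\<phi> (f' (fst z) (snd z))) * indicator (D \<times> D) z" for z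
    have Fm: "F \<in> borel_measurable (lborel \<Otimes>\<^sub>M lborel)"
    proof -
      have 1: "(\<lambda>z. ennreal (\<phi> (f' (fst z) (snd z)))) \<in> borel_measurable borel"
        by (rule measurable_compose[OF measurable_compose[OF m \<phi>] measurable_ennreal])
      have "F \<in> borel_measurable borel"
        unfolding F_def by (intro borel_measurable_times_ennreal 1 borel_measurable_indicator borel_open DD)
      then show ?thesis by (simp only: lborel_prod) simp
    qed
    have "(\<integral>\<^sup>+x. (\<integral>\<^sup>+y. ennreal (\<phi> (f' x y)) \<partial>M) \<partial>M) = (\<integral>\<^sup>+x. (\<integral>\<^sup>+y. ennreal (\<phi> (f' x y)) * indicator D y \<partial>lborel) * indicator D x \<partial>lborel)"
      using D(1) by (subst nn_integral_restrict_space, simp, subst nn_integral_restrict_space) auto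
    also have "\<dots> = (\<integral>\<^sup>+x. (\<integral>\<^sup>+y. F (x, y) \<partial>lborel) \<partial>lborel)"
      by (intro nn_integral_cong) (auto simp: F_def indicator_def)
    also have "\<dots> = (\<integral>\<^sup>+z. F z \<partial>(lborel \<Otimes>\<^sub>M lborel))" by (rule lborel.nn_integral_fst[OF Fm])
    also have "\<dots> = (\<integral>\<^sup>+z. F z \<partial>lborel)" by (simp add: lborel_prod)
    also have "\<dots> = (\<integral>\<^sup>+z. ennreal (\<phi> (f (fst z) (snd z))) * indicator (D \<times> D) z \<partial>lborel)"
      using ae by (intro nn_integral_cong_AE) (auto simp: F_def indicator_def elim!: AE_mp)
    also have "\<dots> = (\<integral>\<^sup>+z. ennreal (\<phi> (f (fst z) (snd z))) * indicator (D \<times> D) z \<partial>lebesgue)"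
      by (simp add: nn_integral_completion)
    also have "\<dots> = (\<integral>\<^sup>+z. ennreal (\<phi> (f (fst z) (snd z))) \<partial>lebesgue_on (D \<times> D))"
      using DD by (subst nn_integral_restrict_space) auto
    finally show ?thesis .
  qed
  show thesis by (rule that[OF m b ae int])
qed

text \<open>Monotonicity of norms on a probability space, up to a factor \<open>2\<close>. For
  \<open>A > 0\<close> the function \<open>u\<close> obtained by dividing the power \<open>q\<close>
  of \<open>|F|\<close> by \<open>A\<close> has mean \<open>1\<close>; the fourth power of
  \<open>F\<close> is \<open>A powr (4 / q) * u powr (4 / q)\<close>, and
  \<open>u powr (4 / q) \<le> 1 + u\<close>.\<close>

lemma L4_le_Lq:
  fixes f :: "real^2 \<Rightarrow> real^2 \<Rightarrow> real"
  assumes f: "(\<lambda>(x, y). f x y) \<in> borel_measurable (lebesgue_on (D \<times> D))"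
    and B: "\<And>x y. x \<in> D \<Longrightarrow> y \<in> D \<Longrightarrow> \<bar>f x y\<bar> \<le> B" "0 \<le> B" and q: "4 \<le> q"
    and one: "emeasure (lebesgue_on (D \<times> D)) (space (lebesgue_on (D \<times> D))) = 1"
  shows "(\<integral>\<^sup>+z. ennreal (f (fst z) (snd z) ^ 4) \<partial>lebesgue_on (D \<times> D))
     \<le> ennreal (2 * ((Lq_norm q (lebesgue_on (D \<times> D)) (\<lambda>(x, y). f x y))\<^sup>2)\<^sup>2)"
proof -
  let ?\<Lambda> = "lebesgue_on (D \<times> D)"
  define F where "F z = f (fst z) (snd z)" for z
  have Fm[measurable]: "F \<in> borel_measurable ?\<Lambda>" using f by (simp add: F_def[abs_def] split_def)
  have FB: "\<bar>F z\<bar> \<le> B" if "z \<in> space ?\<Lambda>" for z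
    using that B(1)[of "fst z" "snd z"] by (auto simp: F_def space_restrict_space)
  define A where "A = (\<integral>z. \<bar>F z\<bar> powr q \<partial>?\<Lambda>)"
  have A0: "0 \<le> A" unfolding A_def by (rule integral_nonneg_AE) simp
  have fin: "(\<integral>\<^sup>+z. ennreal (\<bar>F z\<bar> powr q) \<partial>?\<Lambda>) < \<infinity>"
  proof -
    have "(\<integral>\<^sup>+z. ennreal (\<bar>F z\<bar> powr q) \<partial>?\<Lambda>) \<le> (\<integral>\<^sup>+z. ennreal (B powr q) \<partial>?\<Lambda>)"
      using FB q by (intro nn_integral_mono ennreal_leI powr_mono2) auto
    also have "\<dots> < \<infinity>" using one by (simp add: ennreal_mult_less_top)
    finally show ?thesis .
  qed
  have A: "(\<integral>\<^sup>+z. ennreal (\<bar>F z\<bar> powr q) \<partial>?\<Lambda>) = ennreal A"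
    unfolding A_def using fin by (subst integral_eq_nn_integral) (auto simp: less_top)
  have N: "((Lq_norm q ?\<Lambda> (\<lambda>(x, y). f x y))\<^sup>2)\<^sup>2 = A powr (4 / q)"
  proof -
    have "Lq_norm q ?\<Lambda> (\<lambda>(x, y). f x y) = A powr (1 / q)"
      by (simp add: Lq_norm_def A_def F_def split_def)
    then have "((Lq_norm q ?\<Lambda> (\<lambda>(x, y). f x y))\<^sup>2)\<^sup>2 = (A powr (1 / q)) ^ 4" by (simp flip: power_mult)
    also have "\<dots> = A powr (4 / q)" using A0 by (cases "A = 0") (auto simp: powr_power)
    finally show ?thesis .
  qed
  have "(\<integral>\<^sup>+z. ennreal (F z ^ 4) \<partial>?\<Lambda>) \<le> ennreal (2 * A powr (4 / q))"
  proof (cases "A = 0")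
    case True
    then have "AE z in ?\<Lambda>. ennreal (\<bar>F z\<bar> powr q) = 0"
      using A by (subst nn_integral_0_iff_AE[symmetric]) auto
    then have "AE z in ?\<Lambda>. ennreal (F z ^ 4) = 0" by eventually_elim auto
    then have "(\<integral>\<^sup>+z. ennreal (F z ^ 4) \<partial>?\<Lambda>) = 0" by (subst nn_integral_0_iff_AE) auto
    then show ?thesis by simp
  next
    case False
    then have A1: "0 < A" using A0 by simp
    define p where "p = A powr (4 / q)"
    have p: "0 \<le> p" by (simp add: p_def)
    have "(\<integral>\<^sup>+z. ennreal (F z ^ 4) \<partial>?\<Lambda>) \<le> (\<integral>\<^sup>+z. ennreal p * (1 + ennreal (1 / A) * ennreal (\<bar>F z\<bar> powr q)) \<partial>?\<Lambda>)"
    proof (rule nn_integral_mono)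
      fix z
      define u where "u = \<bar>F z\<bar> powr q / A"
      have u: "0 \<le> u" using A1 by (simp add: u_def)
      have "F z ^ 4 = \<bar>F z\<bar> ^ 4" by simp
      also have "\<dots> = (\<bar>F z\<bar> powr q) powr (4 / q)"
        using q by (cases "F z = 0") (auto simp: powr_powr simp flip: powr_numeral)
      also have "\<dots> = p * u powr (4 / q)" using A1 by (simp add: p_def u_def powr_divide)
      also have "\<dots> \<le> p * (1 + u)"
      proof (rule mult_left_mono[OF _ p])
        have "u powr (4 / q) \<le> 1 + 4 / q * u" using q u by (intro powr_le_Bernoulli) auto
        also have "\<dots> \<le> 1 + 1 * u" using q u by (intro add_left_mono mult_right_mono) auto
        finally show "u powr (4 / q) \<le> 1 + u" by simp
      qed
      finally have "ennreal (F z ^ 4) \<le> ennreal (p * (1 + 1 / A * \<bar>F z\<bar> powr q))" by (intro ennreal_leI) (simp add: u_def)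
      also have "\<dots> = ennreal p * ennreal (1 + 1 / A * \<bar>F z\<bar> powr q)" using A1 p by (intro ennreal_mult) auto
      also have "ennreal (1 + 1 / A * \<bar>F z\<bar> powr q) = 1 + ennreal (1 / A * \<bar>F z\<bar> powr q)" using A1 by (subst ennreal_plus) auto
      also have "ennreal (1 / A * \<bar>F z\<bar> powr q) = ennreal (1 / A) * ennreal (\<bar>F z\<bar> powr q)" using A1 by (intro ennreal_mult) auto
      finally show "ennreal (F z ^ 4) \<le> ennreal p * (1 + ennreal (1 / A) * ennreal (\<bar>F z\<bar> powr q))" .
    qed
    also have "\<dots> = ennreal p * (1 + ennreal (1 / A) * ennreal A)"
      using one by (subst nn_integral_cmult, simp, subst nn_integral_add) (auto simp: nn_integral_cmult A)
    also have "ennreal (1 / A) * ennreal A = 1" using A1 by (subst ennreal_mult[symmetric]) auto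
    also have "ennreal p * (1 + 1) = ennreal (2 * p)"
      using p by (simp add: ennreal_mult mult.commute)
    finally show ?thesis by (simp add: p_def)
  qed
  then show ?thesis unfolding N F_def .
qed

lemma main_estimate:
  fixes g f :: "real^2 \<Rightarrow> real^2 \<Rightarrow> real" and \<xi> :: "nat \<Rightarrow> real"
  assumes \<beta>: "0 \<le> \<beta>" and \<epsilon>: "0 < \<epsilon>" "\<epsilon> < 1 / 2"
    and gG: "\<And>x y. x \<in> D \<Longrightarrow> y \<in> D \<Longrightarrow> x \<noteq> y \<Longrightarrow> green g x y = - 1 / (4 * pi) * ln (1 - T x y)"
    and gU: "\<And>x. x \<in> D \<Longrightarrow> g x x \<le> 1 / (2 * pi) * ln \<Delta>"
    and gL: "\<And>x. x \<in> D \<Longrightarrow> 1 / (2 * pi) * ln (infdist x (frontier D)) \<le> g x x"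
    and N: "1 \<le> N" and xi: "\<And>i. i < N \<Longrightarrow> \<xi> i \<in> {1, -1}" and neu: "(\<Sum>i<N. \<xi> i) = 0"
    and Cw: "0 \<le> Cw" "(\<integral>\<^sup>+x. ennreal (majorant N (\<beta> / (2 * pi) / real N) \<xi> x) \<partial>P N) \<le> ennreal Cw"
    and f: "(\<lambda>(x, y). f x y) \<in> borel_measurable (lebesgue_on (D \<times> D))"
    and fB: "\<And>x y. x \<in> D \<Longrightarrow> y \<in> D \<Longrightarrow> \<bar>f x y\<bar> \<le> B"
    and fsym: "\<And>x y. x \<in> D \<Longrightarrow> y \<in> D \<Longrightarrow> f x y = f y x"
    and fd: "(\<lambda>x. f x x) \<in> borel_measurable (lebesgue_on D)" "(\<integral>x. f x x \<partial>lebesgue_on D) = 0"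
  shows "(\<integral>x. (1 / real N * (\<Sum>i<N. \<Sum>j<N. \<xi> i * \<xi> j * f (x i) (x j)))\<^sup>2 \<partial>gibbs_measure D g \<beta> N \<xi>)
     \<le> 2 * sqrt (Cw * 10 ^ 11) / exp (- (\<beta> / (4 * pi) * ln \<Delta>)) * ((Lq_norm (2 / \<epsilon>) (lebesgue_on (D \<times> D)) (\<lambda>(x, y). f x y))\<^sup>2
                  + 1 / real N * (SUP x\<in>D. \<bar>f x x\<bar>\<^sup>2)
                  + 1 / real N powr (1 - \<epsilon>) * (SUP x\<in>D. \<bar>f x x\<bar>)
                      * Lq_norm (1 / \<epsilon>) (lebesgue_on (D \<times> D)) (\<lambda>(x, y). f x y))"
    (is "?lhs \<le> ?C * ?rhs")
proof -
  obtain z where z: "z \<in> D" using not_empty by (auto simp: space_M)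
  have B0: "0 \<le> B" using fB[OF z z] by simp
  \<comment> \<open>The self-energies contribute at least \<open>c0\<close>, because
    \<open>g x x\<close> is bounded above, and the pair interaction at least \<open>1\<close> on
    average; so \<open>c0\<close> is a lower bound for the partition function when the weight is
    integrable.\<close>
  define c0 where "c0 = exp (- (\<beta> / (4 * pi) * ln \<Delta>))"
  have c0: "0 < c0" by (simp add: c0_def)
  define s where "s = (SUP x\<in>D. \<bar>f x x\<bar>)"
  define s2 where "s2 = (SUP x\<in>D. \<bar>f x x\<bar>\<^sup>2)"
  have bd: "bdd_above ((\<lambda>x. \<bar>f x x\<bar>) ` D)" using fB by (intro bdd_aboveI2[of _ _ B]) auto
  have bd2: "bdd_above ((\<lambda>x. \<bar>f x x\<bar>\<^sup>2) ` D)" using fB by (intro bdd_aboveI2[of _ _ "B\<^sup>2"] power_mono) auto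
  have fs: "\<bar>f x x\<bar> \<le> s" if "x \<in> D" for x unfolding s_def by (rule cSUP_upper[OF that bd])
  have s0: "0 \<le> s" using fs[OF z] by simp
  have ss: "s\<^sup>2 \<le> s2"
  proof -
    have "s \<le> sqrt s2" unfolding s_def
    proof (rule cSUP_least)
      fix x assume "x \<in> D"
      then have "\<bar>f x x\<bar>\<^sup>2 \<le> s2" unfolding s2_def by (rule cSUP_upper[OF _ bd2])
      then show "\<bar>f x x\<bar> \<le> sqrt s2" by (rule real_le_rsqrt)
    qed (use z in auto)
    moreover have "0 \<le> s2" unfolding s2_def using cSUP_upper[OF z bd2] by (meson order_trans zero_le_power2)
    ultimately show ?thesis using s0 power_mono[of s "sqrt s2" 2] by simp
  qed
  define n2 where "n2 = (Lq_norm (2 / \<epsilon>) (lebesgue_on (D \<times> D)) (\<lambda>(x, y). f x y))\<^sup>2"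
  define n1 where "n1 = Lq_norm (1 / \<epsilon>) (lebesgue_on (D \<times> D)) (\<lambda>(x, y). f x y)"
  have n: "0 \<le> n2" "0 \<le> n1" by (auto simp: n2_def n1_def Lq_norm_def)
  have rhs: "?rhs = n2 + 1 / real N * s2 + 1 / real N powr (1 - \<epsilon>) * s * n1"
    by (simp add: n2_def n1_def s_def s2_def)
  have s20: "0 \<le> s2" using ss by (meson order_trans zero_le_power2)
  have rhs_ge: "n2 + s\<^sup>2 / real N \<le> ?rhs"
  proof -
    have "s\<^sup>2 / real N \<le> s2 / real N" using ss by (intro divide_right_mono) auto
    moreover have "0 \<le> 1 / real N powr (1 - \<epsilon>) * s * n1" using s0 n by simp
    ultimately show ?thesis unfolding rhs by simp
  qed
  then have rhs0: "0 \<le> ?rhs" using n s0 by (meson add_nonneg_nonneg divide_nonneg_nonneg of_nat_0_le_iff order_trans zero_le_power2)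
  have C0: "0 \<le> ?C" using Cw by simp
  have CR: "0 \<le> ?C * ?rhs" using C0 rhs0 by (rule mult_nonneg_nonneg)
  define w where "w x = exp (- (\<beta> / real N) * hamiltonian g N \<xi> x)" for x
  define Z where "Z = partition_function D g \<beta> N \<xi>"
  have Z: "Z = (\<integral>x. w x \<partial>completion (P N))" by (simp add: Z_def partition_function_def w_def config_lebesgue_def)
  have gm: "gibbs_measure D g \<beta> N \<xi> = density (completion (P N)) (\<lambda>x. ennreal (w x / Z))"
    by (simp add: gibbs_measure_def w_def Z_def config_lebesgue_def)
  define G where "G x = (1 / real N * (\<Sum>i<N. \<Sum>j<N. \<xi> i * \<xi> j * f (x i) (x j)))\<^sup>2" for x
  have lhs: "?lhs = (\<integral>x. G x \<partial>density (completion (P N)) (\<lambda>x. ennreal (w x / Z)))"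
    by (simp add: G_def gm)
  \<comment> \<open>The factor \<open>1 / (4 * pi)\<close> comes from expressing the Green function
    by \<open>L\<close>; squaring the weight doubles \<open>k\<close> to the exponent of
    \<open>majorant\<close>.\<close>
  define k where "k = \<beta> / (4 * pi) / real N"
  have k: "0 \<le> k" using \<beta> by (simp add: k_def)
  have wx: "w x = exp (- k * pairsum N \<xi> L x) * exp (- (\<beta> / real N) / 2 * (\<Sum>i<N. g (x i) (x i)))"
    if x: "\<And>i. i < N \<Longrightarrow> x i \<in> D" and dis: "\<And>i j. i < N \<Longrightarrow> j < N \<Longrightarrow> i \<noteq> j \<Longrightarrow> x i \<noteq> x j" for x
  proof -
    have 1: "(\<Sum>j<N. \<Sum>i<j. \<xi> i * \<xi> j * green g (x i) (x j)) = 1 / (4 * pi) * pairsum N \<xi> L x"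
      unfolding pairsum_def sum_distrib_left
    proof (intro sum.cong refl)
      fix i j assume "j \<in> {..<N}" "i \<in> {..<j}"
      then have "green g (x i) (x j) = 1 / (4 * pi) * L (x i) (x j)" using gG[of "x i" "x j"] x dis by (simp add: L_def)
      then show "\<xi> i * \<xi> j * green g (x i) (x j) = 1 / (4 * pi) * (\<xi> i * \<xi> j * L (x i) (x j))" by simp
    qed
    have 2: "(\<Sum>i<N. (\<xi> i)\<^sup>2 * g (x i) (x i)) = (\<Sum>i<N. g (x i) (x i))"
      by (intro sum.cong refl) (use xi in force)
    show ?thesis unfolding w_def hamiltonian_def 1 2 k_def exp_add[symmetric] by (simp add: algebra_simps)
  qed
  have w_lower: "AE x in P N. c0 * exp (- k * pairsum N \<xi> L x) \<le> w x"
    using AE_distinct[of N] AE_space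
  proof eventually_elim
    case (elim x)
    then have x: "\<And>i. i < N \<Longrightarrow> x i \<in> D" and dis: "\<And>i j. i < N \<Longrightarrow> j < N \<Longrightarrow> i \<noteq> j \<Longrightarrow> x i \<noteq> x j"
      using space_P_D by auto
    have "(\<Sum>i<N. g (x i) (x i)) \<le> (\<Sum>i<N. 1 / (2 * pi) * ln \<Delta>)" by (intro sum_mono gU x) auto
    then have "\<beta> / real N / 2 * (\<Sum>i<N. g (x i) (x i)) \<le> \<beta> / real N / 2 * (real N * (1 / (2 * pi) * ln \<Delta>))"
      using \<beta> by (intro mult_left_mono) auto
    also have "\<dots> = \<beta> / (4 * pi) * ln \<Delta>" using N by simp
    finally have "c0 \<le> exp (- (\<beta> / real N) / 2 * (\<Sum>i<N. g (x i) (x i)))" by (simp add: c0_def)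
    then have "c0 * exp (- k * pairsum N \<xi> L x) \<le> exp (- (\<beta> / real N) / 2 * (\<Sum>i<N. g (x i) (x i))) * exp (- k * pairsum N \<xi> L x)"
      by (rule mult_right_mono) simp
    moreover have "w x = exp (- k * pairsum N \<xi> L x) * exp (- (\<beta> / real N) / 2 * (\<Sum>i<N. g (x i) (x i)))"
      by (rule wx) (use x dis in auto)
    ultimately show ?case by (simp only: mult.commute)
  qed
  have w_upper: "AE x in P N. (w x)\<^sup>2 \<le> majorant N (\<beta> / (2 * pi) / real N) \<xi> x"
    using AE_distinct[of N] AE_space
  proof eventually_elim
    case (elim x)
    then have x: "\<And>i. i < N \<Longrightarrow> x i \<in> D" and dis: "\<And>i j. i < N \<Longrightarrow> j < N \<Longrightarrow> i \<noteq> j \<Longrightarrow> x i \<noteq> x j"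
      using space_P_D by auto
    have "(w x)\<^sup>2 = exp (- (\<beta> / (2 * pi) / real N) * pairsum N \<xi> L x) * (\<Prod>i<N. exp (- (\<beta> / real N) * g (x i) (x i)))"
    proof -
      have "(w x)\<^sup>2 = exp (- (\<beta> / (2 * pi) / real N) * pairsum N \<xi> L x) * exp (- (\<beta> / real N) * (\<Sum>i<N. g (x i) (x i)))"
      proof -
        have "w x = exp (- k * pairsum N \<xi> L x) * exp (- (\<beta> / real N) / 2 * (\<Sum>i<N. g (x i) (x i)))"
          by (rule wx) (use x dis in auto)
        then show ?thesis
          by (simp only: power2_eq_square exp_add[symmetric]) (simp add: k_def algebra_simps)
      qed
      then show ?thesis by (simp add: sum_distrib_left exp_sum)
    qed
    also have "\<dots> \<le> majorant N (\<beta> / (2 * pi) / real N) \<xi> x"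
    proof (intro mult_left_mono prod_mono conjI)
      fix i assume "i \<in> {..<N}"
      then have xi: "x i \<in> D" using x by simp
      have "\<beta> / real N * (1 / (2 * pi) * ln (dist_bd (x i))) \<le> \<beta> / real N * g (x i) (x i)"
        using gL[OF xi] \<beta> unfolding dist_bd_def by (intro mult_left_mono) auto
      then show "exp (- (\<beta> / real N) * g (x i) (x i)) \<le> dist_bd (x i) powr (- (\<beta> / (2 * pi) / real N))"
        using dist_bd_pos[OF xi] by (simp add: powr_def mult.commute)
    qed auto
    finally show ?case .
  qed
  show ?thesis
  proof (cases "integrable (completion (P N)) w \<and> integrable (density (completion (P N)) (\<lambda>x. ennreal (w x / Z))) G")
    \<comment> \<open>Here the convention that non-integrable functions have integral \<open>0\<close> makes the left-hand side vanish.\<close>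
    case False
    have "?lhs = 0"
    proof (cases "integrable (completion (P N)) w")
      case True
      then show ?thesis using False unfolding lhs by (intro not_integrable_integral_eq) simp
    next
      case False
      then have "Z = 0" unfolding Z by (rule not_integrable_integral_eq)
      then show ?thesis unfolding lhs by (intro integral_eq_zero_AE) (simp add: AE_density)
    qed
    then show ?thesis using CR by simp
  next
    case True
    \<comment> \<open>Joint measurability of \<open>g\<close> is not among the assumptions; here the
      measurability of \<open>w\<close> and \<open>G\<close> is read off from integrability.\<close>
    have wm: "w \<in> borel_measurable (completion (P N))" using True by auto
    have "G \<in> borel_measurable (density (completion (P N)) (\<lambda>x. ennreal (w x / Z)))" using True by blast
    then have Gm: "G \<in> borel_measurable (completion (P N))" by simp
    have Zc: "c0 \<le> Z" unfolding Z by (rule exp_pairsum_integral_ge[OF xi neu k]) (use c0 True w_lower in auto)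
    then have Z0: "0 < Z" using c0 by simp
    have G0: "0 \<le> G x" for x by (simp add: G_def)
    have w0: "0 \<le> w x" for x by (simp add: w_def)
    obtain f' where f': "(\<lambda>z. f' (fst z) (snd z)) \<in> borel_measurable borel" "\<And>x y. \<bar>f' x y\<bar> \<le> B"
      "AE z in lborel. fst z \<in> D \<longrightarrow> snd z \<in> D \<longrightarrow> f (fst z) (snd z) = f' (fst z) (snd z)"
      "\<And>\<phi>. \<phi> \<in> borel_measurable borel \<Longrightarrow>
        (\<integral>\<^sup>+x. (\<integral>\<^sup>+y. ennreal (\<phi> (f' x y)) \<partial>M) \<partial>M) = (\<integral>\<^sup>+z. ennreal (\<phi> (f (fst z) (snd z))) \<partial>lebesgue_on (D \<times> D))"
      using Borel_kernel[OF f fB B0] by blast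
    have one: "emeasure (lebesgue_on (D \<times> D)) (space (lebesgue_on (D \<times> D))) = 1"
      using f'(4)[of "\<lambda>_. 1"] by (simp add: emeasure_space_1)
    define Q where "Q = 2 * n2\<^sup>2"
    \<comment> \<open>The condition \<open>\<epsilon> < 1 / 2\<close> enters as
      \<open>2 / \<epsilon> \<ge> 4\<close>.\<close>
    have I4: "(\<integral>\<^sup>+x. (\<integral>\<^sup>+y. ennreal (f' x y ^ 4) \<partial>M) \<partial>M) \<le> ennreal Q"
      unfolding f'(4)[of "\<lambda>t. t ^ 4", simplified] Q_def n2_def
      by (rule L4_le_Lq[OF f fB B0 _ one]) (use \<epsilon> in \<open>auto simp: field_simps\<close>)
    have f'M: "(\<lambda>z. f' (fst z) (snd z)) \<in> borel_measurable (M \<Otimes>\<^sub>M M)"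
    proof -
      have "(\<lambda>z. (fst z, snd z)) \<in> M \<Otimes>\<^sub>M M \<rightarrow>\<^sub>M borel"
        using measurable_compose[OF measurable_fst id_meas] measurable_compose[OF measurable_snd id_meas] by measurable
      from measurable_compose[OF this f'(1)] show ?thesis by simp
    qed
    have f'M': "(\<lambda>z. f' (snd z) (fst z)) \<in> borel_measurable (M \<Otimes>\<^sub>M M)"
    proof -
      have "(\<lambda>z. (snd z, fst z)) \<in> M \<Otimes>\<^sub>M M \<rightarrow>\<^sub>M M \<Otimes>\<^sub>M M" by measurable
      from measurable_compose[OF this f'M] show ?thesis by simp
    qed
    \<comment> \<open>\<open>f'\<close> agrees with the symmetric \<open>f\<close> only almost
      everywhere, while symmetrization asks for exact symmetry; averaging \<open>f'\<close> with its
      transpose restores it without increasing the integral of the fourth power.\<close>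
    define v where "v x y = (f' x y + f' y x) / 2" for x y
    have vm: "(\<lambda>z. v (fst z) (snd z)) \<in> borel_measurable (M \<Otimes>\<^sub>M M)" unfolding v_def using f'M f'M' by measurable
    have vB: "\<bar>v x y\<bar> \<le> B" for x y using f'(2)[of x y] f'(2)[of y x] by (simp add: v_def abs_le_iff)
    have vI: "(\<integral>\<^sup>+x. (\<integral>\<^sup>+y. ennreal (v x y ^ 4) \<partial>M) \<partial>M) \<le> ennreal Q"
    proof -
      interpret pair_sigma_finite M M by standard
      define H where "H x y = ennreal (1 / 2) * ennreal (f' x y ^ 4)" for x y
      have Hm: "(\<lambda>z. H (fst z) (snd z)) \<in> borel_measurable (M \<Otimes>\<^sub>M M)" "(\<lambda>z. H (snd z) (fst z)) \<in> borel_measurable (M \<Otimes>\<^sub>M M)"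
        unfolding H_def using f'M f'M' by measurable
      have "(\<integral>\<^sup>+x. (\<integral>\<^sup>+y. ennreal (v x y ^ 4) \<partial>M) \<partial>M) \<le> (\<integral>\<^sup>+x. (\<integral>\<^sup>+y. H x y + H y x \<partial>M) \<partial>M)"
      proof (intro nn_integral_mono)
        fix x y
        have "v x y ^ 4 \<le> (1 - 1/2) * f' x y ^ 4 + 1/2 * f' y x ^ 4"
          using convex_onD[OF convex_power_even[of 4], of "1/2" "f' x y" "f' y x"] by (simp add: v_def add_divide_distrib)
        then have "ennreal (v x y ^ 4) \<le> ennreal (1/2 * f' x y ^ 4 + 1/2 * f' y x ^ 4)" by (intro ennreal_leI) simp
        also have "\<dots> = ennreal (1/2 * f' x y ^ 4) + ennreal (1/2 * f' y x ^ 4)"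
          by (rule ennreal_plus) (auto simp: zero_le_even_power)
        also have "\<dots> = H x y + H y x"
          unfolding H_def by (intro arg_cong2[of _ _ _ _ plus] ennreal_mult) (auto simp: zero_le_even_power)
        finally show "ennreal (v x y ^ 4) \<le> H x y + H y x" .
      qed
      also have "\<dots> = (\<integral>\<^sup>+x. (\<integral>\<^sup>+y. H x y \<partial>M) + (\<integral>\<^sup>+y. H y x \<partial>M) \<partial>M)"
      proof (rule nn_integral_cong, rule nn_integral_add)
        fix x assume x: "x \<in> space M"
        show "(\<lambda>y. H x y) \<in> borel_measurable M" using measurable_compose[OF measurable_Pair1'[OF x] Hm(1)] by simp
        show "(\<lambda>y. H y x) \<in> borel_measurable M" using measurable_compose[OF measurable_Pair1'[OF x] Hm(2)] by simp
      qed
      also have "\<dots> = (\<integral>\<^sup>+x. (\<integral>\<^sup>+y. H x y \<partial>M) \<partial>M) + (\<integral>\<^sup>+x. (\<integral>\<^sup>+y. H y x \<partial>M) \<partial>M)"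
        using Hm by (intro nn_integral_add borel_measurable_nn_integral) (auto simp: split_def)
      also have "(\<integral>\<^sup>+x. (\<integral>\<^sup>+y. H y x \<partial>M) \<partial>M) = (\<integral>\<^sup>+x. (\<integral>\<^sup>+y. H x y \<partial>M) \<partial>M)"
        using Hm(1) by (intro Fubini') (simp add: split_def)
      also have "(\<integral>\<^sup>+x. (\<integral>\<^sup>+y. H x y \<partial>M) \<partial>M) = ennreal (1 / 2) * (\<integral>\<^sup>+x. (\<integral>\<^sup>+y. ennreal (f' x y ^ 4) \<partial>M) \<partial>M)"
      proof -
        have "(\<integral>\<^sup>+y. H x y \<partial>M) = ennreal (1 / 2) * (\<integral>\<^sup>+y. ennreal (f' x y ^ 4) \<partial>M)" if "x \<in> space M" for x
          unfolding H_def using measurable_compose[OF measurable_Pair1'[OF that] f'M] by (intro nn_integral_cmult) simp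
        then have "(\<integral>\<^sup>+x. (\<integral>\<^sup>+y. H x y \<partial>M) \<partial>M) = (\<integral>\<^sup>+x. ennreal (1 / 2) * (\<integral>\<^sup>+y. ennreal (f' x y ^ 4) \<partial>M) \<partial>M)"
          by (intro nn_integral_cong)
        also have "\<dots> = ennreal (1 / 2) * (\<integral>\<^sup>+x. (\<integral>\<^sup>+y. ennreal (f' x y ^ 4) \<partial>M) \<partial>M)"
          using f'M by (intro nn_integral_cmult borel_measurable_nn_integral) (simp add: split_def)
        finally show ?thesis .
      qed
      also have "ennreal (1 / 2) * (\<integral>\<^sup>+x. (\<integral>\<^sup>+y. ennreal (f' x y ^ 4) \<partial>M) \<partial>M) + ennreal (1 / 2) * (\<integral>\<^sup>+x. (\<integral>\<^sup>+y. ennreal (f' x y ^ 4) \<partial>M) \<partial>M)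
        \<le> ennreal (1 / 2) * ennreal Q + ennreal (1 / 2) * ennreal Q" by (intro add_mono mult_left_mono I4) auto
      also have "\<dots> = ennreal (1 / 2 * Q) + ennreal (1 / 2 * Q)"
        by (intro arg_cong2[of _ _ _ _ plus] ennreal_mult[symmetric]) (auto simp: Q_def)
      also have "\<dots> = ennreal (1 / 2 * Q + 1 / 2 * Q)" by (rule ennreal_plus[symmetric]) (auto simp: Q_def)
      also have "1 / 2 * Q + 1 / 2 * Q = Q" by simp
      finally show ?thesis .
    qed
    \<comment> \<open>The diagonal is null in \<open>D \<times> D\<close>, so the function
      \<open>f x x\<close> needs a Borel version of its own. Truncation at \<open>s\<close> keeps
      the supremum bound, and mean zero survives a change on a null set.\<close>
    obtain h where h: "h \<in> borel_measurable M" "\<And>x. x \<in> D \<Longrightarrow> \<bar>h x\<bar> \<le> s" "(\<integral>x. h x \<partial>M) = 0"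
      "AE x in lborel. x \<in> D \<longrightarrow> f x x = h x"
    proof -
      define d0 where "d0 x = (if x \<in> D then f x x else 0)" for x
      have "d0 \<in> borel_measurable lebesgue"
        unfolding d0_def[abs_def] using fd(1) D(1) by (subst borel_measurable_if) auto
      then obtain d1 where d1: "d1 \<in> borel_measurable lborel" "AE x in lborel. d0 x = d1 x"
        using completion_ex_borel_measurable_real by metis
      define h where "h x = max (- s) (min s (d1 x))" for x
      have hb: "h \<in> borel_measurable borel" using d1(1) unfolding h_def by simp
      have ae: "AE x in lborel. x \<in> D \<longrightarrow> f x x = h x"
        using d1(2)
      proof eventually_elim
        case (elim x)
        show ?case
        proof
          assume x: "x \<in> D"
          then have "d1 x = f x x" using elim by (simp add: d0_def)
          then show "f x x = h x" using fs[OF x] by (auto simp: h_def)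
        qed
      qed
      have "(\<integral>x. h x \<partial>M) = (\<integral>x. indicator D x *\<^sub>R h x \<partial>lborel)" using D(1) by (subst integral_restrict_space) auto
      also have "\<dots> = (\<integral>x. indicator D x *\<^sub>R h x \<partial>lebesgue)"
        using hb D(1) by (intro integral_completion[symmetric]) measurable
      also have "\<dots> = (\<integral>x. indicator D x *\<^sub>R f x x \<partial>lebesgue)"
      proof (rule integral_cong_AE)
        show "(\<lambda>x. indicator D x *\<^sub>R h x) \<in> borel_measurable lebesgue"
          using hb D(1) by (intro measurable_completion) measurable
        have "(\<lambda>x. indicator D x *\<^sub>R f x x) = d0" by (auto simp: d0_def fun_eq_iff)
        then show "(\<lambda>x. indicator D x *\<^sub>R f x x) \<in> borel_measurable lebesgue" using \<open>d0 \<in> borel_measurable lebesgue\<close> by simp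
        have "AE x in lborel. indicator D x *\<^sub>R h x = indicator D x *\<^sub>R f x x"
          using ae by eventually_elim (auto simp: indicator_def)
        then show "AE x in lebesgue. indicator D x *\<^sub>R h x = indicator D x *\<^sub>R f x x" by (simp add: AE_completion_iff)
      qed
      also have "\<dots> = (\<integral>x. f x x \<partial>lebesgue_on D)" using D(1) by (subst integral_restrict_space) auto
      finally have "(\<integral>x. h x \<partial>M) = 0" using fd(2) by simp
      moreover have "h \<in> borel_measurable M" using hb by (intro measurable_restrict_space1) simp
      moreover have "\<bar>h x\<bar> \<le> s" for x using s0 by (auto simp: h_def)
      ultimately show ?thesis using that ae by blast
    qed
    \<comment> \<open>Since \<open>\<xi> i * \<xi> i = 1\<close>, the normalized double sum is
      almost everywhere twice the pair sum of \<open>v\<close> plus the sum of \<open>h\<close>,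
      both divided by \<open>N\<close>.\<close>
    define F' where "F' x = 2 / real N * pairsum N \<xi> v x + 1 / real N * (\<Sum>i<N. h (x i))" for x
    have AE_F: "AE x in P N. G x = (F' x)\<^sup>2"
    proof -
      have "AE x in P N. \<forall>i\<in>{..<N}. \<forall>j\<in>{..<N}. i \<noteq> j \<longrightarrow> x i \<in> D \<longrightarrow> x j \<in> D \<longrightarrow> f (x i) (x j) = f' (x i) (x j)"
      proof (intro AE_finite_allI finite_lessThan)
        fix i j assume ij: "i \<in> {..<N}" "j \<in> {..<N}"
        show "AE x in P N. i \<noteq> j \<longrightarrow> x i \<in> D \<longrightarrow> x j \<in> D \<longrightarrow> f (x i) (x j) = f' (x i) (x j)"
        proof (cases "i = j")
          case False
          have "AE x in P N. x i \<in> D \<longrightarrow> x j \<in> D \<longrightarrow> f (x i) (x j) = f' (x i) (x j)"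
            by (rule AE_pair_transfer[where Q = "\<lambda>a b. a \<in> D \<longrightarrow> b \<in> D \<longrightarrow> f a b = f' a b", OF f'(3)]) (use ij False in auto)
          then show ?thesis by eventually_elim simp
        qed simp
      qed
      moreover have "AE x in P N. \<forall>i\<in>{..<N}. x i \<in> D \<longrightarrow> f (x i) (x i) = h (x i)"
        by (intro AE_finite_allI finite_lessThan AE_component_transfer[where Q = "\<lambda>a. a \<in> D \<longrightarrow> f a a = h a", OF h(4)]) auto
      ultimately show ?thesis using AE_space
      proof eventually_elim
        case (elim x)
        then have x: "\<And>i. i < N \<Longrightarrow> x i \<in> D" using space_P_D by auto
        have "(\<Sum>i<N. \<Sum>j<N. \<xi> i * \<xi> j * f (x i) (x j)) =
          2 * (\<Sum>j<N. \<Sum>i<j. \<xi> i * \<xi> j * f (x i) (x j)) + (\<Sum>i<N. \<xi> i * \<xi> i * f (x i) (x i))"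
          by (rule sum_sym_split) (use fsym x in \<open>simp add: mult_ac\<close>)
        also have "(\<Sum>i<N. \<xi> i * \<xi> i * f (x i) (x i)) = (\<Sum>i<N. h (x i))"
          by (intro sum.cong refl) (use elim x xi in force)
        also have "(\<Sum>j<N. \<Sum>i<j. \<xi> i * \<xi> j * f (x i) (x j)) = pairsum N \<xi> v x"
          unfolding pairsum_def
        proof (intro sum.cong refl)
          fix i j assume "j \<in> {..<N}" "i \<in> {..<j}"
          then have ij: "i < N" "j < N" "i \<noteq> j" by auto
          have "f' (x i) (x j) = f (x i) (x j)" "f' (x j) (x i) = f (x j) (x i)" using elim(1) ij x by auto
          then have "v (x i) (x j) = f (x i) (x j)" using fsym[OF x[OF ij(1)] x[OF ij(2)]] by (simp add: v_def)
          then show "\<xi> i * \<xi> j * f (x i) (x j) = \<xi> i * \<xi> j * v (x i) (x j)" by simp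
        qed
        finally show ?case by (simp add: G_def F'_def distrib_left)
      qed
    qed
    define b1 where "b1 = sqrt Cw / Z"
    define b2 where "b2 = sqrt (10 ^ 11 * (Q + s ^ 4 / (real N)\<^sup>2))"
    have b12: "0 \<le> b1" "0 \<le> b2" using Cw Z0 n s0 by (auto simp: b1_def b2_def Q_def)
    have fourth: "(\<integral>\<^sup>+x. (ennreal (G x))\<^sup>2 \<partial>completion (P N)) \<le> ennreal (b2\<^sup>2)"
    proof -
      have "(\<integral>\<^sup>+x. (ennreal (G x))\<^sup>2 \<partial>completion (P N)) = (\<integral>\<^sup>+x. ennreal ((F' x) ^ 4) \<partial>P N)"
        unfolding nn_integral_completion
      proof (rule nn_integral_cong_AE)
        show "AE x in P N. (ennreal (G x))\<^sup>2 = ennreal ((F' x) ^ 4)"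
          using AE_F by eventually_elim (simp add: ennreal_power flip: power_mult)
      qed
      also have "\<dots> \<le> ennreal (10 ^ 11 * (Q + s ^ 4 / (real N)\<^sup>2))"
        unfolding F'_def
        by (rule fourth_moment_bound[OF vm vB _ h(1,2) s0 h(3) N xi neu vI]) (auto simp: v_def Q_def add.commute)
      also have "\<dots> = ennreal (b2\<^sup>2)" using s0 by (simp add: b2_def Q_def)
      finally show ?thesis .
    qed
    have weight: "(\<integral>\<^sup>+x. (ennreal (w x / Z))\<^sup>2 \<partial>completion (P N)) \<le> ennreal (b1\<^sup>2)"
    proof -
      define W where "W x = majorant N (\<beta> / (2 * pi) / real N) \<xi> x" for x
      have Wm: "W \<in> borel_measurable (P N)" unfolding W_def by measurable
      have "(\<integral>\<^sup>+x. (ennreal (w x / Z))\<^sup>2 \<partial>completion (P N)) \<le> (\<integral>\<^sup>+x. ennreal (1 / Z\<^sup>2) * ennreal (W x) \<partial>P N)"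
        unfolding nn_integral_completion
      proof (rule nn_integral_mono_AE)
        show "AE x in P N. (ennreal (w x / Z))\<^sup>2 \<le> ennreal (1 / Z\<^sup>2) * ennreal (W x)"
          using w_upper
        proof eventually_elim
          case (elim x)
          have "(ennreal (w x / Z))\<^sup>2 = ennreal ((w x / Z)\<^sup>2)" using w0 Z0 by (simp add: ennreal_power)
          also have "(w x / Z)\<^sup>2 = 1 / Z\<^sup>2 * (w x)\<^sup>2" by (simp add: power_divide)
          also have "ennreal (1 / Z\<^sup>2 * (w x)\<^sup>2) \<le> ennreal (1 / Z\<^sup>2 * W x)"
            using elim unfolding W_def by (intro ennreal_leI mult_left_mono) auto
          also have "\<dots> = ennreal (1 / Z\<^sup>2) * ennreal (W x)"
            by (rule ennreal_mult) (auto simp: W_def prod_nonneg)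
          finally show ?case .
        qed
      qed
      also have "\<dots> = ennreal (1 / Z\<^sup>2) * (\<integral>\<^sup>+x. ennreal (W x) \<partial>P N)"
        by (intro nn_integral_cmult measurable_compose[OF Wm measurable_ennreal])
      also have "\<dots> \<le> ennreal (1 / Z\<^sup>2) * ennreal Cw" using Cw(2) unfolding W_def by (intro mult_left_mono) auto
      also have "\<dots> = ennreal (1 / Z\<^sup>2 * Cw)" by (rule ennreal_mult[symmetric]) (use Cw in auto)
      also have "1 / Z\<^sup>2 * Cw = b1\<^sup>2" using Cw by (simp add: b1_def power_divide)
      finally show ?thesis .
    qed
    have "?lhs = (\<integral>x. (w x / Z) *\<^sub>R G x \<partial>completion (P N))"
      unfolding lhs using Gm wm w0 Z0 by (intro integral_density) auto
    also have "\<dots> = enn2real (\<integral>\<^sup>+x. ennreal ((w x / Z) *\<^sub>R G x) \<partial>completion (P N))"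
      using Gm wm w0 Z0 G0 by (intro integral_eq_nn_integral) auto
    also have "\<dots> \<le> b1 * b2"
    proof (rule enn2real_leI)
      have "(\<integral>\<^sup>+x. ennreal ((w x / Z) *\<^sub>R G x) \<partial>completion (P N)) = (\<integral>\<^sup>+x. ennreal (w x / Z) * ennreal (G x) \<partial>completion (P N))"
        unfolding real_scaleR_def using w0 Z0 G0 by (intro nn_integral_cong ennreal_mult) auto
      also have "\<dots> \<le> ennreal (b1 * b2)"
        by (rule nn_Cauchy_Schwarz_le[OF _ _ weight fourth b12]) (use Gm wm in measurable)
      finally show "(\<integral>\<^sup>+x. ennreal ((w x / Z) *\<^sub>R G x) \<partial>completion (P N)) \<le> ennreal (b1 * b2)" .
    qed (use b12 in auto)
    also have "\<dots> \<le> (sqrt Cw / c0) * (sqrt (10 ^ 11) * (2 * (n2 + s\<^sup>2 / real N)))"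
    proof (rule mult_mono)
      show "b1 \<le> sqrt Cw / c0" unfolding b1_def using Zc c0 Cw by (intro divide_left_mono) auto
      \<comment> \<open>The square root of the fourth moment turns \<open>Q = 2 * n2\<^sup>2\<close>
        and \<open>s ^ 4 / N\<^sup>2\<close> into multiples of \<open>n2\<close> and
        \<open>s\<^sup>2 / N\<close>, which are bounded by the first two terms of the
        estimate.\<close>
      have "Q + s ^ 4 / (real N)\<^sup>2 \<le> (2 * (n2 + s\<^sup>2 / real N))\<^sup>2"
      proof -
        have s4: "s ^ 4 / (real N)\<^sup>2 = (s\<^sup>2 / real N)\<^sup>2" by (simp add: power_divide flip: power_mult)
        have "2 * a\<^sup>2 + b\<^sup>2 \<le> (2 * (a + b))\<^sup>2" if "0 \<le> a" "0 \<le> b" for a b :: real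
        proof -
          have "(2 * (a + b))\<^sup>2 = 2 * a\<^sup>2 + b\<^sup>2 + (2 * a\<^sup>2 + 3 * b\<^sup>2 + 8 * (a * b))" by (simp add: power2_eq_square algebra_simps)
          moreover have "0 \<le> 2 * a\<^sup>2 + 3 * b\<^sup>2 + 8 * (a * b)" using that by simp
          ultimately show ?thesis by linarith
        qed
        then show ?thesis unfolding Q_def s4 using n(1) zero_le_power2[of s] by (metis divide_nonneg_nonneg of_nat_0_le_iff)
      qed
      then have "sqrt (Q + s ^ 4 / (real N)\<^sup>2) \<le> 2 * (n2 + s\<^sup>2 / real N)"
        using n by (intro real_le_lsqrt) (auto simp: add_nonneg_nonneg)
      then show "b2 \<le> sqrt (10 ^ 11) * (2 * (n2 + s\<^sup>2 / real N))"
        unfolding b2_def real_sqrt_mult by (intro mult_left_mono) auto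
    qed (use b12 Cw c0 in auto)
    also have "\<dots> = ?C * (n2 + s\<^sup>2 / real N)" by (simp add: c0_def real_sqrt_mult)
    also have "\<dots> \<le> ?C * ?rhs" by (intro mult_left_mono rhs_ge C0)
    finally show ?thesis .
  qed
qed

end

theorem theorem2p5:
  fixes D :: "(real^2) set" and \<beta> \<epsilon> :: real
  assumes "open D" and "convex D" and "bounded D" and "smooth_boundary D"
    and "measure lebesgue D = 1"
    and "0 \<le> \<beta>" and "0 < \<epsilon>" and "\<epsilon> < 1 / 2"
  shows "\<exists>C::real. \<forall>(g :: real^2 \<Rightarrow> real^2 \<Rightarrow> real) (f :: real^2 \<Rightarrow> real^2 \<Rightarrow> real)
             (N::nat) (\<xi> :: nat \<Rightarrow> real).
           green_regular_part D g \<longrightarrow>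
           (\<lambda>(x, y). f x y) \<in> borel_measurable (lebesgue_on (D \<times> D)) \<longrightarrow>
           (\<exists>B. \<forall>x\<in>D. \<forall>y\<in>D. \<bar>f x y\<bar> \<le> B) \<longrightarrow>
           (\<forall>x\<in>D. \<forall>y\<in>D. f x y = f y x) \<longrightarrow>
           (\<lambda>x. f x x) \<in> borel_measurable (lebesgue_on D) \<longrightarrow>
           (\<integral>x. f x x \<partial>lebesgue_on D) = 0 \<longrightarrow>
           even N \<longrightarrow> 2 \<le> N \<longrightarrow> \<beta> < 2 * pi * real N \<longrightarrow>
           (\<forall>i<N. \<xi> i \<in> {1, -1}) \<longrightarrow> (\<Sum>i<N. \<xi> i) = 0 \<longrightarrow>
           (\<integral>x. (1 / real N * (\<Sum>i<N. \<Sum>j<N. \<xi> i * \<xi> j * f (x i) (x j)))\<^sup>2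
              \<partial>gibbs_measure D g \<beta> N \<xi>)
           \<le> C * ((Lq_norm (2 / \<epsilon>) (lebesgue_on (D \<times> D)) (\<lambda>(x, y). f x y))\<^sup>2
                  + 1 / real N * (SUP x\<in>D. \<bar>f x x\<bar>\<^sup>2)
                  + 1 / real N powr (1 - \<epsilon>) * (SUP x\<in>D. \<bar>f x x\<bar>)
                      * Lq_norm (1 / \<epsilon>) (lebesgue_on (D \<times> D)) (\<lambda>(x, y). f x y))"
proof (cases "\<exists>g. green_regular_part D g")
  \<comment> \<open>The bounds on \<open>T\<close> are derived from some regular part; if there is
    none, the statement is vacuous for every constant.\<close>
  case False
  then show ?thesis by blast
next
  case True
  note D = assms(1-3,5)
  obtain T \<Delta> where V: "vortex_domain D T \<Delta>"
    and G: "\<And>g x y. green_regular_part D g \<Longrightarrow> x \<in> D \<Longrightarrow> y \<in> D \<Longrightarrow> x \<noteq> y \<Longrightarrow> green g x y = - 1 / (4 * pi) * ln (1 - T x y)"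
    and U: "\<And>g x. green_regular_part D g \<Longrightarrow> x \<in> D \<Longrightarrow> g x x \<le> 1 / (2 * pi) * ln \<Delta>"
    using vortex_domain_of_green[OF D] True by metis
  interpret vortex_domain D T \<Delta> by (rule V)
  obtain Cw where Cw: "0 \<le> Cw" "\<And>N \<xi>. 1 \<le> N \<Longrightarrow> \<beta> < 2 * pi * real N \<Longrightarrow> (\<And>i. i < N \<Longrightarrow> \<xi> i \<in> {1, -1}) \<Longrightarrow> (\<Sum>i<N. \<xi> i) = 0 \<Longrightarrow>
    (\<integral>\<^sup>+x. ennreal (majorant N (\<beta> / (2 * pi) / real N) \<xi> x) \<partial>P N) \<le> ennreal Cw"
    by (rule weight_bound[OF assms(6)]) blast
  show ?thesis
  \<comment> \<open>\<open>Cw\<close> and \<open>\<Delta>\<close> have been obtained before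
    \<open>g\<close>, \<open>f\<close>, \<open>N\<close> and \<open>\<xi>\<close> are fixed, so this
    witness is independent of them.\<close>
  proof (intro exI[of _ "2 * sqrt (Cw * 10 ^ 11) / exp (- (\<beta> / (4 * pi) * ln \<Delta>))"] allI impI, elim exE)
    fix g f :: "real^2 \<Rightarrow> real^2 \<Rightarrow> real" and N :: nat and \<xi> :: "nat \<Rightarrow> real" and B :: real
    assume g: "green_regular_part D g"
      and f: "(\<lambda>(x, y). f x y) \<in> borel_measurable (lebesgue_on (D \<times> D))" "\<forall>x\<in>D. \<forall>y\<in>D. \<bar>f x y\<bar> \<le> B"
        "\<forall>x\<in>D. \<forall>y\<in>D. f x y = f y x" "(\<lambda>x. f x x) \<in> borel_measurable (lebesgue_on D)" "(\<integral>x. f x x \<partial>lebesgue_on D) = 0"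
      and N: "2 \<le> N" "\<beta> < 2 * pi * real N" and xi: "\<forall>i<N. \<xi> i \<in> {1, -1}" "(\<Sum>i<N. \<xi> i) = 0"
    have N1: "1 \<le> N" using N by simp
    have xi': "\<xi> i \<in> {1, -1}" if "i < N" for i using xi(1) that by blast
    show "(\<integral>x. (1 / real N * (\<Sum>i<N. \<Sum>j<N. \<xi> i * \<xi> j * f (x i) (x j)))\<^sup>2
              \<partial>gibbs_measure D g \<beta> N \<xi>)
           \<le> 2 * sqrt (Cw * 10 ^ 11) / exp (- (\<beta> / (4 * pi) * ln \<Delta>)) * ((Lq_norm (2 / \<epsilon>) (lebesgue_on (D \<times> D)) (\<lambda>(x, y). f x y))\<^sup>2
                  + 1 / real N * (SUP x\<in>D. \<bar>f x x\<bar>\<^sup>2)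
                  + 1 / real N powr (1 - \<epsilon>) * (SUP x\<in>D. \<bar>f x x\<bar>)
                      * Lq_norm (1 / \<epsilon>) (lebesgue_on (D \<times> D)) (\<lambda>(x, y). f x y))"
    proof (rule main_estimate[OF assms(6-8) G[OF g] U[where g = g, OF g] green_regular_ge[OF assms(1-3) g] N1 xi' xi(2) Cw(1) Cw(2)[OF N1 N(2) xi' xi(2)] f(1)])
      show "\<bar>f x y\<bar> \<le> B" if "x \<in> D" "y \<in> D" for x y using f(2) that by blast
      show "f x y = f y x" if "x \<in> D" "y \<in> D" for x y using f(3) that by blast
    qed (use f(4,5) in auto)
  qed
qed

end
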